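(* Let $p\in(2,\infty)$. Assume that $(u_n)$ is bounded in $\mathrm{L}^p(\mathbf{R}^d)$, $u_n\rightharpoonup u$ weakly in $\mathrm{L}^p(\mathbf{R}^d)$, and $$\sum_{j=1}^d\partial_j(a_ju_n)=f_n,$$ where $f_n\to0$ strongly in $\mathrm{W}^{-1,p}(\mathbf{R}^d)$ and $a_j\in\mathrm{L}^\infty(\mathbf{R}^d)\cap\mathrm{VMO}(\mathbf{R}^d)$. Let $m\in\mathrm{C}^\kappa(\mathrm{S}^{d-1})$, let $\chi\in\mathrm{C}_c^\infty(\mathbf{R}^d)$ be non-negative, put $v_n=\chi\,\mathcal{A}_m(u_n)$, and assume $v_n\rightharpoonup v=\chi\,\mathcal{A}_m(u)$ weakly in $\mathrm{L}^p(\mathbf{R}^d)$. Let $D$ be the H-distribution associated, along a subsequence, with $(u_n-u)$ and $(v_n-v)$ (with $q=p$). Then for any $Q\in\mathrm{L}^\infty(\mathbf{R}^d)\cap\mathrm{VMO}(\mathbf{R}^d)$, if $Q\,u_n\overline{v_n}\to\omega$ in $\mathcal{D}'(\mathbf{R}^d)$, then for every $\phi\in\mathrm{C}_c^\infty(\mathbf{R}^d)$ $$\langle\omega-Q\,u\,\overline v,\phi\rangle=D(Q\phi,1).$$ Furthermore, $$\sum_{j=1}^dD(a_j\varphi,\kappa_j\psi)=0$$ for all $\varphi\in\mathrm{L}^\infty(\mathbf{R}^d)\cap\mathrm{VMO}_c(\mathbf{R}^d)$ and $\psi\in\mathrm{C}^\kappa(\mathrm{S}^{d-1})$, where $\ka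ppa_j(\xi)=\xi_j/|\xi|$.
   Context: Functions are complex-valued; $\langle f,\phi\rangle=\int f\phi\,dx$ for $f\in\mathrm{L}^1_{loc}$ (bilinear distributional pairing). $\mathrm{VMO}(\mathbf{R}^d)$ is the closure of $\mathrm{C}_c(\mathbf{R}^d)$ in the norm $\|f\|_{\mathrm{BMO}}=\sup_B\frac1{|B|}\int_B|f-f_B|\,dx$ (sup over balls, $f_B$ the mean). $\mathrm{VMO}_c(\mathbf{R}^d)=\bigcup_n\mathrm{VMO}_{K_n}(\mathbf{R}^d)$ is the set of compactly supported $\mathrm{VMO}(\mathbf{R}^d)$ functions, with the strict inductive limit topology of the Banach spaces $\mathrm{VMO}_{K_n}=\{\varphi\in\mathrm{VMO}:\operatorname{supp}\varphi\subseteq K_n\}$ ($\mathrm{BMO}$ norm), $(K_n)$ a compact exhaustion of $\mathbf{R}^d$; $\mathrm{L}^\infty\cap\mathrm{VMO}_c$ carries the induced topology. $\kappa$ is the least integer $>d/2$. For $\psi\in\mathrm{C}^\kappa(\mathrm{S}^{d-1})$, $\mathcal{A}_\psi u=\mathcal{F}^{-1}(\psi(\xi/|\xi|)\hat u)$, bounded on $\mathrm{L}^s(\mathbf{R}^d)$, $1<s<\infty$. H-distribution: for $U_n\rightharpoonup0$ in $\mathrm{L}^p$, $V_n\rightharpoonup0$ in $\mathrm{L}^q$, $\frac1p+\frac1q<1$, after passing to a subsequence there is a jointly continuous bilinear functional $D$ on $(\mathrm{L}^\infty\cap\mathrm{VMO}_c)\times\mathrm{C}^\kappa(\mathrm{S}^{d-1})$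 with $D(\varphi_1\overline{\varphi_2},\psi)=\lim_n\int_{\mathbf{R}^d}\mathcal{A}_\psi(\varphi_1U_n)\overline{\varphi_2V_n}\,dx$ for all $\varphi_1,\varphi_2\in\mathrm{L}^\infty\cap\mathrm{VMO}_c$, $\psi\in\mathrm{C}^\kappa(\mathrm{S}^{d-1})$. This $D$ is the H-distribution associated with $(U_n),(V_n)$ along that subsequence. $\mathrm{W}^{-1,p}(\mathbf{R}^d)$ is the dual of $\mathrm{W}^{1,p'}(\mathbf{R}^d)$. *)

theory Defs
  imports "HOL-Analysis.Analysis"
begin

text \<open>
  All functions are complex-valued on \<^typ>\<open>real ^ 'n\<close>, so the dimension is \<^term>\<open>CARD('n)\<close>.
  Elements of Lebesgue-type spaces are represented by functions; no quotient by equality almost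
  everywhere is taken.
\<close>

type_synonym 'n cfun = "real ^ 'n \<Rightarrow> complex"

definition clinear_on :: "'n cfun set \<Rightarrow> ('n cfun \<Rightarrow> complex) \<Rightarrow> bool" where
  "clinear_on V F \<longleftrightarrow>
     (\<forall>f\<in>V. \<forall>g\<in>V. \<forall>a b. F (\<lambda>x. a * f x + b * g x) = a * F f + b * F g)"


section \<open>Lebesgue spaces\<close>

definition Lp_space :: "real \<Rightarrow> ('n::finite) cfun set" where
  "Lp_space p = {f \<in> borel_measurable lebesgue. integrable lebesgue (\<lambda>x. norm (f x) powr p)}"

definition Lp_norm :: "real \<Rightarrow> ('n::finite) cfun \<Rightarrow> real" where
  "Lp_norm p f = (\<integral>x. norm (f x) powr p \<partial>lebesgue) powr (1 / p)"

definition Linf_space :: "('n::finite) cfun set" where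
  "Linf_space = {f \<in> borel_measurable lebesgue. \<exists>C. AE x in lebesgue. norm (f x) \<le> C}"

definition L1loc :: "('n::finite) cfun set" where
  "L1loc = {f. \<forall>K. compact K \<longrightarrow> f absolutely_integrable_on K}"

definition conj_exp :: "real \<Rightarrow> real" where
  "conj_exp p = p / (p - 1)"

definition Lp_bounded :: "real \<Rightarrow> (nat \<Rightarrow> ('n::finite) cfun) \<Rightarrow> bool" where
  "Lp_bounded p F \<longleftrightarrow> (\<forall>n. F n \<in> Lp_space p) \<and> (\<exists>C. \<forall>n. Lp_norm p (F n) \<le> C)"

definition Lp_strongly :: "real \<Rightarrow> (nat \<Rightarrow> ('n::finite) cfun) \<Rightarrow> 'n cfun \<Rightarrow> bool" where
  "Lp_strongly p F f \<longleftrightarrow> (\<forall>n. F n \<in> Lp_space p) \<and> f \<in> Lp_space p \<and>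
     (\<lambda>n. Lp_norm p (\<lambda>x. F n x - f x)) \<longlonglongrightarrow> 0"

definition Lp_weakly :: "real \<Rightarrow> (nat \<Rightarrow> ('n::finite) cfun) \<Rightarrow> 'n cfun \<Rightarrow> bool" where
  "Lp_weakly p F f \<longleftrightarrow> (\<forall>n. F n \<in> Lp_space p) \<and> f \<in> Lp_space p \<and>
     (\<forall>g \<in> Lp_space (conj_exp p).
        (\<lambda>n. \<integral>x. F n x * g x \<partial>lebesgue) \<longlonglongrightarrow> (\<integral>x. f x * g x \<partial>lebesgue))"


section \<open>Differentiable functions, test functions and distributions\<close>

definition pderivative :: "'n::finite \<Rightarrow> 'n cfun \<Rightarrow> 'n cfun" where
  "pderivative j f x = frechet_derivative f (at x) (axis j 1)"

text \<open>A list of indices plays the role of a multi-index.\<close>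

primrec pderivs :: "('n::finite) list \<Rightarrow> 'n cfun \<Rightarrow> 'n cfun" where
  "pderivs [] f = f"
| "pderivs (j # js) f = pderivative j (pderivs js f)"

text \<open>Only used for open sets.\<close>

definition Ck_on :: "nat \<Rightarrow> (real ^ 'n) set \<Rightarrow> ('n::finite) cfun set" where
  "Ck_on k S = {f. (\<forall>js. length js < k \<longrightarrow> pderivs js f differentiable_on S) \<and>
                   (\<forall>js. length js \<le> k \<longrightarrow> continuous_on S (pderivs js f))}"

definition Cc :: "('n::finite) cfun set" where
  "Cc = {f. continuous_on UNIV f \<and> (\<exists>K. compact K \<and> (\<forall>x. x \<notin> K \<longrightarrow> f x = 0))}"

definition test_fun :: "('n::finite) cfun set" where
  "test_fun = Cc \<inter> (\<Inter>k. Ck_on k UNIV)"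

definition distribution :: "(('n::finite) cfun \<Rightarrow> complex) \<Rightarrow> bool" where
  "distribution T \<longleftrightarrow> clinear_on test_fun T \<and>
     (\<forall>K. compact K \<longrightarrow> (\<exists>C k. \<forall>f\<in>test_fun. (\<forall>x. x \<notin> K \<longrightarrow> f x = 0) \<longrightarrow>
        norm (T f) \<le> C * (SUP (js, x) \<in> {js. length js \<le> k} \<times> UNIV. norm (pderivs js f x))))"

text \<open>The bilinear pairing, and the distributional derivative.\<close>

definition pairing :: "('n::finite) cfun \<Rightarrow> 'n cfun \<Rightarrow> complex" where
  "pairing f \<phi> = (\<integral>x. f x * \<phi> x \<partial>lebesgue)"

definition distr_deriv :: "'n::finite \<Rightarrow> ('n cfun \<Rightarrow> complex) \<Rightarrow> ('n cfun \<Rightarrow> complex)" where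
  "distr_deriv j T \<phi> = - T (pderivative j \<phi>)"

definition distr_tendsto ::
    "(nat \<Rightarrow> ('n::finite) cfun \<Rightarrow> complex) \<Rightarrow> ('n cfun \<Rightarrow> complex) \<Rightarrow> bool" where
  "distr_tendsto T S \<longleftrightarrow> (\<forall>\<phi>\<in>test_fun. (\<lambda>n. T n \<phi>) \<longlonglongrightarrow> S \<phi>)"


section \<open>Sobolev spaces of order one and their duals\<close>

definition weak_deriv :: "'n::finite \<Rightarrow> 'n cfun \<Rightarrow> 'n cfun \<Rightarrow> bool" where
  "weak_deriv j f g \<longleftrightarrow> f \<in> L1loc \<and> g \<in> L1loc \<and>
     (\<forall>\<phi>\<in>test_fun. distr_deriv j (pairing f) \<phi> = pairing g \<phi>)"

definition W1 :: "real \<Rightarrow> ('n::finite) cfun set" where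
  "W1 s = {f \<in> Lp_space s. \<forall>j. \<exists>g \<in> Lp_space s. weak_deriv j f g}"

definition W1_norm :: "real \<Rightarrow> ('n::finite) cfun \<Rightarrow> real" where
  "W1_norm s f = Lp_norm s f + (\<Sum>j\<in>UNIV. Lp_norm s (SOME g. weak_deriv j f g))"

definition Wm1_norm :: "real \<Rightarrow> (('n::finite) cfun \<Rightarrow> complex) \<Rightarrow> ennreal" where
  "Wm1_norm p F =
     (SUP g \<in> {g \<in> W1 (conj_exp p). W1_norm (conj_exp p) g \<le> 1}. ennreal (norm (F g)))"

definition Wm1 :: "real \<Rightarrow> (('n::finite) cfun \<Rightarrow> complex) set" where
  "Wm1 p = {F. clinear_on (W1 (conj_exp p)) F \<and> Wm1_norm p F < \<infinity>}"


section \<open>Bounded and vanishing mean oscillation\<close>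

definition ball_mean :: "('n::finite) cfun \<Rightarrow> real ^ 'n \<Rightarrow> real \<Rightarrow> complex" where
  "ball_mean f c r =
     (1 / measure lebesgue (ball c r)) *\<^sub>R (\<integral>x\<in>ball c r. f x \<partial>lebesgue)"

definition BMO_norm :: "('n::finite) cfun \<Rightarrow> ennreal" where
  "BMO_norm f = (SUP (c, r) \<in> UNIV \<times> {0<..}.
     (\<integral>\<^sup>+x\<in>ball c r. ennreal (norm (f x - ball_mean f c r)) \<partial>lebesgue)
       / emeasure lebesgue (ball c r))"

definition BMO :: "('n::finite) cfun set" where
  "BMO = {f \<in> L1loc. BMO_norm f < \<infinity>}"

definition VMO :: "('n::finite) cfun set" where
  "VMO = {f \<in> BMO. \<forall>e>0. \<exists>g\<in>Cc. BMO_norm (\<lambda>x. f x - g x) < e}"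

definition VMO_on :: "(real ^ 'n) set \<Rightarrow> ('n::finite) cfun set" where
  "VMO_on K = {f \<in> VMO. AE x in lebesgue. x \<notin> K \<longrightarrow> f x = 0}"

text \<open>The compact exhaustion consists of the closed balls of radius \<open>n\<close> around the origin; neither
  the space nor its topology depends on this choice.\<close>

definition VMO_c :: "('n::finite) cfun set" where
  "VMO_c = (\<Union>n::nat. VMO_on (cball 0 (real n)))"

text \<open>The strict inductive limit topology is the finest locally convex topology for which all
  inclusions of \<^term>\<open>VMO_on (cball 0 (real n))\<close> are continuous. A base of neighbourhoods of
  \<open>0\<close> consists of the absolutely convex sets whose trace on each step is a neighbourhood of \<open>0\<close>
  in the \<open>BMO\<close> norm.\<close>

definition VMO_c_nhds0 :: "('n::finite) cfun set set" where
  "VMO_c_nhds0 = {U. U \<subseteq> VMO_c \<and>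
     (\<forall>f\<in>U. \<forall>g\<in>U. \<forall>a b. norm a + norm b \<le> 1 \<longrightarrow> (\<lambda>x. a * f x + b * g x) \<in> U) \<and>
     (\<forall>n::nat. \<exists>e>0. \<forall>f\<in>VMO_on (cball 0 (real n)). BMO_norm f < e \<longrightarrow> f \<in> U)}"

definition VMO_c_topology :: "('n::finite) cfun topology" where
  "VMO_c_topology = topology (\<lambda>W. W \<subseteq> VMO_c \<and>
     (\<forall>f\<in>W. \<exists>U\<in>VMO_c_nhds0. \<forall>g\<in>U. (\<lambda>x. f x + g x) \<in> W))"

lemma VMO_c_nhds0_Int:
  assumes "U \<in> VMO_c_nhds0" "V \<in> VMO_c_nhds0"
  shows "U \<inter> V \<in> VMO_c_nhds0"
proof -
  have "\<exists>e>0. \<forall>f\<in>VMO_on (cball 0 (real n)). BMO_norm f < e \<longrightarrow> f \<in> U \<inter> V" for n :: nat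
  proof -
    obtain e1 where e1: "e1 > 0" "\<forall>f\<in>VMO_on (cball 0 (real n)). BMO_norm f < e1 \<longrightarrow> f \<in> U"
      using assms(1) unfolding VMO_c_nhds0_def by blast
    obtain e2 where e2: "e2 > 0" "\<forall>f\<in>VMO_on (cball 0 (real n)). BMO_norm f < e2 \<longrightarrow> f \<in> V"
      using assms(2) unfolding VMO_c_nhds0_def by blast
    show ?thesis
      using e1 e2 by (intro exI[of _ "min e1 e2"]) auto
  qed
  then show ?thesis
    using assms unfolding VMO_c_nhds0_def by blast
qed

lemma openin_VMO_c_topology:
  "openin VMO_c_topology W \<longleftrightarrow> W \<subseteq> VMO_c \<and>
     (\<forall>f\<in>W. \<exists>U\<in>VMO_c_nhds0. \<forall>g\<in>U. (\<lambda>x. f x + g x) \<in> W)"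
proof -
  have "istopology (\<lambda>W::'a cfun set. W \<subseteq> VMO_c \<and>
          (\<forall>f\<in>W. \<exists>U\<in>VMO_c_nhds0. \<forall>g\<in>U. (\<lambda>x. f x + g x) \<in> W))"
    unfolding istopology_def
  proof (intro conjI allI impI ballI, goal_cases)
    case (2 S T f)
    then obtain U V where "U \<in> VMO_c_nhds0" "\<forall>g\<in>U. (\<lambda>x. f x + g x) \<in> S"
      "V \<in> VMO_c_nhds0" "\<forall>g\<in>V. (\<lambda>x. f x + g x) \<in> T"
      by (metis IntE)
    then show ?case
      by (intro bexI[of _ "U \<inter> V"]) (auto intro: VMO_c_nhds0_Int)
  next
    case (4 \<K> f)
    then obtain S where S: "S \<in> \<K>" "f \<in> S" by blast
    then obtain U where "U \<in> VMO_c_nhds0" "\<forall>g\<in>U. (\<lambda>x. f x + g x) \<in> S"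
      using 4 by metis
    then show ?case using S by blast
  qed blast+
  then show ?thesis
    unfolding VMO_c_topology_def by (simp add: topology_inverse')
qed

definition Linf_VMO_c_topology :: "('n::finite) cfun topology" where
  "Linf_VMO_c_topology = subtopology VMO_c_topology Linf_space"


section \<open>Symbols on the unit sphere and Fourier multipliers\<close>

text \<open>Functions on the sphere are identified with their extensions that are homogeneous of
  degree \<open>0\<close>. In particular only the values of \<open>\<psi>\<close> on the sphere matter.\<close>

definition hom_ext :: "('n::finite) cfun \<Rightarrow> 'n cfun" where
  "hom_ext \<psi> \<xi> = \<psi> (sgn \<xi>)"

definition Ck_sphere :: "nat \<Rightarrow> ('n::finite) cfun set" where
  "Ck_sphere k = {\<psi>. hom_ext \<psi> \<in> Ck_on k (- {0})}"

definition Ck_sphere_norm :: "nat \<Rightarrow> ('n::finite) cfun \<Rightarrow> real" where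
  "Ck_sphere_norm k \<psi> =
     (SUP (js, \<xi>) \<in> {js. length js \<le> k} \<times> sphere 0 1. norm (pderivs js (hom_ext \<psi>) \<xi>))"

definition Ck_sphere_topology :: "nat \<Rightarrow> ('n::finite) cfun topology" where
  "Ck_sphere_topology k = topology (\<lambda>W. W \<subseteq> Ck_sphere k \<and>
     (\<forall>\<psi>\<in>W. \<exists>e>0. \<forall>\<eta>\<in>Ck_sphere k. Ck_sphere_norm k (\<lambda>\<xi>. \<eta> \<xi> - \<psi> \<xi>) < e \<longrightarrow> \<eta> \<in> W))"

lemma openin_Ck_sphere_topology:
  "openin (Ck_sphere_topology k) W \<longleftrightarrow> W \<subseteq> Ck_sphere k \<and>
     (\<forall>\<psi>\<in>W. \<exists>e>0. \<forall>\<eta>\<in>Ck_sphere k. Ck_sphere_norm k (\<lambda>\<xi>. \<eta> \<xi> - \<psi> \<xi>) < e \<longrightarrow> \<eta> \<in> W)"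
proof -
  have "istopology (\<lambda>W::'a cfun set. W \<subseteq> Ck_sphere k \<and>
     (\<forall>\<psi>\<in>W. \<exists>e>0. \<forall>\<eta>\<in>Ck_sphere k. Ck_sphere_norm k (\<lambda>\<xi>. \<eta> \<xi> - \<psi> \<xi>) < e \<longrightarrow> \<eta> \<in> W))"
    unfolding istopology_def
  proof (intro conjI allI impI ballI, goal_cases)
    case (2 S T \<psi>)
    then obtain d e where
      "d > 0" "\<forall>\<eta>\<in>Ck_sphere k. Ck_sphere_norm k (\<lambda>\<xi>. \<eta> \<xi> - \<psi> \<xi>) < d \<longrightarrow> \<eta> \<in> S"
      "e > 0" "\<forall>\<eta>\<in>Ck_sphere k. Ck_sphere_norm k (\<lambda>\<xi>. \<eta> \<xi> - \<psi> \<xi>) < e \<longrightarrow> \<eta> \<in> T"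
      by (metis IntE)
    then show ?case
      by (intro exI[of _ "min d e"]) auto
  next
    case (4 \<K> \<psi>)
    then obtain S where S: "S \<in> \<K>" "\<psi> \<in> S" by blast
    then obtain e where
      "e > 0" "\<forall>\<eta>\<in>Ck_sphere k. Ck_sphere_norm k (\<lambda>\<xi>. \<eta> \<xi> - \<psi> \<xi>) < e \<longrightarrow> \<eta> \<in> S"
      using 4 by metis
    then show ?case using S by blast
  qed blast+
  then show ?thesis
    unfolding Ck_sphere_topology_def by (simp add: topology_inverse')
qed

definition kappa :: "nat \<Rightarrow> nat" where
  "kappa d = (LEAST k. real d / 2 < real k)"

abbreviation C_kappa :: "('n::finite) cfun set" where
  "C_kappa \<equiv> Ck_sphere (kappa CARD('n))"

abbreviation C_kappa_topology :: "('n::finite) cfun topology" where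
  "C_kappa_topology \<equiv> Ck_sphere_topology (kappa CARD('n))"

definition fourier :: "('n::finite) cfun \<Rightarrow> 'n cfun" where
  "fourier u \<xi> = (\<integral>x. cis (- 2 * pi * (x \<bullet> \<xi>)) * u x \<partial>lebesgue)"

definition inv_fourier :: "('n::finite) cfun \<Rightarrow> 'n cfun" where
  "inv_fourier u x = (\<integral>\<xi>. cis (2 * pi * (x \<bullet> \<xi>)) * u \<xi> \<partial>lebesgue)"

text \<open>The multiplier operator is given by the Fourier formula on test functions, and on
  \<open>L\<^sup>s\<close> by continuous extension from this dense subspace; its value is determined almost
  everywhere.\<close>

definition multiplier_test :: "('n::finite) cfun \<Rightarrow> 'n cfun \<Rightarrow> 'n cfun" where
  "multiplier_test \<psi> u = inv_fourier (\<lambda>\<xi>. hom_ext \<psi> \<xi> * fourier u \<xi>)"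

definition multiplier :: "real \<Rightarrow> ('n::finite) cfun \<Rightarrow> 'n cfun \<Rightarrow> 'n cfun" where
  "multiplier s \<psi> u = (SOME w. w \<in> Lp_space s \<and>
     (\<forall>\<phi>. (\<forall>k. \<phi> k \<in> test_fun) \<and> Lp_strongly s \<phi> u \<longrightarrow>
          Lp_strongly s (\<lambda>k. multiplier_test \<psi> (\<phi> k)) w))"


section \<open>H-distributions\<close>

text \<open>\<open>D\<close> is the H-distribution associated with \<open>(U\<^sub>n)\<close> in \<open>L\<^sup>p\<close> and \<open>(V\<^sub>n)\<close> in
  \<open>L\<^sup>q\<close> along the subsequence with indices \<open>r\<close>.\<close>

definition H_distribution ::
    "real \<Rightarrow> real \<Rightarrow> (nat \<Rightarrow> ('n::finite) cfun) \<Rightarrow> (nat \<Rightarrow> 'n cfun) \<Rightarrow> (nat \<Rightarrow> nat)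
      \<Rightarrow> ('n cfun \<Rightarrow> 'n cfun \<Rightarrow> complex) \<Rightarrow> bool" where
  "H_distribution p q U V r D \<longleftrightarrow>
     1 / p + 1 / q < 1 \<and> Lp_weakly p U (\<lambda>x. 0) \<and> Lp_weakly q V (\<lambda>x. 0) \<and> strict_mono r \<and>
     (\<forall>\<psi>\<in>C_kappa. clinear_on (Linf_space \<inter> VMO_c) (\<lambda>\<phi>. D \<phi> \<psi>)) \<and>
     (\<forall>\<phi>\<in>Linf_space \<inter> VMO_c. clinear_on C_kappa (\<lambda>\<psi>. D \<phi> \<psi>)) \<and>
     continuous_map (prod_topology Linf_VMO_c_topology C_kappa_topology) euclidean
       (\<lambda>(\<phi>, \<psi>). D \<phi> \<psi>) \<and>
     (\<forall>\<phi>\<^sub>1\<in>Linf_space \<inter> VMO_c. \<forall>\<phi>\<^sub>2\<in>Linf_space \<inter> VMO_c. \<forall>\<psi>\<in>C_kappa.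
        (\<lambda>n. \<integral>x. multiplier p \<psi> (\<lambda>y. \<phi>\<^sub>1 y * U (r n) y) x * cnj (\<phi>\<^sub>2 x * V (r n) x) \<partial>lebesgue)
          \<longlonglongrightarrow> D (\<lambda>x. \<phi>\<^sub>1 x * cnj (\<phi>\<^sub>2 x)) \<psi>)"

end

theory Submission
  imports Defs "HOL-Probability.Probability"
begin

text \<open>
  Write \<open>U\<^sub>n = u\<^sub>n - u\<^sub>0\<close> and \<open>V\<^sub>n = v\<^sub>n - v\<^sub>0\<close>. With \<open>\<phi>\<^sub>1 = Q \<phi>\<close> and a cutoff \<open>\<phi>\<^sub>2\<close> equal to \<open>1\<close> on the
  support of \<open>\<phi>\<close>, the symbol \<open>1\<close> gives \<open>D (Q \<phi>) 1 = lim \<integral> Q \<phi> U\<^sub>n cnj V\<^sub>n\<close>, and expanding the product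
  and passing to the weak limits yields the first claim.

  For the second claim, no multiplier theorem is needed. If some symbol in \<open>C_kappa\<close> is not an \<open>L\<^sup>p\<close>
  multiplier, the operators take junk values which force \<open>D = 0\<close> on products. Otherwise let \<open>b\<close> be a
  smooth cutoff, \<open>g\<^sub>j = a\<^sub>j b U\<^sub>n\<close> and \<open>F\<^sub>n = \<Sum>\<^sub>j (\<xi>\<^sub>j / norm \<xi>) fourier g\<^sub>j\<close>. Low frequencies of \<open>F\<^sub>n\<close> tend
  to \<open>0\<close> by weak convergence. Testing the equation with \<open>b z\<close>, where \<open>z\<close> is the Fourier transform
  of \<open>cnj F\<^sub>n / norm \<xi>\<close> restricted to \<open>\<rho> < norm \<xi> < R\<close>, bounds the \<open>L\<^sup>2\<close> mass of the remaining
  frequencies by \<open>o(1) + C / \<rho>\<close>; the test functions stay bounded in \<open>W\<^sup>1\<close> with exponent \<open>conj_exp p\<close> since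
  \<open>conj_exp p \<le> 2\<close> and \<open>b\<close> has compact support. So \<open>F\<^sub>n\<close> tends to \<open>0\<close> in \<open>L\<^sup>2\<close>, and Bessel's
  inequality carries this over to the sum of the multiplier operators.
\<close>

section \<open>Test functions and symbols\<close>

text \<open>The coefficients \<open>a j\<close> are never commuted with an operator. In the limit
  that defines \<open>D\<close> they sit, together with a smooth cutoff \<open>b\<close>, inside the
  first factor, so vanishing mean oscillation enters through one fact only: products such as
  \<open>a j * \<phi>\<close> and \<open>Q * \<phi>\<close> stay in the domain of \<open>D\<close>.
  An oscillation criterion and a mollification argument serve to prove this fact.

  The obstacle in the L2 argument is the derivative of \<open>b\<close>, which leaves a term that is
  bounded but does not vanish. Hence two parameters: for fixed \<rho> everything except
  \<open>C / \<rho>\<close> disappears as n grows, and \<rho> is sent to infinity last. The outer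
  radius R may depend on n, since no bound depends on it.

  Junk values force \<open>D = 0\<close> because the limit then does not see the first factor, which
  may be replaced by 0.

  The differences \<open>u n - u\<^sub>0\<close> satisfy the equation with the same right-hand
  sides: against a fixed test function these tend to 0, so the weak limit solves the homogeneous
  equation.\<close>

lemma pderivs_append: "pderivs (js @ [j]) f = pderivs js (pderivative j f)"
  by (induction js) auto

lemma Ck_on_0: "f \<in> Ck_on 0 S \<longleftrightarrow> continuous_on S f"
  by (auto simp: Ck_on_def)

text \<open>The last index of a list acts first, so splitting a list at its end
  (\<open>rev_cases\<close>) trades one order of smoothness for one derivative of \<open>f\<close>.
  This recursive form carries all later inductions on the order.\<close>

lemma Ck_on_Suc:
  "f \<in> Ck_on (Suc k) S \<longleftrightarrow> f differentiable_on S \<and> (\<forall>j. pderivative j f \<in> Ck_on k S)"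
proof (intro iffI conjI allI)
  assume f: "f \<in> Ck_on (Suc k) S"
  then have "pderivs [] f differentiable_on S" by (auto simp: Ck_on_def dest: spec[of _ "[]"])
  then show "f differentiable_on S" by simp
  fix j
  have "pderivs (js @ [j]) f differentiable_on S" if "length js < k" for js
    using f that unfolding Ck_on_def by simp
  moreover have "continuous_on S (pderivs (js @ [j]) f)" if "length js \<le> k" for js
    using f that unfolding Ck_on_def by simp
  ultimately show "pderivative j f \<in> Ck_on k S"
    unfolding Ck_on_def pderivs_append by blast
next
  assume f: "f differentiable_on S \<and> (\<forall>j. pderivative j f \<in> Ck_on k S)"
  have "pderivs js f differentiable_on S" if "length js < Suc k" for js
  proof (cases js rule: rev_cases)
    case (snoc ks j)
    then show ?thesis using f that by (simp add: pderivs_append Ck_on_def)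
  qed (use f in simp)
  moreover have "continuous_on S (pderivs js f)" if "length js \<le> Suc k" for js
  proof (cases js rule: rev_cases)
    case (snoc ks j)
    then show ?thesis using f that by (simp add: pderivs_append Ck_on_def)
  qed (use f in \<open>simp add: differentiable_imp_continuous_on\<close>)
  ultimately show "f \<in> Ck_on (Suc k) S" by (simp add: Ck_on_def)
qed

lemma Ck_on_antimono: "f \<in> Ck_on l S \<Longrightarrow> k \<le> l \<Longrightarrow> f \<in> Ck_on k S"
  unfolding Ck_on_def by auto

lemma frechet_derivative_cong_open:
  assumes "open S" "x \<in> S" "\<And>y. y \<in> S \<Longrightarrow> f y = g y"
  shows "frechet_derivative f (at x) = frechet_derivative g (at x)"
proof -
  have "(f has_derivative h) (at x) \<longleftrightarrow> (g has_derivative h) (at x)" for h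
    using assms by (metis has_derivative_transform_within_open)
  then show ?thesis unfolding frechet_derivative_def by simp
qed

lemma pderivative_cong_open:
  assumes "open S" "x \<in> S" "\<And>y. y \<in> S \<Longrightarrow> f y = g y"
  shows "pderivative j f x = pderivative j g x"
  unfolding pderivative_def using frechet_derivative_cong_open[OF assms] by simp

lemma differentiable_on_cong_open:
  assumes "open S" "\<And>y. y \<in> S \<Longrightarrow> f y = g y"
  shows "f differentiable_on S \<longleftrightarrow> g differentiable_on S"
proof -
  have "f differentiable (at x) \<longleftrightarrow> g differentiable (at x)" if "x \<in> S" for x
    unfolding differentiable_def using assms that by (metis has_derivative_transform_within_open)
  then show ?thesis using assms(1) by (simp add: differentiable_on_eq_differentiable_at)
qed

lemma Ck_on_cong:
  assumes "open S" "\<And>y. y \<in> S \<Longrightarrow> f y = g y"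
  shows "f \<in> Ck_on k S \<longleftrightarrow> g \<in> Ck_on k S"
  using assms(2)
proof (induction k arbitrary: f g)
  case 0
  then show ?case by (simp add: Ck_on_0 cong: continuous_on_cong)
next
  case (Suc k)
  have "pderivative j f \<in> Ck_on k S \<longleftrightarrow> pderivative j g \<in> Ck_on k S" for j
    by (rule Suc.IH) (use pderivative_cong_open[OF assms(1)] Suc.prems in blast)
  then show ?case
    unfolding Ck_on_Suc using differentiable_on_cong_open[OF assms(1), of f g] Suc.prems by blast
qed

lemma pderivative_eq:
  "(f has_derivative f') (at x) \<Longrightarrow> pderivative j f x = f' (axis j 1)"
  unfolding pderivative_def by (metis frechet_derivative_at)

lemma pderivative_has_derivative:
  "f differentiable (at x) \<Longrightarrow> (f has_derivative frechet_derivative f (at x)) (at x)"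
  by (simp add: frechet_derivative_works)

lemma pderivative_add:
  assumes "f differentiable (at x)" "g differentiable (at x)"
  shows "pderivative j (\<lambda>x. f x + g x) x = pderivative j f x + pderivative j g x"
  by (subst pderivative_eq[OF has_derivative_add[OF assms[THEN pderivative_has_derivative]]])
     (simp add: pderivative_def)

lemma pderivative_mult:
  assumes "f differentiable (at x)" "g differentiable (at x)"
  shows "pderivative j (\<lambda>x. f x * g x) x = pderivative j f x * g x + f x * pderivative j g x"
  by (subst pderivative_eq[OF has_derivative_mult[OF assms[THEN pderivative_has_derivative]]])
     (simp add: pderivative_def add.commute)

lemma pderivative_const [simp]: "pderivative j (\<lambda>x. c) x = 0"
  by (subst pderivative_eq[OF has_derivative_const]) simp

text \<open>A family of differentiable functions closed under partial derivatives consists of smooth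
  functions. Closure is required only up to equality on \<open>S\<close>, so the members of the
  family can be closed expressions such as polynomial times bump.\<close>

lemma Ck_on_coinduct:
  assumes "open S"
    and "\<And>f. f \<in> F \<Longrightarrow> f differentiable_on S"
    and "\<And>f j. f \<in> F \<Longrightarrow> \<exists>g\<in>F. \<forall>x\<in>S. pderivative j f x = g x"
    and "f \<in> F"
  shows "f \<in> Ck_on k S"
  using assms(4)
proof (induction k arbitrary: f)
  case 0
  then show ?case using assms(2) by (simp add: Ck_on_0 differentiable_imp_continuous_on)
next
  case (Suc k)
  have "pderivative j f \<in> Ck_on k S" for j
  proof -
    obtain g where "g \<in> F" "\<forall>x\<in>S. pderivative j f x = g x" using assms(3)[OF Suc.prems] by blast
    then show ?thesis using Suc.IH Ck_on_cong[OF assms(1), of "pderivative j f" g] by blast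
  qed
  then show ?case using assms(2)[OF Suc.prems] by (simp add: Ck_on_Suc)
qed

lemma Ck_on_const: "open S \<Longrightarrow> (\<lambda>x. c) \<in> Ck_on k S"
  by (rule Ck_on_coinduct[where F="range (\<lambda>c x. c)"]) auto

lemma Ck_on_add:
  assumes "open S" "f \<in> Ck_on k S" "g \<in> Ck_on k S"
  shows "(\<lambda>x. f x + g x) \<in> Ck_on k S"
  using assms(2,3)
proof (induction k arbitrary: f g)
  case 0
  then show ?case by (simp add: Ck_on_0 continuous_on_add)
next
  case (Suc k)
  have d: "f differentiable (at x)" "g differentiable (at x)" if "x \<in> S" for x
    using Suc.prems that assms(1) by (auto simp: Ck_on_Suc differentiable_on_eq_differentiable_at)
  have "pderivative j (\<lambda>x. f x + g x) \<in> Ck_on k S" for j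
    by (subst Ck_on_cong[OF assms(1), of _ "\<lambda>x. pderivative j f x + pderivative j g x"])
       (use Suc in \<open>auto simp: Ck_on_Suc pderivative_add[OF d]\<close>)
  then show ?case using Suc.prems by (auto simp: Ck_on_Suc intro: differentiable_on_add)
qed

lemma Ck_on_mult:
  assumes "open S" "f \<in> Ck_on k S" "g \<in> Ck_on k S"
  shows "(\<lambda>x. f x * g x) \<in> Ck_on k S"
  using assms(2,3)
proof (induction k arbitrary: f g)
  case 0
  then show ?case by (simp add: Ck_on_0 continuous_on_mult)
next
  case (Suc k)
  have d: "f differentiable (at x)" "g differentiable (at x)" if "x \<in> S" for x
    using Suc.prems that assms(1) by (auto simp: Ck_on_Suc differentiable_on_eq_differentiable_at)
  have k: "f \<in> Ck_on k S" "g \<in> Ck_on k S"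
    using Suc.prems by (auto intro: Ck_on_antimono)
  have "pderivative j (\<lambda>x. f x * g x) \<in> Ck_on k S" for j
    by (subst Ck_on_cong[OF assms(1), of _ "\<lambda>x. pderivative j f x * g x + f x * pderivative j g x"])
       (use Suc k in \<open>auto simp: Ck_on_Suc pderivative_mult[OF d] intro!: Ck_on_add assms(1)\<close>)
  moreover have "(\<lambda>x. f x * g x) differentiable_on S"
    using d assms(1) by (auto simp: differentiable_on_eq_differentiable_at intro!: differentiable_mult)
  ultimately show ?case by (auto simp: Ck_on_Suc)
qed

section \<open>Complex polynomials in real coordinates\<close>

inductive cpoly :: "('n::finite) cfun \<Rightarrow> bool" where
  cpoly_const: "cpoly (\<lambda>x. c)"
| cpoly_coord: "cpoly (\<lambda>x. complex_of_real (x $ j))"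
| cpoly_add: "cpoly f \<Longrightarrow> cpoly g \<Longrightarrow> cpoly (\<lambda>x. f x + g x)"
| cpoly_mult: "cpoly f \<Longrightarrow> cpoly g \<Longrightarrow> cpoly (\<lambda>x. f x * g x)"

lemma cpoly_diff: "cpoly f \<Longrightarrow> cpoly g \<Longrightarrow> cpoly (\<lambda>x. f x - g x)"
  using cpoly_add[of f "\<lambda>x. (-1) * g x"] cpoly_mult[OF cpoly_const, of g "-1"] by simp

lemma cpoly_sum: "(\<And>i. i \<in> A \<Longrightarrow> cpoly (f i)) \<Longrightarrow> cpoly (\<lambda>x. \<Sum>i\<in>A. f i x)"
  by (induction A rule: infinite_finite_induct) (auto intro: cpoly_const cpoly_add)

lemma cpoly_inner: "cpoly (\<lambda>x. complex_of_real (x \<bullet> x))"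
  by (simp add: inner_vec_def) (intro cpoly_sum cpoly_mult cpoly_coord)

lemma has_derivative_coord:
  "((\<lambda>x. complex_of_real (x $ j)) has_derivative (\<lambda>h. complex_of_real (h $ j))) (at x)"
  by (intro bounded_linear_imp_has_derivative bounded_linear_compose[OF bounded_linear_of_real bounded_linear_vec_nth])

lemma cpoly_differentiable: "cpoly f \<Longrightarrow> f differentiable (at x)"
proof (induction rule: cpoly.induct)
  case (cpoly_coord j)
  then show ?case using has_derivative_coord unfolding differentiable_def by blast
qed (simp_all add: differentiable_mult differentiable_add)

lemma cpoly_pderivative: "cpoly f \<Longrightarrow> \<exists>g. cpoly g \<and> (\<forall>x. pderivative j f x = g x)"
proof (induction rule: cpoly.induct)
  case (cpoly_const c)
  then show ?case using cpoly.cpoly_const[of 0] by auto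
next
  case (cpoly_coord i)
  have "pderivative j (\<lambda>x. complex_of_real (x $ i)) x = (if i = j then 1 else 0)" for x
    by (subst pderivative_eq[OF has_derivative_coord]) (simp add: axis_def)
  then show ?case using cpoly.cpoly_const[of "if i = j then 1 else 0"] by auto
next
  case (cpoly_add f g)
  then obtain f' g' where "cpoly f'" "cpoly g'" "\<And>x. pderivative j f x = f' x" "\<And>x. pderivative j g x = g' x"
    by blast
  then show ?case using cpoly_add.hyps
    by (intro exI[of _ "\<lambda>x. f' x + g' x"])
       (auto intro!: cpoly.cpoly_add simp: pderivative_add cpoly_differentiable)
next
  case (cpoly_mult f g)
  then obtain f' g' where "cpoly f'" "cpoly g'" "\<And>x. pderivative j f x = f' x" "\<And>x. pderivative j g x = g' x"
    by blast
  then show ?case using cpoly_mult.hyps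
    by (intro exI[of _ "\<lambda>x. f' x * g x + f x * g' x"])
       (auto intro!: cpoly.cpoly_add cpoly.cpoly_mult simp: pderivative_mult cpoly_differentiable)
qed

lemma cpoly_Ck_on: "cpoly f \<Longrightarrow> f \<in> Ck_on k UNIV"
  by (rule Ck_on_coinduct[where F="{f. cpoly f}"])
     (auto simp: differentiable_on_def cpoly_differentiable cpoly_pderivative)

lemma real_polynomial_function_cpoly:
  fixes f :: "real ^ 'n \<Rightarrow> real"
  assumes "real_polynomial_function f"
  shows "cpoly (\<lambda>x. complex_of_real (f x))"
  using assms
proof (induction rule: real_polynomial_function.induct)
  case (linear f)
  have "complex_of_real (f x) = (\<Sum>j\<in>UNIV. complex_of_real (x $ j) * complex_of_real (f (axis j 1)))" for x
  proof -
    interpret bounded_linear f by fact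
    have "f x = f (\<Sum>j\<in>UNIV. x $ j *\<^sub>R axis j 1)"
      by (simp add: basis_expansion flip: scalar_mult_eq_scaleR)
    also have "\<dots> = (\<Sum>j\<in>UNIV. x $ j * f (axis j 1))"
      by (simp add: sum scaleR)
    finally show ?thesis by simp
  qed
  then have "(\<lambda>x. complex_of_real (f x)) =
      (\<lambda>x. \<Sum>j\<in>UNIV. complex_of_real (x $ j) * complex_of_real (f (axis j 1)))"
    by (rule ext)
  moreover have "cpoly (\<lambda>x. \<Sum>j\<in>UNIV. complex_of_real (x $ j) * complex_of_real (f (axis j 1)))"
    by (intro cpoly_sum cpoly_mult cpoly_coord cpoly_const)
  ultimately show ?case by (simp only:)
qed (auto intro: cpoly.intros)

text \<open>Links the inductive class, whose closure under derivatives follows by rule induction,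
  with the polynomials that Stone-Weierstrass supplies.\<close>

lemma polynomial_function_cpoly:
  fixes f :: "real ^ 'n \<Rightarrow> complex"
  assumes "polynomial_function f"
  shows "cpoly f"
proof -
  have "real_polynomial_function (\<lambda>x. Re (f x))" "real_polynomial_function (\<lambda>x. Im (f x))"
    using assms[unfolded polynomial_function_def, rule_format, OF bounded_linear_Re]
      assms[unfolded polynomial_function_def, rule_format, OF bounded_linear_Im] by (simp_all add: o_def)
  then have "cpoly (\<lambda>x. complex_of_real (Re (f x)) + \<i> * complex_of_real (Im (f x)))"
    by (intro cpoly_add cpoly_mult cpoly_const real_polynomial_function_cpoly)
  moreover have "(\<lambda>x. complex_of_real (Re (f x)) + \<i> * complex_of_real (Im (f x))) = f"
    by (rule ext) (simp add: complex_eq_iff)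
  ultimately show ?thesis by simp
qed

text \<open>The powers \<open>t ^ k\<close> make the family closed under differentiation up to polynomial factors.\<close>

definition exp_cutoff :: "nat \<Rightarrow> real \<Rightarrow> real" where
  "exp_cutoff k t = (if t > 0 then exp (- 1 / t) / t ^ k else 0)"

text \<open>Raising the exponent costs a factor \<open>t\<close>. This brings both terms of a
  product rule to the same exponent \<open>k + 2\<close>.\<close>

lemma exp_cutoff_step: "exp_cutoff k t = t * exp_cutoff (Suc k) t"
  by (simp add: exp_cutoff_def)

lemma exp_cutoff_tendsto_0: "(exp_cutoff k \<longlongrightarrow> 0) (at 0)"
proof -
  have r: "(exp_cutoff k \<longlongrightarrow> 0) (at_right 0)"
  proof (rule Lim_transform_eventually)
    show "((\<lambda>t. exp (- 1 / t) / t ^ k) \<longlongrightarrow> 0) (at_right (0::real))"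
    proof -
      have "((\<lambda>x::real. x ^ k / exp x) \<longlongrightarrow> 0) at_top" by (rule tendsto_power_div_exp_0)
      then have "((\<lambda>t::real. (inverse t) ^ k / exp (inverse t)) \<longlongrightarrow> 0) (at_right 0)"
        by (rule filterlim_compose[OF _ filterlim_inverse_at_top_right])
      then show ?thesis by (simp add: exp_minus field_simps)
    qed
    show "\<forall>\<^sub>F x in at_right 0. exp (- 1 / x) / x ^ k = exp_cutoff k x"
      by (auto simp: exp_cutoff_def eventually_at_filter)
  qed
  moreover have "(exp_cutoff k \<longlongrightarrow> 0) (at_left 0)"
    by (rule Lim_transform_eventually[of "\<lambda>_. 0"])
       (auto simp: exp_cutoff_def eventually_at_filter)
  ultimately show ?thesis by (simp add: filterlim_split_at)
qed

lemma exp_cutoff_has_derivative: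
  "(exp_cutoff k has_real_derivative (1 - real k * t) * exp_cutoff (k + 2) t) (at t)"
proof -
  consider "t > 0" | "t < 0" | "t = 0" by linarith
  then show ?thesis
  proof cases
    case 1
    have "((\<lambda>t. exp (- 1 / t) / t ^ k) has_real_derivative
            (exp (- 1 / t) * (1 / t\<^sup>2) * t ^ k - exp (- 1 / t) * (real k * t ^ (k - 1))) / (t ^ k * t ^ k)) (at t)"
      using 1 by (auto intro!: derivative_eq_intros simp: power2_eq_square divide_simps)
    moreover have "(exp (- 1 / t) * (1 / t\<^sup>2) * t ^ k - exp (- 1 / t) * (real k * t ^ (k - 1))) / (t ^ k * t ^ k)
        = (1 - real k * t) * exp_cutoff (k + 2) t"
      using 1 by (cases k) (simp_all add: exp_cutoff_def field_simps power2_eq_square)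
    ultimately have "((\<lambda>t. exp (- 1 / t) / t ^ k) has_real_derivative
        (1 - real k * t) * exp_cutoff (k + 2) t) (at t)" by simp
    then show ?thesis
      by (rule has_field_derivative_transform_within_open[where S="{0<..}"])
         (use 1 in \<open>auto simp: exp_cutoff_def\<close>)
  next
    case 2
    have "((\<lambda>t. 0) has_real_derivative 0) (at t)" by simp
    then have "(exp_cutoff k has_real_derivative 0) (at t)"
      by (rule has_field_derivative_transform_within_open[where S="{..<0}"])
         (use 2 in \<open>auto simp: exp_cutoff_def\<close>)
    then show ?thesis using 2 by (simp add: exp_cutoff_def)
  next
    case 3
    \<comment> \<open>At the origin the difference quotient of \<open>exp_cutoff k\<close> is
      \<open>exp_cutoff (Suc k)\<close>, which tends to 0.\<close>
    have "((\<lambda>h. exp_cutoff k h / h) \<longlongrightarrow> 0) (at 0)"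
      by (rule Lim_transform_eventually[OF exp_cutoff_tendsto_0[of "Suc k"]])
         (auto simp: exp_cutoff_def eventually_at_filter)
    then show ?thesis using 3 by (simp add: DERIV_def exp_cutoff_def)
  qed
qed

lemma has_derivative_exp_cutoff_inner:
  fixes x :: "real ^ 'n"
  shows "((\<lambda>x. complex_of_real (exp_cutoff k (R - x \<bullet> x))) has_derivative
      (\<lambda>h. complex_of_real ((1 - real k * (R - x \<bullet> x)) * exp_cutoff (k + 2) (R - x \<bullet> x) * (- 2 * (x \<bullet> h))))) (at x)"
proof -
  have "((\<lambda>x. R - x \<bullet> x) has_derivative (\<lambda>h. - 2 * (x \<bullet> h))) (at x)"
    by (auto intro!: derivative_eq_intros simp: inner_commute)
  from has_derivative_compose[OF this exp_cutoff_has_derivative[of k "R - x \<bullet> x", unfolded has_field_derivative_def]]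
  show ?thesis
    by (intro bounded_linear.has_derivative[OF bounded_linear_of_real]) (simp add: mult_ac)
qed

text \<open>The argument is the difference of squares because the norm itself is not differentiable
  at the origin.\<close>

definition ball_bump :: "real \<Rightarrow> ('n::finite) cfun" where
  "ball_bump R x = complex_of_real (exp_cutoff 0 (R\<^sup>2 - x \<bullet> x))"

text \<open>Differentiation sends a polynomial times \<open>exp_cutoff k\<close> to a polynomial
  times \<open>exp_cutoff (k + 2)\<close>; the products of this kind form a family closed under
  derivatives.\<close>

lemma cpoly_bump_Ck_on:
  fixes P :: "('n::finite) cfun"
  assumes "cpoly P"
  shows "(\<lambda>x. P x * complex_of_real (exp_cutoff k (R - x \<bullet> x))) \<in> Ck_on l UNIV"
proof (rule Ck_on_coinduct[where
      F="{\<lambda>x. P x * complex_of_real (exp_cutoff k (R - x \<bullet> x)) |P k. cpoly P}"])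
  show "(\<lambda>x. P x * complex_of_real (exp_cutoff k (R - x \<bullet> x)))
      \<in> {\<lambda>x. P x * complex_of_real (exp_cutoff k (R - x \<bullet> x)) |P k. cpoly P}"
    by (rule CollectI, rule exI[of _ P], rule exI[of _ k]) (simp add: assms)
next
  fix f :: "'n cfun"
  assume "f \<in> {\<lambda>x. P x * complex_of_real (exp_cutoff k (R - x \<bullet> x)) |P k. cpoly P}"
  then obtain P k where f: "cpoly P" "f = (\<lambda>x. P x * complex_of_real (exp_cutoff k (R - x \<bullet> x)))"
    by (elim CollectE exE conjE) (rule that)
  have d: "(\<lambda>x::real^'n. complex_of_real (exp_cutoff k (R - x \<bullet> x))) differentiable (at x)" for x
    using has_derivative_exp_cutoff_inner unfolding differentiable_def by blast
  show "f differentiable_on UNIV"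
    unfolding f differentiable_on_def using differentiable_mult[OF cpoly_differentiable[OF f(1)] d] by simp
  fix j
  obtain P' where P': "cpoly P'" "\<And>x. pderivative j P x = P' x" using cpoly_pderivative[OF f(1)] by blast
  define s where "s = (\<lambda>x::real^'n. complex_of_real R - complex_of_real (x \<bullet> x))"
  define G where "G = (\<lambda>x. P' x * (s x * s x) + P x * ((1 - of_nat k * s x) * (- 2 * complex_of_real (x $ j))))"
  have s: "cpoly s" unfolding s_def by (intro cpoly_diff cpoly_const cpoly_inner)
  have "cpoly G" unfolding G_def
    by (intro cpoly_add cpoly_mult cpoly_diff cpoly_const cpoly_coord f s P')
  moreover have "pderivative j f x = G x * complex_of_real (exp_cutoff (k + 2) (R - x \<bullet> x))" for x
  proof -
    \<comment> \<open>Two steps of the recursion lift the undifferentiated factor to the exponent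
      that the differentiated one has.\<close>
    have e: "complex_of_real (exp_cutoff k (R - x \<bullet> x)) = s x * s x * complex_of_real (exp_cutoff (k + 2) (R - x \<bullet> x))"
      using exp_cutoff_step[of k "R - x \<bullet> x"] exp_cutoff_step[of "Suc k" "R - x \<bullet> x"]
      by (simp add: s_def)
    have "pderivative j f x = P' x * complex_of_real (exp_cutoff k (R - x \<bullet> x)) +
        P x * pderivative j (\<lambda>x. complex_of_real (exp_cutoff k (R - x \<bullet> x))) x"
      unfolding f(2) using pderivative_mult[OF cpoly_differentiable[OF f(1)] d] P' by simp
    also have "pderivative j (\<lambda>x. complex_of_real (exp_cutoff k (R - x \<bullet> x))) x =
        complex_of_real ((1 - real k * (R - x \<bullet> x)) * exp_cutoff (k + 2) (R - x \<bullet> x) * (- 2 * (x \<bullet> axis j 1)))"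
      by (rule pderivative_eq[OF has_derivative_exp_cutoff_inner])
    also have "\<dots> = (1 - of_nat k * s x) * (- 2 * complex_of_real (x $ j)) * complex_of_real (exp_cutoff (k + 2) (R - x \<bullet> x))"
      by (simp add: s_def inner_axis)
    finally show ?thesis unfolding e G_def by (simp add: algebra_simps)
  qed
  ultimately show "\<exists>g\<in>{\<lambda>x. P x * complex_of_real (exp_cutoff k (R - x \<bullet> x)) |P k. cpoly P}.
      \<forall>x\<in>UNIV. pderivative j f x = g x"
    by (intro bexI[of _ "\<lambda>x. G x * complex_of_real (exp_cutoff (k + 2) (R - x \<bullet> x))"]) auto
qed simp

lemma ball_bump_Ck_on: "ball_bump R \<in> Ck_on k UNIV"
  using cpoly_bump_Ck_on[OF cpoly_const[of 1], of 0 "R\<^sup>2"] by (simp add: ball_bump_def[abs_def])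

lemma ball_bump_0: "R \<ge> 0 \<Longrightarrow> norm x \<ge> R \<Longrightarrow> ball_bump R x = 0"
  using power_mono[of R "norm x" 2]
  by (simp add: ball_bump_def exp_cutoff_def dot_square_norm not_less)

lemma ball_bump_nonzero: "norm x < R \<Longrightarrow> ball_bump R x \<noteq> 0"
  using power_strict_mono[of "norm x" R 2]
  by (auto simp: ball_bump_def exp_cutoff_def dot_square_norm)

section \<open>Test functions as smooth functions of bounded support\<close>

lemma Cc_iff: "f \<in> Cc \<longleftrightarrow> continuous_on UNIV f \<and> (\<exists>R>0. \<forall>x. norm x > R \<longrightarrow> f x = 0)"
proof -
  have "\<exists>R>0. \<forall>x. norm x > R \<longrightarrow> f x = 0" if "compact K" "\<forall>x. x \<notin> K \<longrightarrow> f x = 0" for K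
  proof -
    obtain B where "B > 0" "\<forall>x\<in>K. norm x \<le> B" using compact_imp_bounded[OF \<open>compact K\<close>] bounded_pos by blast
    then show ?thesis using that(2) by (intro exI[of _ B]) force
  qed
  moreover have "\<exists>K. compact K \<and> (\<forall>x. x \<notin> K \<longrightarrow> f x = 0)" if "\<forall>x. norm x > R \<longrightarrow> f x = 0" for R
    using that by (intro exI[of _ "cball 0 R"]) auto
  ultimately show ?thesis unfolding Cc_def by blast
qed

lemma test_fun_iff:
  "f \<in> test_fun \<longleftrightarrow> (\<forall>k. f \<in> Ck_on k UNIV) \<and> (\<exists>R>0. \<forall>x. norm x > R \<longrightarrow> f x = 0)"
  unfolding test_fun_def Int_iff Cc_iff INT_iff using Ck_on_0[of f UNIV] by auto

lemma test_fun_Ck_on: "f \<in> test_fun \<Longrightarrow> f \<in> Ck_on k UNIV"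
  by (simp add: test_fun_iff)

lemma test_fun_Cc: "f \<in> test_fun \<Longrightarrow> f \<in> Cc"
  by (simp add: test_fun_def)

lemma test_fun_differentiable: "f \<in> test_fun \<Longrightarrow> f differentiable (at x)"
  using test_fun_Ck_on[of f 1] by (auto simp: Ck_on_Suc differentiable_on_def)

lemma test_fun_continuous: "f \<in> test_fun \<Longrightarrow> continuous_on UNIV f"
  using test_fun_Cc[of f] by (simp add: Cc_def)

lemma test_fun_mult_smooth:
  assumes "f \<in> test_fun" "\<And>k. g \<in> Ck_on k UNIV"
  shows "(\<lambda>x. f x * g x) \<in> test_fun"
  using assms unfolding test_fun_iff by (auto intro: Ck_on_mult)

lemma test_fun_scale: "f \<in> test_fun \<Longrightarrow> (\<lambda>x. c * f x) \<in> test_fun"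
  using test_fun_mult_smooth[of f "\<lambda>x. c", OF _ Ck_on_const[OF open_UNIV]] by (simp add: mult.commute)

lemma test_fun_add:
  assumes "f \<in> test_fun" "g \<in> test_fun"
  shows "(\<lambda>x. f x + g x) \<in> test_fun"
proof -
  obtain R S where "R > 0" "S > 0" "\<forall>x. norm x > R \<longrightarrow> f x = 0" "\<forall>x. norm x > S \<longrightarrow> g x = 0"
    using assms by (auto simp: test_fun_iff)
  then have "max R S > 0 \<and> (\<forall>x. norm x > max R S \<longrightarrow> f x + g x = 0)" by auto
  then show ?thesis using assms unfolding test_fun_iff by (blast intro: Ck_on_add)
qed

lemma test_fun_diff:
  assumes "f \<in> test_fun" "g \<in> test_fun"
  shows "(\<lambda>x. f x - g x) \<in> test_fun"
  using test_fun_add[OF assms(1) test_fun_scale[OF assms(2), of "-1"]] by simp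

lemma test_fun_0: "(\<lambda>x. 0) \<in> test_fun"
  unfolding test_fun_iff by (auto intro: Ck_on_const exI[of _ 1])

lemma pderivative_outside_support:
  assumes "\<And>x. norm x > R \<Longrightarrow> f x = 0" "norm x > R"
  shows "pderivative j f x = 0"
proof -
  have "open {x::real^'a. norm x > R}" by (rule open_Collect_less) (auto intro: continuous_intros)
  then have "pderivative j f x = pderivative j (\<lambda>x. 0) x"
    using assms by (intro pderivative_cong_open) auto
  then show ?thesis by simp
qed

lemma test_fun_pderivative:
  assumes "f \<in> test_fun"
  shows "pderivative j f \<in> test_fun"
proof -
  have "pderivative j f \<in> Ck_on k UNIV" for k using test_fun_Ck_on[OF assms, of "Suc k"] by (simp add: Ck_on_Suc)
  then show ?thesis using assms pderivative_outside_support[of _ f] unfolding test_fun_iff by blast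
qed

lemma ball_bump_test_fun: "R > 0 \<Longrightarrow> ball_bump R \<in> test_fun"
  unfolding test_fun_iff using ball_bump_Ck_on ball_bump_0 by (auto intro!: exI[of _ R] ball_bump_0)

lemma test_fun_cpoly_bump: "R > 0 \<Longrightarrow> cpoly P \<Longrightarrow> (\<lambda>x. ball_bump R x * P x) \<in> test_fun"
  by (intro test_fun_mult_smooth ball_bump_test_fun cpoly_Ck_on)

subsection \<open>Symbols\<close>

lemma has_derivative_inverse_norm_power:
  fixes x :: "real ^ 'n"
  assumes "x \<noteq> 0"
  shows "((\<lambda>x. complex_of_real (1 / norm x ^ k)) has_derivative
      (\<lambda>h. complex_of_real (- real k * (x \<bullet> h) / norm x ^ (k + 2)))) (at x)"
proof -
  have "((\<lambda>x. 1 / norm x ^ k) has_derivative (\<lambda>h. - real k * (x \<bullet> h) / norm x ^ (k + 2))) (at x)"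
  proof -
    have "((\<lambda>t. 1 / t ^ k) has_real_derivative (- real k / t ^ (k + 1))) (at t)" if "t \<noteq> 0" for t :: real
    proof -
      have "((\<lambda>t. inverse (t ^ k)) has_real_derivative
          - (inverse (t ^ k) * (real k * t ^ (k - 1)) * inverse (t ^ k))) (at t)"
        using that DERIV_pow[of k t UNIV] by (intro DERIV_inverse') auto
      moreover have "inverse (t ^ k) * (real k * t ^ (k - 1)) * inverse (t ^ k) = real k / t ^ (k + 1)"
        using that by (cases k) (simp_all add: field_simps)
      ultimately show ?thesis by (simp add: inverse_eq_divide)
    qed
    from has_derivative_compose[OF has_derivative_norm[OF assms] this[of "norm x", unfolded has_field_derivative_def]]
    show ?thesis using assms
      by (auto elim!: has_derivative_eq_rhs simp: sgn_div_norm field_simps inner_commute)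
  qed
  then show ?thesis
    by (rule bounded_linear.has_derivative[OF bounded_linear_of_real])
qed

text \<open>The derivative of P / |x|^k is (|x|^2 P' - k x_j P) / |x|^(k+2), again a polynomial over
  a power of the norm, so the family of such quotients is closed under derivatives.\<close>

lemma cpoly_norm_power_Ck_on:
  fixes P :: "('n::finite) cfun"
  assumes "cpoly P"
  shows "(\<lambda>x. P x * complex_of_real (1 / norm x ^ k)) \<in> Ck_on l (- {0})"
proof (rule Ck_on_coinduct[where F="{\<lambda>x. P x * complex_of_real (1 / norm x ^ k) |P k. cpoly P}"])
  show "(\<lambda>x. P x * complex_of_real (1 / norm x ^ k))
      \<in> {\<lambda>x. P x * complex_of_real (1 / norm x ^ k) |P k. cpoly P}"
    using assms by blast
next
  fix f :: "'n cfun"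
  assume "f \<in> {\<lambda>x. P x * complex_of_real (1 / norm x ^ k) |P k. cpoly P}"
  then obtain P k where f: "cpoly P" "f = (\<lambda>x. P x * complex_of_real (1 / norm x ^ k))"
    by blast
  have d: "(\<lambda>x::real^'n. complex_of_real (1 / norm x ^ k)) differentiable (at x)" if "x \<noteq> 0" for x
    using has_derivative_inverse_norm_power[OF that] unfolding differentiable_def by blast
  have "(\<lambda>x. P x * complex_of_real (1 / norm x ^ k)) differentiable (at x)" if "x \<noteq> 0" for x
    using d[OF that] cpoly_differentiable[OF f(1)] by (rule differentiable_mult[rotated])
  then show "f differentiable_on - {0}"
    unfolding f by (subst differentiable_on_eq_differentiable_at) auto
  fix j
  obtain P' where P': "cpoly P'" "\<And>x. pderivative j P x = P' x" using cpoly_pderivative[OF f(1)] by blast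
  define G where "G = (\<lambda>x. P' x * complex_of_real (x \<bullet> x) + P x * (- of_nat k * complex_of_real (x $ j)))"
  have "cpoly G" unfolding G_def
    by (intro cpoly_add cpoly_mult cpoly_diff cpoly_const cpoly_coord cpoly_inner f P')
  moreover have "pderivative j f x = G x * complex_of_real (1 / norm x ^ (k + 2))" if "x \<noteq> 0" for x
  proof -
    have "pderivative j f x = P' x * complex_of_real (1 / norm x ^ k) +
        P x * pderivative j (\<lambda>x. complex_of_real (1 / norm x ^ k)) x"
      unfolding f(2) using pderivative_mult[OF cpoly_differentiable[OF f(1)] d[OF that]] P' by simp
    also have "pderivative j (\<lambda>x. complex_of_real (1 / norm x ^ k)) x =
        complex_of_real (- real k * (x \<bullet> axis j 1) / norm x ^ (k + 2))"
      by (rule pderivative_eq[OF has_derivative_inverse_norm_power[OF that]])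
    finally show ?thesis using that
      by (simp add: G_def dot_square_norm inner_axis field_simps power2_eq_square)
  qed
  ultimately show "\<exists>g\<in>{\<lambda>x. P x * complex_of_real (1 / norm x ^ k) |P k. cpoly P}.
      \<forall>x\<in>- {0}. pderivative j f x = g x"
    by (intro bexI[of _ "\<lambda>x. G x * complex_of_real (1 / norm x ^ (k + 2))"]) blast+
qed auto

lemma hom_ext_coord_mult:
  "\<xi> \<noteq> 0 \<Longrightarrow> hom_ext (\<lambda>\<xi>. complex_of_real (\<xi> $ j / norm \<xi>) * \<psi> \<xi>) \<xi>
     = complex_of_real (\<xi> $ j / norm \<xi>) * hom_ext \<psi> \<xi>"
  by (simp add: hom_ext_def norm_sgn sgn_div_norm field_simps)

lemma Ck_sphere_coord_mult:
  assumes "\<psi> \<in> Ck_sphere k"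
  shows "(\<lambda>\<xi>. complex_of_real (\<xi> $ j / norm \<xi>) * \<psi> \<xi>) \<in> Ck_sphere k"
proof -
  have "(\<lambda>\<xi>. complex_of_real (\<xi> $ j) * complex_of_real (1 / norm \<xi> ^ 1)) \<in> Ck_on k (- {0})"
    by (rule cpoly_norm_power_Ck_on[OF cpoly_coord])
  then have "(\<lambda>\<xi>. complex_of_real (\<xi> $ j) * complex_of_real (1 / norm \<xi> ^ 1) * hom_ext \<psi> \<xi>) \<in> Ck_on k (- {0})"
    using assms by (intro Ck_on_mult[OF _ _ assms[unfolded Ck_sphere_def mem_Collect_eq]]) auto
  then show ?thesis
    unfolding Ck_sphere_def mem_Collect_eq
    by (subst Ck_on_cong[of _ _ "\<lambda>\<xi>. complex_of_real (\<xi> $ j) * complex_of_real (1 / norm \<xi> ^ 1) * hom_ext \<psi> \<xi>"])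
       (use hom_ext_coord_mult[of _ j \<psi>] in auto)
qed

lemma Ck_sphere_add:
  assumes "\<psi> \<in> Ck_sphere k" "\<eta> \<in> Ck_sphere k"
  shows "(\<lambda>\<xi>. \<psi> \<xi> + \<eta> \<xi>) \<in> Ck_sphere k"
  using assms Ck_on_add[of "-{0}" "hom_ext \<psi>" k "hom_ext \<eta>"]
  by (auto simp: Ck_sphere_def hom_ext_def[abs_def])

lemma Ck_sphere_const: "(\<lambda>\<xi>. c) \<in> Ck_sphere k"
  using Ck_on_const[of "-{0}" c k] by (auto simp: Ck_sphere_def hom_ext_def[abs_def])

lemma hom_ext_bounded:
  assumes "\<psi> \<in> Ck_sphere k"
  shows "\<exists>C. \<forall>\<xi>. norm (hom_ext \<psi> \<xi>) \<le> C"
proof -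
  have "continuous_on (- {0}) (hom_ext \<psi>)"
    using Ck_on_antimono[of "hom_ext \<psi>" k "- {0}" 0] assms by (simp add: Ck_sphere_def Ck_on_0)
  then have "continuous_on (sphere 0 1) (hom_ext \<psi>)"
    by (rule continuous_on_subset) auto
  then have "bounded (hom_ext \<psi> ` sphere 0 1)"
    by (intro compact_imp_bounded compact_continuous_image) auto
  then obtain C where C: "\<forall>\<xi>\<in>sphere 0 1. norm (hom_ext \<psi> \<xi>) \<le> C"
    by (auto simp: bounded_iff)
  \<comment> \<open>Compactness of the sphere covers every nonzero point; at the origin the
    extension takes the value \<open>\<psi> 0\<close>, since \<open>sgn 0 = 0\<close>.\<close>
  have "norm (hom_ext \<psi> \<xi>) \<le> max C (norm (\<psi> 0))" for \<xi>
  proof (cases "\<xi> = 0")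
    case False
    then have "sgn \<xi> \<in> sphere 0 1" by (simp add: norm_sgn)
    then have "norm (hom_ext \<psi> (sgn \<xi>)) \<le> C" using C by blast
    then show ?thesis using False by (simp add: hom_ext_def le_max_iff_disj sgn_div_norm[of "sgn \<xi>"] norm_sgn)
  qed (simp add: hom_ext_def)
  then show ?thesis by blast
qed

lemma hom_ext_measurable:
  assumes "\<psi> \<in> Ck_sphere k"
  shows "hom_ext \<psi> \<in> borel_measurable borel"
proof -
  have "continuous_on (- {0}) (hom_ext \<psi>)"
    using Ck_on_antimono[of "hom_ext \<psi>" k "- {0}" 0] assms by (simp add: Ck_sphere_def Ck_on_0)
  then have "(\<lambda>x. if x \<in> - {0} then hom_ext \<psi> x else hom_ext \<psi> 0) \<in> borel_measurable borel"
    by (intro borel_measurable_continuous_on_if) auto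
  moreover have "(\<lambda>x. if x \<in> - {0} then hom_ext \<psi> x else hom_ext \<psi> 0) = hom_ext \<psi>" by auto
  ultimately show ?thesis by simp
qed

section \<open>Lebesgue spaces\<close>

lemma borel_measurable_lebesgue_of_borel:
  "f \<in> borel_measurable borel \<Longrightarrow> f \<in> borel_measurable lebesgue"
  by (intro measurable_completion) simp

text \<open>The p-th power of the norm. Its triangle inequality has the factor
  \<open>2 powr p\<close> but holds for every positive exponent by a pointwise bound, and
  convergence to 0 means the same as for the norm (\<open>Lp_strongly_iff_modular\<close>).\<close>

definition Lp_modular :: "real \<Rightarrow> ('n::finite) cfun \<Rightarrow> real" where
  "Lp_modular p f = (\<integral>x. norm (f x) powr p \<partial>lebesgue)"

lemma Lp_modular_nonneg: "Lp_modular p f \<ge> 0"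
  unfolding Lp_modular_def by simp

lemma Lp_norm_modular: "Lp_norm p f = Lp_modular p f powr (1 / p)"
  by (simp add: Lp_norm_def Lp_modular_def)

lemma norm_add_powr_le:
  fixes a b :: complex
  assumes "p > 0"
  shows "norm (a + b) powr p \<le> 2 powr p * (norm a powr p + norm b powr p)"
proof -
  have "norm (a + b) powr p \<le> (2 * max (norm a) (norm b)) powr p"
    using assms norm_triangle_ineq[of a b] by (intro powr_mono2) auto
  also have "\<dots> = 2 powr p * max (norm a) (norm b) powr p" by (simp add: powr_mult)
  also have "\<dots> \<le> 2 powr p * (norm a powr p + norm b powr p)"
    by (intro mult_left_mono) (auto simp: max_def)
  finally show ?thesis .
qed

lemma Lp_space_measurable: "f \<in> Lp_space p \<Longrightarrow> f \<in> borel_measurable lebesgue"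
  by (simp add: Lp_space_def)

lemma Lp_space_integrable: "f \<in> Lp_space p \<Longrightarrow> integrable lebesgue (\<lambda>x. norm (f x) powr p)"
  by (simp add: Lp_space_def)

lemma Lp_space_bound:
  assumes "f \<in> borel_measurable lebesgue" "integrable lebesgue g"
    "AE x in lebesgue. norm (f x) powr p \<le> g x"
  shows "f \<in> Lp_space p"
proof -
  have "integrable lebesgue (\<lambda>x. norm (f x) powr p)"
    by (rule Bochner_Integration.integrable_bound[OF assms(2)])
       (use assms in \<open>auto elim!: eventually_mono\<close>)
  then show ?thesis using assms(1) by (simp add: Lp_space_def)
qed

lemma Lp_modular_mono:
  assumes "f \<in> borel_measurable lebesgue" "integrable lebesgue g"
    "AE x in lebesgue. norm (f x) powr p \<le> g x"
  shows "Lp_modular p f \<le> (\<integral>x. g x \<partial>lebesgue)"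
  unfolding Lp_modular_def
  using Lp_space_integrable[OF Lp_space_bound[OF assms]] assms by (intro integral_mono_AE) auto

lemma Lp_space_add:
  assumes "f \<in> Lp_space p" "g \<in> Lp_space p" "p > 0"
  shows "(\<lambda>x. f x + g x) \<in> Lp_space p"
  using norm_add_powr_le[OF assms(3)] assms
  by (intro Lp_space_bound[where g="\<lambda>x. 2 powr p * (norm (f x) powr p + norm (g x) powr p)"])
     (auto simp: Lp_space_def)

lemma Lp_modular_add_le:
  assumes "f \<in> Lp_space p" "g \<in> Lp_space p" "p > 0"
  shows "Lp_modular p (\<lambda>x. f x + g x) \<le> 2 powr p * (Lp_modular p f + Lp_modular p g)"
proof -
  have "Lp_modular p (\<lambda>x. f x + g x) \<le> (\<integral>x. 2 powr p * (norm (f x) powr p + norm (g x) powr p) \<partial>lebesgue)"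
    using norm_add_powr_le[OF assms(3)] assms by (intro Lp_modular_mono) (auto simp: Lp_space_def)
  also have "\<dots> = 2 powr p * (Lp_modular p f + Lp_modular p g)"
    using assms by (simp add: Lp_space_def Lp_modular_def)
  finally show ?thesis .
qed

lemma Lp_modular_scale: "Lp_modular p (\<lambda>x. c * f x) = norm c powr p * Lp_modular p f"
  by (simp add: Lp_modular_def norm_mult powr_mult)

lemma Lp_space_scale: "f \<in> Lp_space p \<Longrightarrow> (\<lambda>x. c * f x) \<in> Lp_space p"
  by (auto simp: Lp_space_def norm_mult powr_mult)

lemma Lp_space_diff:
  assumes "f \<in> Lp_space p" "g \<in> Lp_space p" "p > 0"
  shows "(\<lambda>x. f x - g x) \<in> Lp_space p"
  using Lp_space_add[OF assms(1) Lp_space_scale[OF assms(2), of "-1"] assms(3)] by simp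

lemma Lp_modular_diff_commute: "Lp_modular p (\<lambda>x. f x - g x) = Lp_modular p (\<lambda>x. g x - f x)"
  by (simp add: Lp_modular_def norm_minus_commute)

lemma Lp_modular_diff_le:
  assumes "f \<in> Lp_space p" "g \<in> Lp_space p" "p > 0"
  shows "Lp_modular p (\<lambda>x. f x - g x) \<le> 2 powr p * (Lp_modular p f + Lp_modular p g)"
  using Lp_modular_add_le[OF assms(1) Lp_space_scale[OF assms(2), of "-1"] assms(3)]
    Lp_modular_scale[of p "-1" g] by simp

lemma Lp_modular_triangle:
  assumes "f \<in> Lp_space p" "g \<in> Lp_space p" "h \<in> Lp_space p" "p > 0"
  shows "Lp_modular p (\<lambda>x. f x - h x)
    \<le> 2 powr p * (Lp_modular p (\<lambda>x. f x - g x) + Lp_modular p (\<lambda>x. g x - h x))"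
  using Lp_modular_add_le[OF Lp_space_diff[OF assms(1,2,4)] Lp_space_diff[OF assms(2,3,4)] assms(4)]
  by simp

lemma Lp_space_0 [simp]: "(\<lambda>x. 0) \<in> Lp_space p"
  by (simp add: Lp_space_def)

lemma Lp_space_cong_AE:
  assumes "f \<in> Lp_space p" "AE x in lebesgue. f x = g x"
  shows "g \<in> Lp_space p"
proof -
  have m: "g \<in> borel_measurable lebesgue"
    using borel_measurable_AE[OF Lp_space_measurable[OF assms(1)] assms(2)] .
  show ?thesis
    by (rule Lp_space_bound[OF m Lp_space_integrable[OF assms(1)]]) (use assms(2) in \<open>auto elim!: eventually_mono\<close>)
qed

lemma Lp_modular_cong_AE:
  assumes "f \<in> Lp_space p" "AE x in lebesgue. f x = g x"
  shows "Lp_modular p f = Lp_modular p g"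
  unfolding Lp_modular_def
  using Lp_space_integrable[OF assms(1)] Lp_space_integrable[OF Lp_space_cong_AE[OF assms]]
  by (intro integral_cong_AE) (use assms(2) in \<open>auto elim!: eventually_mono\<close>)

lemma Lp_modular_eq_0_imp_AE:
  assumes "f \<in> Lp_space p" "Lp_modular p f \<le> 0"
  shows "AE x in lebesgue. f x = 0"
proof -
  have "Lp_modular p f = 0" using assms(2) Lp_modular_nonneg[of p f] by linarith
  then have "AE x in lebesgue. norm (f x) powr p = 0"
    using Lp_space_integrable[OF assms(1)] unfolding Lp_modular_def
    by (subst (asm) integral_nonneg_eq_0_iff_AE) auto
  then show ?thesis by (auto elim!: eventually_mono)
qed

lemma Lp_strongly_iff_modular:
  assumes "p > 0"
  shows "Lp_strongly p F f \<longleftrightarrow> (\<forall>n. F n \<in> Lp_space p) \<and> f \<in> Lp_space p \<and>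
     (\<lambda>n. Lp_modular p (\<lambda>x. F n x - f x)) \<longlonglongrightarrow> 0"
proof -
  have "(\<lambda>n. Lp_norm p (\<lambda>x. F n x - f x)) \<longlonglongrightarrow> 0 \<longleftrightarrow>
     (\<lambda>n. Lp_modular p (\<lambda>x. F n x - f x)) \<longlonglongrightarrow> 0"
  proof
    assume "(\<lambda>n. Lp_norm p (\<lambda>x. F n x - f x)) \<longlonglongrightarrow> 0"
    then have "(\<lambda>n. Lp_norm p (\<lambda>x. F n x - f x) powr p) \<longlonglongrightarrow> 0 powr p"
      using assms by (intro tendsto_powr2) (auto simp: Lp_norm_def)
    moreover have "Lp_norm p (\<lambda>x. F n x - f x) powr p = Lp_modular p (\<lambda>x. F n x - f x)" for n
      using assms by (simp add: Lp_norm_modular powr_powr Lp_modular_nonneg)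
    ultimately show "(\<lambda>n. Lp_modular p (\<lambda>x. F n x - f x)) \<longlonglongrightarrow> 0" by simp
  next
    assume "(\<lambda>n. Lp_modular p (\<lambda>x. F n x - f x)) \<longlonglongrightarrow> 0"
    then have "(\<lambda>n. Lp_modular p (\<lambda>x. F n x - f x) powr (1/p)) \<longlonglongrightarrow> 0 powr (1/p)"
      using assms by (intro tendsto_powr2) (auto simp: Lp_modular_nonneg)
    then show "(\<lambda>n. Lp_norm p (\<lambda>x. F n x - f x)) \<longlonglongrightarrow> 0" by (simp add: Lp_norm_modular)
  qed
  then show ?thesis by (simp add: Lp_strongly_def)
qed

section \<open>Bounded support, Fatou's lemma and completeness\<close>

lemma bounded_ball_support_integrable:
  fixes f :: "real ^ 'n \<Rightarrow> 'b::{banach, second_countable_topology}"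
  assumes "f \<in> borel_measurable lebesgue" "AE x in lebesgue. norm (f x) \<le> M" "AE x in lebesgue. norm x > R \<longrightarrow> f x = 0"
  shows "integrable lebesgue f"
proof (rule Bochner_Integration.integrable_bound)
  show "integrable lebesgue (\<lambda>x. M * indicator (cball (0::real^'n) R) x)"
    by (intro integrable_mult_right integrable_real_indicator)
       (use emeasure_lborel_cball_finite[of "0::real^'n" R] in \<open>auto simp: top.not_eq_extremum\<close>)
  show "AE x in lebesgue. norm (f x) \<le> norm (M * indicator (cball 0 R) x)"
    using assms(2,3) by eventually_elim (auto simp: indicator_def)
qed fact

lemma Cc_integrable_lebesgue:
  assumes "f \<in> Cc"
  shows "integrable lebesgue f" "f \<in> borel_measurable lebesgue"
    "\<exists>M. \<forall>x. norm (f x) \<le> M" "p > 0 \<Longrightarrow> f \<in> Lp_space p"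
proof -
  obtain R where R: "R > 0" "\<forall>x. norm x > R \<longrightarrow> f x = 0" and c: "continuous_on UNIV f"
    using assms by (auto simp: Cc_iff)
  have "bounded (f ` cball 0 R)"
    by (intro compact_imp_bounded compact_continuous_image continuous_on_subset[OF c]) auto
  then obtain M where M: "\<forall>x\<in>cball 0 R. norm (f x) \<le> M" by (auto simp: bounded_iff)
  have b: "norm (f x) \<le> max M 0" for x
    using M R by (cases "norm x \<le> R") (force simp: le_max_iff_disj)+
  then show "\<exists>M. \<forall>x. norm (f x) \<le> M" by blast
  show m: "f \<in> borel_measurable lebesgue"
    by (intro borel_measurable_lebesgue_of_borel borel_measurable_continuous_onI c)
  show "integrable lebesgue f"
    by (rule bounded_ball_support_integrable[OF m, of "max M 0" R]) (use b R in auto)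
  show "f \<in> Lp_space p" if "p > 0"
  proof -
    have "integrable lebesgue (\<lambda>x. norm (f x) powr p)"
    proof (rule bounded_ball_support_integrable[of _ "(max M 0) powr p" R])
      show "(\<lambda>x. norm (f x) powr p) \<in> borel_measurable lebesgue" using m by measurable
      show "AE x in lebesgue. norm (norm (f x) powr p) \<le> max M 0 powr p"
        using b that by (intro always_eventually allI) (simp add: powr_mono2)
      show "AE x in lebesgue. R < norm x \<longrightarrow> norm (f x) powr p = 0" using R by auto
    qed
    then show ?thesis using m by (simp add: Lp_space_def)
  qed
qed

lemma nn_integral_Lp_modular:
  "f \<in> Lp_space p \<Longrightarrow> (\<integral>\<^sup>+x. ennreal (norm (f x) powr p) \<partial>lebesgue) = ennreal (Lp_modular p f)"
  unfolding Lp_modular_def by (intro nn_integral_eq_integral Lp_space_integrable) auto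

text \<open>Fatou's lemma for p-th powers. The bound is asked for only eventually, which is what the
  tail of a Cauchy sequence offers.\<close>

lemma Lp_fatou:
  assumes "\<And>k::nat. F k \<in> Lp_space p" "f \<in> borel_measurable lebesgue"
    "AE x in lebesgue. (\<lambda>k. F k x) \<longlonglongrightarrow> f x" "\<forall>\<^sub>F k in sequentially. Lp_modular p (F k) \<le> C" "p > 0"
  shows "f \<in> Lp_space p" "Lp_modular p f \<le> C"
proof -
  have meas: "F k \<in> borel_measurable lebesgue" for k using assms(1) Lp_space_measurable by blast
  obtain k0 where k0: "\<And>k. k \<ge> k0 \<Longrightarrow> Lp_modular p (F k) \<le> C"
    using assms(4) by (auto simp: eventually_sequentially)
  have C: "C \<ge> 0" using k0[of k0] Lp_modular_nonneg[of p "F k0"] by linarith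
  have "(\<integral>\<^sup>+x. ennreal (norm (f x) powr p) \<partial>lebesgue)
      = (\<integral>\<^sup>+x. liminf (\<lambda>k. ennreal (norm (F k x) powr p)) \<partial>lebesgue)"
  proof (rule nn_integral_cong_AE, use assms(3) in eventually_elim)
    fix x assume "(\<lambda>k. F k x) \<longlonglongrightarrow> f x"
    then have "(\<lambda>k. norm (F k x) powr p) \<longlonglongrightarrow> norm (f x) powr p"
      using assms(5) by (intro tendsto_powr2 tendsto_norm) auto
    then have "(\<lambda>k. ennreal (norm (F k x) powr p)) \<longlonglongrightarrow> ennreal (norm (f x) powr p)"
      by (rule tendsto_ennrealI)
    then show "ennreal (norm (f x) powr p) = liminf (\<lambda>k. ennreal (norm (F k x) powr p))"
      by (rule lim_imp_Liminf[symmetric, rotated]) simp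
  qed
  also have "\<dots> \<le> liminf (\<lambda>k. \<integral>\<^sup>+x. ennreal (norm (F k x) powr p) \<partial>lebesgue)"
    using meas by (intro nn_integral_liminf) measurable
  also have "\<dots> \<le> liminf (\<lambda>k. ennreal C)"
    by (rule Liminf_mono)
      (use k0 assms(1) in \<open>auto simp: nn_integral_Lp_modular eventually_sequentially intro!: exI[of _ k0] ennreal_leI\<close>)
  finally have fin: "(\<integral>\<^sup>+x. ennreal (norm (f x) powr p) \<partial>lebesgue) \<le> ennreal C"
    by (simp add: Liminf_const)
  have "integrable lebesgue (\<lambda>x. norm (f x) powr p)"
  proof (rule integrableI_bounded)
    show "(\<lambda>x. norm (f x) powr p) \<in> borel_measurable lebesgue" using assms(2) by measurable
    show "(\<integral>\<^sup>+ x. ennreal (norm (norm (f x) powr p)) \<partial>lebesgue) < \<infinity>"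
      using fin le_less_trans[OF _ ennreal_less_top] by simp
  qed
  then show f: "f \<in> Lp_space p" using assms(2) by (simp add: Lp_space_def)
  show "Lp_modular p f \<le> C" using fin C unfolding nn_integral_Lp_modular[OF f] by simp
qed

text \<open>Riesz-Fischer. Along a subsequence the k-th successive difference has modular at most
  4^(-pk); weighted with 2^(pk) these still form a convergent series, so at almost every point the
  differences are bounded by a constant times 2^(-k) and the subsequence converges. Fatou's lemma
  then identifies the limit of the full sequence.\<close>

lemma Lp_complete:
  assumes F: "\<And>k::nat. F k \<in> Lp_space p" and p: "p > 0"
    and cauchy: "\<And>e. e > 0 \<Longrightarrow> \<exists>N. \<forall>m\<ge>N. \<forall>n\<ge>N. Lp_modular p (\<lambda>x. F m x - F n x) < e"
  shows "\<exists>f\<in>Lp_space p. (\<lambda>n. Lp_modular p (\<lambda>x. F n x - f x)) \<longlonglongrightarrow> 0"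
proof -
  have "\<forall>k. \<exists>N. \<forall>m\<ge>N. \<forall>n\<ge>N. Lp_modular p (\<lambda>x. F m x - F n x) < (1/4) powr (p * real k)"
    using cauchy by simp
  then obtain N where N: "\<And>k m n. m \<ge> N k \<Longrightarrow> n \<ge> N k \<Longrightarrow>
      Lp_modular p (\<lambda>x. F m x - F n x) < (1/4) powr (p * real k)"
    by metis
  \<comment> \<open>Adding up all earlier thresholds makes \<open>s k\<close> exceed both
    \<open>N k\<close> and \<open>k\<close>, and \<open>s (Suc k)\<close> exceed \<open>N k\<close>,
    without assuming that \<open>N\<close> is monotone.\<close>
  define s where "s k = k + (\<Sum>i\<le>k. N i)" for k
  have s1: "s k \<ge> N k" "s (Suc k) \<ge> N k" "s k \<ge> k" for k
  proof -
    have "N k \<le> (\<Sum>i\<le>k. N i)" by (rule member_le_sum) auto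
    then show "s k \<ge> N k" "s (Suc k) \<ge> N k" "s k \<ge> k" by (simp_all add: s_def)
  qed
  define G where "G k = F (s k)" for k
  define d where "d k x = G (Suc k) x - G k x" for k x
  have G: "G k \<in> Lp_space p" for k unfolding G_def by (rule F)
  have d: "d k \<in> Lp_space p" for k unfolding d_def[abs_def] by (intro Lp_space_diff G p)
  have Gm: "G k \<in> borel_measurable lebesgue" "d k \<in> borel_measurable lebesgue" for k
    using G d Lp_space_measurable by blast+
  have dn: "Lp_modular p (d k) \<le> (1/4) powr (p * real k)" for k
    unfolding d_def G_def using N[of k "s (Suc k)" "s k"] s1 by (simp add: less_imp_le)
  have "(\<integral>\<^sup>+x. (\<Sum>k. ennreal (2 powr (p * real k) * norm (d k x) powr p)) \<partial>lebesgue)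
      = (\<Sum>k. \<integral>\<^sup>+x. ennreal (2 powr (p * real k) * norm (d k x) powr p) \<partial>lebesgue)"
    using Gm by (intro nn_integral_suminf) measurable
  also have "\<dots> = (\<Sum>k. ennreal (2 powr (p * real k) * Lp_modular p (d k)))"
  proof -
    have "(\<integral>\<^sup>+x. ennreal (2 powr (p * real k) * norm (d k x) powr p) \<partial>lebesgue)
        = ennreal (2 powr (p * real k)) * (\<integral>\<^sup>+x. ennreal (norm (d k x) powr p) \<partial>lebesgue)" for k
    proof -
      have "(\<lambda>x. ennreal (norm (d k x) powr p)) \<in> borel_measurable lebesgue" using Gm(2)[of k] by measurable
      then show ?thesis by (subst nn_integral_cmult[symmetric]) (auto simp: ennreal_mult)
    qed
    then show ?thesis by (simp add: nn_integral_Lp_modular[OF d] ennreal_mult Lp_modular_nonneg)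
  qed
  also have "\<dots> \<le> (\<Sum>k. ennreal (((1/2) powr p) ^ k))"
  proof (intro suminf_le ennreal_leI)
    fix k
    have "2 powr (p * real k) * Lp_modular p (d k) \<le> 2 powr (p * real k) * (1/4) powr (p * real k)"
      by (intro mult_left_mono dn) auto
    also have "\<dots> = (1/2) powr (p * real k)" by (simp add: powr_mult[symmetric])
    also have "\<dots> = ((1/2) powr p) ^ k" by (simp add: powr_powr[symmetric] powr_realpow)
    finally show "2 powr (p * real k) * Lp_modular p (d k) \<le> ((1/2) powr p) ^ k" .
  qed auto
  also have "\<dots> < \<infinity>"
  proof -
    have "(1/2::real) powr p < 1" using p powr_less_mono2[of p "1/2" 1] by simp
    then have "summable (\<lambda>k. ((1/2::real) powr p) ^ k)" by (intro summable_geometric) auto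
    then show ?thesis by (subst suminf_ennreal2) auto
  qed
  finally have "AE x in lebesgue. (\<Sum>k. ennreal (2 powr (p * real k) * norm (d k x) powr p)) \<noteq> \<infinity>"
    using Gm by (intro nn_integral_noteq_infinite) (auto simp: top.not_eq_extremum)
  then have conv: "AE x in lebesgue. convergent (\<lambda>k. G k x)"
  proof eventually_elim
    case (elim x)
    define S where "S = enn2real (\<Sum>k. ennreal (2 powr (p * real k) * norm (d k x) powr p))"
    have S: "ennreal S = (\<Sum>k. ennreal (2 powr (p * real k) * norm (d k x) powr p))"
      unfolding S_def using elim by (simp add: top.not_eq_extremum)
    have "norm (d k x) \<le> S powr (1/p) * (1/2) ^ k" for k
    proof -
      have "sum (\<lambda>k. ennreal (2 powr (p * real k) * norm (d k x) powr p)) {k}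
          \<le> (\<Sum>k. ennreal (2 powr (p * real k) * norm (d k x) powr p))"
        by (rule sum_le_suminf) auto
      then have "ennreal (2 powr (p * real k) * norm (d k x) powr p) \<le> ennreal S"
        unfolding S[symmetric] by (subst (asm) sum.insert) (simp_all only: finite.emptyI empty_iff not_False_eq_True sum.empty add_0_right)
      moreover have "0 \<le> S" unfolding S_def by (rule enn2real_nonneg)
      ultimately have "2 powr (p * real k) * norm (d k x) powr p \<le> S"
        by (simp only: ennreal_le_iff)
      then have "(2 powr (p * real k) * norm (d k x) powr p) powr (1/p) \<le> S powr (1/p)"
        using p by (intro powr_mono2) auto
      then have "2 ^ k * norm (d k x) \<le> S powr (1/p)"
        using p by (simp add: powr_mult powr_powr powr_realpow)
      then show ?thesis by (simp add: field_simps power_one_over)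
    qed
    then have "summable (\<lambda>k. d k x)"
      by (intro summable_comparison_test[of "\<lambda>k. d k x" "\<lambda>k. S powr (1/p) * (1/2) ^ k"])
         (auto intro!: summable_mult summable_geometric)
    then have "convergent (\<lambda>n. \<Sum>k<n. d k x)" by (simp add: summable_iff_convergent)
    moreover have "(\<Sum>k<n. d k x) = G n x - G 0 x" for n
      unfolding d_def by (rule sum_lessThan_telescope)
    ultimately have "convergent (\<lambda>n. (G n x - G 0 x) + G 0 x)"
      by (intro convergent_add) (auto simp: convergent_const)
    then show ?case by simp
  qed
  define f where "f x = lim (\<lambda>k. G k x)" for x
  have fm: "f \<in> borel_measurable lebesgue" unfolding f_def using Gm by measurable
  have lim: "AE x in lebesgue. (\<lambda>k. G k x) \<longlonglongrightarrow> f x"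
    using conv by eventually_elim (simp add: f_def convergent_LIMSEQ_iff)
  have main: "(\<lambda>x. F n x - f x) \<in> Lp_space p \<and> Lp_modular p (\<lambda>x. F n x - f x) \<le> e"
    if "\<forall>m\<ge>K. \<forall>n\<ge>K. Lp_modular p (\<lambda>x. F m x - F n x) < e" "n \<ge> K" for n K e
  proof -
    have ev: "\<forall>\<^sub>F k in sequentially. Lp_modular p (\<lambda>x. F n x - G k x) \<le> e"
      unfolding eventually_sequentially G_def
      using that s1(3) by (intro exI[of _ K]) (meson le_trans less_imp_le)
    have "AE x in lebesgue. (\<lambda>k. F n x - G k x) \<longlonglongrightarrow> F n x - f x"
      using lim by eventually_elim (intro tendsto_intros)
    moreover have "(\<lambda>x. F n x - f x) \<in> borel_measurable lebesgue"
      using fm Lp_space_measurable[OF F] by measurable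
    ultimately show ?thesis
      using Lp_fatou[where F="\<lambda>k x. F n x - G k x"] Lp_space_diff[OF F G p] ev p by blast
  qed
  obtain K where "\<forall>m\<ge>K. \<forall>n\<ge>K. Lp_modular p (\<lambda>x. F m x - F n x) < 1" using cauchy[of 1] by auto
  from main[OF this, of K] have "(\<lambda>x. F K x - f x) \<in> Lp_space p" by simp
  then have f: "f \<in> Lp_space p" using Lp_space_diff[OF F[of K] _ p, of "\<lambda>x. F K x - f x"] by simp
  have "(\<lambda>n. Lp_modular p (\<lambda>x. F n x - f x)) \<longlonglongrightarrow> 0"
  proof (rule LIMSEQ_I)
    fix r :: real assume "r > 0"
    then obtain K where K: "\<forall>m\<ge>K. \<forall>n\<ge>K. Lp_modular p (\<lambda>x. F m x - F n x) < r / 2" using cauchy[of "r/2"] by auto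
    have "norm (Lp_modular p (\<lambda>x. F n x - f x) - 0) < r" if "n \<ge> K" for n
      using main[OF K that] \<open>r > 0\<close> Lp_modular_nonneg[of p "\<lambda>x. F n x - f x"] by simp
    then show "\<exists>no. \<forall>n\<ge>no. norm (Lp_modular p (\<lambda>x. F n x - f x) - 0) < r" by blast
  qed
  then show ?thesis using f by blast
qed

subsection \<open>Square integrability on balls\<close>

lemma norm_powr2 [simp]: "norm (z::complex) powr 2 = (norm z)\<^sup>2"
  by (cases "z = 0") (simp_all add: powr_numeral)

text \<open>Young's inequality with a free weight \<open>s\<close>, from the square of
  \<open>s * norm (f x) - norm (g x)\<close>. The bound is linear in the modulars; if one factor is
  small, a large weight on it makes the contribution of the other small as well.\<close>

lemma L2_product:
  assumes "f \<in> Lp_space 2" "g \<in> Lp_space 2"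
  shows "integrable lebesgue (\<lambda>x. f x * g x)"
    and "s > 0 \<Longrightarrow> norm (\<integral>x. f x * g x \<partial>lebesgue) \<le> s * Lp_modular 2 f + Lp_modular 2 g / s"
proof -
  have m: "f \<in> borel_measurable lebesgue" "g \<in> borel_measurable lebesgue"
    using assms Lp_space_measurable by blast+
  have i: "integrable lebesgue (\<lambda>x. (norm (f x))\<^sup>2)" "integrable lebesgue (\<lambda>x. (norm (g x))\<^sup>2)"
    using assms Lp_space_integrable by fastforce+
  have *: "norm (f x * g x) \<le> s * (norm (f x))\<^sup>2 + (norm (g x))\<^sup>2 / s" if "s > 0" for s x
  proof -
    have "0 \<le> (s * norm (f x) - norm (g x))\<^sup>2" by simp
    then have "2 * s * (norm (f x) * norm (g x)) \<le> s\<^sup>2 * (norm (f x))\<^sup>2 + (norm (g x))\<^sup>2"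
      by (simp add: power2_eq_square algebra_simps)
    moreover have "s * (norm (f x) * norm (g x)) \<le> 2 * s * (norm (f x) * norm (g x))"
      using that by (simp add: mult_right_mono)
    ultimately have "s * (norm (f x) * norm (g x)) \<le> s\<^sup>2 * (norm (f x))\<^sup>2 + (norm (g x))\<^sup>2"
      by linarith
    also have "\<dots> = s * (s * (norm (f x))\<^sup>2 + (norm (g x))\<^sup>2 / s)"
      using that by (simp add: algebra_simps power2_eq_square)
    finally have "norm (f x) * norm (g x) \<le> s * (norm (f x))\<^sup>2 + (norm (g x))\<^sup>2 / s"
      by (rule mult_left_le_imp_le) (rule that)
    then show ?thesis by (simp add: norm_mult)
  qed
  show I: "integrable lebesgue (\<lambda>x. f x * g x)"
    by (rule Bochner_Integration.integrable_bound[where f="\<lambda>x. (norm (f x))\<^sup>2 + (norm (g x))\<^sup>2"])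
       (use i m *[of 1] in \<open>auto intro!: always_eventually\<close>)
  assume s: "s > 0"
  have "norm (\<integral>x. f x * g x \<partial>lebesgue) \<le> (\<integral>x. norm (f x * g x) \<partial>lebesgue)" by simp
  also have "\<dots> \<le> (\<integral>x. s * (norm (f x))\<^sup>2 + (norm (g x))\<^sup>2 / s \<partial>lebesgue)"
    using I i *[OF s] by (intro integral_mono) auto
  also have "\<dots> = s * Lp_modular 2 f + Lp_modular 2 g / s"
    using i by (simp add: Lp_modular_def)
  finally show "norm (\<integral>x. f x * g x \<partial>lebesgue) \<le> s * Lp_modular 2 f + Lp_modular 2 g / s" .
qed

lemma powr_le_one_plus_powr:
  fixes t :: real
  assumes "t \<ge> 0" "0 < s" "s \<le> p"
  shows "t powr s \<le> 1 + t powr p"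
proof (cases "t \<le> 1")
  case True
  then have "t powr s \<le> 1 powr s" using assms by (intro powr_mono2) auto
  then show ?thesis by (simp add: add_increasing2)
next
  case False
  then have "t powr s \<le> t powr p" using powr_mono[of s p t] assms by simp
  then show ?thesis by simp
qed

text \<open>On a bounded set the exponent may be lowered since t^s \<le> 1 + t^p; the summand 1
  contributes the volume of the ball.\<close>

lemma Lp_space_ball_subexponent:
  assumes "f \<in> Lp_space p" "0 < s" "s \<le> p" "AE x in lebesgue. norm x > R \<longrightarrow> f x = 0"
  shows "f \<in> Lp_space s" "Lp_modular s f \<le> measure lebesgue (cball (0::real^'n::finite) R) + Lp_modular p (f::'n cfun)"
proof -
  have i: "integrable lebesgue (\<lambda>x. indicator (cball 0 R) x + norm (f x) powr p)"
    using emeasure_lborel_cball_finite[of "0::real^'n" R] Lp_space_integrable[OF assms(1)]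
    by (intro Bochner_Integration.integrable_add integrable_real_indicator) (auto simp: top.not_eq_extremum)
  have ae: "AE x in lebesgue. norm (f x) powr s \<le> indicator (cball 0 R) x + norm (f x) powr p"
    using assms(4)
    by eventually_elim (use powr_le_one_plus_powr[OF _ assms(2,3)] in \<open>auto simp: indicator_def\<close>)
  show "f \<in> Lp_space s"
    by (rule Lp_space_bound[OF Lp_space_measurable[OF assms(1)] i ae])
  have "Lp_modular s f \<le> (\<integral>x. indicator (cball 0 R) x + norm (f x) powr p \<partial>lebesgue)"
    by (rule Lp_modular_mono[OF Lp_space_measurable[OF assms(1)] i ae])
  also have "\<dots> = measure lebesgue (cball (0::real^'n) R) + Lp_modular p f"
    using emeasure_lborel_cball_finite[of "0::real^'n" R] Lp_space_integrable[OF assms(1)]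
    by (subst Bochner_Integration.integral_add) (auto simp: Lp_modular_def top.not_eq_extremum)
  finally show "Lp_modular s f \<le> measure lebesgue (cball (0::real^'n::finite) R) + Lp_modular p f" .
qed

text \<open>Above the threshold \<open>d\<close> the factor \<open>t powr (2 - p)\<close> is at most
  \<open>d powr (2 - p)\<close>, as \<open>p \<ge> 2\<close>. A small \<open>d\<close> makes the
  first summand small on a set of finite measure, at the price of a large but fixed factor on the
  second.\<close>

lemma power2_le_powr:
  fixes t :: real
  assumes "t \<ge> 0" "d > 0" "p \<ge> 2"
  shows "t\<^sup>2 \<le> d\<^sup>2 + d powr (2 - p) * t powr p"
proof (cases "t \<le> d")
  case True
  then have "t\<^sup>2 \<le> d\<^sup>2" using assms by (intro power_mono) auto
  then show ?thesis by (simp add: add_increasing2)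
next
  case False
  then have "d powr (p - 2) \<le> t powr (p - 2)" using assms by (intro powr_mono2) auto
  then have "d powr (2 - p) * (d powr (p - 2) * t powr 2) \<le> d powr (2 - p) * (t powr (p - 2) * t powr 2)"
    by (intro mult_left_mono mult_right_mono) auto
  moreover have "d powr (2 - p) * (d powr (p - 2) * t powr 2) = t\<^sup>2"
    using assms False by (simp add: powr_add[symmetric] powr_numeral flip: mult.assoc)
  moreover have "t powr (p - 2) * t powr 2 = t powr p" by (simp add: powr_add[symmetric])
  ultimately have "t\<^sup>2 \<le> d powr (2 - p) * t powr p" by (simp only:)
  then show ?thesis by (simp add: add_increasing)
qed

lemma Lp_tendsto_imp_L2_tendsto:
  fixes F :: "nat \<Rightarrow> ('n::finite) cfun"
  assumes "\<And>k. F k \<in> Lp_space p" "p \<ge> 2" "\<And>k. AE x in lebesgue. norm x > R \<longrightarrow> F k x = 0"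
    "(\<lambda>k. Lp_modular p (F k)) \<longlonglongrightarrow> 0"
  shows "(\<lambda>k. Lp_modular 2 (F k)) \<longlonglongrightarrow> 0"
proof (rule LIMSEQ_I)
  fix r :: real assume r: "r > 0"
  define V where "V = measure lebesgue (cball (0::real^'n) R)"
  have V: "V \<ge> 0" by (simp add: V_def)
  \<comment> \<open>The threshold at which the values below \<open>d\<close> contribute less than
    \<open>r / 2\<close> on the ball; the \<open>+ 1\<close> keeps the denominator positive.\<close>
  define d where "d = sqrt (r / (2 * (V + 1)))"
  have d: "d > 0" "d\<^sup>2 * V < r / 2" using r V by (simp_all add: d_def field_simps)
  have le: "Lp_modular 2 (F k) \<le> d\<^sup>2 * V + d powr (2 - p) * Lp_modular p (F k)" for k
  proof -
    have i: "integrable lebesgue (\<lambda>x. d\<^sup>2 * indicator (cball 0 R) x + d powr (2 - p) * norm (F k x) powr p)"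
      using emeasure_lborel_cball_finite[of "0::real^'n" R] Lp_space_integrable[OF assms(1)]
      by (intro Bochner_Integration.integrable_add integrable_real_indicator integrable_mult_right) (auto simp: top.not_eq_extremum)
    have ae: "AE x in lebesgue. norm (F k x) powr 2 \<le> d\<^sup>2 * indicator (cball 0 R) x + d powr (2 - p) * norm (F k x) powr p"
      using assms(3)[of k]
      by eventually_elim (use power2_le_powr[OF _ d(1) assms(2)] in \<open>auto simp: indicator_def\<close>)
    have "Lp_modular 2 (F k) \<le> (\<integral>x. d\<^sup>2 * indicator (cball 0 R) x + d powr (2 - p) * norm (F k x) powr p \<partial>lebesgue)"
      by (rule Lp_modular_mono[OF Lp_space_measurable[OF assms(1)] i ae])
    also have "\<dots> = d\<^sup>2 * V + d powr (2 - p) * Lp_modular p (F k)"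
      using emeasure_lborel_cball_finite[of "0::real^'n" R] Lp_space_integrable[OF assms(1)]
      by (subst Bochner_Integration.integral_add) (auto simp: Lp_modular_def V_def top.not_eq_extremum)
    finally show ?thesis .
  qed
  have "(\<lambda>k. d powr (2 - p) * Lp_modular p (F k)) \<longlonglongrightarrow> d powr (2 - p) * 0"
    by (intro tendsto_intros assms(4))
  then have "\<forall>\<^sub>F k in sequentially. d powr (2 - p) * Lp_modular p (F k) < r / 2"
    using r by (intro order_tendstoD(2)) auto
  then have "\<forall>\<^sub>F k in sequentially. norm (Lp_modular 2 (F k) - 0) < r"
  proof eventually_elim
    case (elim k)
    then show ?case using le[of k] d(2) Lp_modular_nonneg[of 2 "F k"] by simp
  qed
  then show "\<exists>no. \<forall>n\<ge>no. norm (Lp_modular 2 (F n) - 0) < r" by (simp add: eventually_sequentially)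
qed

lemma conj_exp_product_integrable:
  assumes "f \<in> Lp_space p" "g \<in> Lp_space (conj_exp p)" "p > 1"
  shows "integrable lebesgue (\<lambda>x. f x * g x)"
proof (rule Bochner_Integration.integrable_bound)
  let ?q = "conj_exp p"
  have q: "?q > 1" "1 / p + 1 / ?q = 1" using assms(3) by (auto simp: conj_exp_def field_simps)
  show "integrable lebesgue (\<lambda>x. norm (f x) powr p / p + norm (g x) powr ?q / ?q)"
    using assms by (auto simp: Lp_space_def)
  show "(\<lambda>x. f x * g x) \<in> borel_measurable lebesgue"
    using assms by (auto simp: Lp_space_def)
  have "norm (f x * g x) \<le> norm (f x) powr p / p + norm (g x) powr ?q / ?q" for x
    using Youngs_inequality[of p ?q "norm (f x)" "norm (g x)"] q assms(3) by (simp add: norm_mult)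
  then show "AE x in lebesgue. norm (f x * g x) \<le> norm (norm (f x) powr p / p + norm (g x) powr ?q / ?q)"
    using assms(3) q by (intro always_eventually allI) (smt (verit) real_norm_def)
qed

subsection \<open>Density of test functions\<close>

lemma tendsto_0_le_nonneg:
  fixes f g :: "nat \<Rightarrow> real"
  assumes "\<And>k. 0 \<le> f k" "\<And>k. f k \<le> g k" "g \<longlonglongrightarrow> 0"
  shows "f \<longlonglongrightarrow> 0"
  using tendsto_sandwich[of "\<lambda>_. 0" f sequentially g 0] assms by auto

lemma ball_bump_norm_le: "norm (ball_bump R x) \<le> 1"
  by (simp add: ball_bump_def exp_cutoff_def)

text \<open>Stone-Weierstrass is applied to the quotient of \<open>h\<close> by a bump, not to
  \<open>h\<close>: multiplying the approximating polynomial by the bump afterwards gives a smooth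
  function of bounded support, and the error does not grow because the bump is at most 1.\<close>

lemma Cc_uniform_approx_test_fun:
  fixes h :: "('n::finite) cfun"
  assumes "continuous_on UNIV h" "R > 0" "\<And>x. norm x \<ge> R \<Longrightarrow> h x = 0" "e > 0"
  shows "\<exists>\<phi>\<in>test_fun. (\<forall>x. norm (h x - \<phi> x) < e) \<and> (\<forall>x. norm x > R + 1 \<longrightarrow> \<phi> x = 0)"
proof -
  \<comment> \<open>The second summand keeps the denominator away from 0 on and beyond the sphere of
    radius \<open>R + 1\<close>, where the bump vanishes. It is 0 for \<open>norm x \<le> R\<close>,
    so it does not disturb the quotient where \<open>h\<close> lives.\<close>
  define den where "den x = ball_bump (R + 1) x + complex_of_real (max 0 (norm x - R))" for x :: "real ^ 'n"
  define q where "q x = h x / den x" for x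
  have re: "den x = complex_of_real (exp_cutoff 0 ((R + 1)\<^sup>2 - x \<bullet> x) + max 0 (norm x - R))" for x
    by (simp add: den_def ball_bump_def)
  have den: "den x \<noteq> 0" for x
  proof (cases "norm x < R + 1")
    case True
    then have "exp_cutoff 0 ((R + 1)\<^sup>2 - x \<bullet> x) \<noteq> 0" using ball_bump_nonzero[of x "R+1"] by (simp add: ball_bump_def)
    then have "exp_cutoff 0 ((R + 1)\<^sup>2 - x \<bullet> x) > 0" by (simp add: exp_cutoff_def split: if_splits)
    then have "exp_cutoff 0 ((R + 1)\<^sup>2 - x \<bullet> x) + max 0 (norm x - R) \<noteq> 0" by linarith
    then show ?thesis by (metis re of_real_eq_0_iff)
  next
    case False
    have "exp_cutoff 0 ((R + 1)\<^sup>2 - x \<bullet> x) \<ge> 0" by (simp add: exp_cutoff_def)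
    then have "exp_cutoff 0 ((R + 1)\<^sup>2 - x \<bullet> x) + max 0 (norm x - R) \<noteq> 0" using False by linarith
    then show ?thesis by (metis re of_real_eq_0_iff)
  qed
  have "continuous_on UNIV den"
    unfolding den_def using test_fun_continuous[OF ball_bump_test_fun[of "R + 1"]] assms(2)
    by (intro continuous_intros) auto
  then have "continuous_on (cball 0 (R + 1)) q"
    unfolding q_def using assms(1) den by (intro continuous_intros) (auto intro: continuous_on_subset)
  then obtain P where P: "polynomial_function P" "\<And>x. x \<in> cball 0 (R + 1) \<Longrightarrow> norm (q x - P x) < e"
    using Stone_Weierstrass_polynomial_function[of "cball 0 (R+1)" q e] assms(4) by auto
  define \<phi> where "\<phi> x = ball_bump (R + 1) x * P x" for x
  have "\<phi> \<in> test_fun"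
    unfolding \<phi>_def[abs_def] using assms(2) by (intro test_fun_cpoly_bump polynomial_function_cpoly P(1)) auto
  moreover have z: "\<phi> x = 0" if "norm x > R + 1" for x
    using ball_bump_0[of "R + 1" x] that assms(2) by (simp add: \<phi>_def)
  moreover have "norm (h x - \<phi> x) < e" for x
  proof (cases "norm x \<le> R + 1")
    case True
    have "h x = ball_bump (R + 1) x * q x"
    proof (cases "norm x < R")
      case True
      then have "den x = ball_bump (R + 1) x" by (simp add: den_def)
      then show ?thesis using den[of x] by (simp add: q_def)
    qed (use assms(3) in \<open>simp add: q_def\<close>)
    then have "norm (h x - \<phi> x) = norm (ball_bump (R + 1) x) * norm (q x - P x)"
      by (simp add: \<phi>_def norm_mult[symmetric] algebra_simps)
    also have "\<dots> \<le> 1 * norm (q x - P x)" by (intro mult_right_mono ball_bump_norm_le) auto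
    also have "\<dots> < e" using P(2)[of x] True by simp
    finally show ?thesis .
  next
    case False
    then show ?thesis using z[of x] assms(3)[of x] assms(4) by simp
  qed
  ultimately show ?thesis by blast
qed

text \<open>Measurability supplies continuous functions converging almost everywhere. They are
  truncated in value and in space and then replaced uniformly by test functions; the common bound
  and the common support make dominated convergence applicable to the result.\<close>

lemma test_fun_approx_AE:
  fixes s :: "('n::finite) cfun"
  assumes s: "s \<in> borel_measurable lebesgue" "\<And>x. norm (s x) \<le> M"
    and R: "R > 0" "\<And>x. norm x > R \<Longrightarrow> s x = 0"
  shows "\<exists>\<phi>::nat \<Rightarrow> 'n cfun. (\<forall>k. \<phi> k \<in> test_fun) \<and> (\<forall>k x. norm (\<phi> k x) \<le> M + 2) \<and>
      (\<forall>k x. norm x > R + 2 \<longrightarrow> \<phi> k x = 0) \<and> (AE x in lebesgue. (\<lambda>k. \<phi> k x) \<longlonglongrightarrow> s x)"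
proof -
  have M: "M \<ge> 0" using s(2)[of 0] norm_ge_zero order_trans by blast
  \<comment> \<open>Positive also for \<open>M = 0\<close>, so the radial retraction
    \<open>T\<close> onto the disc of radius \<open>M'\<close> is continuous. The bound
    \<open>M + 2\<close> leaves 1 for the uniform error.\<close>
  define M' where "M' = M + 1"
  have "s measurable_on UNIV"
    using lebesgue_measurable_imp_measurable_on[of s UNIV] s(1) by simp
  then obtain N g where N: "negligible N" and g: "\<And>n. continuous_on UNIV (g n)"
      "\<And>x. x \<notin> N \<Longrightarrow> (\<lambda>n. g n x) \<longlonglongrightarrow> s x"
    unfolding measurable_on_def by auto
  define c where "c x = complex_of_real (max 0 (min 1 (R + 1 - norm x)))" for x :: "real ^ 'n"
  define T where "T z = z * complex_of_real (M' / max M' (norm z))" for z :: complex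
  have T: "norm (T z) \<le> M'" for z
  proof -
    have pos: "max M' (norm z) > 0" using M unfolding M'_def by linarith
    have "norm (T z) = norm z * (M' / max M' (norm z))"
      unfolding T_def norm_mult norm_of_real using pos M by (subst abs_of_nonneg) (auto simp: M'_def)
    also have "\<dots> = M' * (norm z / max M' (norm z))" by simp
    also have "\<dots> \<le> M' * 1" using pos M by (intro mult_left_mono) (auto simp: M'_def)
    finally show ?thesis by simp
  qed
  have Tid: "T z = z" if "norm z \<le> M'" for z
    using that M by (simp add: T_def M'_def max_def)
  have Tc: "continuous_on UNIV T"
  proof -
    have "max M' (norm z) \<noteq> 0" for z :: complex using M unfolding M'_def by linarith
    then show ?thesis unfolding T_def by (intro continuous_intros) auto
  qed
  define h where "h n x = c x * T (g n x)" for n x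
  have "continuous_on UNIV c" unfolding c_def by (intro continuous_intros)
  then have hc: "continuous_on UNIV (h n)" for n
    unfolding h_def using continuous_on_compose2[OF Tc g(1)] by (intro continuous_intros) auto
  have h0: "h n x = 0" if "norm x \<ge> R + 1" for n x using that by (simp add: h_def c_def)
  have hM: "norm (h n x) \<le> M'" for n x
  proof -
    have "norm (h n x) = norm (c x) * norm (T (g n x))" by (simp add: h_def norm_mult)
    also have "\<dots> \<le> 1 * M'" by (intro mult_mono T) (auto simp: c_def)
    finally show ?thesis by simp
  qed
  have "\<forall>n. \<exists>\<phi>\<in>test_fun. (\<forall>x. norm (h n x - \<phi> x) < inverse (real (Suc n))) \<and>
      (\<forall>x. norm x > R + 1 + 1 \<longrightarrow> \<phi> x = 0)"
    using Cc_uniform_approx_test_fun[OF hc, of "R + 1"] h0 R(1) by simp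
  then obtain \<phi> where \<phi>: "\<And>n. \<phi> n \<in> test_fun" "\<And>n x. norm (h n x - \<phi> n x) < inverse (real (Suc n))"
      "\<And>n x. norm x > R + 1 + 1 \<Longrightarrow> \<phi> n x = 0"
    by metis
  have "norm (\<phi> n x) \<le> M + 2" for n x
  proof -
    have "norm (\<phi> n x) \<le> norm (h n x) + norm (h n x - \<phi> n x)" by norm
    moreover have "inverse (real (Suc n)) \<le> 1" by (simp add: field_simps)
    ultimately show ?thesis using hM[of n x] \<phi>(2)[of n x] by (simp add: M'_def)
  qed
  moreover have "(\<lambda>n. \<phi> n x) \<longlonglongrightarrow> s x" if "x \<notin> N" for x
  proof -
    have "isCont T (s x)" using Tc by (simp add: continuous_on_eq_continuous_at)
    then have "(\<lambda>n. T (g n x)) \<longlonglongrightarrow> T (s x)" using g(2)[OF that] by (rule isCont_tendsto_compose)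
    then have "(\<lambda>n. h n x) \<longlonglongrightarrow> c x * T (s x)" unfolding h_def by (intro tendsto_intros)
    moreover have "c x * T (s x) = s x"
      using R(2)[of x] s(2)[of x] by (cases "norm x > R") (auto simp: Tid M'_def c_def)
    ultimately have "(\<lambda>n. h n x) \<longlonglongrightarrow> s x" by simp
    moreover have "(\<lambda>n. h n x - \<phi> n x) \<longlonglongrightarrow> 0"
      by (rule Lim_null_comparison[OF _ LIMSEQ_inverse_real_of_nat])
         (use \<phi>(2) in \<open>auto intro!: always_eventually less_imp_le\<close>)
    ultimately have "(\<lambda>n. h n x - (h n x - \<phi> n x)) \<longlonglongrightarrow> s x - 0" by (rule tendsto_diff)
    then show ?thesis by simp
  qed
  then have "AE x in lebesgue. (\<lambda>n. \<phi> n x) \<longlonglongrightarrow> s x"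
    using N by (intro AE_I'[of N]) (auto simp: negligible_iff_null_sets)
  ultimately show ?thesis using \<phi>(1,3) by (intro exI[of _ \<phi>]) (auto simp: add.assoc)
qed

lemma Lp_dense_bounded:
  fixes s :: "('n::finite) cfun"
  assumes s: "s \<in> borel_measurable lebesgue" "\<And>x. norm (s x) \<le> M"
    and R: "R > 0" "\<And>x. norm x > R \<Longrightarrow> s x = 0" and p: "p > 0" and e: "e > 0"
  shows "\<exists>\<phi>\<in>test_fun. (\<forall>x. norm x > R + 2 \<longrightarrow> \<phi> x = 0) \<and> Lp_modular p (\<lambda>x. \<phi> x - s x) < e"
proof -
  obtain \<phi> :: "nat \<Rightarrow> 'n cfun" where \<phi>: "\<And>k. \<phi> k \<in> test_fun" "\<And>k x. norm (\<phi> k x) \<le> M + 2"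
      "\<And>k x. norm x > R + 2 \<Longrightarrow> \<phi> k x = 0" "AE x in lebesgue. (\<lambda>k. \<phi> k x) \<longlonglongrightarrow> s x"
    using test_fun_approx_AE[OF s R] by blast
  have m: "\<phi> k \<in> borel_measurable lebesgue" for k
    using Cc_integrable_lebesgue(2)[OF test_fun_Cc[OF \<phi>(1)]] .
  have M: "M \<ge> 0" using s(2)[of 0] norm_ge_zero order_trans by blast
  have "(\<lambda>k. \<integral>x. norm (\<phi> k x - s x) powr p \<partial>lebesgue) \<longlonglongrightarrow> (\<integral>x. 0 \<partial>(lebesgue :: (real^'n) measure))"
  proof (rule integral_dominated_convergence)
    show "integrable lebesgue (\<lambda>x. (2 * M + 2) powr p * indicator (cball (0::real^'n) (R + 2)) x)"
      by (intro integrable_mult_right integrable_real_indicator)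
         (use emeasure_lborel_cball_finite[of "0::real^'n" "R+2"] in \<open>auto simp: top.not_eq_extremum\<close>)
    show "AE x in lebesgue. (\<lambda>k. norm (\<phi> k x - s x) powr p) \<longlonglongrightarrow> 0"
      using \<phi>(4)
    proof eventually_elim
      case (elim x)
      then have "(\<lambda>k. norm (\<phi> k x - s x)) \<longlonglongrightarrow> 0" by (simp add: LIM_zero tendsto_norm_zero)
      then have "(\<lambda>k. norm (\<phi> k x - s x) powr p) \<longlonglongrightarrow> 0 powr p" using p by (intro tendsto_powr2) auto
      then show ?case by simp
    qed
    fix k
    show "AE x in lebesgue. norm (norm (\<phi> k x - s x) powr p) \<le> (2 * M + 2) powr p * indicator (cball 0 (R + 2)) x"
    proof (intro always_eventually allI)
      fix x
      show "norm (norm (\<phi> k x - s x) powr p) \<le> (2 * M + 2) powr p * indicator (cball 0 (R + 2)) x"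
      proof (cases "norm x \<le> R + 2")
        case True
        have "norm (\<phi> k x - s x) \<le> 2 * M + 2"
          using norm_triangle_ineq4[of "\<phi> k x" "s x"] \<phi>(2)[of k x] s(2)[of x] by linarith
        then show ?thesis using True p by (simp add: powr_mono2)
      qed (use \<phi>(3)[of x k] R(2)[of x] in simp)
    qed
  qed (use m s in measurable)
  then have "(\<lambda>k. Lp_modular p (\<lambda>x. \<phi> k x - s x)) \<longlonglongrightarrow> 0" by (simp add: Lp_modular_def)
  from order_tendstoD(2)[OF this e] obtain k where "Lp_modular p (\<lambda>x. \<phi> k x - s x) < e"
    by (auto simp: eventually_sequentially)
  then show ?thesis using \<phi> by blast
qed

lemma Lp_truncation_tendsto:
  fixes g :: "('n::finite) cfun"
  assumes "g \<in> Lp_space p" "p > 0"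
  shows "(\<lambda>k. Lp_modular p (\<lambda>x. (if norm x \<le> real k \<and> norm (g x) \<le> real k then g x else 0) - g x)) \<longlonglongrightarrow> 0"
proof -
  have m: "g \<in> borel_measurable lebesgue" using assms Lp_space_measurable by blast
  have mn: "(\<lambda>x::real^'n. norm x) \<in> borel_measurable lebesgue" by (intro borel_measurable_lebesgue_of_borel) simp
  have "(\<lambda>k. \<integral>x. norm ((if norm x \<le> real k \<and> norm (g x) \<le> real k then g x else 0) - g x) powr p \<partial>lebesgue)
      \<longlonglongrightarrow> (\<integral>x. 0 \<partial>(lebesgue :: (real^'n) measure))"
  proof (rule integral_dominated_convergence)
    show "integrable lebesgue (\<lambda>x. norm (g x) powr p)" using assms(1) by (rule Lp_space_integrable)
    show "AE x in lebesgue. (\<lambda>k. norm ((if norm x \<le> real k \<and> norm (g x) \<le> real k then g x else 0) - g x) powr p) \<longlonglongrightarrow> 0"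
    proof (intro always_eventually allI)
      fix x
      have "\<forall>\<^sub>F k in sequentially. real k \<ge> max (norm x) (norm (g x))"
        using filterlim_real_sequentially unfolding filterlim_at_top by blast
      then have "\<forall>\<^sub>F k in sequentially. 0 = norm ((if norm x \<le> real k \<and> norm (g x) \<le> real k then g x else 0) - g x) powr p"
        by eventually_elim auto
      then show "(\<lambda>k. norm ((if norm x \<le> real k \<and> norm (g x) \<le> real k then g x else 0) - g x) powr p) \<longlonglongrightarrow> 0"
        using tendsto_const tendsto_cong by fast
    qed
  qed (use m mn in auto)
  then show ?thesis by (simp add: Lp_modular_def)
qed

lemma Lp_dense_test_fun:
  fixes g :: "('n::finite) cfun"
  assumes g: "g \<in> Lp_space p" and p: "p > 0"
  shows "\<exists>\<phi>. (\<forall>k. \<phi> k \<in> test_fun) \<and> (\<lambda>k. Lp_modular p (\<lambda>x. \<phi> k x - g x)) \<longlonglongrightarrow> 0"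
    and "R > 0 \<Longrightarrow> (\<And>x. norm x > R \<Longrightarrow> g x = 0) \<Longrightarrow> \<exists>\<phi>. (\<forall>k. \<phi> k \<in> test_fun) \<and>
      (\<forall>k x. norm x > R + 2 \<longrightarrow> \<phi> k x = 0) \<and> (\<lambda>k. Lp_modular p (\<lambda>x. \<phi> k x - g x)) \<longlonglongrightarrow> 0"
proof -
  have m: "g \<in> borel_measurable lebesgue" using assms Lp_space_measurable by blast
  have mn: "(\<lambda>x::real^'n. norm x) \<in> borel_measurable lebesgue" by (intro borel_measurable_lebesgue_of_borel) simp
  define s where "s k x = (if norm x \<le> real k \<and> norm (g x) \<le> real k then g x else 0)" for k x
  have sm: "s k \<in> borel_measurable lebesgue" for k unfolding s_def using m mn by measurable
  have sp: "s k \<in> Lp_space p" for k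
    by (rule Lp_space_bound[OF sm Lp_space_integrable[OF g]]) (auto simp: s_def)
  have sb: "norm (s k x) \<le> real k" for k x by (simp add: s_def)
  have lim: "(\<lambda>k. Lp_modular p (\<lambda>x. s k x - g x)) \<longlonglongrightarrow> 0"
    unfolding s_def by (rule Lp_truncation_tendsto[OF assms])
  \<comment> \<open>Stated for arbitrary radii \<open>\<rho> k\<close> so that one argument yields
    both claims: growing radii for a general \<open>g\<close>, the constant radius \<open>R\<close>
    for \<open>g\<close> of bounded support.\<close>
  have main: "\<exists>\<phi>. (\<forall>k. \<phi> k \<in> test_fun) \<and> (\<forall>k x. norm x > \<rho> k + 2 \<longrightarrow> \<phi> k x = 0) \<and>
      (\<lambda>k. Lp_modular p (\<lambda>x. \<phi> k x - g x)) \<longlonglongrightarrow> 0"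
    if \<rho>: "\<And>k. \<rho> k > 0" "\<And>k x. norm x > \<rho> k \<Longrightarrow> s k x = 0" for \<rho>
  proof -
    have "\<forall>k. \<exists>\<phi>\<in>test_fun. (\<forall>x. norm x > \<rho> k + 2 \<longrightarrow> \<phi> x = 0) \<and>
        Lp_modular p (\<lambda>x. \<phi> x - s k x) < inverse (real (Suc k))"
      using Lp_dense_bounded[OF sm sb \<rho>(1) \<rho>(2) p] by simp
    then obtain \<phi> where \<phi>: "\<And>k. \<phi> k \<in> test_fun" "\<And>k x. norm x > \<rho> k + 2 \<Longrightarrow> \<phi> k x = 0"
        "\<And>k. Lp_modular p (\<lambda>x. \<phi> k x - s k x) < inverse (real (Suc k))"
      by metis
    have "Lp_modular p (\<lambda>x. \<phi> k x - g x)
        \<le> 2 powr p * (inverse (real (Suc k)) + Lp_modular p (\<lambda>x. s k x - g x))" for k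
    proof -
      have "Lp_modular p (\<lambda>x. \<phi> k x - g x)
        \<le> 2 powr p * (Lp_modular p (\<lambda>x. \<phi> k x - s k x) + Lp_modular p (\<lambda>x. s k x - g x))"
        by (rule Lp_modular_triangle[OF Cc_integrable_lebesgue(4)[OF test_fun_Cc[OF \<phi>(1)] p] sp g p])
      also have "\<dots> \<le> 2 powr p * (inverse (real (Suc k)) + Lp_modular p (\<lambda>x. s k x - g x))"
        using \<phi>(3)[of k] by (intro mult_left_mono add_mono) auto
      finally show ?thesis .
    qed
    moreover have "(\<lambda>k. 2 powr p * (inverse (real (Suc k)) + Lp_modular p (\<lambda>x. s k x - g x))) \<longlonglongrightarrow> 0"
    proof -
      have "(\<lambda>k. 2 powr p * (inverse (real (Suc k)) + Lp_modular p (\<lambda>x. s k x - g x))) \<longlonglongrightarrow> 2 powr p * (0 + 0)"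
        by (intro tendsto_intros lim LIMSEQ_inverse_real_of_nat)
      then show ?thesis by simp
    qed
    ultimately have "(\<lambda>k. Lp_modular p (\<lambda>x. \<phi> k x - g x)) \<longlonglongrightarrow> 0"
      by (rule tendsto_0_le_nonneg[OF Lp_modular_nonneg])
    then show ?thesis using \<phi> by blast
  qed
  show "\<exists>\<phi>. (\<forall>k. \<phi> k \<in> test_fun) \<and> (\<lambda>k. Lp_modular p (\<lambda>x. \<phi> k x - g x)) \<longlonglongrightarrow> 0"
    using main[of "\<lambda>k. real k + 1"] unfolding s_def by auto
  show "\<exists>\<phi>. (\<forall>k. \<phi> k \<in> test_fun) \<and> (\<forall>k x. norm x > R + 2 \<longrightarrow> \<phi> k x = 0) \<and>
      (\<lambda>k. Lp_modular p (\<lambda>x. \<phi> k x - g x)) \<longlonglongrightarrow> 0" if "R > 0" "\<And>x. norm x > R \<Longrightarrow> g x = 0"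
    using main[of "\<lambda>k. R"] that by (simp add: s_def)
qed

section \<open>Locally integrable functions\<close>

lemma L1loc_integrable_mult:
  fixes g :: "('n::finite) cfun"
  assumes g: "g \<in> L1loc" and s: "s \<in> borel_measurable lebesgue" "\<And>x. norm (s x) \<le> M"
    "\<And>x. norm x > R \<Longrightarrow> s x = 0"
  shows "integrable lebesgue (\<lambda>x. g x * s x)"
proof -
  have gi: "integrable lebesgue (\<lambda>x. indicator (cball 0 R) x *\<^sub>R g x)"
    using g by (auto simp: L1loc_def set_integrable_def)
  have eq: "g x * s x = (indicator (cball 0 R) x *\<^sub>R g x) * s x" for x
    using s(3)[of x] by (auto simp: indicator_def)
  have "integrable lebesgue (\<lambda>x. (indicator (cball 0 R) x *\<^sub>R g x) * s x)"
  proof (rule Bochner_Integration.integrable_bound[OF integrable_mult_right[OF integrable_norm[OF gi], of M]])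
    show "AE x in lebesgue. norm ((indicator (cball 0 R) x *\<^sub>R g x) * s x)
        \<le> norm (M * norm (indicator (cball 0 R) x *\<^sub>R g x))"
    proof (intro always_eventually allI)
      fix x
      have "norm ((indicator (cball 0 R) x *\<^sub>R g x) * s x) \<le> norm (indicator (cball 0 R) x *\<^sub>R g x) * M"
        unfolding norm_mult by (intro mult_left_mono s(2)) auto
      then show "norm ((indicator (cball 0 R) x *\<^sub>R g x) * s x) \<le> norm (M * norm (indicator (cball 0 R) x *\<^sub>R g x))"
        by (simp add: mult.commute)
    qed
  qed (use gi s in measurable)
  then show ?thesis unfolding eq .
qed

text \<open>Pairing with the conjugate sign of \<open>g\<close> on a ball gives the integral of
  \<open>norm (g x)\<close> over the ball. Test functions approximate this sign boundedly and almost
  everywhere, so the pairing is a limit of zeros.\<close>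

lemma L1loc_zero_if_pairing_zero:
  fixes g :: "('n::finite) cfun"
  assumes g: "g \<in> L1loc" and z: "\<And>\<phi>. \<phi> \<in> test_fun \<Longrightarrow> pairing g \<phi> = 0"
  shows "AE x in lebesgue. g x = 0"
proof -
  have ball: "AE x in lebesgue. norm x \<le> R \<longrightarrow> g x = 0" if R: "R > 0" for R
  proof -
    have gi: "integrable lebesgue (\<lambda>x. indicator (cball 0 R') x *\<^sub>R g x)" for R'
      using g by (auto simp: L1loc_def set_integrable_def)
    define s where "s x = cnj (sgn (indicator (cball 0 R) x *\<^sub>R g x))" for x
    have "(\<lambda>x. indicator (cball 0 R) x *\<^sub>R g x) \<in> borel_measurable lebesgue" using gi by auto
    moreover have "(\<lambda>z::complex. cnj (sgn z)) \<in> borel_measurable borel"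
    proof -
      have "cnj \<in> borel_measurable borel" by (intro borel_measurable_continuous_onI continuous_intros)
      moreover have "(sgn :: complex \<Rightarrow> complex) \<in> borel_measurable borel"
        unfolding sgn_div_norm[abs_def] by measurable
      ultimately show ?thesis by measurable
    qed
    ultimately have sm: "s \<in> borel_measurable lebesgue" unfolding s_def by measurable
    have sb: "norm (s x) \<le> 1" for x by (simp add: s_def norm_sgn)
    have s0: "norm x > R \<Longrightarrow> s x = 0" for x by (simp add: s_def)
    obtain \<phi> :: "nat \<Rightarrow> 'n cfun" where \<phi>: "\<And>k. \<phi> k \<in> test_fun" "\<And>k x. norm (\<phi> k x) \<le> 1 + 2"
      "\<And>k x. norm x > R + 2 \<Longrightarrow> \<phi> k x = 0" "AE x in lebesgue. (\<lambda>k. \<phi> k x) \<longlonglongrightarrow> s x"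
      using test_fun_approx_AE[OF sm sb R s0] by blast
    have m: "\<phi> k \<in> borel_measurable lebesgue" for k
      using Cc_integrable_lebesgue(2)[OF test_fun_Cc[OF \<phi>(1)]] .
    have "(\<lambda>k. \<integral>x. g x * \<phi> k x \<partial>lebesgue) \<longlonglongrightarrow> (\<integral>x. g x * s x \<partial>lebesgue)"
    proof (rule integral_dominated_convergence)
      show "integrable lebesgue (\<lambda>x. 3 * norm (indicator (cball 0 (R+2)) x *\<^sub>R g x))"
        using gi by (intro integrable_mult_right integrable_norm)
      show "AE x in lebesgue. (\<lambda>k. g x * \<phi> k x) \<longlonglongrightarrow> g x * s x"
        using \<phi>(4) by eventually_elim (intro tendsto_intros)
      show "(\<lambda>x. g x * s x) \<in> borel_measurable lebesgue"
        using L1loc_integrable_mult[OF g sm sb s0] by auto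
      fix k
      show "(\<lambda>x. g x * \<phi> k x) \<in> borel_measurable lebesgue"
        using L1loc_integrable_mult[OF g m \<phi>(2,3)] by auto
      show "AE x in lebesgue. norm (g x * \<phi> k x) \<le> 3 * norm (indicator (cball 0 (R+2)) x *\<^sub>R g x)"
      proof (intro always_eventually allI)
        fix x
        show "norm (g x * \<phi> k x) \<le> 3 * norm (indicator (cball 0 (R+2)) x *\<^sub>R g x)"
          using \<phi>(3)[of x k] mult_left_mono[OF \<phi>(2)[of k x], of "norm (g x)"]
          by (cases "norm x > R + 2") (auto simp: norm_mult)
      qed
    qed
    moreover have "(\<integral>x. g x * \<phi> k x \<partial>lebesgue) = 0" for k using z[OF \<phi>(1)] by (simp add: pairing_def)
    ultimately have "(\<integral>x. g x * s x \<partial>lebesgue) = 0" by (simp add: LIMSEQ_const_iff)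
    moreover have "g x * s x = complex_of_real (norm (indicator (cball 0 R) x *\<^sub>R g x))" for x
    proof (cases "norm x \<le> R \<and> g x \<noteq> 0")
      case True
      have "g x * cnj (g x) = complex_of_real (norm (g x)) * complex_of_real (norm (g x))"
        by (simp add: complex_norm_square[symmetric] power2_eq_square)
      then show ?thesis using True by (simp add: s_def sgn_div_norm scaleR_conv_of_real field_simps)
    qed (auto simp: s_def indicator_def)
    ultimately have "(\<integral>x. norm (indicator (cball 0 R) x *\<^sub>R g x) \<partial>lebesgue) = 0"
      by (simp only: integral_complex_of_real of_real_eq_0_iff)
    then have "AE x in lebesgue. norm (indicator (cball 0 R) x *\<^sub>R g x) = 0"
      using integrable_norm[OF gi[of R]] by (subst (asm) integral_nonneg_eq_0_iff_AE) (simp_all del: norm_scaleR)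
    then show ?thesis by eventually_elim (auto simp: indicator_def)
  qed
  have "AE x in lebesgue. \<forall>k::nat. norm x \<le> real (Suc k) \<longrightarrow> g x = 0"
    by (subst AE_all_countable) (use ball in auto)
  then show ?thesis
  proof eventually_elim
    case (elim x)
    obtain k :: nat where "norm x \<le> real k" using real_arch_simple by blast
    then show ?case using elim by (metis of_nat_Suc add_increasing2 le_add_same_cancel2 zero_le_one add.commute order_trans)
  qed
qed

section \<open>Sobolev spaces of order one\<close>

lemma integral_lebesgue_translation:
  fixes f :: "real ^ 'n \<Rightarrow> 'b::{banach, second_countable_topology}"
  assumes "f \<in> borel_measurable borel"
  shows "(\<integral>x. f (c + x) \<partial>lebesgue) = (\<integral>x. f x \<partial>lebesgue)"
proof -
  have "(\<integral>x. f x \<partial>lebesgue) = (\<integral>x. f x \<partial>distr lborel borel ((+) c))"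
    using assms by (simp add: integral_completion lborel_distr_plus)
  also have "\<dots> = (\<integral>x. f (c + x) \<partial>lborel)"
    using assms by (subst integral_distr) auto
  also have "\<dots> = (\<integral>x. f (c + x) \<partial>lebesgue)"
    using assms by (subst integral_completion) auto
  finally show ?thesis by simp
qed

lemma has_vector_derivative_along_axis:
  assumes "\<And>y. f differentiable (at y)"
  shows "((\<lambda>t. f (x + t *\<^sub>R axis j 1)) has_vector_derivative pderivative j f (x + s *\<^sub>R axis j 1)) (at s within S)"
proof -
  let ?F = "frechet_derivative f (at (x + s *\<^sub>R axis j 1))"
  have F: "(f has_derivative ?F) (at (x + s *\<^sub>R axis j 1))" using pderivative_has_derivative[OF assms] .
  have "((\<lambda>t. x + t *\<^sub>R axis j 1) has_derivative (\<lambda>h. h *\<^sub>R axis j 1)) (at s within S)"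
    by (auto intro!: derivative_eq_intros)
  from has_derivative_compose[OF this F]
  have "((\<lambda>t. f (x + t *\<^sub>R axis j 1)) has_derivative (\<lambda>h. ?F (h *\<^sub>R axis j 1))) (at s within S)" .
  moreover have "?F (h *\<^sub>R axis j 1) = h *\<^sub>R pderivative j f (x + s *\<^sub>R axis j 1)" for h
    using linear_cmul[OF has_derivative_linear[OF F]] by (simp add: pderivative_def)
  ultimately show ?thesis by (simp add: has_vector_derivative_def)
qed

lemma test_fun_borel: "f \<in> test_fun \<Longrightarrow> f \<in> borel_measurable borel"
  by (intro borel_measurable_continuous_onI test_fun_continuous)

text \<open>By translation invariance every difference quotient has integral 0. The quotients
  converge pointwise to the derivative and are dominated, by the mean value inequality, by a
  constant on a ball; the steps are at most 1, hence the radius \<open>R + 1\<close>.\<close>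

lemma integral_pderivative_test_fun:
  fixes f :: "('n::finite) cfun"
  assumes f: "f \<in> test_fun"
  shows "(\<integral>x. pderivative j f x \<partial>lebesgue) = 0"
proof -
  let ?e = "axis j 1 :: real ^ 'n"
  have fd: "f differentiable (at x)" for x by (rule test_fun_differentiable[OF f])
  obtain B where B: "\<And>x. norm (pderivative j f x) \<le> B"
    using Cc_integrable_lebesgue(3)[OF test_fun_Cc[OF test_fun_pderivative[OF f]]] by blast
  obtain R where R: "R > 0" "\<And>x. norm x > R \<Longrightarrow> f x = 0" using f by (auto simp: test_fun_iff)
  define t where "t n = inverse (real (Suc n))" for n
  have t: "t n > 0" "t n \<le> 1" for n by (auto simp: t_def field_simps)
  have tlim: "t \<longlonglongrightarrow> 0" unfolding t_def by (rule LIMSEQ_inverse_real_of_nat)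
  define q where "q n x = (f (t n *\<^sub>R ?e + x) - f x) /\<^sub>R t n" for n x
  have fi: "integrable lebesgue f" by (rule Cc_integrable_lebesgue(1)[OF test_fun_Cc[OF f]])
  have cont: "continuous_on UNIV (\<lambda>x. f (c + x))" for c
    by (intro continuous_on_compose2[OF test_fun_continuous[OF f]] continuous_intros) auto
  have shift: "(\<lambda>x. f (c + x)) \<in> Cc" for c
  proof -
    have "f (c + x) = 0" if "norm x > R + norm c" for x
      using R(2)[of "c + x"] that norm_diff_ineq[of x c] by (simp add: add.commute)
    then show ?thesis
      unfolding Cc_iff using cont R(1) by (intro conjI exI[of _ "R + norm c"]) (auto intro: add_pos_nonneg)
  qed
  have "(\<integral>x. q n x \<partial>lebesgue) = 0" for n
    using integral_lebesgue_translation[OF test_fun_borel[OF f], of "t n *\<^sub>R ?e"]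
      fi Cc_integrable_lebesgue(1)[OF shift]
    by (simp add: q_def)
  moreover have "(\<lambda>n. \<integral>x. q n x \<partial>lebesgue) \<longlonglongrightarrow> (\<integral>x. pderivative j f x \<partial>lebesgue)"
  proof (rule integral_dominated_convergence)
    show "integrable lebesgue (\<lambda>x. B * indicator (cball (0::real^'n) (R + 1)) x)"
      by (intro integrable_mult_right integrable_real_indicator)
         (use emeasure_lborel_cball_finite[of "0::real^'n" "R+1"] in \<open>auto simp: top.not_eq_extremum\<close>)
    show "pderivative j f \<in> borel_measurable lebesgue"
      by (rule Cc_integrable_lebesgue(2)[OF test_fun_Cc[OF test_fun_pderivative[OF f]]])
    show "q n \<in> borel_measurable lebesgue" for n
      unfolding q_def using Cc_integrable_lebesgue(2)[OF shift] Cc_integrable_lebesgue(2)[OF test_fun_Cc[OF f]]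
      by measurable
    have qlim: "(\<lambda>n. q n x) \<longlonglongrightarrow> pderivative j f x" for x
    proof -
      have "((\<lambda>t. f (x + t *\<^sub>R ?e)) has_vector_derivative pderivative j f x) (at 0)"
        using has_vector_derivative_along_axis[OF fd, where s=0 and x=x and S=UNIV] by simp
      then have *: "((\<lambda>h. norm (f (x + h *\<^sub>R ?e) - f x - h *\<^sub>R pderivative j f x) / \<bar>h\<bar>) \<longlongrightarrow> 0) (at 0)"
        by (simp add: has_vector_derivative_def has_derivative_at)
      have "((\<lambda>h. norm ((f (x + h *\<^sub>R ?e) - f x) /\<^sub>R h - pderivative j f x)) \<longlongrightarrow> 0) (at 0)"
      proof (rule Lim_transform_eventually[OF *])
        show "\<forall>\<^sub>F h in at 0. norm (f (x + h *\<^sub>R ?e) - f x - h *\<^sub>R pderivative j f x) / \<bar>h\<bar>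
            = norm ((f (x + h *\<^sub>R ?e) - f x) /\<^sub>R h - pderivative j f x)"
          unfolding eventually_at_filter
        proof (intro always_eventually allI impI)
          fix h :: real assume "h \<noteq> 0"
          then have "(f (x + h *\<^sub>R ?e) - f x) /\<^sub>R h - pderivative j f x
              = (f (x + h *\<^sub>R ?e) - f x - h *\<^sub>R pderivative j f x) /\<^sub>R h"
            by (simp add: scaleR_diff_right)
          then show "norm (f (x + h *\<^sub>R ?e) - f x - h *\<^sub>R pderivative j f x) / \<bar>h\<bar>
              = norm ((f (x + h *\<^sub>R ?e) - f x) /\<^sub>R h - pderivative j f x)"
            by (simp add: divide_inverse_commute)
        qed
      qed
      then have "((\<lambda>h. (f (x + h *\<^sub>R ?e) - f x) /\<^sub>R h) \<longlongrightarrow> pderivative j f x) (at 0)"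
        by (rule LIM_zero_cancel[OF tendsto_norm_zero_cancel])
      moreover have "filterlim t (at 0) sequentially"
        unfolding filterlim_at using tlim t(1) by (auto intro!: always_eventually simp: less_imp_neq[THEN not_sym])
      ultimately have "(\<lambda>n. (f (x + t n *\<^sub>R ?e) - f x) /\<^sub>R t n) \<longlonglongrightarrow> pderivative j f x"
        by (rule filterlim_compose)
      then show ?thesis by (simp add: q_def add.commute)
    qed
    then show "AE x in lebesgue. (\<lambda>n. q n x) \<longlonglongrightarrow> pderivative j f x" by simp
    fix n
    have "norm (q n x) \<le> B * indicator (cball 0 (R + 1)) x" for x
    proof (cases "norm x \<le> R + 1")
      case True
      have "norm (f (x + t n *\<^sub>R ?e) - f (x + 0 *\<^sub>R ?e)) \<le> B * norm (t n - 0)"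
      proof (rule differentiable_bound[where S="{0..t n}" and f'="\<lambda>s h. h *\<^sub>R pderivative j f (x + s *\<^sub>R ?e)"])
        show "((\<lambda>t. f (x + t *\<^sub>R ?e)) has_derivative (\<lambda>h. h *\<^sub>R pderivative j f (x + s *\<^sub>R ?e))) (at s within {0..t n})" for s
          using has_vector_derivative_along_axis[OF fd] by (simp add: has_vector_derivative_def)
        show "onorm (\<lambda>h. h *\<^sub>R pderivative j f (x + s *\<^sub>R ?e)) \<le> B" for s
          using B[of "x + s *\<^sub>R ?e"] by (intro onorm_le) (simp add: mult.commute[of B] mult_left_mono)
      qed (use t(1)[of n] in auto)
      moreover have "norm (q n x) = norm (f (x + t n *\<^sub>R ?e) - f (x + 0 *\<^sub>R ?e)) / t n"
        using t(1)[of n] by (simp add: q_def add.commute divide_inverse_commute)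
      ultimately have "norm (q n x) \<le> B"
        using t(1)[of n] by (simp add: pos_divide_le_eq)
      then show ?thesis using True by simp
    next
      case False
      have "norm (t n *\<^sub>R ?e) \<le> 1" using t[of n] by (simp add: norm_axis_1)
      then have "norm (t n *\<^sub>R ?e + x) > R" using False norm_diff_ineq[of x "t n *\<^sub>R ?e"] by (simp add: add.commute)
      then show ?thesis using False R(2)[of x] R(2)[of "t n *\<^sub>R ?e + x"] by (simp add: q_def)
    qed
    then show "AE x in lebesgue. norm (q n x) \<le> B * indicator (cball 0 (R + 1)) x" by simp
  qed
  ultimately show ?thesis by (simp add: LIMSEQ_const_iff)
qed

section \<open>Weak derivatives and the dual norm on test functions\<close>

lemma integrable_imp_L1loc:
  assumes "integrable lebesgue f" shows "f \<in> L1loc"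
  unfolding L1loc_def
proof (intro CollectI allI impI)
  fix K :: "(real ^ 'a) set" assume "compact K"
  then have "K \<in> sets lebesgue" using compact_imp_closed by (auto intro!: sets_completionI_sets borel_closed)
  then show "f absolutely_integrable_on K"
    unfolding set_integrable_def using assms integrable_mult_indicator by blast
qed

lemma test_fun_pairing_integrable:
  assumes "g \<in> L1loc" "\<phi> \<in> test_fun"
  shows "integrable lebesgue (\<lambda>x. g x * \<phi> x)"
proof -
  obtain M where "\<And>x. norm (\<phi> x) \<le> M" using Cc_integrable_lebesgue(3)[OF test_fun_Cc[OF assms(2)]] by blast
  moreover obtain R where "\<And>x. norm x > R \<Longrightarrow> \<phi> x = 0" using assms(2) by (auto simp: test_fun_iff)
  ultimately show ?thesis
    using L1loc_integrable_mult[OF assms(1) Cc_integrable_lebesgue(2)[OF test_fun_Cc[OF assms(2)]]] by blast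
qed

lemma test_fun_weak_deriv:
  assumes f: "f \<in> test_fun"
  shows "weak_deriv j f (pderivative j f)"
  unfolding weak_deriv_def
proof (intro conjI ballI)
  show L: "f \<in> L1loc" "pderivative j f \<in> L1loc"
    by (rule integrable_imp_L1loc[OF Cc_integrable_lebesgue(1)[OF test_fun_Cc]]; intro test_fun_pderivative f)+
  fix \<phi> :: "'a cfun" assume \<phi>: "\<phi> \<in> test_fun"
  have "0 = (\<integral>x. pderivative j (\<lambda>x. f x * \<phi> x) x \<partial>lebesgue)"
    using integral_pderivative_test_fun[OF test_fun_mult_smooth[OF f test_fun_Ck_on[OF \<phi>]]] by simp
  also have "\<dots> = (\<integral>x. pderivative j f x * \<phi> x + f x * pderivative j \<phi> x \<partial>lebesgue)"
    by (simp add: pderivative_mult[OF test_fun_differentiable[OF f] test_fun_differentiable[OF \<phi>]])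
  also have "\<dots> = pairing (pderivative j f) \<phi> + pairing f (pderivative j \<phi>)"
    unfolding pairing_def
    by (intro Bochner_Integration.integral_add test_fun_pairing_integrable L \<phi> test_fun_pderivative)
  finally show "distr_deriv j (pairing f) \<phi> = pairing (pderivative j f) \<phi>"
    by (simp add: distr_deriv_def) (metis add.commute minus_unique)
qed

lemma weak_deriv_unique:
  assumes "weak_deriv j f g" "weak_deriv j f h"
  shows "AE x in lebesgue. g x = h x"
proof -
  have L: "g \<in> L1loc" "h \<in> L1loc" using assms by (auto simp: weak_deriv_def)
  have "AE x in lebesgue. g x - h x = 0"
  proof (rule L1loc_zero_if_pairing_zero)
    show "(\<lambda>x. g x - h x) \<in> L1loc" using L by (auto simp: L1loc_def)
    fix \<phi> :: "'a cfun" assume \<phi>: "\<phi> \<in> test_fun"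
    have "pairing (\<lambda>x. g x - h x) \<phi> = pairing g \<phi> - pairing h \<phi>"
      unfolding pairing_def left_diff_distrib
      by (intro Bochner_Integration.integral_diff test_fun_pairing_integrable L \<phi>)
    also have "\<dots> = 0" using assms \<phi> by (auto simp: weak_deriv_def)
    finally show "pairing (\<lambda>x. g x - h x) \<phi> = 0" .
  qed
  then show ?thesis by eventually_elim simp
qed

lemma test_fun_Lp_space: "f \<in> test_fun \<Longrightarrow> s > 0 \<Longrightarrow> f \<in> Lp_space s"
  using Cc_integrable_lebesgue(4) test_fun_Cc by blast

lemma test_fun_W1: "\<theta> \<in> test_fun \<Longrightarrow> s > 0 \<Longrightarrow> \<theta> \<in> W1 s"
  unfolding W1_def using test_fun_weak_deriv test_fun_pderivative test_fun_Lp_space by blast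

text \<open>\<open>W1_norm\<close> refers to a chosen weak derivative. By uniqueness it agrees
  almost everywhere with the classical one, and the norm does not see the difference.\<close>

lemma test_fun_W1_norm:
  assumes "\<theta> \<in> test_fun" "s > 0"
  shows "W1_norm s \<theta> = Lp_norm s \<theta> + (\<Sum>j\<in>UNIV. Lp_norm s (pderivative j \<theta>))"
proof -
  have "Lp_norm s (SOME g. weak_deriv j \<theta> g) = Lp_norm s (pderivative j \<theta>)" for j
  proof -
    have "weak_deriv j \<theta> (SOME g. weak_deriv j \<theta> g)"
      using test_fun_weak_deriv[OF assms(1), of j] by (rule someI[of "weak_deriv j \<theta>"])
    then have "AE x in lebesgue. pderivative j \<theta> x = (SOME g. weak_deriv j \<theta> g) x"
      using weak_deriv_unique[OF test_fun_weak_deriv[OF assms(1)]] by blast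
    then show ?thesis
      using Lp_modular_cong_AE[OF test_fun_Lp_space[OF test_fun_pderivative[OF assms(1)] assms(2)]]
      by (simp add: Lp_norm_modular)
  qed
  then show ?thesis by (simp add: W1_norm_def)
qed

lemma Lp_norm_scale:
  assumes "p > 0" shows "Lp_norm p (\<lambda>x. c * f x) = norm c * Lp_norm p f"
  using assms by (simp add: Lp_norm_modular Lp_modular_scale powr_mult powr_powr Lp_modular_nonneg)

lemma pderivative_scale:
  "f differentiable (at x) \<Longrightarrow> pderivative j (\<lambda>x. c * f x) x = c * pderivative j f x"
  using pderivative_mult[of "\<lambda>x. c" x f j] by simp

text \<open>The dual norm is a supremum over the unit ball, so \<theta> is rescaled by a positive
  upper bound \<open>C\<close> of its norm; using the bound instead of the norm avoids a division by
  0.\<close>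

lemma Wm1_test_fun_bound:
  assumes F: "F \<in> Wm1 p" and p: "p > 1" and \<theta>: "\<theta> \<in> test_fun" "W1_norm (conj_exp p) \<theta> \<le> C" "C > 0"
  shows "norm (F \<theta>) \<le> enn2real (Wm1_norm p F) * C"
proof -
  let ?s = "conj_exp p"
  have s: "?s > 0" using p by (simp add: conj_exp_def)
  define g where "g x = complex_of_real (1 / C) * \<theta> x" for x
  have g: "g \<in> test_fun" unfolding g_def[abs_def] by (rule test_fun_scale[OF \<theta>(1)])
  have "Lp_norm ?s g = Lp_norm ?s \<theta> / C"
    unfolding g_def[abs_def] using \<theta>(3) by (simp add: Lp_norm_scale[OF s] norm_divide del: of_real_divide)
  moreover have "Lp_norm ?s (pderivative j g) = Lp_norm ?s (pderivative j \<theta>) / C" for j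
  proof -
    have "pderivative j g = (\<lambda>x. complex_of_real (1 / C) * pderivative j \<theta> x)"
      unfolding g_def[abs_def] by (rule ext) (rule pderivative_scale[OF test_fun_differentiable[OF \<theta>(1)]])
    then show ?thesis using \<theta>(3) by (simp add: Lp_norm_scale[OF s] norm_divide del: of_real_divide)
  qed
  ultimately have "W1_norm ?s g = W1_norm ?s \<theta> / C"
    by (simp add: test_fun_W1_norm[OF g s] test_fun_W1_norm[OF \<theta>(1) s] add_divide_distrib sum_divide_distrib)
  then have "W1_norm ?s g \<le> 1" using \<theta> by simp
  then have "ennreal (norm (F g)) \<le> Wm1_norm p F"
    unfolding Wm1_norm_def using test_fun_W1[OF g s] by (intro SUP_upper) auto
  moreover have fin: "Wm1_norm p F < \<infinity>" using F by (simp add: Wm1_def)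
  ultimately have "norm (F g) \<le> enn2real (Wm1_norm p F)"
    using enn2real_mono[of "ennreal (norm (F g))" "Wm1_norm p F"] by simp
  moreover have "F g = complex_of_real (1 / C) * F \<theta>"
  proof -
    have "clinear_on (W1 ?s) F" using F by (simp add: Wm1_def)
    then have "F (\<lambda>x. complex_of_real (1 / C) * \<theta> x + 0 * \<theta> x) = complex_of_real (1 / C) * F \<theta> + 0 * F \<theta>"
      unfolding clinear_on_def using test_fun_W1[OF \<theta>(1) s] by blast
    then show ?thesis by (simp add: g_def[abs_def])
  qed
  ultimately show ?thesis using \<theta>(3) by (simp add: norm_mult norm_divide field_simps)
qed

lemma Wm1_test_fun_tendsto_0:
  assumes F: "\<And>n. F n \<in> Wm1 p" "(\<lambda>n. Wm1_norm p (F n)) \<longlonglongrightarrow> 0" and p: "p > 1"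
    and \<theta>: "\<And>n. \<theta> n \<in> test_fun" "\<And>n. W1_norm (conj_exp p) (\<theta> n) \<le> C"
  shows "(\<lambda>n. F n (\<theta> n)) \<longlonglongrightarrow> 0"
proof (rule Lim_null_comparison)
  have "(\<lambda>n. enn2real (Wm1_norm p (F n))) \<longlonglongrightarrow> 0"
    using tendsto_enn2real[of "\<lambda>n. Wm1_norm p (F n)" 0 sequentially] F(2) by simp
  \<comment> \<open>The maximum with 1 supplies the positive bound by which the test functions are
    rescaled.\<close>
  then have "(\<lambda>n. enn2real (Wm1_norm p (F n)) * max C 1) \<longlonglongrightarrow> 0 * max C 1"
    by (rule tendsto_mult[OF _ tendsto_const])
  then show "(\<lambda>n. enn2real (Wm1_norm p (F n)) * max C 1) \<longlonglongrightarrow> 0" by simp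
  show "\<forall>\<^sub>F n in sequentially. norm (F n (\<theta> n)) \<le> enn2real (Wm1_norm p (F n)) * max C 1"
    using Wm1_test_fun_bound[OF F(1) p \<theta>(1), of _ "max C 1"] \<theta>(2) by (intro always_eventually) (auto simp: le_max_iff_disj)
qed

lemma W1_norm_le_of_modular:
  assumes "\<theta> \<in> test_fun" "s > 0" "Lp_modular s \<theta> \<le> K" "\<And>j. Lp_modular s (pderivative j \<theta>) \<le> K"
  shows "W1_norm s (\<theta> :: ('n::finite) cfun) \<le> (1 + real CARD('n)) * K powr (1 / s)"
proof -
  have *: "Lp_norm s f \<le> K powr (1 / s)" if "Lp_modular s f \<le> K" for f :: "'n cfun"
    unfolding Lp_norm_modular using that assms(2) by (intro powr_mono2) (auto simp: Lp_modular_nonneg)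
  have "(\<Sum>j\<in>(UNIV::'n set). Lp_norm s (pderivative j \<theta>)) \<le> (\<Sum>j\<in>(UNIV::'n set). K powr (1 / s))"
    by (intro sum_mono * assms)
  then show ?thesis
    using *[OF assms(3)] by (simp add: test_fun_W1_norm[OF assms(1,2)] algebra_simps)
qed

section \<open>The Fourier transform\<close>

lemma sigma_finite_lebesgue: "sigma_finite_measure (lebesgue :: ('a::euclidean_space) measure)"
proof
  show "\<exists>A. countable A \<and> A \<subseteq> sets (lebesgue::'a measure) \<and> \<Union>A = space lebesgue \<and> (\<forall>a\<in>A. emeasure lebesgue a \<noteq> \<infinity>)"
  proof (intro exI[of _ "range (\<lambda>n::nat. cball 0 (real n))"] conjI)
    show "\<Union> (range (\<lambda>n. cball (0::'a) (real n))) = space lebesgue"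
      using real_arch_simple by auto
    show "\<forall>a\<in>range (\<lambda>n. cball (0::'a) (real n)). emeasure lebesgue a \<noteq> \<infinity>"
      using emeasure_lborel_cball_finite[of "0::'a"] by (auto simp: less_top[symmetric])
  qed auto
qed

lemma pair_sigma_finite_lebesgue:
  "pair_sigma_finite (lebesgue :: ('a::euclidean_space) measure) (lebesgue :: ('b::euclidean_space) measure)"
  by (intro pair_sigma_finite.intro sigma_finite_lebesgue)

lemma fourier_kernel_measurable: "(\<lambda>x. cis (c * (x \<bullet> \<xi>))) \<in> borel_measurable lebesgue"
  by (intro borel_measurable_lebesgue_of_borel borel_measurable_continuous_onI continuous_intros)

lemma fourier_integrable:
  assumes "integrable lebesgue u"
  shows "integrable lebesgue (\<lambda>x. cis (c * (x \<bullet> \<xi>)) * u x)"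
  by (rule Bochner_Integration.integrable_bound[OF assms])
     (use assms in \<open>auto simp: norm_mult intro!: borel_measurable_times fourier_kernel_measurable\<close>)

lemma fourier_norm_le:
  assumes "integrable lebesgue u"
  shows "norm (fourier u \<xi>) \<le> (\<integral>x. norm (u x) \<partial>lebesgue)"
proof -
  have "norm (fourier u \<xi>) \<le> (\<integral>x. norm (cis (- 2 * pi * (x \<bullet> \<xi>)) * u x) \<partial>lebesgue)"
    unfolding fourier_def by (rule integral_norm_bound)
  then show ?thesis by (simp add: norm_mult)
qed

lemma fourier_continuous:
  fixes u :: "('n::finite) cfun"
  assumes "integrable lebesgue u"
  shows "continuous_on UNIV (fourier u)"
  unfolding continuous_on_sequentially
proof (intro allI ballI impI, elim conjE)
  fix x and a :: "real ^ 'n" assume x: "x \<longlonglongrightarrow> a"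
  show "(fourier u \<circ> x) \<longlonglongrightarrow> fourier u a"
    unfolding fourier_def o_def
  proof (rule integral_dominated_convergence)
    show "integrable lebesgue (\<lambda>y. norm (u y))" using assms by simp
    show "(\<lambda>y. cis (- 2 * pi * (y \<bullet> a)) * u y) \<in> borel_measurable lebesgue"
      "(\<lambda>y. cis (- 2 * pi * (y \<bullet> x n)) * u y) \<in> borel_measurable lebesgue" for n
      by (rule borel_measurable_integrable[OF fourier_integrable[OF assms]])+
    have "isCont cis t" for t unfolding cis_conv_exp by (intro continuous_intros)
    then have "(\<lambda>n. cis (- 2 * pi * (y \<bullet> x n))) \<longlonglongrightarrow> cis (- 2 * pi * (y \<bullet> a))" for y
      by (rule isCont_tendsto_compose) (intro tendsto_intros x)
    then show "AE y in lebesgue. (\<lambda>n. cis (- 2 * pi * (y \<bullet> x n)) * u y) \<longlonglongrightarrow> cis (- 2 * pi * (y \<bullet> a)) * u y"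
      by (intro always_eventually allI tendsto_mult tendsto_const)
    show "AE y in lebesgue. norm (cis (- 2 * pi * (y \<bullet> x n)) * u y) \<le> norm (u y)" for n
      by (simp add: norm_mult)
  qed
qed

lemma fourier_borel: "integrable lebesgue u \<Longrightarrow> fourier u \<in> borel_measurable borel"
  by (intro borel_measurable_continuous_onI fourier_continuous)

lemma fourier_lebesgue: "integrable lebesgue u \<Longrightarrow> fourier u \<in> borel_measurable lebesgue"
  by (intro borel_measurable_lebesgue_of_borel fourier_borel)

lemma fourier_add:
  assumes "integrable lebesgue u" "integrable lebesgue v"
  shows "fourier (\<lambda>x. u x + v x) \<xi> = fourier u \<xi> + fourier v \<xi>"
  unfolding fourier_def distrib_left
  by (intro Bochner_Integration.integral_add fourier_integrable assms)

lemma fourier_scale: "fourier (\<lambda>x. c * u x) \<xi> = c * fourier u \<xi>"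
  unfolding fourier_def by (subst integral_mult_right_zero[symmetric]) (simp add: mult_ac)

lemma fourier_diff:
  assumes "integrable lebesgue u" "integrable lebesgue v"
  shows "fourier (\<lambda>x. u x - v x) \<xi> = fourier u \<xi> - fourier v \<xi>"
  unfolding fourier_def right_diff_distrib
  by (intro Bochner_Integration.integral_diff fourier_integrable assms)

lemma inv_fourier_conv_fourier: "inv_fourier u x = cnj (fourier (\<lambda>\<xi>. cnj (u \<xi>)) x)"
proof -
  have "cnj (fourier (\<lambda>\<xi>. cnj (u \<xi>)) x) = (\<integral>\<xi>. cnj (cis (- 2 * pi * (\<xi> \<bullet> x)) * cnj (u \<xi>)) \<partial>lebesgue)"
    unfolding fourier_def by (rule Bochner_Integration.integral_cnj[symmetric])
  then show ?thesis by (simp add: inv_fourier_def inner_commute cis_cnj)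
qed

lemma lebesgue_id_measurable: "(\<lambda>x. x) \<in> measurable (lebesgue :: ('a::euclidean_space) measure) borel"
  by (rule borel_measurable_lebesgue_of_borel[where f="\<lambda>x. x"] | rule measurable_completion) simp

text \<open>Fubini's theorem for the kernel of the transform. Gaussian regularisation, Bessel's
  inequality and the duality on frequency bands all move the transform from one factor to the other
  in this way.\<close>

lemma fourier_multiplication_formula:
  fixes f g :: "('n::finite) cfun"
  assumes f: "integrable lebesgue f" and g: "integrable lebesgue g"
  shows "(\<integral>\<xi>. fourier f \<xi> * g \<xi> \<partial>lebesgue) = (\<integral>x. f x * fourier g x \<partial>lebesgue)"
proof -
  interpret pair_sigma_finite "lebesgue :: (real^'n) measure" "lebesgue :: (real^'n) measure"
    by (rule pair_sigma_finite_lebesgue)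
  have [measurable]: "(\<lambda>x. x) \<in> measurable (lebesgue :: (real^'n) measure) borel" by (rule lebesgue_id_measurable)
  have [measurable]: "f \<in> borel_measurable lebesgue" "g \<in> borel_measurable lebesgue" using f g by auto
  have 1: "(\<lambda>z::(real^'n) \<times> (real^'n). cis (- 2 * pi * (fst z \<bullet> snd z))) \<in> borel_measurable (borel \<Otimes>\<^sub>M borel)"
    unfolding borel_prod by (intro borel_measurable_continuous_onI continuous_intros)
  have 2: "(\<lambda>z::(real^'n) \<times> (real^'n). (fst z, snd z)) \<in> measurable (lebesgue \<Otimes>\<^sub>M lebesgue) (borel \<Otimes>\<^sub>M borel)"
    by measurable
  have km: "(\<lambda>z::(real^'n) \<times> (real^'n). cis (- 2 * pi * (fst z \<bullet> snd z))) \<in> borel_measurable (lebesgue \<Otimes>\<^sub>M lebesgue)"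
    using measurable_compose[OF 2 1] by (simp only: fst_conv snd_conv)
  define F where "F x \<xi> = cis (- 2 * pi * (x \<bullet> \<xi>)) * f x * g \<xi>" for x \<xi>
  have Fm: "case_prod F \<in> borel_measurable (lebesgue \<Otimes>\<^sub>M lebesgue)"
    unfolding F_def split_beta using km by measurable
  have int: "integrable (lebesgue \<Otimes>\<^sub>M lebesgue) (case_prod F)"
  proof (rule Fubini_integrable[OF Fm])
    have "(\<lambda>x. \<integral>y. norm (case_prod F (x, y)) \<partial>lebesgue) = (\<lambda>x. norm (f x) * (\<integral>y. norm (g y) \<partial>lebesgue))"
      by (simp add: F_def norm_mult)
    then show "integrable lebesgue (\<lambda>x. \<integral>y. norm (case_prod F (x, y)) \<partial>lebesgue)" using f by simp
    have "integrable lebesgue (\<lambda>y. F x y)" for x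
    proof -
      have "integrable lebesgue (\<lambda>y. f x * (cis ((- 2 * pi) * (y \<bullet> x)) * g y))"
        by (intro integrable_mult_right fourier_integrable g)
      then show ?thesis by (simp add: F_def inner_commute mult_ac)
    qed
    then show "AE x in lebesgue. integrable lebesgue (\<lambda>y. case_prod F (x, y))" by simp
  qed
  have "(\<integral>\<xi>. fourier f \<xi> * g \<xi> \<partial>lebesgue) = (\<integral>\<xi>. (\<integral>x. F x \<xi> \<partial>lebesgue) \<partial>lebesgue)"
    by (simp add: F_def fourier_def)
  also have "\<dots> = (\<integral>x. (\<integral>\<xi>. F x \<xi> \<partial>lebesgue) \<partial>lebesgue)" by (rule Fubini_integral[OF int])
  also have "\<dots> = (\<integral>x. f x * fourier g x \<partial>lebesgue)"
  proof -
    have "(\<integral>\<xi>. F x \<xi> \<partial>lebesgue) = f x * fourier g x" for x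
      unfolding fourier_def F_def by (subst integral_mult_right_zero[symmetric]) (simp add: inner_commute mult_ac)
    then show ?thesis by simp
  qed
  finally show ?thesis .
qed

subsection \<open>Gaussians\<close>

text \<open>The value is the characteristic function of the standard normal distribution after the
  substitution with factor \<open>sqrt (2 * pi) * e\<close>. Integrability follows from the value: a
  function that is not integrable has integral 0, and the value is not 0.\<close>

lemma fourier_gaussian_real:
  assumes e: "e > 0"
  shows "(\<integral>s. cis (- 2 * pi * (s * y)) * complex_of_real (exp (- pi * e\<^sup>2 * s\<^sup>2)) \<partial>lborel)
    = complex_of_real (exp (- pi * y\<^sup>2 / e\<^sup>2) / e)"
    and "integrable lborel (\<lambda>s. cis (- 2 * pi * (s * y)) * complex_of_real (exp (- pi * e\<^sup>2 * s\<^sup>2)))"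
proof -
  define c where "c = sqrt (2 * pi) * e"
  define t where "t = - sqrt (2 * pi) * y / e"
  have c: "c > 0" using e by (simp add: c_def)
  have "complex_of_real (exp (- t\<^sup>2 / 2)) = (\<integral>x. iexp (t * x) \<partial>std_normal_distribution)"
    using char_std_normal_distribution by (simp add: char_def fun_eq_iff)
  also have "\<dots> = (\<integral>x. std_normal_density x *\<^sub>R iexp (t * x) \<partial>lborel)"
    by (rule integral_density) auto
  also have "\<dots> = \<bar>c\<bar> *\<^sub>R (\<integral>s. std_normal_density (0 + c * s) *\<^sub>R iexp (t * (0 + c * s)) \<partial>lborel)"
    using c by (intro lborel_integral_real_affine) simp
  also have "(\<lambda>s. std_normal_density (0 + c * s) *\<^sub>R iexp (t * (0 + c * s)))
      = (\<lambda>s. (1 / sqrt (2 * pi)) *\<^sub>R (cis (- 2 * pi * (s * y)) * complex_of_real (exp (- pi * e\<^sup>2 * s\<^sup>2))))"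
  proof
    fix s
    have 1: "t * (c * s) = - 2 * pi * (s * y)" using e by (simp add: t_def c_def field_simps)
    have 2: "(c * s)\<^sup>2 / 2 = pi * e\<^sup>2 * s\<^sup>2" by (simp add: c_def power_mult_distrib)
    have "std_normal_density (0 + c * s) = (1 / sqrt (2 * pi)) * exp (- pi * e\<^sup>2 * s\<^sup>2)"
      unfolding std_normal_density_def using 2 by simp
    moreover have "iexp (t * (0 + c * s)) = cis (- 2 * pi * (s * y))"
      using 1 by (simp add: cis_conv_exp)
    ultimately show "std_normal_density (0 + c * s) *\<^sub>R iexp (t * (0 + c * s))
      = (1 / sqrt (2 * pi)) *\<^sub>R (cis (- 2 * pi * (s * y)) * complex_of_real (exp (- pi * e\<^sup>2 * s\<^sup>2)))"
      by (simp add: scaleR_conv_of_real mult_ac)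
  qed
  also have "\<bar>c\<bar> *\<^sub>R (\<integral>s. (1 / sqrt (2 * pi)) *\<^sub>R (cis (- 2 * pi * (s * y)) * complex_of_real (exp (- pi * e\<^sup>2 * s\<^sup>2))) \<partial>lborel)
     = e *\<^sub>R (\<integral>s. cis (- 2 * pi * (s * y)) * complex_of_real (exp (- pi * e\<^sup>2 * s\<^sup>2)) \<partial>lborel)"
    using c e by (simp add: c_def)
  finally have E: "complex_of_real (exp (- t\<^sup>2 / 2))
    = e *\<^sub>R (\<integral>s. cis (- 2 * pi * (s * y)) * complex_of_real (exp (- pi * e\<^sup>2 * s\<^sup>2)) \<partial>lborel)" .
  have "t\<^sup>2 / 2 = pi * y\<^sup>2 / e\<^sup>2" by (simp add: t_def power_divide power_mult_distrib)
  then have "exp (- t\<^sup>2 / 2) = exp (- pi * y\<^sup>2 / e\<^sup>2)" by simp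
  from E[unfolded this] show I: "(\<integral>s. cis (- 2 * pi * (s * y)) * complex_of_real (exp (- pi * e\<^sup>2 * s\<^sup>2)) \<partial>lborel)
    = complex_of_real (exp (- pi * y\<^sup>2 / e\<^sup>2) / e)"
    using e by (auto simp: scaleR_conv_of_real)
  have "complex_of_real (exp (- pi * y\<^sup>2 / e\<^sup>2) / e) \<noteq> 0" using e by simp
  then show "integrable lborel (\<lambda>s. cis (- 2 * pi * (s * y)) * complex_of_real (exp (- pi * e\<^sup>2 * s\<^sup>2)))"
    unfolding I[symmetric] by (rule contrapos_np) (rule not_integrable_integral_eq)
qed

definition gaussian :: "real \<Rightarrow> ('n::finite) cfun" where
  "gaussian e x = complex_of_real (exp (- pi * e\<^sup>2 * (x \<bullet> x)))"

lemma integral_lborel_prod: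
  fixes f :: "'a::euclidean_space \<Rightarrow> real \<Rightarrow> complex"
  assumes "\<And>b. b \<in> Basis \<Longrightarrow> integrable lborel (f b)"
  shows "(\<integral>x. (\<Prod>b\<in>Basis. f b (x \<bullet> b)) \<partial>lborel) = (\<Prod>b\<in>Basis. (\<integral>x. f b x \<partial>lborel))"
proof -
  interpret product_sigma_finite "\<lambda>_::'a. lborel :: real measure"
    by (simp add: product_sigma_finite_def lborel.sigma_finite_measure_axioms)
  have m: "f b \<in> borel_measurable borel" if "b \<in> Basis" for b using assms[OF that] by auto
  have "(\<integral>x. (\<Prod>b\<in>Basis. f b (x \<bullet> b)) \<partial>lborel)
      = (\<integral>x. (\<Prod>b\<in>Basis. f b (x \<bullet> b)) \<partial>distr (\<Pi>\<^sub>M b\<in>Basis. lborel) borel (\<lambda>f. \<Sum>b\<in>Basis. f b *\<^sub>R b))"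
    by (subst lborel_eq) simp
  also have "\<dots> = (\<integral>x. (\<Prod>b\<in>Basis. f b ((\<Sum>b\<in>Basis. x b *\<^sub>R b) \<bullet> b)) \<partial>(\<Pi>\<^sub>M b\<in>Basis. lborel))"
  proof (rule integral_distr)
    show "(\<lambda>x::'a. \<Prod>b\<in>Basis. f b (x \<bullet> b)) \<in> borel_measurable borel"
    proof (rule borel_measurable_prod)
      fix b :: 'a assume b: "b \<in> Basis"
      have "(\<lambda>x::'a. x \<bullet> b) \<in> borel_measurable borel" by measurable
      from measurable_compose[OF this m[OF b]] show "(\<lambda>x. f b (x \<bullet> b)) \<in> borel_measurable borel" .
    qed
  qed measurable
  also have "\<dots> = (\<integral>x. (\<Prod>b\<in>Basis. f b (x b)) \<partial>(\<Pi>\<^sub>M b\<in>Basis. lborel))"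
    by simp
  also have "\<dots> = (\<Prod>b\<in>Basis. (\<integral>x. f b x \<partial>lborel))"
    by (rule product_integral_prod) (use assms in auto)
  finally show ?thesis .
qed

lemma gaussian_borel: "gaussian e \<in> borel_measurable borel"
  unfolding gaussian_def[abs_def] by (intro borel_measurable_continuous_onI continuous_intros)

lemma fourier_gaussian:
  fixes y :: "real ^ 'n"
  assumes "e > 0"
  shows "fourier (gaussian e) y = complex_of_real (1 / e ^ CARD('n)) * gaussian (1 / e) y"
proof -
  have k: "(\<lambda>x::real^'n. cis (- 2 * pi * (x \<bullet> y))) \<in> borel_measurable borel"
    by (intro borel_measurable_continuous_onI continuous_intros)
  have P: "cis (- 2 * pi * (x \<bullet> y)) * gaussian e x
      = (\<Prod>b\<in>Basis. cis (- 2 * pi * ((x \<bullet> b) * (y \<bullet> b))) * complex_of_real (exp (- pi * e\<^sup>2 * (x \<bullet> b)\<^sup>2)))" for x :: "real ^ 'n"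
  proof -
    have "cis (- 2 * pi * (x \<bullet> y)) = (\<Prod>b\<in>Basis. cis (- 2 * pi * ((x \<bullet> b) * (y \<bullet> b))))"
      unfolding cis_conv_exp by (subst euclidean_inner, subst exp_sum[symmetric])
        (auto simp: sum_distrib_left)
    moreover have "gaussian e x = (\<Prod>b\<in>Basis. complex_of_real (exp (- pi * e\<^sup>2 * (x \<bullet> b)\<^sup>2)))"
      unfolding gaussian_def of_real_prod[symmetric]
      by (subst euclidean_inner, subst exp_sum[symmetric]) (auto simp: sum_distrib_left power2_eq_square)
    ultimately show ?thesis by (simp add: prod.distrib)
  qed
  have "fourier (gaussian e) y = (\<integral>x. cis (- 2 * pi * (x \<bullet> y)) * gaussian e x \<partial>lborel)"
    unfolding fourier_def by (rule integral_completion) (use k gaussian_borel[of e] in \<open>auto intro!: borel_measurable_times\<close>)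
  also have "\<dots> = (\<Prod>b\<in>Basis. \<integral>s. cis (- 2 * pi * (s * (y \<bullet> b))) * complex_of_real (exp (- pi * e\<^sup>2 * s\<^sup>2)) \<partial>lborel)"
    unfolding P
    by (rule integral_lborel_prod[where f="\<lambda>b s. cis (- 2 * pi * (s * (y \<bullet> b))) * complex_of_real (exp (- pi * e\<^sup>2 * s\<^sup>2))"])
       (rule fourier_gaussian_real(2)[OF assms])
  also have "\<dots> = (\<Prod>b\<in>(Basis::(real^'n) set). complex_of_real (exp (- pi * (y \<bullet> b)\<^sup>2 / e\<^sup>2) / e))"
    by (simp only: fourier_gaussian_real(1)[OF assms])
  also have "\<dots> = complex_of_real ((\<Prod>b\<in>(Basis::(real^'n) set). exp (- pi * (y \<bullet> b)\<^sup>2 / e\<^sup>2)) / e ^ CARD('n))"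
    by (simp add: prod_dividef flip: of_real_prod)
  also have "(\<Prod>b\<in>(Basis::(real^'n) set). exp (- pi * (y \<bullet> b)\<^sup>2 / e\<^sup>2)) = exp (- pi * (1 / e)\<^sup>2 * (y \<bullet> y))"
    by (subst exp_sum[symmetric]) (auto simp: euclidean_inner[of y y] sum_distrib_left power2_eq_square intro!: sum.cong)
  finally show ?thesis by (simp add: gaussian_def[of "1 / e"])
qed

lemma gaussian_integrable:
  assumes "e > 0"
  shows "integrable lebesgue (gaussian e :: ('n::finite) cfun)"
proof -
  have "fourier (gaussian e :: 'n cfun) 0 \<noteq> 0"
    using assms unfolding fourier_gaussian[OF assms] by (simp add: gaussian_def)
  then have "integrable lebesgue (\<lambda>x::real^'n. cis (- 2 * pi * (x \<bullet> 0)) * gaussian e x)"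
    unfolding fourier_def by (rule contrapos_np) (rule not_integrable_integral_eq)
  then show ?thesis by simp
qed

lemma norm_gaussian: "norm (gaussian e x) = exp (- pi * e\<^sup>2 * (x \<bullet> x))"
  by (simp add: gaussian_def)

lemma integral_gaussian:
  assumes "e > 0"
  shows "(\<integral>x. norm (gaussian e x :: complex) \<partial>(lebesgue :: (real^'n) measure)) = 1 / e ^ CARD('n)"
proof -
  have "complex_of_real (\<integral>x. norm (gaussian e x :: complex) \<partial>(lebesgue :: (real^'n) measure)) = fourier (gaussian e) (0::real^'n)"
    unfolding fourier_def norm_gaussian by (simp add: gaussian_def flip: integral_complex_of_real)
  also have "\<dots> = complex_of_real (1 / e ^ CARD('n))"
    unfolding fourier_gaussian[OF assms] by (simp add: gaussian_def)
  finally show ?thesis by (simp only: of_real_eq_iff)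
qed

lemma borel_measurable_cnj [measurable (raw)]:
  assumes "f \<in> borel_measurable M"
  shows "(\<lambda>x. cnj (f x)) \<in> borel_measurable M"
proof -
  have "cnj \<in> borel_measurable borel" by (intro borel_measurable_continuous_onI continuous_intros)
  from measurable_compose[OF assms this] show ?thesis .
qed

lemma fourier_modulate: "fourier (\<lambda>\<xi>. cis (2 * pi * (x \<bullet> \<xi>)) * u \<xi>) y = fourier u (y - x)"
proof -
  have "cis (- 2 * pi * (\<xi> \<bullet> y)) * (cis (2 * pi * (x \<bullet> \<xi>)) * u \<xi>) = cis (- 2 * pi * (\<xi> \<bullet> (y - x))) * u \<xi>" for \<xi>
  proof -
    have "- 2 * pi * (\<xi> \<bullet> y) + 2 * pi * (x \<bullet> \<xi>) = - 2 * pi * (\<xi> \<bullet> (y - x))"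
      unfolding inner_diff_right inner_commute[of x] by (simp add: right_diff_distrib)
    then show ?thesis by (simp only: mult.assoc[symmetric] cis_mult)
  qed
  then show ?thesis unfolding fourier_def by (simp only:)
qed

text \<open>The Fourier transform of \<open>gaussian e\<close>: a positive kernel of mass 1 that
  concentrates at the origin as \<open>e\<close> tends to 0.\<close>

definition heat_kernel :: "real \<Rightarrow> ('n::finite) cfun" where
  "heat_kernel e x = complex_of_real (1 / e ^ CARD('n)) * gaussian (1 / e) x"

lemma heat_kernel_borel: "heat_kernel e \<in> borel_measurable borel"
  unfolding heat_kernel_def[abs_def] using gaussian_borel by measurable

lemma heat_kernel_integrable: "e > 0 \<Longrightarrow> integrable lebesgue (heat_kernel e :: ('n::finite) cfun)"
  unfolding heat_kernel_def[abs_def] by (intro integrable_mult_right gaussian_integrable) simp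

lemma heat_kernel_integral:
  "e > 0 \<Longrightarrow> (\<integral>x. norm (heat_kernel e x :: complex) \<partial>(lebesgue :: (real^'n) measure)) = 1"
  unfolding heat_kernel_def norm_mult by (simp add: integral_gaussian norm_divide norm_power power_one_over)

lemma heat_kernel_shift_integral:
  fixes x :: "real ^ 'n"
  assumes "e > 0"
  shows "(\<integral>\<^sup>+y. ennreal (norm (heat_kernel e (y - x) :: complex)) \<partial>(lebesgue :: (real^'n) measure)) = 1"
    "integrable lebesgue (\<lambda>y. heat_kernel e (y - x))"
    "(\<integral>y. norm (heat_kernel e (y - x) :: complex) \<partial>(lebesgue :: (real^'n) measure)) = 1"
proof -
  have hb: "(\<lambda>y. heat_kernel e y :: complex) \<in> borel_measurable (borel :: (real^'n) measure)" by (rule heat_kernel_borel)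
  have "integrable (distr lborel borel ((+) (- x))) (heat_kernel e)"
    using heat_kernel_integrable[OF assms, where 'n='n] hb integrable_completion[of "heat_kernel e" "lborel :: (real^'n) measure"]
    by (simp add: lborel_distr_plus)
  then have "integrable lborel (\<lambda>y. heat_kernel e (- x + y))"
    using hb by (subst (asm) integrable_distr_eq) auto
  moreover have "(\<lambda>y. heat_kernel e (y - x)) \<in> borel_measurable borel" using hb by measurable
  ultimately show i: "integrable lebesgue (\<lambda>y. heat_kernel e (y - x))"
    by (subst integrable_completion) auto
  have "(\<lambda>y. norm (heat_kernel e y :: complex)) \<in> borel_measurable (borel :: (real^'n) measure)" using hb by measurable
  from integral_lebesgue_translation[OF this, of "-x"]
  show e: "(\<integral>y. norm (heat_kernel e (y - x) :: complex) \<partial>(lebesgue :: (real^'n) measure)) = 1"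
    using heat_kernel_integral[OF assms, where 'n='n] by simp
  show "(\<integral>\<^sup>+y. ennreal (norm (heat_kernel e (y - x) :: complex)) \<partial>(lebesgue :: (real^'n) measure)) = 1"
    using i e by (subst nn_integral_eq_integral) auto
qed

lemma gaussian_multiplied_integrable:
  assumes "v \<in> borel_measurable lebesgue" "\<And>\<xi>. norm (v \<xi>) \<le> M" "e > 0"
  shows "integrable lebesgue (\<lambda>\<xi>. v \<xi> * gaussian e \<xi>)"
proof (rule Bochner_Integration.integrable_bound[OF integrable_mult_right[OF integrable_norm[OF gaussian_integrable[OF assms(3)]], of M]])
  show "(\<lambda>\<xi>. v \<xi> * gaussian e \<xi>) \<in> borel_measurable lebesgue"
    using assms(1) borel_measurable_lebesgue_of_borel[OF gaussian_borel] by measurable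
  show "AE x in lebesgue. norm (v x * gaussian e x) \<le> norm (M * norm (gaussian e x))"
  proof (intro always_eventually allI)
    fix x
    have "norm (v x * gaussian e x) \<le> M * norm (gaussian e x)"
      unfolding norm_mult by (intro mult_right_mono assms(2)) simp
    then show "norm (v x * gaussian e x) \<le> norm (M * norm (gaussian e x))" by simp
  qed
qed

text \<open>Damping by a Gaussian makes the inversion integral absolutely convergent for every
  integrable \<open>u\<close>; the multiplication formula turns it into a convolution with the heat
  kernel.\<close>

lemma fourier_gaussian_regularization:
  assumes u: "integrable lebesgue u" and e: "e > 0"
  shows "(\<integral>\<xi>. fourier u \<xi> * (cis (2 * pi * (x \<bullet> \<xi>)) * gaussian e \<xi>) \<partial>lebesgue)
    = (\<integral>y. u y * heat_kernel e (y - x) \<partial>lebesgue)"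
proof -
  have "integrable lebesgue (\<lambda>\<xi>. cis (2 * pi * (\<xi> \<bullet> x)) * gaussian e \<xi>)"
    by (rule fourier_integrable[OF gaussian_integrable[OF e]])
  then have "integrable lebesgue (\<lambda>\<xi>. cis (2 * pi * (x \<bullet> \<xi>)) * gaussian e \<xi>)" by (simp add: inner_commute)
  from fourier_multiplication_formula[OF u this] show ?thesis
    by (simp add: fourier_modulate fourier_gaussian[OF e] heat_kernel_def)
qed

lemma gaussian_tendsto_1: "(\<lambda>n. gaussian (inverse (real (Suc n))) x) \<longlonglongrightarrow> 1"
proof -
  have "(\<lambda>n. complex_of_real (exp (- pi * (inverse (real (Suc n)))\<^sup>2 * (x \<bullet> x)))) \<longlonglongrightarrow> complex_of_real (exp (- pi * 0\<^sup>2 * (x \<bullet> x)))"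
    by (intro tendsto_intros LIMSEQ_inverse_real_of_nat)
  then show ?thesis by (simp add: gaussian_def)
qed

lemma norm_gaussian_le_1: "norm (gaussian e x) \<le> 1"
  by (simp add: norm_gaussian mult_nonneg_nonneg)

lemma cnj_gaussian: "cnj (gaussian e x) = gaussian e x"
  by (simp add: gaussian_def)

subsection \<open>Bessel's inequality\<close>

text \<open>Schur's test for a symmetric kernel of mass 1: \<open>norm (u x) * norm (u y)\<close> is
  at most the mean of the two squares, and in each of the two resulting integrals the kernel
  integrates to 1 in the free variable.\<close>

lemma heat_form_bound:
  fixes u :: "('n::finite) cfun"
  assumes u: "integrable lebesgue u" "u \<in> Lp_space 2" and e: "e > 0"
  shows "norm (\<integral>x. u x * cnj (\<integral>y. u y * heat_kernel e (y - x) \<partial>lebesgue) \<partial>lebesgue) \<le> Lp_modular 2 u"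
proof -
  interpret pair_sigma_finite "lebesgue :: (real^'n) measure" "lebesgue :: (real^'n) measure"
    by (rule pair_sigma_finite_lebesgue)
  have [measurable]: "(\<lambda>x. x) \<in> measurable (lebesgue :: (real^'n) measure) borel" by (rule lebesgue_id_measurable)
  have [measurable]: "u \<in> borel_measurable lebesgue" using u by auto
  have [measurable]: "heat_kernel e \<in> borel_measurable (borel :: (real^'n) measure)" by (rule heat_kernel_borel)
  define H where "H x y = ennreal (norm (heat_kernel e (y - x) :: complex))" for x y :: "real ^ 'n"
  have Hm: "(\<lambda>z. H (fst z) (snd z)) \<in> borel_measurable (lebesgue \<Otimes>\<^sub>M lebesgue)" unfolding H_def by measurable
  have Hsym: "H x y = H y x" for x y
  proof -
    have "(y - x) \<bullet> (y - x) = (x - y) \<bullet> (x - y)" by (simp add: inner_diff_left inner_diff_right inner_commute)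
    then show ?thesis unfolding H_def heat_kernel_def gaussian_def by (simp only:)
  qed
  have H1: "(\<integral>\<^sup>+y. H x y \<partial>lebesgue) = 1" for x unfolding H_def by (rule heat_kernel_shift_integral[OF e])
  have H1': "(\<integral>\<^sup>+x. H x y \<partial>lebesgue) = 1" for y using H1[of y] by (simp add: Hsym[of _ y])
  have U2: "(\<integral>\<^sup>+x. ennreal ((norm (u x))\<^sup>2) \<partial>lebesgue) = ennreal (Lp_modular 2 u)"
    using nn_integral_Lp_modular[OF u(2)] by simp
  have half: "ennreal (a * b) \<le> ennreal (a\<^sup>2 / 2) + ennreal (b\<^sup>2 / 2)" for a b :: real
  proof -
    have "a * b \<le> a\<^sup>2 / 2 + b\<^sup>2 / 2" using sum_squares_bound[of a b] by (simp add: power2_eq_square)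
    then have "ennreal (a * b) \<le> ennreal (a\<^sup>2 / 2 + b\<^sup>2 / 2)" by (rule ennreal_leI)
    also have "\<dots> = ennreal (a\<^sup>2 / 2) + ennreal (b\<^sup>2 / 2)" by (rule ennreal_plus) auto
    finally show ?thesis .
  qed
  \<comment> \<open>The passage to nonnegative integrals covers the case of a divergent inner or
    outer integral, whose Bochner value is 0.\<close>
  have Ht: "ennreal (norm (\<integral>x. u x * cnj (\<integral>y. u y * heat_kernel e (y - x) \<partial>lebesgue) \<partial>lebesgue))
      \<le> (\<integral>\<^sup>+x. (\<integral>\<^sup>+y. ennreal (norm (u x) * norm (u y)) * H x y \<partial>lebesgue) \<partial>lebesgue)"
  proof -
    have "ennreal (norm (\<integral>x. u x * cnj (\<integral>y. u y * heat_kernel e (y - x) \<partial>lebesgue) \<partial>lebesgue))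
        \<le> (\<integral>\<^sup>+x. ennreal (norm (u x * cnj (\<integral>y. u y * heat_kernel e (y - x) \<partial>lebesgue))) \<partial>lebesgue)"
      by (cases "integrable lebesgue (\<lambda>x. u x * cnj (\<integral>y. u y * heat_kernel e (y - x) \<partial>lebesgue))")
         (auto simp: not_integrable_integral_eq intro: integral_norm_bound_ennreal)
    also have "\<dots> \<le> (\<integral>\<^sup>+x. (\<integral>\<^sup>+y. ennreal (norm (u x) * norm (u y)) * H x y \<partial>lebesgue) \<partial>lebesgue)"
    proof (rule nn_integral_mono)
      fix x
      have "ennreal (norm (\<integral>y. u y * heat_kernel e (y - x) \<partial>lebesgue))
          \<le> (\<integral>\<^sup>+y. ennreal (norm (u y * heat_kernel e (y - x))) \<partial>lebesgue)"
        by (cases "integrable lebesgue (\<lambda>y. u y * heat_kernel e (y - x))")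
           (auto simp: not_integrable_integral_eq intro: integral_norm_bound_ennreal)
      then have "ennreal (norm (u x * cnj (\<integral>y. u y * heat_kernel e (y - x) \<partial>lebesgue)))
          \<le> ennreal (norm (u x)) * (\<integral>\<^sup>+y. ennreal (norm (u y * heat_kernel e (y - x))) \<partial>lebesgue)"
        by (simp add: norm_mult ennreal_mult mult_left_mono)
      also have "\<dots> = (\<integral>\<^sup>+y. ennreal (norm (u x)) * ennreal (norm (u y * heat_kernel e (y - x))) \<partial>lebesgue)"
        by (intro nn_integral_cmult[symmetric]) measurable
      also have "\<dots> = (\<integral>\<^sup>+y. ennreal (norm (u x) * norm (u y)) * H x y \<partial>lebesgue)"
        by (intro nn_integral_cong) (simp add: H_def norm_mult ennreal_mult mult_ac)
      finally show "ennreal (norm (u x * cnj (\<integral>y. u y * heat_kernel e (y - x) \<partial>lebesgue)))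
          \<le> (\<integral>\<^sup>+y. ennreal (norm (u x) * norm (u y)) * H x y \<partial>lebesgue)" .
    qed
    finally show ?thesis .
  qed
  also have "\<dots> \<le> (\<integral>\<^sup>+x. (\<integral>\<^sup>+y. ennreal ((norm (u x))\<^sup>2 / 2) * H x y + ennreal ((norm (u y))\<^sup>2 / 2) * H x y \<partial>lebesgue) \<partial>lebesgue)"
    by (intro nn_integral_mono) (use half in \<open>auto simp: distrib_right[symmetric] intro!: mult_right_mono\<close>)
  also have "\<dots> = (\<integral>\<^sup>+x. (\<integral>\<^sup>+y. ennreal ((norm (u x))\<^sup>2 / 2) * H x y \<partial>lebesgue) + (\<integral>\<^sup>+y. ennreal ((norm (u y))\<^sup>2 / 2) * H x y \<partial>lebesgue) \<partial>lebesgue)"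
    unfolding H_def by (intro nn_integral_cong nn_integral_add) measurable
  also have "\<dots> = (\<integral>\<^sup>+x. (\<integral>\<^sup>+y. ennreal ((norm (u x))\<^sup>2 / 2) * H x y \<partial>lebesgue) \<partial>lebesgue)
      + (\<integral>\<^sup>+x. (\<integral>\<^sup>+y. ennreal ((norm (u y))\<^sup>2 / 2) * H x y \<partial>lebesgue) \<partial>lebesgue)"
    unfolding H_def by (intro nn_integral_add) measurable
  also have "(\<integral>\<^sup>+x. (\<integral>\<^sup>+y. ennreal ((norm (u x))\<^sup>2 / 2) * H x y \<partial>lebesgue) \<partial>lebesgue)
      = (\<integral>\<^sup>+x. ennreal ((norm (u x))\<^sup>2 / 2) \<partial>lebesgue)"
  proof (intro nn_integral_cong)
    fix x
    have "(\<integral>\<^sup>+y. ennreal ((norm (u x))\<^sup>2 / 2) * H x y \<partial>lebesgue) = ennreal ((norm (u x))\<^sup>2 / 2) * (\<integral>\<^sup>+y. H x y \<partial>lebesgue)"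
      unfolding H_def by (intro nn_integral_cmult) measurable
    then show "(\<integral>\<^sup>+y. ennreal ((norm (u x))\<^sup>2 / 2) * H x y \<partial>lebesgue) = ennreal ((norm (u x))\<^sup>2 / 2)" by (simp add: H1)
  qed
  also have "(\<integral>\<^sup>+x. (\<integral>\<^sup>+y. ennreal ((norm (u y))\<^sup>2 / 2) * H x y \<partial>lebesgue) \<partial>lebesgue)
      = (\<integral>\<^sup>+y. (\<integral>\<^sup>+x. ennreal ((norm (u y))\<^sup>2 / 2) * H x y \<partial>lebesgue) \<partial>lebesgue)"
    unfolding H_def by (rule Fubini'[symmetric]) measurable
  also have "\<dots> = (\<integral>\<^sup>+y. ennreal ((norm (u y))\<^sup>2 / 2) \<partial>lebesgue)"
  proof (intro nn_integral_cong)
    fix y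
    have "(\<integral>\<^sup>+x. ennreal ((norm (u y))\<^sup>2 / 2) * H x y \<partial>lebesgue) = ennreal ((norm (u y))\<^sup>2 / 2) * (\<integral>\<^sup>+x. H x y \<partial>lebesgue)"
      unfolding H_def by (intro nn_integral_cmult) measurable
    then show "(\<integral>\<^sup>+x. ennreal ((norm (u y))\<^sup>2 / 2) * H x y \<partial>lebesgue) = ennreal ((norm (u y))\<^sup>2 / 2)" by (simp add: H1')
  qed
  also have "(\<integral>\<^sup>+x. ennreal ((norm (u x))\<^sup>2 / 2) \<partial>lebesgue) + (\<integral>\<^sup>+x. ennreal ((norm (u x))\<^sup>2 / 2) \<partial>lebesgue)
      = (\<integral>\<^sup>+x. ennreal ((norm (u x))\<^sup>2) \<partial>lebesgue)"
    by (subst nn_integral_add[symmetric]) (measurable, auto simp flip: ennreal_plus)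
  finally show ?thesis unfolding U2 using Lp_modular_nonneg[of 2 u] by simp
qed

text \<open>The L2 mass of \<open>fourier u\<close> damped by a Gaussian equals the heat form of
  \<open>u\<close>, which is at most the L2 mass of \<open>u\<close>. Fatou's lemma removes the
  damping.\<close>

lemma fourier_bessel:
  fixes u :: "('n::finite) cfun"
  assumes u: "integrable lebesgue u" "u \<in> Lp_space 2"
  shows "fourier u \<in> Lp_space 2" "Lp_modular 2 (fourier u) \<le> Lp_modular 2 u"
proof -
  define e where "e n = inverse (real (Suc n))" for n
  have e: "e n > 0" for n by (simp add: e_def)
  obtain M where M: "\<And>\<xi>. norm (fourier u \<xi>) \<le> M" using fourier_norm_le[OF u(1)] by blast
  have fm: "fourier u \<in> borel_measurable lebesgue" by (rule fourier_lebesgue[OF u(1)])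
  have gm: "gaussian c \<in> borel_measurable (lebesgue :: (real^'n) measure)" for c by (intro borel_measurable_lebesgue_of_borel gaussian_borel)
  define F where "F n \<xi> = fourier u \<xi> * gaussian (e n) \<xi>" for n \<xi>
  have Fi: "integrable lebesgue (F n)" for n
    unfolding F_def by (rule gaussian_multiplied_integrable[OF fm M e])
  have form: "(\<integral>\<xi>. fourier u \<xi> * (cnj (fourier u \<xi>) * gaussian c \<xi>) \<partial>lebesgue)
      = (\<integral>x. u x * cnj (\<integral>y. u y * heat_kernel c (y - x) \<partial>lebesgue) \<partial>lebesgue)" if "c > 0" for c
  proof -
    have "integrable lebesgue (\<lambda>\<xi>. cnj (fourier u \<xi>) * gaussian c \<xi>)"
      by (rule gaussian_multiplied_integrable[OF _ _ that, where M=M]) (use fm M in \<open>auto intro: borel_measurable_cnj\<close>)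
    from fourier_multiplication_formula[OF u(1) this]
    have "(\<integral>\<xi>. fourier u \<xi> * (cnj (fourier u \<xi>) * gaussian c \<xi>) \<partial>lebesgue)
      = (\<integral>x. u x * fourier (\<lambda>\<xi>. cnj (fourier u \<xi>) * gaussian c \<xi>) x \<partial>lebesgue)" .
    moreover have "fourier (\<lambda>\<xi>. cnj (fourier u \<xi>) * gaussian c \<xi>) x = cnj (\<integral>y. u y * heat_kernel c (y - x) \<partial>lebesgue)" for x
    proof -
      have "cnj (\<integral>\<xi>. fourier u \<xi> * (cis (2 * pi * (x \<bullet> \<xi>)) * gaussian c \<xi>) \<partial>lebesgue)
          = (\<integral>\<xi>. cnj (fourier u \<xi> * (cis (2 * pi * (x \<bullet> \<xi>)) * gaussian c \<xi>)) \<partial>lebesgue)"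
        by (rule Bochner_Integration.integral_cnj[symmetric])
      also have "\<dots> = fourier (\<lambda>\<xi>. cnj (fourier u \<xi>) * gaussian c \<xi>) x"
        unfolding fourier_def[of "\<lambda>\<xi>. cnj (fourier u \<xi>) * gaussian c \<xi>"]
        by (simp add: cis_cnj cnj_gaussian inner_commute mult_ac)
      finally show ?thesis using fourier_gaussian_regularization[OF u(1) that, of x] by simp
    qed
    ultimately show ?thesis by simp
  qed
  have F2: "F n \<in> Lp_space 2 \<and> Lp_modular 2 (F n) \<le> Lp_modular 2 u" for n
  proof
    have "norm (F n \<xi>) powr 2 \<le> M * norm (F n \<xi>)" for \<xi>
    proof -
      have "norm (F n \<xi>) \<le> M * 1" unfolding F_def norm_mult
        using M[of \<xi>] norm_gaussian_le_1[of "e n" \<xi>] order_trans[OF norm_ge_zero M] by (intro mult_mono) auto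
      then show ?thesis by (simp add: power2_eq_square mult_right_mono)
    qed
    then show F: "F n \<in> Lp_space 2"
      using Fi[of n] by (intro Lp_space_bound[where g="\<lambda>\<xi>. M * norm (F n \<xi>)"]) auto
    \<comment> \<open>The square of \<open>gaussian (e n)\<close> is the Gaussian with parameter
      \<open>sqrt 2 * e n\<close>, since the parameter enters squared.\<close>
    define c where "c = sqrt 2 * e n"
    have c: "c > 0" using e[of n] by (simp add: c_def)
    have g2: "gaussian (e n) \<xi> * gaussian (e n) \<xi> = gaussian c \<xi>" for \<xi> :: "real^'n"
      by (simp add: gaussian_def c_def power_mult_distrib flip: of_real_mult exp_add)
    have "complex_of_real (Lp_modular 2 (F n)) = (\<integral>\<xi>. complex_of_real (norm (F n \<xi>) powr 2) \<partial>lebesgue)"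
      unfolding Lp_modular_def by (rule integral_complex_of_real[symmetric])
    also have "\<dots> = (\<integral>\<xi>. fourier u \<xi> * (cnj (fourier u \<xi>) * gaussian c \<xi>) \<partial>lebesgue)"
    proof (intro Bochner_Integration.integral_cong refl)
      fix \<xi>
      have "complex_of_real (norm (F n \<xi>) powr 2) = F n \<xi> * cnj (F n \<xi>)"
        by (simp add: complex_norm_square[symmetric])
      then show "complex_of_real (norm (F n \<xi>) powr 2) = fourier u \<xi> * (cnj (fourier u \<xi>) * gaussian c \<xi>)"
        by (simp add: F_def cnj_gaussian mult_ac flip: g2)
    qed
    finally have "complex_of_real (Lp_modular 2 (F n)) = (\<integral>x. u x * cnj (\<integral>y. u y * heat_kernel c (y - x) \<partial>lebesgue) \<partial>lebesgue)"
      unfolding form[OF c] .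
    then have "norm (complex_of_real (Lp_modular 2 (F n))) \<le> Lp_modular 2 u"
      using heat_form_bound[OF u c] by simp
    then show "Lp_modular 2 (F n) \<le> Lp_modular 2 u" using Lp_modular_nonneg[of 2 "F n"] by simp
  qed
  have lim: "AE \<xi> in lebesgue. (\<lambda>n. F n \<xi>) \<longlonglongrightarrow> fourier u \<xi>"
  proof (intro always_eventually allI)
    fix \<xi>
    have "(\<lambda>n. F n \<xi>) \<longlonglongrightarrow> fourier u \<xi> * 1" unfolding F_def e_def by (intro tendsto_mult tendsto_const gaussian_tendsto_1)
    then show "(\<lambda>n. F n \<xi>) \<longlonglongrightarrow> fourier u \<xi>" by simp
  qed
  show "fourier u \<in> Lp_space 2" "Lp_modular 2 (fourier u) \<le> Lp_modular 2 u"
    by (rule Lp_fatou[OF _ fm lim, of 2 "Lp_modular 2 u"]; use F2 in simp)+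
qed

lemma inv_fourier_bessel:
  assumes u: "integrable lebesgue u" "u \<in> Lp_space 2"
  shows "inv_fourier u \<in> Lp_space 2" "Lp_modular 2 (inv_fourier u) \<le> Lp_modular 2 u"
proof -
  have u': "integrable lebesgue (\<lambda>x. cnj (u x))" "(\<lambda>x. cnj (u x)) \<in> Lp_space 2"
    using u by (auto simp: Lp_space_def intro: borel_measurable_cnj)
  have c: "Lp_modular 2 (\<lambda>x. cnj (v x)) = Lp_modular 2 v" for v :: "'a cfun" by (simp add: Lp_modular_def)
  have "inv_fourier u = (\<lambda>x. cnj (fourier (\<lambda>\<xi>. cnj (u \<xi>)) x))" by (rule ext) (rule inv_fourier_conv_fourier)
  then show "inv_fourier u \<in> Lp_space 2" "Lp_modular 2 (inv_fourier u) \<le> Lp_modular 2 u"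
    using fourier_bessel[OF u'] by (auto simp: c Lp_space_def intro: borel_measurable_cnj)
qed

subsection \<open>Fourier inversion for test functions\<close>

lemma has_derivative_cis_inner:
  fixes \<xi> :: "real ^ 'n"
  shows "((\<lambda>x. cis (c * (x \<bullet> \<xi>))) has_derivative (\<lambda>h. complex_of_real (c * (h \<bullet> \<xi>)) * (\<i> * cis (c * (x \<bullet> \<xi>))))) (at x)"
proof -
  have "((\<lambda>x. \<i> * complex_of_real (c * (x \<bullet> \<xi>))) has_derivative (\<lambda>h. \<i> * complex_of_real (c * (h \<bullet> \<xi>)))) (at x)"
    by (intro bounded_linear_imp_has_derivative bounded_linear_compose[OF bounded_linear_mult_right]
        bounded_linear_compose[OF bounded_linear_of_real] bounded_linear_inner_left)
  from has_derivative_compose[OF this DERIV_exp[unfolded has_field_derivative_def]]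
  show ?thesis by (simp add: cis_conv_exp mult_ac)
qed

lemma cis_inner_differentiable:
  fixes \<xi> :: "real ^ 'n"
  shows "(\<lambda>x. cis (c * (x \<bullet> \<xi>))) differentiable (at x)"
  unfolding differentiable_def by (rule exI, rule has_derivative_cis_inner)

lemma pderivative_cis_inner:
  "pderivative j (\<lambda>x. cis (c * (x \<bullet> \<xi>))) x = \<i> * complex_of_real (c * \<xi> $ j) * cis (c * (x \<bullet> \<xi>))"
  by (subst pderivative_eq[OF has_derivative_cis_inner]) (simp add: inner_axis' mult_ac)

lemma cis_inner_Ck_on: "(\<lambda>x::real^'n. cis (c * (x \<bullet> \<xi>))) \<in> Ck_on k UNIV"
proof (rule Ck_on_coinduct[where F="range (\<lambda>b x. b * cis (c * (x \<bullet> \<xi>)))"])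
  show "(\<lambda>x. cis (c * (x \<bullet> \<xi>))) \<in> range (\<lambda>b x. b * cis (c * (x \<bullet> \<xi>)))"
    by (rule image_eqI[of _ _ 1]) auto
  fix f assume "f \<in> range (\<lambda>b (x::real^'n). b * cis (c * (x \<bullet> \<xi>)))"
  then obtain b where f: "f = (\<lambda>x. b * cis (c * (x \<bullet> \<xi>)))" by auto
  have d: "(\<lambda>x. b * cis (c * (x \<bullet> \<xi>))) differentiable (at x)" for x :: "real^'n"
    by (rule differentiable_mult[OF differentiable_const cis_inner_differentiable])
  then show "f differentiable_on UNIV" unfolding f by (simp add: differentiable_on_def)
  fix j
  have "pderivative j f x = b * (\<i> * complex_of_real (c * \<xi> $ j)) * cis (c * (x \<bullet> \<xi>))" for x
    unfolding f by (subst pderivative_scale[OF cis_inner_differentiable]) (simp add: pderivative_cis_inner mult_ac)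
  then show "\<exists>g\<in>range (\<lambda>b (x::real^'n). b * cis (c * (x \<bullet> \<xi>))). \<forall>x\<in>UNIV. pderivative j f x = g x"
    by (intro bexI[of _ "\<lambda>x. b * (\<i> * complex_of_real (c * \<xi> $ j)) * cis (c * (x \<bullet> \<xi>))"]) auto
qed simp

lemma test_fun_integrable: "\<theta> \<in> test_fun \<Longrightarrow> integrable lebesgue \<theta>"
  using Cc_integrable_lebesgue(1) test_fun_Cc by blast

lemma fourier_pderivative:
  assumes \<theta>: "\<theta> \<in> test_fun"
  shows "fourier (pderivative j \<theta>) \<xi> = 2 * pi * \<i> * complex_of_real (\<xi> $ j) * fourier \<theta> \<xi>"
proof -
  let ?E = "\<lambda>x. cis (- 2 * pi * (x \<bullet> \<xi>))"
  have "0 = (\<integral>x. pderivative j (\<lambda>x. \<theta> x * ?E x) x \<partial>lebesgue)"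
    by (rule integral_pderivative_test_fun[OF test_fun_mult_smooth[OF \<theta> cis_inner_Ck_on], symmetric])
  also have "\<dots> = (\<integral>x. ?E x * pderivative j \<theta> x + (- 2 * pi * \<i> * complex_of_real (\<xi> $ j)) * (?E x * \<theta> x) \<partial>lebesgue)"
    by (intro Bochner_Integration.integral_cong refl, subst pderivative_mult[OF test_fun_differentiable[OF \<theta>] cis_inner_differentiable],
        subst pderivative_cis_inner) (simp add: mult_ac)
  also have "\<dots> = fourier (pderivative j \<theta>) \<xi> + (- 2 * pi * \<i> * complex_of_real (\<xi> $ j)) * fourier \<theta> \<xi>"
  proof -
    have "integrable lebesgue (\<lambda>x. ?E x * pderivative j \<theta> x)" "integrable lebesgue (\<lambda>x. ?E x * \<theta> x)"
      by (intro fourier_integrable test_fun_integrable[OF test_fun_pderivative[OF \<theta>]] test_fun_integrable[OF \<theta>])+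
    then show ?thesis
      unfolding fourier_def by (subst Bochner_Integration.integral_add) (auto intro: integrable_mult_right)
  qed
  finally show ?thesis by (simp add: add_eq_0_iff)
qed

text \<open>The transforms of the pure second derivatives, summed over all coordinates, carry the
  factor |\<xi>|^2. Each induction step gains this factor; the constant
  \<open>(2 * pi)\<^sup>2 \<ge> 1\<close> is dropped.\<close>

lemma fourier_test_fun_decay:
  fixes \<theta> :: "('n::finite) cfun"
  assumes "\<theta> \<in> test_fun"
  shows "\<exists>C. \<forall>\<xi>. norm \<xi> ^ (2 * k) * norm (fourier \<theta> \<xi>) \<le> C"
  using assms
proof (induction k arbitrary: \<theta>)
  case 0
  then show ?case using fourier_norm_le[OF test_fun_integrable] by auto
next
  case (Suc k)
  define D where "D j = pderivative j (pderivative j \<theta>)" for j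
  have D: "D j \<in> test_fun" for j unfolding D_def by (intro test_fun_pderivative Suc.prems)
  then have "\<forall>j. \<exists>C. \<forall>\<xi>. norm \<xi> ^ (2 * k) * norm (fourier (D j) \<xi>) \<le> C" using Suc.IH by blast
  then obtain C where C: "\<And>j \<xi>. norm \<xi> ^ (2 * k) * norm (fourier (D j) \<xi>) \<le> C j" by metis
  have "norm \<xi> ^ (2 * Suc k) * norm (fourier \<theta> \<xi>) \<le> (\<Sum>j\<in>UNIV. C j)" for \<xi>
  proof -
    have "fourier (D j) \<xi> = - (2 * pi)\<^sup>2 * complex_of_real ((\<xi> $ j)\<^sup>2) * fourier \<theta> \<xi>" for j
      unfolding D_def fourier_pderivative[OF test_fun_pderivative[OF Suc.prems]] fourier_pderivative[OF Suc.prems]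
      by (simp add: power2_eq_square mult_ac)
    then have n: "norm (fourier (D j) \<xi>) = (2 * pi)\<^sup>2 * (\<xi> $ j)\<^sup>2 * norm (fourier \<theta> \<xi>)" for j
      by (simp add: norm_mult norm_power)
    have "norm \<xi> ^ (2 * Suc k) * norm (fourier \<theta> \<xi>) = (\<Sum>j\<in>UNIV. norm \<xi> ^ (2 * k) * ((\<xi> $ j)\<^sup>2 * norm (fourier \<theta> \<xi>)))"
    proof -
      have "norm \<xi> ^ 2 = (\<Sum>j\<in>UNIV. (\<xi> $ j)\<^sup>2)"
        unfolding power2_norm_eq_inner inner_vec_def by (simp add: power2_eq_square)
      then have "norm \<xi> ^ (2 * Suc k) = norm \<xi> ^ (2 * k) * (\<Sum>j\<in>UNIV. (\<xi> $ j)\<^sup>2)"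
        by (simp add: power_add[symmetric] power2_eq_square mult_ac)
      then show ?thesis by (simp only: sum_distrib_left sum_distrib_right mult.assoc)
    qed
    also have "\<dots> \<le> (\<Sum>j\<in>UNIV. norm \<xi> ^ (2 * k) * norm (fourier (D j) \<xi>))"
    proof (intro sum_mono mult_left_mono)
      fix j
      have "(1::real) \<le> (2 * pi)\<^sup>2" using pi_ge_two by (intro one_le_power) auto
      then have "1 * ((\<xi> $ j)\<^sup>2 * norm (fourier \<theta> \<xi>)) \<le> (2 * pi)\<^sup>2 * ((\<xi> $ j)\<^sup>2 * norm (fourier \<theta> \<xi>))"
        by (intro mult_right_mono) auto
      then show "(\<xi> $ j)\<^sup>2 * norm (fourier \<theta> \<xi>) \<le> norm (fourier (D j) \<xi>)" unfolding n by simp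
    qed auto
    also have "\<dots> \<le> (\<Sum>j\<in>UNIV. C j)" by (intro sum_mono C)
    finally show ?thesis .
  qed
  then show ?case by blast
qed

section \<open>Integrability of the transform of a test function\<close>

lemma measure_lebesgue_cball_scale:
  assumes "r \<ge> 0"
  shows "measure lebesgue (cball (0::real^'n) r) = r ^ CARD('n) * measure lebesgue (cball (0::real^'n) 1)"
  using content_cball[of r "0::real^'n"] content_cball[of 1 "0::real^'n"] assms by simp

lemma term_le_suminf_ennreal:
  fixes f :: "nat \<Rightarrow> ennreal"
  shows "f k \<le> (\<Sum>k. f k)"
  using sum_le_suminf[of f "{k}"] by simp

text \<open>Dyadic comparison, with d the dimension: on the first ball of radius 2^k that contains
  \<xi> the weight is at most 2^(d+1) 2^(-k(d+1)), while the ball has volume proportional to 2^(kd).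
  The sum over k is geometric with ratio 1/2.\<close>

lemma weight_integrable:
  "integrable lebesgue (\<lambda>\<xi>::real^'n. 1 / (1 + norm \<xi>) ^ (CARD('n) + 1))"
proof (rule integrableI_bounded)
  let ?d = "CARD('n)"
  let ?A = "\<lambda>k::nat. cball (0::real^'n) (2 ^ k)"
  define V where "V = measure lebesgue (cball (0::real^'n) 1)"
  show "(\<lambda>\<xi>::real^'n. 1 / (1 + norm \<xi>) ^ (?d + 1)) \<in> borel_measurable lebesgue"
    by (intro borel_measurable_lebesgue_of_borel) measurable
  have "ennreal (norm (1 / (1 + norm \<xi>) ^ (?d + 1)))
      \<le> (\<Sum>k. ennreal (2 ^ (?d + 1) / (2 ^ k) ^ (?d + 1)) * indicator (?A k) \<xi>)" for \<xi> :: "real ^ 'n"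
  proof -
    have ex: "\<exists>k::nat. norm \<xi> \<le> 2 ^ k" using real_arch_pow[of 2 "norm \<xi>"] by (auto intro: less_imp_le)
    define k where "k = (LEAST k::nat. norm \<xi> \<le> 2 ^ k)"
    have k: "norm \<xi> \<le> 2 ^ k" unfolding k_def using ex by (rule LeastI_ex)
    \<comment> \<open>Minimality of \<open>k\<close> says that 2^(k-1) is below the norm when
      \<open>k\<close> is positive; for \<open>k = 0\<close> the summand 1 suffices.\<close>
    have "2 ^ k \<le> 2 * (1 + norm \<xi>)"
    proof (cases k)
      case (Suc l)
      then have "\<not> norm \<xi> \<le> 2 ^ l" using not_less_Least[of l "\<lambda>k. norm \<xi> \<le> 2 ^ k"] by (simp add: k_def)
      then show ?thesis using Suc by simp
    qed simp
    then have "(2 ^ k) ^ (?d + 1) \<le> (2 * (1 + norm \<xi>)) ^ (?d + 1)" by (intro power_mono) auto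
    also have "\<dots> = 2 ^ (?d + 1) * (1 + norm \<xi>) ^ (?d + 1)" by (rule power_mult_distrib)
    finally have le': "(2 ^ k) ^ (?d + 1) \<le> 2 ^ (?d + 1) * (1 + norm \<xi>) ^ (?d + 1)" .
    have le: "1 / (1 + norm \<xi>) ^ (?d + 1) \<le> 2 ^ (?d + 1) / (2 ^ k) ^ (?d + 1)"
    proof (rule mult_imp_div_pos_le)
      show "0 < (1 + norm \<xi>) ^ (?d + 1)" by (intro zero_less_power add_pos_nonneg) auto
      have "0 < ((2::real) ^ k) ^ (?d + 1)" by (intro zero_less_power) auto
      then show "1 \<le> 2 ^ (?d + 1) / (2 ^ k) ^ (?d + 1) * (1 + norm \<xi>) ^ (?d + 1)"
        using le' by (simp only: times_divide_eq_left pos_le_divide_eq mult_1_left)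
    qed
    have "ennreal (norm (1 / (1 + norm \<xi>) ^ (?d + 1))) = ennreal (1 / (1 + norm \<xi>) ^ (?d + 1))"
      by (simp add: abs_of_nonneg)
    also have "\<dots> \<le> ennreal (2 ^ (?d + 1) / (2 ^ k) ^ (?d + 1)) * indicator (?A k) \<xi>"
      using le k by (simp add: ennreal_leI del: power_Suc)
    also have "\<dots> \<le> (\<Sum>k. ennreal (2 ^ (?d + 1) / (2 ^ k) ^ (?d + 1)) * indicator (?A k) \<xi>)"
      by (rule term_le_suminf_ennreal[of "\<lambda>k. ennreal (2 ^ (?d + 1) / (2 ^ k) ^ (?d + 1)) * indicator (?A k) \<xi>" k])
    finally show ?thesis .
  qed
  then have "(\<integral>\<^sup>+\<xi>. ennreal (norm (1 / (1 + norm (\<xi>::real^'n)) ^ (?d + 1))) \<partial>lebesgue)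
      \<le> (\<integral>\<^sup>+\<xi>. (\<Sum>k. ennreal (2 ^ (?d + 1) / (2 ^ k) ^ (?d + 1)) * indicator (?A k) \<xi>) \<partial>lebesgue)"
    by (intro nn_integral_mono)
  also have "\<dots> = (\<Sum>k. \<integral>\<^sup>+\<xi>. ennreal (2 ^ (?d + 1) / (2 ^ k) ^ (?d + 1)) * indicator (?A k) \<xi> \<partial>lebesgue)"
    by (intro nn_integral_suminf borel_measurable_times_ennreal borel_measurable_indicator measurable_const) auto
  also have "\<dots> = (\<Sum>k. ennreal (2 ^ (?d + 1) * V * (1 / 2) ^ k))"
  proof (intro suminf_cong)
    fix k
    have "emeasure lebesgue (?A k) = ennreal (measure lebesgue (?A k))"
      using emeasure_lborel_cball_finite[of "0::real^'n" "2 ^ k"] by (intro emeasure_eq_ennreal_measure) (auto simp: top.not_eq_extremum)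
    then have "(\<integral>\<^sup>+\<xi>. ennreal (2 ^ (?d + 1) / (2 ^ k) ^ (?d + 1)) * indicator (?A k) \<xi> \<partial>lebesgue)
        = ennreal (2 ^ (?d + 1) / (2 ^ k) ^ (?d + 1)) * ennreal ((2 ^ k) ^ ?d * V)"
      unfolding V_def measure_lebesgue_cball_scale[of "2 ^ k", symmetric, OF zero_le_power[OF zero_le_numeral]]
      by (subst nn_integral_cmult_indicator) (auto simp del: power_Suc)
    also have "\<dots> = ennreal (2 ^ (?d + 1) / (2 ^ k) ^ (?d + 1) * ((2 ^ k) ^ ?d * V))"
      by (rule ennreal_mult'[symmetric]) (auto simp: V_def)
    also have "2 ^ (?d + 1) / (2 ^ k) ^ (?d + 1) * ((2 ^ k) ^ ?d * V) = 2 ^ (?d + 1) * V * (1 / 2) ^ k"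
      by (simp add: field_simps power_one_over)
    finally show "(\<integral>\<^sup>+\<xi>. ennreal (2 ^ (?d + 1) / (2 ^ k) ^ (?d + 1)) * indicator (?A k) \<xi> \<partial>lebesgue)
        = ennreal (2 ^ (?d + 1) * V * (1 / 2) ^ k)" .
  qed
  also have "\<dots> < \<infinity>"
    by (subst suminf_ennreal2) (auto simp: V_def intro!: summable_mult summable_geometric)
  finally show "(\<integral>\<^sup>+\<xi>. ennreal (norm (1 / (1 + norm (\<xi>::real^'n)) ^ (?d + 1))) \<partial>lebesgue) < \<infinity>" .
qed

lemma fourier_test_fun_integrable:
  fixes \<theta> :: "('n::finite) cfun"
  assumes "\<theta> \<in> test_fun"
  shows "integrable lebesgue (fourier \<theta>)"
proof -
  let ?d = "CARD('n)"
  obtain C where C: "\<And>\<xi>. norm \<xi> ^ (2 * (?d + 1)) * norm (fourier \<theta> \<xi>) \<le> C"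
    using fourier_test_fun_decay[OF assms] by blast
  obtain M where M: "\<And>\<xi>. norm (fourier \<theta> \<xi>) \<le> M" using fourier_norm_le[OF test_fun_integrable[OF assms]] by blast
  have bd: "norm (fourier \<theta> \<xi>) \<le> 2 ^ (?d + 1) * (max C 0 + max M 0) * (1 / (1 + norm \<xi>) ^ (?d + 1))" for \<xi>
  proof -
    have pos: "(1 + norm \<xi>) ^ (?d + 1) > 0" by (intro zero_less_power) (simp add: add_pos_nonneg)
    have "(1 + norm \<xi>) ^ (?d + 1) * norm (fourier \<theta> \<xi>) \<le> 2 ^ (?d + 1) * (max C 0 + max M 0)"
    proof (cases "norm \<xi> \<le> 1")
      case True
      have "(1 + norm \<xi>) ^ (?d + 1) * norm (fourier \<theta> \<xi>) \<le> 2 ^ (?d + 1) * M"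
        using True M by (intro mult_mono power_mono) auto
      also have "\<dots> \<le> 2 ^ (?d + 1) * (max C 0 + max M 0)" by (intro mult_left_mono) auto
      finally show ?thesis .
    next
      case False
      have "1 + norm \<xi> \<le> 2 * (norm \<xi>)\<^sup>2"
        using False mult_mono[of 1 "norm \<xi>" 1 "norm \<xi>"] mult_right_mono[of 1 "norm \<xi>" "norm \<xi>"]
        by (simp add: power2_eq_square)
      then have "(1 + norm \<xi>) ^ (?d + 1) \<le> (2 * (norm \<xi>)\<^sup>2) ^ (?d + 1)" by (intro power_mono) auto
      also have "\<dots> = 2 ^ (?d + 1) * norm \<xi> ^ (2 * (?d + 1))" by (simp only: power_mult_distrib power_mult)
      finally have "(1 + norm \<xi>) ^ (?d + 1) * norm (fourier \<theta> \<xi>) \<le> 2 ^ (?d + 1) * norm \<xi> ^ (2 * (?d + 1)) * norm (fourier \<theta> \<xi>)"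
        by (intro mult_right_mono) auto
      also have "\<dots> = 2 ^ (?d + 1) * (norm \<xi> ^ (2 * (?d + 1)) * norm (fourier \<theta> \<xi>))" by (rule mult.assoc)
      also have "\<dots> \<le> 2 ^ (?d + 1) * (max C 0 + max M 0)" using C[of \<xi>] by (intro mult_left_mono) auto
      finally show ?thesis .
    qed
    then show ?thesis using pos by (simp only: pos_le_divide_eq times_divide_eq_right mult_1_right mult.commute[of "norm (fourier \<theta> \<xi>)"])
  qed
  show ?thesis
  proof (rule Bochner_Integration.integrable_bound[OF integrable_mult_right[OF weight_integrable[where 'n='n], of "2 ^ (?d + 1) * (max C 0 + max M 0)"]])
    show "fourier \<theta> \<in> borel_measurable lebesgue" by (rule fourier_lebesgue[OF test_fun_integrable[OF assms]])
    show "AE \<xi> in lebesgue. norm (fourier \<theta> \<xi>) \<le> norm (2 ^ (?d + 1) * (max C 0 + max M 0) * (1 / (1 + norm \<xi>) ^ (?d + 1)))"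
      by (intro always_eventually allI order_trans[OF bd]) simp
  qed
qed

section \<open>Concentration of the heat kernel and Fourier inversion\<close>

lemma inverse_exp_bound: "(s::real) \<ge> 0 \<Longrightarrow> s * exp (- s) \<le> 2 * exp (- (s / 2))"
proof -
  assume "s \<ge> 0"
  have "s / 2 \<le> exp (s / 2)" using exp_ge_add_one_self[of "s/2"] by linarith
  then have "s / 2 * exp (- s) \<le> exp (s / 2) * exp (- s)" by (intro mult_right_mono) auto
  also have "\<dots> = exp (- (s / 2))" by (simp flip: exp_add)
  finally show ?thesis by simp
qed

text \<open>Half of the exponent absorbs the quadratic factor. What remains is a multiple of the
  heat kernel with parameter \<open>sqrt 2 * e\<close>, whose mass is 1;
  \<open>sqrt 2 ^ CARD('n)\<close> corrects the normalisation. The bound is of order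
  \<open>e\<^sup>2\<close>.\<close>

lemma heat_kernel_second_moment:
  assumes e: "e > 0"
  shows "(\<integral>\<^sup>+z. ennreal ((norm z)\<^sup>2 * norm (heat_kernel e z :: complex)) \<partial>(lebesgue :: (real^'n) measure))
    \<le> ennreal (2 * e\<^sup>2 / pi * sqrt 2 ^ CARD('n))"
proof -
  define c where "c = sqrt 2 * e"
  have c: "c > 0" using e by (simp add: c_def)
  have "(norm z)\<^sup>2 * norm (heat_kernel e z :: complex) \<le> 2 * e\<^sup>2 / pi * sqrt 2 ^ CARD('n) * norm (heat_kernel c z :: complex)" for z :: "real^'n"
  proof -
    define s where "s = pi * (1 / e)\<^sup>2 * (norm z)\<^sup>2"
    have s: "s \<ge> 0" by (simp add: s_def)
    have z: "(norm z)\<^sup>2 = e\<^sup>2 / pi * s" using e by (simp add: s_def field_simps)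
    have 1: "norm (heat_kernel e z :: complex) = 1 / e ^ CARD('n) * exp (- s)"
      using e by (simp add: heat_kernel_def norm_mult norm_gaussian s_def dot_square_norm norm_divide norm_power)
    have 2: "norm (heat_kernel c z :: complex) = 1 / (sqrt 2 ^ CARD('n) * e ^ CARD('n)) * exp (- (s / 2))"
      using e by (simp add: heat_kernel_def norm_mult norm_gaussian s_def dot_square_norm c_def power_mult_distrib power_divide norm_divide norm_power)
    have "(norm z)\<^sup>2 * norm (heat_kernel e z :: complex) = e\<^sup>2 / pi * (1 / e ^ CARD('n)) * (s * exp (- s))"
      unfolding 1 z by simp
    also have "\<dots> \<le> e\<^sup>2 / pi * (1 / e ^ CARD('n)) * (2 * exp (- (s / 2)))"
      using e by (intro mult_left_mono inverse_exp_bound s) auto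
    also have "\<dots> = 2 * e\<^sup>2 / pi * sqrt 2 ^ CARD('n) * norm (heat_kernel c z :: complex)"
      unfolding 2 using e by simp
    finally show ?thesis .
  qed
  then have "(\<integral>\<^sup>+z. ennreal ((norm z)\<^sup>2 * norm (heat_kernel e z :: complex)) \<partial>(lebesgue :: (real^'n) measure))
    \<le> (\<integral>\<^sup>+z. ennreal (2 * e\<^sup>2 / pi * sqrt 2 ^ CARD('n) * norm (heat_kernel c z :: complex)) \<partial>(lebesgue :: (real^'n) measure))"
    by (intro nn_integral_mono ennreal_leI)
  also have "\<dots> = ennreal (\<integral>z. 2 * e\<^sup>2 / pi * sqrt 2 ^ CARD('n) * norm (heat_kernel c z :: complex) \<partial>(lebesgue :: (real^'n) measure))"
    using heat_kernel_integrable[OF c, where 'n='n] e by (intro nn_integral_eq_integral integrable_mult_right integrable_norm) auto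
  also have "\<dots> = ennreal (2 * e\<^sup>2 / pi * sqrt 2 ^ CARD('n))"
    using heat_kernel_integral[OF c, where 'n='n] by simp
  finally show ?thesis .
qed

lemma heat_kernel_of_norm:
  "e > 0 \<Longrightarrow> heat_kernel e z = complex_of_real (norm (heat_kernel e z))"
  by (simp add: heat_kernel_def norm_mult norm_gaussian gaussian_def norm_divide norm_power)

lemma heat_kernel_approx:
  fixes u :: "('n::finite) cfun"
  assumes u: "u \<in> Cc"
  shows "(\<lambda>n. \<integral>y. u y * heat_kernel (inverse (real (Suc n))) (y - x) \<partial>lebesgue) \<longlonglongrightarrow> u x"
proof (rule LIMSEQ_I)
  fix r :: real assume r: "r > 0"
  obtain M where M: "\<And>y. norm (u y) \<le> M" using Cc_integrable_lebesgue(3)[OF u] by blast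
  have M0: "M \<ge> 0" using M[of 0] norm_ge_zero order_trans by blast
  have "isCont u x" using u by (simp add: Cc_def continuous_on_eq_continuous_at)
  then obtain d where d: "d > 0" "\<And>y. norm (y - x) < d \<Longrightarrow> norm (u y - u x) < r / 2"
    unfolding continuous_at_eps_delta dist_norm using half_gt_zero[OF r] by meson
  have um: "u \<in> borel_measurable lebesgue" by (rule Cc_integrable_lebesgue(2)[OF u])
  \<comment> \<open>Chosen so that
    \<open>norm (u y - u x) \<le> r / 2 + K * (norm (y - x))\<^sup>2\<close> holds for all
    \<open>y\<close>: near \<open>x\<close> by continuity, and at distance at least \<open>d\<close>
    because the quadratic term then exceeds \<open>2 * M\<close>. The second moment bounds its
    integral.\<close>
  define K where "K = 2 * M / d\<^sup>2"
  have K: "K \<ge> 0" using M0 by (simp add: K_def)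
  have bd: "norm (u y - u x) \<le> r / 2 + K * (norm (y - x))\<^sup>2" for y
  proof (cases "norm (y - x) < d")
    case True
    then show ?thesis using d(2)[OF True] K by (simp add: add_increasing2 less_imp_le)
  next
    case False
    then have "1 \<le> (norm (y - x))\<^sup>2 / d\<^sup>2" using d(1) by (simp add: power_mono)
    then have "2 * M * 1 \<le> 2 * M * ((norm (y - x))\<^sup>2 / d\<^sup>2)" using M0 by (intro mult_left_mono) auto
    moreover have "norm (u y - u x) \<le> 2 * M" using norm_triangle_ineq4[of "u y" "u x"] M[of x] M[of y] by linarith
    ultimately show ?thesis using r by (simp add: K_def)
  qed
  define S where "S = K * (2 / pi * sqrt 2 ^ CARD('n))"
  have main: "norm ((\<integral>y. u y * heat_kernel e (y - x) \<partial>lebesgue) - u x) \<le> r / 2 + S * e\<^sup>2" if e: "e > 0" for e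
  proof -
    let ?h = "\<lambda>y. heat_kernel e (y - x) :: complex"
    have hi: "integrable lebesgue ?h" by (rule heat_kernel_shift_integral(2)[OF e])
    have h1: "(\<integral>y. ?h y \<partial>lebesgue) = 1"
    proof -
      have "?h = (\<lambda>y. complex_of_real (norm (?h y)))"
        using heat_kernel_of_norm[OF e] by (rule ext)
      then have "(\<integral>y. ?h y \<partial>lebesgue) = (\<integral>y. complex_of_real (norm (?h y)) \<partial>lebesgue)" by (rule arg_cong)
      also have "\<dots> = complex_of_real (\<integral>y. norm (?h y) \<partial>lebesgue)" by (rule integral_complex_of_real)
      finally show ?thesis using heat_kernel_shift_integral(3)[OF e] by simp
    qed
    have uhi: "integrable lebesgue (\<lambda>y. u y * ?h y)"
    proof (rule Bochner_Integration.integrable_bound[OF integrable_mult_right[OF integrable_norm[OF hi], of M]])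
      show "AE y in lebesgue. norm (u y * ?h y) \<le> norm (M * norm (?h y))"
      proof (intro always_eventually allI)
        fix y show "norm (u y * ?h y) \<le> norm (M * norm (?h y))"
          unfolding norm_mult using mult_right_mono[OF M[of y], of "norm (?h y)"] M0 by simp
      qed
    qed (use um hi in auto)
    have "(\<integral>y. u y * ?h y \<partial>lebesgue) - u x = (\<integral>y. u y * ?h y - u x * ?h y \<partial>lebesgue)"
      using uhi hi h1 by (subst Bochner_Integration.integral_diff) auto
    also have "\<dots> = (\<integral>y. (u y - u x) * ?h y \<partial>lebesgue)" by (simp add: left_diff_distrib)
    finally have eq: "(\<integral>y. u y * ?h y \<partial>lebesgue) - u x = (\<integral>y. (u y - u x) * ?h y \<partial>lebesgue)" .
    have hm: "?h \<in> borel_measurable lebesgue" using hi by auto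
    have nm: "(\<lambda>y. (norm (y - x))\<^sup>2) \<in> borel_measurable lebesgue"
      by (intro borel_measurable_lebesgue_of_borel) measurable
    have "ennreal (norm (\<integral>y. (u y - u x) * ?h y \<partial>lebesgue)) \<le> (\<integral>\<^sup>+y. ennreal (norm ((u y - u x) * ?h y)) \<partial>lebesgue)"
      using uhi hi by (intro integral_norm_bound_ennreal) (auto simp: left_diff_distrib)
    also have "\<dots> \<le> (\<integral>\<^sup>+y. ennreal (r / 2) * ennreal (norm (?h y)) + ennreal K * ennreal ((norm (y - x))\<^sup>2 * norm (?h y)) \<partial>lebesgue)"
    proof (rule nn_integral_mono)
      fix y
      have "norm ((u y - u x) * ?h y) \<le> (r / 2 + K * (norm (y - x))\<^sup>2) * norm (?h y)"
        unfolding norm_mult by (intro mult_right_mono bd) simp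
      also have "\<dots> = r / 2 * norm (?h y) + K * ((norm (y - x))\<^sup>2 * norm (?h y))" by (simp add: algebra_simps)
      finally show "ennreal (norm ((u y - u x) * ?h y)) \<le> ennreal (r / 2) * ennreal (norm (?h y)) + ennreal K * ennreal ((norm (y - x))\<^sup>2 * norm (?h y))"
        using r K by (simp add: ennreal_leI flip: ennreal_mult' ennreal_plus)
    qed
    also have "\<dots> = ennreal (r / 2) * (\<integral>\<^sup>+y. ennreal (norm (?h y)) \<partial>lebesgue) + ennreal K * (\<integral>\<^sup>+y. ennreal ((norm (y - x))\<^sup>2 * norm (?h y)) \<partial>lebesgue)"
      using hm nm by (subst nn_integral_add) (auto simp: nn_integral_cmult)
    also have "(\<integral>\<^sup>+y. ennreal ((norm (y - x))\<^sup>2 * norm (?h y)) \<partial>lebesgue) = (\<integral>\<^sup>+z. ennreal ((norm z)\<^sup>2 * norm (heat_kernel e z :: complex)) \<partial>(lebesgue :: (real^'n) measure))"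
    proof -
      define G where "G z = ennreal ((norm z)\<^sup>2 * norm (heat_kernel e z :: complex))" for z :: "real^'n"
      have G: "G \<in> borel_measurable borel" unfolding G_def using heat_kernel_borel by measurable
      have "(\<integral>\<^sup>+z. G z \<partial>lebesgue) = (\<integral>\<^sup>+z. G z \<partial>distr lborel borel ((+) (- x)))"
        using G by (simp add: nn_integral_completion lborel_distr_plus)
      also have "\<dots> = (\<integral>\<^sup>+y. G (- x + y) \<partial>lborel)" using G by (subst nn_integral_distr) auto
      also have "\<dots> = (\<integral>\<^sup>+y. G (y - x) \<partial>lebesgue)"
        by (simp add: nn_integral_completion)
      finally show ?thesis by (simp add: G_def)
    qed
    also have "(\<integral>\<^sup>+y. ennreal (norm (?h y)) \<partial>lebesgue) = 1" by (rule heat_kernel_shift_integral(1)[OF e])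
    also have "ennreal (r / 2) * 1 + ennreal K * (\<integral>\<^sup>+z. ennreal ((norm z)\<^sup>2 * norm (heat_kernel e z :: complex)) \<partial>(lebesgue :: (real^'n) measure))
        \<le> ennreal (r / 2) * 1 + ennreal K * ennreal (2 * e\<^sup>2 / pi * sqrt 2 ^ CARD('n))"
      by (intro add_left_mono mult_left_mono heat_kernel_second_moment e) auto
    also have "\<dots> = ennreal (r / 2 + S * e\<^sup>2)"
      using r K by (simp add: S_def ennreal_mult'[symmetric] ennreal_plus[symmetric] mult_ac del: ennreal_plus)
    finally show ?thesis unfolding eq using r K by (subst (asm) ennreal_le_iff) (auto simp: S_def)
  qed
  have "(\<lambda>n. r / 2 + S * (inverse (real (Suc n)))\<^sup>2) \<longlonglongrightarrow> r / 2 + S * 0\<^sup>2"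
    by (intro tendsto_intros LIMSEQ_inverse_real_of_nat)
  then have "\<forall>\<^sub>F n in sequentially. r / 2 + S * (inverse (real (Suc n)))\<^sup>2 < r"
    by (rule order_tendstoD(2)) (use r in simp)
  then obtain N where N: "\<And>n. n \<ge> N \<Longrightarrow> r / 2 + S * (inverse (real (Suc n)))\<^sup>2 < r"
    unfolding eventually_sequentially by blast
  show "\<exists>no. \<forall>n\<ge>no. norm ((\<integral>y. u y * heat_kernel (inverse (real (Suc n))) (y - x) \<partial>lebesgue) - u x) < r"
  proof (intro exI[of _ N] allI impI)
    fix n assume "n \<ge> N"
    show "norm ((\<integral>y. u y * heat_kernel (inverse (real (Suc n))) (y - x) \<partial>lebesgue) - u x) < r"
      by (rule le_less_trans[OF main N[OF \<open>n \<ge> N\<close>]]) simp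
  qed
qed

text \<open>The damped inversion integral is a heat average of \<theta>. As the damping disappears,
  the integral converges by dominated convergence, the transform being integrable, and the average
  converges to the value of \<theta>.\<close>

lemma fourier_inversion_test_fun:
  fixes \<theta> :: "('n::finite) cfun"
  assumes \<theta>: "\<theta> \<in> test_fun"
  shows "inv_fourier (fourier \<theta>) x = \<theta> x"
proof -
  define e where "e n = inverse (real (Suc n))" for n
  have e: "e n > 0" for n by (simp add: e_def)
  have i: "integrable lebesgue (fourier \<theta>)" by (rule fourier_test_fun_integrable[OF \<theta>])
  have km: "(\<lambda>\<xi>. cis (2 * pi * (x \<bullet> \<xi>))) \<in> borel_measurable lebesgue"
    by (intro borel_measurable_lebesgue_of_borel borel_measurable_continuous_onI continuous_intros)
  have "(\<lambda>n. \<integral>\<xi>. fourier \<theta> \<xi> * (cis (2 * pi * (x \<bullet> \<xi>)) * gaussian (e n) \<xi>) \<partial>lebesgue)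
      \<longlonglongrightarrow> (\<integral>\<xi>. cis (2 * pi * (x \<bullet> \<xi>)) * fourier \<theta> \<xi> \<partial>lebesgue)"
  proof (rule integral_dominated_convergence)
    show "integrable lebesgue (\<lambda>\<xi>. norm (fourier \<theta> \<xi>))" using i by simp
    show "(\<lambda>\<xi>. cis (2 * pi * (x \<bullet> \<xi>)) * fourier \<theta> \<xi>) \<in> borel_measurable lebesgue"
      using km i by (intro borel_measurable_times) auto
    show "(\<lambda>\<xi>. fourier \<theta> \<xi> * (cis (2 * pi * (x \<bullet> \<xi>)) * gaussian (e n) \<xi>)) \<in> borel_measurable lebesgue" for n
      using km i by (intro borel_measurable_times borel_measurable_lebesgue_of_borel[OF gaussian_borel]) auto
    show "AE \<xi> in lebesgue. (\<lambda>n. fourier \<theta> \<xi> * (cis (2 * pi * (x \<bullet> \<xi>)) * gaussian (e n) \<xi>)) \<longlonglongrightarrow> cis (2 * pi * (x \<bullet> \<xi>)) * fourier \<theta> \<xi>"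
    proof (intro always_eventually allI)
      fix \<xi>
      have "(\<lambda>n. fourier \<theta> \<xi> * (cis (2 * pi * (x \<bullet> \<xi>)) * gaussian (e n) \<xi>)) \<longlonglongrightarrow> fourier \<theta> \<xi> * (cis (2 * pi * (x \<bullet> \<xi>)) * 1)"
        unfolding e_def by (intro tendsto_mult tendsto_const gaussian_tendsto_1)
      then show "(\<lambda>n. fourier \<theta> \<xi> * (cis (2 * pi * (x \<bullet> \<xi>)) * gaussian (e n) \<xi>)) \<longlonglongrightarrow> cis (2 * pi * (x \<bullet> \<xi>)) * fourier \<theta> \<xi>"
        by (simp add: mult.commute)
    qed
    show "AE \<xi> in lebesgue. norm (fourier \<theta> \<xi> * (cis (2 * pi * (x \<bullet> \<xi>)) * gaussian (e n) \<xi>)) \<le> norm (fourier \<theta> \<xi>)" for n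
    proof (intro always_eventually allI)
      fix \<xi>
      show "norm (fourier \<theta> \<xi> * (cis (2 * pi * (x \<bullet> \<xi>)) * gaussian (e n) \<xi>)) \<le> norm (fourier \<theta> \<xi>)"
        using mult_left_mono[OF norm_gaussian_le_1[of "e n" \<xi>], of "norm (fourier \<theta> \<xi>)"] by (simp add: norm_mult)
    qed
  qed
  then have "(\<lambda>n. \<integral>y. \<theta> y * heat_kernel (e n) (y - x) \<partial>lebesgue) \<longlonglongrightarrow> inv_fourier (fourier \<theta>) x"
    unfolding fourier_gaussian_regularization[OF test_fun_integrable[OF \<theta>] e] inv_fourier_def .
  moreover have "(\<lambda>n. \<integral>y. \<theta> y * heat_kernel (e n) (y - x) \<partial>lebesgue) \<longlonglongrightarrow> \<theta> x"
    unfolding e_def by (rule heat_kernel_approx[OF test_fun_Cc[OF \<theta>]])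
  ultimately show ?thesis by (rule LIMSEQ_unique)
qed

subsection \<open>Band-limited functions\<close>

lemma norm_cis_taylor_le: "norm (cis t - 1 - \<i> * complex_of_real t) \<le> t\<^sup>2"
proof -
  have "norm (iexp t - (\<Sum>k\<le>1. (\<i> * complex_of_real t) ^ k / fact k)) \<le> \<bar>t\<bar> ^ Suc 1 / fact (Suc 1)"
    by (rule iexp_approx1)
  then have "norm (cis t - (1 + \<i> * complex_of_real t)) \<le> t\<^sup>2 / 2"
    by (simp add: cis_conv_exp numeral_2_eq_2)
  moreover have "cis t - (1 + \<i> * complex_of_real t) = cis t - 1 - \<i> * complex_of_real t" by simp
  ultimately have "norm (cis t - 1 - \<i> * complex_of_real t) \<le> t\<^sup>2 / 2" by (simp only:)
  then show ?thesis using zero_le_power2[of t] by linarith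
qed

lemma bounded_support_integrable_mult:
  fixes Z :: "('n::finite) cfun"
  assumes Z: "integrable lebesgue Z" "\<And>\<xi>. norm \<xi> > R \<Longrightarrow> Z \<xi> = 0" and q: "continuous_on UNIV q"
  shows "integrable lebesgue (\<lambda>\<xi>. q \<xi> * Z \<xi>)"
proof -
  have "bounded (q ` cball 0 R)"
    by (intro compact_imp_bounded compact_continuous_image continuous_on_subset[OF q]) auto
  then obtain B where B: "\<forall>\<xi>\<in>cball 0 R. norm (q \<xi>) \<le> B" by (auto simp: bounded_iff)
  show ?thesis
  proof (rule Bochner_Integration.integrable_bound[OF integrable_mult_right[OF integrable_norm[OF Z(1)], of B]])
    show "(\<lambda>\<xi>. q \<xi> * Z \<xi>) \<in> borel_measurable lebesgue"
      using borel_measurable_lebesgue_of_borel[OF borel_measurable_continuous_onI[OF q]] Z(1) by (intro borel_measurable_times) auto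
    show "AE \<xi> in lebesgue. norm (q \<xi> * Z \<xi>) \<le> norm (B * norm (Z \<xi>))"
    proof (intro always_eventually allI)
      fix \<xi>
      show "norm (q \<xi> * Z \<xi>) \<le> norm (B * norm (Z \<xi>))"
      proof (cases "norm \<xi> \<le> R")
        case True
        then have "norm (q \<xi>) * norm (Z \<xi>) \<le> B * norm (Z \<xi>)" using B by (intro mult_right_mono) auto
        then show ?thesis by (simp add: norm_mult)
      qed (use Z(2)[of \<xi>] in simp)
    qed
  qed
qed

text \<open>On the support of \<open>Z\<close> the second-order Taylor bound for the exponential is
  uniform, so the remainder is at most a multiple of the squared increment.\<close>

lemma fourier_has_derivative:
  fixes Z :: "('n::finite) cfun"
  assumes Z: "integrable lebesgue Z" "\<And>\<xi>. norm \<xi> > R \<Longrightarrow> Z \<xi> = 0"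
  shows "(fourier Z has_derivative (\<lambda>h. fourier (\<lambda>\<xi>. - 2 * pi * \<i> * complex_of_real (\<xi> \<bullet> h) * Z \<xi>) x)) (at x)"
proof (rule has_derivativeI_sandwich[where e=1 and H="\<lambda>y. (2 * pi * \<bar>R\<bar>)\<^sup>2 * (\<integral>\<xi>. norm (Z \<xi>) \<partial>lebesgue) * norm (y - x)"])
  have Zh: "integrable lebesgue (\<lambda>\<xi>. - 2 * pi * \<i> * complex_of_real (\<xi> \<bullet> h) * Z \<xi>)" for h
    by (rule bounded_support_integrable_mult[OF Z]) (auto intro!: continuous_intros)
  show "bounded_linear (\<lambda>h. fourier (\<lambda>\<xi>. - 2 * pi * \<i> * complex_of_real (\<xi> \<bullet> h) * Z \<xi>) x)"
  proof (subst linear_conv_bounded_linear[symmetric], rule linearI)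
    fix a b :: "real ^ 'n" and c :: real
    show "fourier (\<lambda>\<xi>. - 2 * pi * \<i> * complex_of_real (\<xi> \<bullet> (a + b)) * Z \<xi>) x =
        fourier (\<lambda>\<xi>. - 2 * pi * \<i> * complex_of_real (\<xi> \<bullet> a) * Z \<xi>) x + fourier (\<lambda>\<xi>. - 2 * pi * \<i> * complex_of_real (\<xi> \<bullet> b) * Z \<xi>) x"
      by (subst fourier_add[OF Zh Zh, symmetric]) (simp add: inner_add_right algebra_simps)
    show "fourier (\<lambda>\<xi>. - 2 * pi * \<i> * complex_of_real (\<xi> \<bullet> (c *\<^sub>R a)) * Z \<xi>) x =
        c *\<^sub>R fourier (\<lambda>\<xi>. - 2 * pi * \<i> * complex_of_real (\<xi> \<bullet> a) * Z \<xi>) x"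
      unfolding scaleR_conv_of_real[of c "fourier _ x"] by (subst fourier_scale[symmetric]) (simp add: mult_ac)
  qed
  show "((\<lambda>y. (2 * pi * \<bar>R\<bar>)\<^sup>2 * (\<integral>\<xi>. norm (Z \<xi>) \<partial>lebesgue) * norm (y - x)) \<longlongrightarrow> 0) (at x)"
    by (rule tendsto_eq_intros | simp)+
  fix y assume y: "y \<noteq> x"
  define h where "h = y - x"
  have I: "integrable lebesgue (\<lambda>\<xi>. cis (- 2 * pi * (\<xi> \<bullet> y)) * Z \<xi>)" "integrable lebesgue (\<lambda>\<xi>. cis (- 2 * pi * (\<xi> \<bullet> x)) * Z \<xi>)"
    "integrable lebesgue (\<lambda>\<xi>. cis (- 2 * pi * (\<xi> \<bullet> x)) * (- 2 * pi * \<i> * complex_of_real (\<xi> \<bullet> h) * Z \<xi>))"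
    by (intro fourier_integrable Z Zh)+
  have eq: "fourier Z y - fourier Z x - fourier (\<lambda>\<xi>. - 2 * pi * \<i> * complex_of_real (\<xi> \<bullet> h) * Z \<xi>) x
      = (\<integral>\<xi>. cis (- 2 * pi * (\<xi> \<bullet> y)) * Z \<xi> - cis (- 2 * pi * (\<xi> \<bullet> x)) * Z \<xi>
          - cis (- 2 * pi * (\<xi> \<bullet> x)) * (- 2 * pi * \<i> * complex_of_real (\<xi> \<bullet> h) * Z \<xi>) \<partial>lebesgue)"
    unfolding fourier_def using I
    by (simp only: Bochner_Integration.integral_diff Bochner_Integration.integrable_diff)
  have bound: "norm (fourier Z y - fourier Z x - fourier (\<lambda>\<xi>. - 2 * pi * \<i> * complex_of_real (\<xi> \<bullet> h) * Z \<xi>) x)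
      \<le> (\<integral>\<xi>. (2 * pi * \<bar>R\<bar> * norm h)\<^sup>2 * norm (Z \<xi>) \<partial>lebesgue)"
    unfolding eq
  proof (rule Bochner_Integration.integral_norm_bound_integral)
    show "integrable lebesgue (\<lambda>\<xi>. cis (- 2 * pi * (\<xi> \<bullet> y)) * Z \<xi> - cis (- 2 * pi * (\<xi> \<bullet> x)) * Z \<xi>
          - cis (- 2 * pi * (\<xi> \<bullet> x)) * (- 2 * pi * \<i> * complex_of_real (\<xi> \<bullet> h) * Z \<xi>))"
      by (intro Bochner_Integration.integrable_diff I)
    show "integrable lebesgue (\<lambda>\<xi>. (2 * pi * \<bar>R\<bar> * norm h)\<^sup>2 * norm (Z \<xi>))" using Z(1) by simp
    fix \<xi> :: "real ^ 'n"
    define t where "t = - 2 * pi * (\<xi> \<bullet> h)"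
    have "cis (- 2 * pi * (\<xi> \<bullet> y)) = cis (- 2 * pi * (\<xi> \<bullet> x)) * cis t"
    proof -
      have "- 2 * pi * (\<xi> \<bullet> y) = - 2 * pi * (\<xi> \<bullet> x) + t" by (simp add: t_def h_def inner_diff_right right_diff_distrib)
      then show ?thesis by (simp only: cis_mult)
    qed
    then have "cis (- 2 * pi * (\<xi> \<bullet> y)) * Z \<xi> - cis (- 2 * pi * (\<xi> \<bullet> x)) * Z \<xi>
          - cis (- 2 * pi * (\<xi> \<bullet> x)) * (- 2 * pi * \<i> * complex_of_real (\<xi> \<bullet> h) * Z \<xi>)
        = cis (- 2 * pi * (\<xi> \<bullet> x)) * Z \<xi> * (cis t - 1 - \<i> * complex_of_real t)"
      by (simp add: t_def algebra_simps)
    then have "norm (cis (- 2 * pi * (\<xi> \<bullet> y)) * Z \<xi> - cis (- 2 * pi * (\<xi> \<bullet> x)) * Z \<xi>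
          - cis (- 2 * pi * (\<xi> \<bullet> x)) * (- 2 * pi * \<i> * complex_of_real (\<xi> \<bullet> h) * Z \<xi>))
        = norm (cis t - 1 - \<i> * complex_of_real t) * norm (Z \<xi>)"
      by (simp add: norm_mult)
    also have "\<dots> \<le> (2 * pi * \<bar>R\<bar> * norm h)\<^sup>2 * norm (Z \<xi>)"
    proof (cases "norm \<xi> \<le> R")
      case True
      have "\<bar>\<xi> \<bullet> h\<bar> \<le> \<bar>R\<bar> * norm h"
        using Cauchy_Schwarz_ineq2[of \<xi> h] mult_right_mono[of "norm \<xi>" "\<bar>R\<bar>" "norm h"] True by fastforce
      then have "\<bar>t\<bar> \<le> 2 * pi * \<bar>R\<bar> * norm h"
        using mult_left_mono[of "\<bar>\<xi> \<bullet> h\<bar>" "\<bar>R\<bar> * norm h" "2 * pi"] by (simp add: t_def abs_mult)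
      then have "t\<^sup>2 \<le> (2 * pi * \<bar>R\<bar> * norm h)\<^sup>2" by (rule abs_le_square_iff[THEN iffD1, OF order_trans]) simp
      then show ?thesis using norm_cis_taylor_le[of t] by (intro mult_right_mono) auto
    qed (use Z(2)[of \<xi>] in simp)
    finally show "norm (cis (- 2 * pi * (\<xi> \<bullet> y)) * Z \<xi> - cis (- 2 * pi * (\<xi> \<bullet> x)) * Z \<xi>
          - cis (- 2 * pi * (\<xi> \<bullet> x)) * (- 2 * pi * \<i> * complex_of_real (\<xi> \<bullet> h) * Z \<xi>)) \<le> (2 * pi * \<bar>R\<bar> * norm h)\<^sup>2 * norm (Z \<xi>)" .
  qed
  have rhs: "(\<integral>\<xi>. (2 * pi * \<bar>R\<bar> * norm h)\<^sup>2 * norm (Z \<xi>) \<partial>lebesgue) = ((2 * pi * \<bar>R\<bar>)\<^sup>2 * (\<integral>\<xi>. norm (Z \<xi>) \<partial>lebesgue) * norm h) * norm h"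
  proof -
    have "(2 * pi * \<bar>R\<bar> * norm h)\<^sup>2 = (2 * pi * \<bar>R\<bar>)\<^sup>2 * (norm h * norm h)"
      unfolding power_mult_distrib[of "2 * pi * \<bar>R\<bar>"] power2_eq_square[of "norm h"] ..
    then show ?thesis unfolding integral_mult_right_zero by (simp only: mult_ac)
  qed
  show "norm (fourier Z y - fourier Z x - fourier (\<lambda>\<xi>. - 2 * pi * \<i> * complex_of_real (\<xi> \<bullet> (y - x)) * Z \<xi>) x) / norm (y - x)
      \<le> (2 * pi * \<bar>R\<bar>)\<^sup>2 * (\<integral>\<xi>. norm (Z \<xi>) \<partial>lebesgue) * norm (y - x)"
    by (rule mult_imp_div_pos_le[OF _ bound[unfolded rhs, unfolded h_def]]) (use y in simp)
qed simp

lemma pderivative_fourier: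
  fixes Z :: "('n::finite) cfun"
  assumes "integrable lebesgue Z" "\<And>\<xi>. norm \<xi> > R \<Longrightarrow> Z \<xi> = 0"
  shows "pderivative j (fourier Z) x = fourier (\<lambda>\<xi>. - 2 * pi * \<i> * complex_of_real (\<xi> $ j) * Z \<xi>) x"
  by (subst pderivative_eq[OF fourier_has_derivative[OF assms]]) (simp_all add: inner_axis)

text \<open>Multiplication by a coordinate preserves integrability and the bound on the support, so
  the transforms of such functions form a family closed under partial derivatives.\<close>

lemma fourier_Ck_on:
  fixes Z :: "('n::finite) cfun"
  assumes "integrable lebesgue Z" "\<And>\<xi>. norm \<xi> > R \<Longrightarrow> Z \<xi> = 0"
  shows "fourier Z \<in> Ck_on k UNIV"
proof (rule Ck_on_coinduct[where F="{fourier Z |Z. integrable lebesgue Z \<and> (\<forall>\<xi>. norm \<xi> > R \<longrightarrow> Z \<xi> = 0)}"])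
  show "fourier Z \<in> {fourier Z |Z. integrable lebesgue Z \<and> (\<forall>\<xi>. norm \<xi> > R \<longrightarrow> Z \<xi> = 0)}"
    using assms by blast
  fix f :: "'n cfun" assume "f \<in> {fourier Z |Z. integrable lebesgue Z \<and> (\<forall>\<xi>. norm \<xi> > R \<longrightarrow> Z \<xi> = 0)}"
  then obtain Y where Y: "f = fourier Y" "integrable lebesgue Y" "\<And>\<xi>. norm \<xi> > R \<Longrightarrow> Y \<xi> = 0" by blast
  have "fourier Y differentiable (at x)" for x
    unfolding differentiable_def by (rule exI) (rule fourier_has_derivative[OF Y(2,3)])
  then show "f differentiable_on UNIV" unfolding Y(1) by (simp add: differentiable_on_def)
  fix j
  have "integrable lebesgue (\<lambda>\<xi>. - 2 * pi * \<i> * complex_of_real (\<xi> $ j) * Y \<xi>)"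
    by (rule bounded_support_integrable_mult[OF Y(2,3)]) (auto intro!: continuous_intros)
  moreover have "\<forall>x\<in>UNIV. pderivative j f x = fourier (\<lambda>\<xi>. - 2 * pi * \<i> * complex_of_real (\<xi> $ j) * Y \<xi>) x"
    unfolding Y(1) using pderivative_fourier[OF Y(2,3)] by blast
  moreover have "\<forall>\<xi>. norm \<xi> > R \<longrightarrow> - 2 * pi * \<i> * complex_of_real (\<xi> $ j) * Y \<xi> = 0" using Y(3) by simp
  ultimately show "\<exists>g\<in>{fourier Z |Z. integrable lebesgue Z \<and> (\<forall>\<xi>. norm \<xi> > R \<longrightarrow> Z \<xi> = 0)}. \<forall>x\<in>UNIV. pderivative j f x = g x"
    by (intro bexI[of _ "fourier (\<lambda>\<xi>. - 2 * pi * \<i> * complex_of_real (\<xi> $ j) * Y \<xi>)"]) blast+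
qed simp

section \<open>Fourier multipliers\<close>

text \<open>The property whose witness \<open>multiplier\<close> chooses, named separately so that
  existence, uniqueness and bounds can be stated for an arbitrary witness.\<close>

definition multiplier_value :: "real \<Rightarrow> ('n::finite) cfun \<Rightarrow> 'n cfun \<Rightarrow> 'n cfun \<Rightarrow> bool" where
  "multiplier_value s \<psi> u w \<longleftrightarrow> w \<in> Lp_space s \<and>
     (\<forall>\<phi>. (\<forall>k. \<phi> k \<in> test_fun) \<and> Lp_strongly s \<phi> u \<longrightarrow>
          Lp_strongly s (\<lambda>k. multiplier_test \<psi> (\<phi> k)) w)"

lemma multiplier_eq_SOME: "multiplier s \<psi> u = (SOME w. multiplier_value s \<psi> u w)"
  by (simp add: multiplier_def multiplier_value_def)

lemma multiplier_value_multiplier: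
  "multiplier_value s \<psi> u w \<Longrightarrow> multiplier_value s \<psi> u (multiplier s \<psi> u)"
  unfolding multiplier_eq_SOME by (rule someI[of "multiplier_value s \<psi> u"])

section \<open>Linearity of the operators on test functions\<close>

lemma symbol_fourier_integrable:
  assumes "\<psi> \<in> Ck_sphere k" "\<theta> \<in> test_fun"
  shows "integrable lebesgue (\<lambda>\<xi>. hom_ext \<psi> \<xi> * fourier \<theta> \<xi>)"
proof -
  obtain C where C: "\<And>\<xi>. norm (hom_ext \<psi> \<xi>) \<le> C" using hom_ext_bounded[OF assms(1)] by blast
  have i: "integrable lebesgue (fourier \<theta>)" by (rule fourier_test_fun_integrable[OF assms(2)])
  show ?thesis
  proof (rule Bochner_Integration.integrable_bound[OF integrable_mult_right[OF integrable_norm[OF i], of C]])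
    show "(\<lambda>\<xi>. hom_ext \<psi> \<xi> * fourier \<theta> \<xi>) \<in> borel_measurable lebesgue"
      using borel_measurable_lebesgue_of_borel[OF hom_ext_measurable[OF assms(1)]] i by (intro borel_measurable_times) auto
    show "AE \<xi> in lebesgue. norm (hom_ext \<psi> \<xi> * fourier \<theta> \<xi>) \<le> norm (C * norm (fourier \<theta> \<xi>))"
    proof (intro always_eventually allI)
      fix \<xi>
      have "norm (hom_ext \<psi> \<xi>) * norm (fourier \<theta> \<xi>) \<le> C * norm (fourier \<theta> \<xi>)" by (intro mult_right_mono C) simp
      then show "norm (hom_ext \<psi> \<xi> * fourier \<theta> \<xi>) \<le> norm (C * norm (fourier \<theta> \<xi>))" by (simp add: norm_mult)
    qed
  qed
qed

lemma inv_fourier_add: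
  assumes "integrable lebesgue u" "integrable lebesgue v"
  shows "inv_fourier (\<lambda>\<xi>. u \<xi> + v \<xi>) x = inv_fourier u x + inv_fourier v x"
proof -
  have "integrable lebesgue (\<lambda>\<xi>. cis (2 * pi * (x \<bullet> \<xi>)) * w \<xi>)" if "integrable lebesgue w" for w
    using fourier_integrable[OF that, of "2 * pi" x] by (simp add: inner_commute)
  then show ?thesis unfolding inv_fourier_def distrib_left
    using assms by (intro Bochner_Integration.integral_add)
qed

lemma inv_fourier_scale: "inv_fourier (\<lambda>\<xi>. c * u \<xi>) x = c * inv_fourier u x"
  unfolding inv_fourier_def by (subst integral_mult_right_zero[symmetric]) (simp add: mult_ac)

lemma multiplier_test_add:
  assumes "\<psi> \<in> Ck_sphere k" "\<theta> \<in> test_fun" "\<eta> \<in> test_fun"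
  shows "multiplier_test \<psi> (\<lambda>x. \<theta> x + \<eta> x) x = multiplier_test \<psi> \<theta> x + multiplier_test \<psi> \<eta> x"
  unfolding multiplier_test_def
  by (simp add: fourier_add[OF test_fun_integrable[OF assms(2)] test_fun_integrable[OF assms(3)]] distrib_left
      inv_fourier_add[OF symbol_fourier_integrable[OF assms(1,2)] symbol_fourier_integrable[OF assms(1,3)]])

lemma multiplier_test_scale: "multiplier_test \<psi> (\<lambda>x. c * \<theta> x) x = c * multiplier_test \<psi> \<theta> x"
  unfolding multiplier_test_def inv_fourier_scale[symmetric] fourier_scale by (simp add: mult_ac)

lemma multiplier_test_diff:
  assumes "\<psi> \<in> Ck_sphere k" "\<theta> \<in> test_fun" "\<eta> \<in> test_fun"
  shows "multiplier_test \<psi> (\<lambda>x. \<theta> x - \<eta> x) x = multiplier_test \<psi> \<theta> x - multiplier_test \<psi> \<eta> x"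
  using multiplier_test_add[OF assms(1,2) test_fun_scale[OF assms(3), of "-1"]] multiplier_test_scale[of \<psi> "-1" \<eta> x]
  by simp

lemma multiplier_test_symbol_add:
  assumes "\<psi> \<in> Ck_sphere k" "\<psi>' \<in> Ck_sphere k" "\<theta> \<in> test_fun"
  shows "multiplier_test (\<lambda>\<xi>. \<psi> \<xi> + \<psi>' \<xi>) \<theta> x = multiplier_test \<psi> \<theta> x + multiplier_test \<psi>' \<theta> x"
  unfolding multiplier_test_def
  by (subst inv_fourier_add[symmetric, OF symbol_fourier_integrable[OF assms(1,3)] symbol_fourier_integrable[OF assms(2,3)]])
     (simp add: hom_ext_def distrib_right)

lemma multiplier_test_one: "\<theta> \<in> test_fun \<Longrightarrow> multiplier_test (\<lambda>\<xi>. 1) \<theta> = \<theta>"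
  by (rule ext) (simp add: multiplier_test_def hom_ext_def fourier_inversion_test_fun)

lemma Lp_dense_strongly:
  assumes "g \<in> Lp_space s" "s > 0"
  shows "\<exists>\<phi>. (\<forall>k. \<phi> k \<in> test_fun) \<and> Lp_strongly s \<phi> g"
  using Lp_dense_test_fun(1)[OF assms] assms test_fun_Lp_space by (fastforce simp: Lp_strongly_iff_modular)

lemma Lp_limit_unique:
  assumes "Lp_strongly s F f" "Lp_strongly s F g" "s > 0"
  shows "AE x in lebesgue. f x = g x"
proof -
  have L: "F n \<in> Lp_space s" "f \<in> Lp_space s" "g \<in> Lp_space s"
    and lim: "(\<lambda>n. Lp_modular s (\<lambda>x. F n x - f x)) \<longlonglongrightarrow> 0" "(\<lambda>n. Lp_modular s (\<lambda>x. F n x - g x)) \<longlonglongrightarrow> 0" for n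
    using assms by (auto simp: Lp_strongly_iff_modular)
  have le: "Lp_modular s (\<lambda>x. f x - g x) \<le> 2 powr s * (Lp_modular s (\<lambda>x. F n x - f x) + Lp_modular s (\<lambda>x. F n x - g x))" for n
    using Lp_modular_triangle[OF L(2,1,3) assms(3), of n] by (simp add: Lp_modular_diff_commute[of s f])
  have "(\<lambda>n. 2 powr s * (Lp_modular s (\<lambda>x. F n x - f x) + Lp_modular s (\<lambda>x. F n x - g x))) \<longlonglongrightarrow> 2 powr s * (0 + 0)"
    by (intro tendsto_mult tendsto_const tendsto_add lim)
  then have "Lp_modular s (\<lambda>x. f x - g x) \<le> 2 powr s * (0 + 0)"
    by (rule LIMSEQ_le_const) (use le in blast)
  then have "AE x in lebesgue. f x - g x = 0"
    by (intro Lp_modular_eq_0_imp_AE[OF Lp_space_diff[OF L(2,3) assms(3)]]) simp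
  then show ?thesis by eventually_elim simp
qed

lemma multiplier_value_one: "g \<in> Lp_space s \<Longrightarrow> multiplier_value s (\<lambda>\<xi>. 1) g g"
  unfolding multiplier_value_def by (auto simp: multiplier_test_one)

lemma multiplier_value_unique:
  assumes "multiplier_value s \<psi> g w" "multiplier_value s \<psi> g w'" "g \<in> Lp_space s" "s > 0"
  shows "AE x in lebesgue. w x = w' x"
  using Lp_dense_strongly[OF assms(3,4)] Lp_limit_unique assms(1,2,4) unfolding multiplier_value_def by metis

lemma multiplier_one_AE:
  assumes "g \<in> Lp_space s" "s > 0"
  shows "AE x in lebesgue. multiplier s (\<lambda>\<xi>. 1) g x = g x"
  using multiplier_value_unique[OF multiplier_value_multiplier[OF multiplier_value_one[OF assms(1)]] multiplier_value_one[OF assms(1)] assms] .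

lemma multiplier_value_cong_AE:
  assumes "multiplier_value s \<psi> g w" "AE x in lebesgue. g x = g' x" "g \<in> Lp_space s" "s > 0"
  shows "multiplier_value s \<psi> g' w"
proof -
  have g': "g' \<in> Lp_space s" by (rule Lp_space_cong_AE[OF assms(3,2)])
  have "Lp_strongly s \<phi> g" if "Lp_strongly s \<phi> g'" for \<phi>
  proof -
    have \<phi>: "\<phi> n \<in> Lp_space s" for n using that assms(4) by (simp add: Lp_strongly_iff_modular)
    have "Lp_modular s (\<lambda>x. \<phi> n x - g x) = Lp_modular s (\<lambda>x. \<phi> n x - g' x)" for n
      by (rule Lp_modular_cong_AE[OF Lp_space_diff[OF \<phi> assms(3,4)]]) (use assms(2) in \<open>auto elim!: eventually_mono\<close>)
    then show ?thesis using that assms(3,4) by (simp add: Lp_strongly_iff_modular)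
  qed
  then show ?thesis using assms(1) unfolding multiplier_value_def by blast
qed

lemma Lp_strongly_add:
  assumes "Lp_strongly s F f" "Lp_strongly s G g" "s > 0"
  shows "Lp_strongly s (\<lambda>k x. F k x + G k x) (\<lambda>x. f x + g x)"
proof -
  have L: "F n \<in> Lp_space s" "f \<in> Lp_space s" "G n \<in> Lp_space s" "g \<in> Lp_space s"
    and lim: "(\<lambda>n. Lp_modular s (\<lambda>x. F n x - f x)) \<longlonglongrightarrow> 0" "(\<lambda>n. Lp_modular s (\<lambda>x. G n x - g x)) \<longlonglongrightarrow> 0" for n
    using assms by (auto simp: Lp_strongly_iff_modular)
  have "Lp_modular s (\<lambda>x. F n x + G n x - (f x + g x)) \<le> 2 powr s * (Lp_modular s (\<lambda>x. F n x - f x) + Lp_modular s (\<lambda>x. G n x - g x))" for n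
    using Lp_modular_add_le[OF Lp_space_diff[OF L(1,2) assms(3), of n] Lp_space_diff[OF L(3,4) assms(3), of n] assms(3)]
    by (simp add: algebra_simps)
  moreover have "(\<lambda>n. 2 powr s * (Lp_modular s (\<lambda>x. F n x - f x) + Lp_modular s (\<lambda>x. G n x - g x))) \<longlonglongrightarrow> 0"
  proof -
    have "(\<lambda>n. 2 powr s * (Lp_modular s (\<lambda>x. F n x - f x) + Lp_modular s (\<lambda>x. G n x - g x))) \<longlonglongrightarrow> 2 powr s * (0 + 0)"
      by (intro tendsto_mult tendsto_const tendsto_add lim)
    then show ?thesis by simp
  qed
  ultimately have "(\<lambda>n. Lp_modular s (\<lambda>x. F n x + G n x - (f x + g x))) \<longlonglongrightarrow> 0"
    by (rule tendsto_0_le_nonneg[OF Lp_modular_nonneg])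
  then show ?thesis unfolding Lp_strongly_iff_modular[OF assms(3)] using L Lp_space_add assms(3) by blast
qed

lemma Lp_strongly_scale:
  assumes "Lp_strongly s F f" "s > 0"
  shows "Lp_strongly s (\<lambda>k x. c * F k x) (\<lambda>x. c * f x)"
proof -
  have L: "F n \<in> Lp_space s" "f \<in> Lp_space s"
    and lim: "(\<lambda>n. Lp_modular s (\<lambda>x. F n x - f x)) \<longlonglongrightarrow> 0" for n
    using assms by (auto simp: Lp_strongly_iff_modular)
  have "Lp_modular s (\<lambda>x. c * F n x - c * f x) = norm c powr s * Lp_modular s (\<lambda>x. F n x - f x)" for n
    using Lp_modular_scale[of s c "\<lambda>x. F n x - f x"] by (simp add: right_diff_distrib)
  moreover have "(\<lambda>n. norm c powr s * Lp_modular s (\<lambda>x. F n x - f x)) \<longlonglongrightarrow> norm c powr s * 0"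
    by (intro tendsto_mult tendsto_const lim)
  ultimately show ?thesis
    unfolding Lp_strongly_iff_modular[OF assms(2)] by (simp add: Lp_space_scale[OF L(1)] Lp_space_scale[OF L(2)])
qed

lemma Lp_strongly_diff:
  assumes "Lp_strongly s F f" "Lp_strongly s G g" "s > 0"
  shows "Lp_strongly s (\<lambda>k x. F k x - G k x) (\<lambda>x. f x - g x)"
  using Lp_strongly_add[OF assms(1) Lp_strongly_scale[OF assms(2,3), of "-1"] assms(3)] by simp

text \<open>If the defining property of the multiplier holds for one function, then the operator is bounded
  on test functions: perturb an approximating sequence by a null sequence.\<close>

lemma multiplier_value_imp_bounded:
  fixes g :: "('n::finite) cfun"
  assumes \<psi>: "\<psi> \<in> Ck_sphere k" and w: "multiplier_value s \<psi> g w" and g: "g \<in> Lp_space s" and s: "s > 0"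
  shows "\<exists>C\<ge>0. \<forall>\<theta>\<in>test_fun. multiplier_test \<psi> \<theta> \<in> Lp_space s \<and>
           Lp_modular s (multiplier_test \<psi> \<theta>) \<le> C * Lp_modular s \<theta>"
proof -
  let ?T = "multiplier_test \<psi>"
  obtain \<phi> where \<phi>: "\<And>k. \<phi> k \<in> test_fun" "Lp_strongly s \<phi> g" using Lp_dense_strongly[OF g s] by blast
  have w\<phi>: "Lp_strongly s (\<lambda>k. ?T (\<phi> k)) w" using w \<phi> unfolding multiplier_value_def by blast
  have null: "Lp_strongly s (\<lambda>k. ?T (\<theta> k)) (\<lambda>x. 0)" if \<theta>: "\<And>k. \<theta> k \<in> test_fun" "Lp_strongly s \<theta> (\<lambda>x. 0)" for \<theta>
  proof -
    have "Lp_strongly s (\<lambda>k x. \<phi> k x + \<theta> k x) (\<lambda>x. g x + 0)" by (rule Lp_strongly_add[OF \<phi>(2) \<theta>(2) s])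
    moreover have "(\<lambda>x. \<phi> k x + \<theta> k x) \<in> test_fun" for k by (intro test_fun_add \<phi> \<theta>)
    ultimately have "Lp_strongly s (\<lambda>k. ?T (\<lambda>x. \<phi> k x + \<theta> k x)) w"
      using w unfolding multiplier_value_def by simp
    from Lp_strongly_diff[OF this w\<phi> s] show ?thesis
      by (simp add: multiplier_test_add[OF \<psi> \<phi>(1) \<theta>(1)])
  qed
  have T: "?T \<theta> \<in> Lp_space s" if \<theta>: "\<theta> \<in> test_fun" for \<theta>
  proof -
    \<comment> \<open>A sequence that starts with \<theta> and then is 0 converges to 0. Strong
      convergence of the images includes membership of all of them in Lp, in particular of the image
      of \<theta>.\<close>
    define \<theta>' where "\<theta>' k = (if k = 0 then \<theta> else (\<lambda>x. 0))" for k :: nat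
    have t: "\<theta>' k \<in> test_fun" for k using \<theta> by (simp add: \<theta>'_def test_fun_0)
    have "(\<lambda>k. Lp_modular s (\<lambda>x. \<theta>' k x - 0)) \<longlonglongrightarrow> 0"
    proof (rule Lim_transform_eventually[OF tendsto_const])
      show "\<forall>\<^sub>F k in sequentially. 0 = Lp_modular s (\<lambda>x. \<theta>' k x - 0)"
        using eventually_gt_at_top[of 0] by eventually_elim (simp add: \<theta>'_def Lp_modular_def)
    qed
    then have "Lp_strongly s \<theta>' (\<lambda>x. 0)"
      unfolding Lp_strongly_iff_modular[OF s] using test_fun_Lp_space[OF t s] by simp
    from null[OF t this] have "?T (\<theta>' 0) \<in> Lp_space s" unfolding Lp_strongly_iff_modular[OF s] by blast
    then show ?thesis by (simp add: \<theta>'_def)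
  qed
  have "\<exists>C\<ge>0. \<forall>\<theta>\<in>test_fun. Lp_modular s (?T \<theta>) \<le> C * Lp_modular s \<theta>"
  proof (rule ccontr)
    assume "\<not> ?thesis"
    then have "\<forall>k::nat. \<exists>\<theta>\<in>test_fun. Lp_modular s (?T \<theta>) > real k * Lp_modular s \<theta>"
      by (metis not_le of_nat_0_le_iff)
    then obtain \<theta> where \<theta>: "\<And>k. \<theta> k \<in> test_fun" "\<And>k. Lp_modular s (?T (\<theta> k)) > real k * Lp_modular s (\<theta> k)" by metis
    \<comment> \<open>The modular scales with the power \<open>s\<close> of the modulus, so this
      factor normalises the image to modular 1, while the preimage has modular at most
      \<open>1 / k\<close>: a null sequence whose images do not tend to 0.\<close>
    define c where "c k = complex_of_real ((1 / Lp_modular s (?T (\<theta> k))) powr (1 / s))" for k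
    have pos: "Lp_modular s (?T (\<theta> k)) > 0" for k
      using \<theta>(2)[of k] Lp_modular_nonneg[of s "\<theta> k"] by (meson le_less_trans mult_nonneg_nonneg of_nat_0_le_iff)
    have c: "norm (c k) powr s = 1 / Lp_modular s (?T (\<theta> k))" for k
      unfolding c_def norm_of_real using pos[of k] s by (simp add: powr_powr)
    define \<theta>' where "\<theta>' k x = c k * \<theta> k x" for k x
    have t: "\<theta>' k \<in> test_fun" for k unfolding \<theta>'_def[abs_def] by (rule test_fun_scale[OF \<theta>(1)])
    have small: "Lp_modular s (\<theta>' k) \<le> inverse (real k)" if "k > 0" for k
    proof -
      have "Lp_modular s (\<theta>' k) = Lp_modular s (\<theta> k) / Lp_modular s (?T (\<theta> k))"
        unfolding \<theta>'_def[abs_def] Lp_modular_scale c by simp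
      also have "\<dots> \<le> inverse (real k)"
        using \<theta>(2)[of k] pos[of k] that by (simp add: field_simps)
      finally show ?thesis .
    qed
    have "(\<lambda>k. Lp_modular s (\<lambda>x. \<theta>' k x - 0)) \<longlonglongrightarrow> 0"
    proof (rule Lim_null_comparison[OF _ lim_inverse_n])
      show "\<forall>\<^sub>F k in sequentially. norm (Lp_modular s (\<lambda>x. \<theta>' k x - 0)) \<le> inverse (real k)"
        using eventually_gt_at_top[of 0] by eventually_elim (use small in \<open>simp add: Lp_modular_nonneg\<close>)
    qed
    then have "Lp_strongly s \<theta>' (\<lambda>x. 0)"
      unfolding Lp_strongly_iff_modular[OF s] using test_fun_Lp_space[OF t s] by simp
    from null[OF t this] have "(\<lambda>k. Lp_modular s (\<lambda>x. ?T (\<theta>' k) x - 0)) \<longlonglongrightarrow> 0" unfolding Lp_strongly_iff_modular[OF s] by blast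
    moreover have "Lp_modular s (\<lambda>x. ?T (\<theta>' k) x - 0) = 1" for k
    proof -
      have "(\<lambda>x. ?T (\<theta>' k) x - 0) = (\<lambda>x. c k * ?T (\<theta> k) x)"
        unfolding \<theta>'_def[abs_def] by (simp add: multiplier_test_scale)
      then show ?thesis using pos[of k] by (simp only: Lp_modular_scale c) simp
    qed
    ultimately show False by (simp add: LIMSEQ_const_iff)
  qed
  then show ?thesis using T by blast
qed

text \<open>Extension of a bounded operator from the dense subspace of test functions, by
  completeness. In the bound one factor \<open>2 powr s\<close> comes from comparing the value with
  an approximating image, the other from comparing the approximating function with
  \<open>g\<close>.\<close>

lemma bounded_imp_multiplier_value:
  fixes g :: "('n::finite) cfun"
  assumes \<psi>: "\<psi> \<in> Ck_sphere k" and s: "s > 0" and C: "C \<ge> 0"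
    and T: "\<And>\<theta>. \<theta> \<in> test_fun \<Longrightarrow> multiplier_test \<psi> \<theta> \<in> Lp_space s"
    and B: "\<And>\<theta>. \<theta> \<in> test_fun \<Longrightarrow> Lp_modular s (multiplier_test \<psi> \<theta>) \<le> C * Lp_modular s \<theta>"
    and g: "g \<in> Lp_space s"
  shows "\<exists>w. multiplier_value s \<psi> g w" "multiplier_value s \<psi> g w \<Longrightarrow> Lp_modular s w \<le> 2 powr s * (C * (2 powr s * Lp_modular s g))"
proof -
  let ?T = "multiplier_test \<psi>"
  have diff: "Lp_modular s (\<lambda>x. ?T \<theta> x - ?T \<eta> x) \<le> C * Lp_modular s (\<lambda>x. \<theta> x - \<eta> x)"
    if "\<theta> \<in> test_fun" "\<eta> \<in> test_fun" for \<theta> \<eta>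
  proof -
    have "(\<lambda>x. ?T \<theta> x - ?T \<eta> x) = ?T (\<lambda>x. \<theta> x - \<eta> x)"
      by (rule ext) (rule multiplier_test_diff[OF \<psi> that, symmetric])
    then show ?thesis using B[OF test_fun_diff[OF that]] by simp
  qed
  obtain \<phi> where \<phi>: "\<And>k. \<phi> k \<in> test_fun" "Lp_strongly s \<phi> g" using Lp_dense_strongly[OF g s] by blast
  have \<phi>L: "\<phi> k \<in> Lp_space s" for k by (rule test_fun_Lp_space[OF \<phi>(1) s])
  have \<phi>lim: "(\<lambda>n. Lp_modular s (\<lambda>x. \<phi> n x - g x)) \<longlonglongrightarrow> 0" using \<phi>(2) s by (simp add: Lp_strongly_iff_modular)
  have dd: "Lp_modular s (\<lambda>x. \<theta> x - \<phi> n x) \<le> 2 powr s * (Lp_modular s (\<lambda>x. \<theta> x - g x) + Lp_modular s (\<lambda>x. \<phi> n x - g x))"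
    if "\<theta> \<in> test_fun" for \<theta> n
    using Lp_modular_triangle[OF test_fun_Lp_space[OF that s] g \<phi>L s, of n] by (simp add: Lp_modular_diff_commute[of s g])
  have "\<exists>f\<in>Lp_space s. (\<lambda>n. Lp_modular s (\<lambda>x. ?T (\<phi> n) x - f x)) \<longlonglongrightarrow> 0"
  proof (rule Lp_complete[OF T[OF \<phi>(1)] s])
    fix e :: real assume e: "e > 0"
    \<comment> \<open>Two approximants are each within \<open>d\<close> of \<open>g\<close>, whence
      the 2; the factor \<open>C + 1\<close> keeps the denominator positive and the final inequality
      strict.\<close>
    define d where "d = e / (2 * (C + 1) * 2 powr s)"
    have d: "d > 0" using e C by (simp add: d_def)
    from order_tendstoD(2)[OF \<phi>lim d] obtain N where N: "\<And>n. n \<ge> N \<Longrightarrow> Lp_modular s (\<lambda>x. \<phi> n x - g x) < d"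
      unfolding eventually_sequentially by blast
    have "Lp_modular s (\<lambda>x. ?T (\<phi> m) x - ?T (\<phi> n) x) < e" if "m \<ge> N" "n \<ge> N" for m n
    proof -
      have "Lp_modular s (\<lambda>x. ?T (\<phi> m) x - ?T (\<phi> n) x) \<le> C * Lp_modular s (\<lambda>x. \<phi> m x - \<phi> n x)" by (rule diff[OF \<phi>(1) \<phi>(1)])
      also have "\<dots> \<le> C * (2 powr s * (d + d))"
        using dd[OF \<phi>(1), of m n] N[OF that(1)] N[OF that(2)] C
        by (intro mult_left_mono order_trans[OF dd[OF \<phi>(1)]]) auto
      also have "\<dots> < (C + 1) * (2 powr s * (d + d))" using d by (intro mult_strict_right_mono) auto
      also have "\<dots> = d * (2 * (C + 1) * 2 powr s)" by (simp add: algebra_simps)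
      also have "\<dots> = e" unfolding d_def using C by simp
      finally show ?thesis .
    qed
    then show "\<exists>N. \<forall>m\<ge>N. \<forall>n\<ge>N. Lp_modular s (\<lambda>x. ?T (\<phi> m) x - ?T (\<phi> n) x) < e" by blast
  qed
  then obtain w0 where w: "w0 \<in> Lp_space s" "(\<lambda>n. Lp_modular s (\<lambda>x. ?T (\<phi> n) x - w0 x)) \<longlonglongrightarrow> 0" by blast
  \<comment> \<open>Independence of the approximating sequence: the images along \<theta> are
    compared with those along \<phi>, and both sequences approach \<open>g\<close>.\<close>
  have "Lp_strongly s (\<lambda>k. ?T (\<theta> k)) w0" if \<theta>: "\<And>k. \<theta> k \<in> test_fun" "Lp_strongly s \<theta> g" for \<theta>
  proof -
    have \<theta>lim: "(\<lambda>n. Lp_modular s (\<lambda>x. \<theta> n x - g x)) \<longlonglongrightarrow> 0" using \<theta>(2) s by (simp add: Lp_strongly_iff_modular)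
    let ?b = "\<lambda>n. 2 powr s * (C * (2 powr s * (Lp_modular s (\<lambda>x. \<theta> n x - g x) + Lp_modular s (\<lambda>x. \<phi> n x - g x)))
        + Lp_modular s (\<lambda>x. ?T (\<phi> n) x - w0 x))"
    have "Lp_modular s (\<lambda>x. ?T (\<theta> n) x - w0 x) \<le> ?b n" for n
    proof -
      have "Lp_modular s (\<lambda>x. ?T (\<theta> n) x - w0 x) \<le> 2 powr s * (Lp_modular s (\<lambda>x. ?T (\<theta> n) x - ?T (\<phi> n) x) + Lp_modular s (\<lambda>x. ?T (\<phi> n) x - w0 x))"
        by (rule Lp_modular_triangle[OF T[OF \<theta>(1)] T[OF \<phi>(1)] w(1) s])
      also have "\<dots> \<le> ?b n"
        by (intro mult_left_mono add_right_mono order_trans[OF diff[OF \<theta>(1) \<phi>(1)]] dd \<theta>(1) C) auto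
      finally show ?thesis .
    qed
    moreover have "?b \<longlonglongrightarrow> 0"
    proof -
      have "?b \<longlonglongrightarrow> 2 powr s * (C * (2 powr s * (0 + 0)) + 0)"
        by (intro tendsto_mult tendsto_const tendsto_add \<theta>lim \<phi>lim w)
      then show ?thesis by simp
    qed
    ultimately have "(\<lambda>n. Lp_modular s (\<lambda>x. ?T (\<theta> n) x - w0 x)) \<longlonglongrightarrow> 0"
      by (rule tendsto_0_le_nonneg[OF Lp_modular_nonneg])
    then show ?thesis unfolding Lp_strongly_iff_modular[OF s] using T \<theta>(1) w(1) by blast
  qed
  then have "multiplier_value s \<psi> g w0" unfolding multiplier_value_def using w(1) by blast
  then show "\<exists>w. multiplier_value s \<psi> g w" by blast
  assume v: "multiplier_value s \<psi> g w"
  show "Lp_modular s w \<le> 2 powr s * (C * (2 powr s * Lp_modular s g))"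
  proof -
    have wL: "w \<in> Lp_space s" and wlim: "(\<lambda>n. Lp_modular s (\<lambda>x. ?T (\<phi> n) x - w x)) \<longlonglongrightarrow> 0"
      using v \<phi> unfolding multiplier_value_def Lp_strongly_iff_modular[OF s] by blast+
    let ?b = "\<lambda>n. 2 powr s * (Lp_modular s (\<lambda>x. ?T (\<phi> n) x - w x) + C * (2 powr s * (Lp_modular s (\<lambda>x. \<phi> n x - g x) + Lp_modular s g)))"
    have "Lp_modular s w \<le> ?b n" for n
    proof -
      have "Lp_modular s w \<le> 2 powr s * (Lp_modular s (\<lambda>x. w x - ?T (\<phi> n) x) + Lp_modular s (?T (\<phi> n)))"
        using Lp_modular_add_le[OF Lp_space_diff[OF wL T[OF \<phi>(1)] s] T[OF \<phi>(1)] s, of n n] by simp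
      moreover have "Lp_modular s (\<lambda>x. (\<phi> n x - g x) + g x) \<le> 2 powr s * (Lp_modular s (\<lambda>x. \<phi> n x - g x) + Lp_modular s g)"
        by (rule Lp_modular_add_le[OF Lp_space_diff[OF \<phi>L g s] g s])
      then have "Lp_modular s (?T (\<phi> n)) \<le> C * (2 powr s * (Lp_modular s (\<lambda>x. \<phi> n x - g x) + Lp_modular s g))"
        using order_trans[OF B[OF \<phi>(1)] mult_left_mono[OF _ C]] by simp
      then have "2 powr s * (Lp_modular s (\<lambda>x. w x - ?T (\<phi> n) x) + Lp_modular s (?T (\<phi> n))) \<le> ?b n"
        by (intro mult_left_mono add_mono) (auto simp: Lp_modular_diff_commute[of s w])
      ultimately show ?thesis by (rule order_trans)
    qed
    moreover have "?b \<longlonglongrightarrow> 2 powr s * (0 + C * (2 powr s * (0 + Lp_modular s g)))"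
      by (intro tendsto_mult tendsto_const tendsto_add wlim \<phi>lim)
    ultimately have "Lp_modular s w \<le> 2 powr s * (0 + C * (2 powr s * (0 + Lp_modular s g)))"
      by (intro LIMSEQ_le_const[where X="?b"]) blast+
    then show ?thesis by simp
  qed
qed

text \<open>A single function with a value decides: it forces boundedness on test functions, and
  boundedness provides a value for every function. Consequently a symbol that fails at one function
  of Lp fails at all of them.\<close>

definition Lp_multiplier :: "real \<Rightarrow> ('n::finite) cfun \<Rightarrow> bool" where
  "Lp_multiplier s \<psi> \<longleftrightarrow> (\<exists>g\<in>Lp_space s. \<exists>w. multiplier_value s \<psi> g w)"

lemma Lp_multiplier_value:
  assumes "Lp_multiplier s \<psi>" "\<psi> \<in> Ck_sphere k" "s > 0" "g \<in> Lp_space s"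
  shows "multiplier_value s \<psi> g (multiplier s \<psi> g)"
proof -
  obtain g0 w0 where "g0 \<in> Lp_space s" "multiplier_value s \<psi> g0 w0" using assms(1) by (auto simp: Lp_multiplier_def)
  from multiplier_value_imp_bounded[OF assms(2) this(2,1) assms(3)] obtain C where C: "C \<ge> 0"
    "\<And>\<theta>. \<theta> \<in> test_fun \<Longrightarrow> multiplier_test \<psi> \<theta> \<in> Lp_space s"
    "\<And>\<theta>. \<theta> \<in> test_fun \<Longrightarrow> Lp_modular s (multiplier_test \<psi> \<theta>) \<le> C * Lp_modular s \<theta>" by blast
  from bounded_imp_multiplier_value(1)[OF assms(2,3) C assms(4)] show ?thesis
    using multiplier_value_multiplier by blast
qed

lemma Lp_multiplier_modular_bound:
  fixes \<psi> :: "('n::finite) cfun"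
  assumes "Lp_multiplier s \<psi>" "\<psi> \<in> Ck_sphere k" "s > 0"
  shows "\<exists>C\<ge>0. \<forall>g\<in>Lp_space s. multiplier s \<psi> g \<in> Lp_space s \<and> Lp_modular s (multiplier s \<psi> g) \<le> C * Lp_modular s g"
proof -
  obtain g0 w0 where "g0 \<in> Lp_space s" "multiplier_value s \<psi> g0 w0" using assms(1) by (auto simp: Lp_multiplier_def)
  from multiplier_value_imp_bounded[OF assms(2) this(2,1) assms(3)] obtain C where C: "C \<ge> 0"
    "\<And>\<theta>. \<theta> \<in> test_fun \<Longrightarrow> multiplier_test \<psi> \<theta> \<in> Lp_space s"
    "\<And>\<theta>. \<theta> \<in> test_fun \<Longrightarrow> Lp_modular s (multiplier_test \<psi> \<theta>) \<le> C * Lp_modular s \<theta>" by blast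
  have "multiplier s \<psi> g \<in> Lp_space s \<and> Lp_modular s (multiplier s \<psi> g) \<le> (2 powr s * C * 2 powr s) * Lp_modular s g"
    if "g \<in> Lp_space s" for g
    using Lp_multiplier_value[OF assms that] bounded_imp_multiplier_value(2)[OF assms(2,3) C that, of "multiplier s \<psi> g"]
    by (simp add: multiplier_value_def mult.assoc)
  then show ?thesis using C(1) by (intro exI[of _ "2 powr s * C * 2 powr s"]) auto
qed

text \<open>Values subtract, and it suffices to do so at the zero function. The contrapositive is
  what is used later: a multiplier plus a symbol that is none is again none.\<close>

lemma Lp_multiplier_add_cancel:
  assumes "Lp_multiplier s \<psi>" "Lp_multiplier s (\<lambda>\<xi>. \<psi> \<xi> + \<psi>' \<xi>)" "\<psi> \<in> Ck_sphere k" "\<psi>' \<in> Ck_sphere k" "s > 0"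
  shows "Lp_multiplier s \<psi>'"
proof -
  have z: "(\<lambda>x. 0) \<in> Lp_space s" by simp
  let ?z = "(\<lambda>x. 0) :: 'a cfun"
  have 1: "multiplier_value s \<psi> ?z (multiplier s \<psi> ?z)" by (rule Lp_multiplier_value[OF assms(1,3,5) z])
  have 2: "multiplier_value s (\<lambda>\<xi>. \<psi> \<xi> + \<psi>' \<xi>) ?z (multiplier s (\<lambda>\<xi>. \<psi> \<xi> + \<psi>' \<xi>) ?z)"
    by (rule Lp_multiplier_value[OF assms(2) Ck_sphere_add[OF assms(3,4)] assms(5) z])
  have "multiplier_value s \<psi>' ?z (\<lambda>x. multiplier s (\<lambda>\<xi>. \<psi> \<xi> + \<psi>' \<xi>) ?z x - multiplier s \<psi> ?z x)"
    unfolding multiplier_value_def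
  proof (intro conjI allI impI)
    show "(\<lambda>x. multiplier s (\<lambda>\<xi>. \<psi> \<xi> + \<psi>' \<xi>) ?z x - multiplier s \<psi> ?z x) \<in> Lp_space s"
      using 1 2 assms(5) by (intro Lp_space_diff) (auto simp: multiplier_value_def)
    fix \<phi> :: "nat \<Rightarrow> 'a cfun" assume \<phi>: "(\<forall>k. \<phi> k \<in> test_fun) \<and> Lp_strongly s \<phi> (\<lambda>x. 0)"
    have "Lp_strongly s (\<lambda>k. multiplier_test (\<lambda>\<xi>. \<psi> \<xi> + \<psi>' \<xi>) (\<phi> k)) (multiplier s (\<lambda>\<xi>. \<psi> \<xi> + \<psi>' \<xi>) ?z)"
      "Lp_strongly s (\<lambda>k. multiplier_test \<psi> (\<phi> k)) (multiplier s \<psi> ?z)"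
      using 1 2 \<phi> unfolding multiplier_value_def by blast+
    from Lp_strongly_diff[OF this assms(5)]
    show "Lp_strongly s (\<lambda>k. multiplier_test \<psi>' (\<phi> k)) (\<lambda>x. multiplier s (\<lambda>\<xi>. \<psi> \<xi> + \<psi>' \<xi>) ?z x - multiplier s \<psi> ?z x)"
      using \<phi> by (simp add: multiplier_test_symbol_add[OF assms(3,4)])
  qed
  then show ?thesis using z unfolding Lp_multiplier_def by blast
qed

text \<open>No witness exists, so the choice is made from the constantly false predicate and depends
  neither on the symbol nor on the function.\<close>

lemma multiplier_undefined:
  assumes "\<not> Lp_multiplier s \<psi>" "g \<in> Lp_space s"
  shows "multiplier s \<psi> g = (SOME w. False)"
proof -
  have "multiplier_value s \<psi> g = (\<lambda>w. False)" using assms by (auto simp: Lp_multiplier_def fun_eq_iff)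
  then show ?thesis by (simp add: multiplier_eq_SOME)
qed

section \<open>Products of bounded VMO functions\<close>

lemma emeasure_ball_eq:
  "emeasure lebesgue (ball (c::real^'n) r) = ennreal (measure lebesgue (ball c r))"
  using emeasure_lborel_ball_finite[of c r] by (intro emeasure_eq_ennreal_measure) (auto simp: top.not_eq_extremum)

lemma measure_ball_pos: "r > 0 \<Longrightarrow> measure lebesgue (ball (c::real^'n) r) > 0"
  using content_ball_pos[of r c] by simp

lemma ball_lebesgue_measurable [measurable]: "ball (c::real^'n) r \<in> sets lebesgue"
  by (intro sets_completionI_sets) simp

lemma nn_integral_ball_add_const:
  fixes c :: "real ^ 'n"
  assumes [measurable]: "F \<in> borel_measurable lebesgue"
  shows "(\<integral>\<^sup>+x. F x * indicator (ball c r) x + K * indicator (ball c r) x \<partial>lebesgue)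
    = (\<integral>\<^sup>+x\<in>ball c r. F x \<partial>lebesgue) + K * emeasure lebesgue (ball c r)"
proof -
  have "(\<integral>\<^sup>+x. F x * indicator (ball c r) x + K * indicator (ball c r) x \<partial>lebesgue)
    = (\<integral>\<^sup>+x. F x * indicator (ball c r) x \<partial>lebesgue) + (\<integral>\<^sup>+x. K * indicator (ball c r) x \<partial>lebesgue)"
    by (rule nn_integral_add) measurable
  then show ?thesis by (simp only: nn_integral_cmult_indicator[OF ball_lebesgue_measurable])
qed

lemma norm_diff_const_measurable:
  fixes f :: "'a \<Rightarrow> complex"
  assumes "f \<in> borel_measurable M"
  shows "(\<lambda>x. ennreal (norm (f x - a))) \<in> borel_measurable M"
  by (rule measurable_compose[OF measurable_compose[OF borel_measurable_diff[OF assms borel_measurable_const] borel_measurable_norm] measurable_ennreal])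

lemma ennreal_le_plus: "a \<le> b + c \<Longrightarrow> b \<ge> 0 \<Longrightarrow> c \<ge> 0 \<Longrightarrow> ennreal a \<le> ennreal b + ennreal c"
  by (metis ennreal_leI ennreal_plus)

lemma divide_emeasure_ball_le_iff:
  fixes c :: "real ^ 'n"
  assumes "r > 0"
  shows "a / emeasure lebesgue (ball c r) \<le> e \<longleftrightarrow> a \<le> e * emeasure lebesgue (ball c r)"
proof -
  let ?V = "emeasure lebesgue (ball c r)"
  have V: "?V \<noteq> 0" "?V < \<top>" "?V > 0"
    using measure_ball_pos[OF assms, of c] unfolding emeasure_ball_eq by auto
  have "a / ?V * ?V = a" unfolding ennreal_divide_times ennreal_divide_self[OF V(1,2)] by simp
  then show ?thesis using V(3) mult_right_mono[of "a / ?V" e ?V] divide_le_posI_ennreal[of ?V a e]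
    by (auto simp: mult.commute)
qed

lemma BMO_norm_leI:
  assumes "\<And>c r. r > 0 \<Longrightarrow> (\<integral>\<^sup>+x\<in>ball c r. ennreal (norm (f x - ball_mean f c r)) \<partial>lebesgue) \<le> e * emeasure lebesgue (ball c r)"
  shows "BMO_norm f \<le> e"
  unfolding BMO_norm_def
proof (rule SUP_least)
  fix z :: "(real ^ 'a) \<times> real" assume z: "z \<in> UNIV \<times> {0<..}"
  obtain c r where cr: "z = (c, r)" by (cases z)
  have r: "r > 0" using z cr by simp
  from assms[OF r, of c] show "(case z of (c, r) \<Rightarrow> (\<integral>\<^sup>+x\<in>ball c r. ennreal (norm (f x - ball_mean f c r)) \<partial>lebesgue) / emeasure lebesgue (ball c r)) \<le> e"
    unfolding cr prod.case divide_emeasure_ball_le_iff[OF r] .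
qed

lemma BMO_norm_osc_le:
  assumes "BMO_norm f \<le> e" "r > 0"
  shows "(\<integral>\<^sup>+x\<in>ball c r. ennreal (norm (f x - ball_mean f c r)) \<partial>lebesgue) \<le> e * emeasure lebesgue (ball c r)"
proof -
  have "(\<integral>\<^sup>+x\<in>ball c r. ennreal (norm (f x - ball_mean f c r)) \<partial>lebesgue) / emeasure lebesgue (ball c r) \<le> BMO_norm f"
    unfolding BMO_norm_def using assms(2) by (intro SUP_upper2[of "(c, r)"]) auto
  then have "(\<integral>\<^sup>+x\<in>ball c r. ennreal (norm (f x - ball_mean f c r)) \<partial>lebesgue) / emeasure lebesgue (ball c r) \<le> e"
    using assms(1) by (rule order_trans)
  then show ?thesis by (simp only: divide_emeasure_ball_le_iff[OF assms(2)])
qed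

lemma ball_mean_cong_AE:
  assumes "AE x in lebesgue. f x = g x" "f \<in> borel_measurable lebesgue"
  shows "ball_mean f c r = ball_mean g c r"
proof -
  have "g \<in> borel_measurable lebesgue" by (rule borel_measurable_AE[OF assms(2,1)])
  then have "(\<integral>x\<in>ball c r. f x \<partial>lebesgue) = (\<integral>x\<in>ball c r. g x \<partial>lebesgue)"
    unfolding set_lebesgue_integral_def
    using assms by (intro integral_cong_AE borel_measurable_scaleR borel_measurable_indicator ball_lebesgue_measurable) (auto elim!: eventually_mono)
  then show ?thesis by (simp add: ball_mean_def)
qed

lemma BMO_norm_cong_AE:
  assumes "AE x in lebesgue. f x = g x" "f \<in> borel_measurable lebesgue"
  shows "BMO_norm f = BMO_norm g"
proof -
  have "(\<integral>\<^sup>+x\<in>ball c r. ennreal (norm (f x - ball_mean f c r)) \<partial>lebesgue)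
      = (\<integral>\<^sup>+x\<in>ball c r. ennreal (norm (g x - ball_mean g c r)) \<partial>lebesgue)" for c r
    unfolding ball_mean_cong_AE[OF assms, of c r]
    by (intro nn_integral_cong_AE) (use assms(1) in \<open>auto elim!: eventually_mono\<close>)
  then show ?thesis by (simp add: BMO_norm_def)
qed

lemma set_integrable_ball:
  fixes f :: "('n::finite) cfun"
  assumes "f \<in> L1loc" shows "set_integrable lebesgue (ball c r) f"
proof (rule set_integrable_subset)
  show "set_integrable lebesgue (cball c r) f" using assms by (simp add: L1loc_def)
qed auto

lemma L1loc_measurable:
  fixes f :: "('n::finite) cfun"
  assumes "f \<in> L1loc" shows "f \<in> borel_measurable lebesgue"
proof (rule borel_measurable_LIMSEQ_metric)
  show "(\<lambda>x. indicator (ball 0 (real n)) x *\<^sub>R f x) \<in> borel_measurable lebesgue" for n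
    using set_integrable_ball[OF assms, of 0 "real n"] unfolding set_integrable_def by auto
  fix x :: "real ^ 'n"
  obtain N :: nat where N: "norm x < real N" using reals_Archimedean2 by blast
  show "(\<lambda>n. indicator (ball 0 (real n)) x *\<^sub>R f x) \<longlonglongrightarrow> f x"
  proof (rule Lim_transform_eventually[OF tendsto_const])
    show "\<forall>\<^sub>F n in sequentially. f x = indicator (ball 0 (real n)) x *\<^sub>R f x"
      using eventually_ge_at_top[of N] by eventually_elim (use N in auto)
  qed
qed

lemma ball_mean_diff_le:
  fixes f :: "('n::finite) cfun"
  assumes "f \<in> L1loc" "r > 0"
  shows "ennreal (norm (a - ball_mean f c r)) * emeasure lebesgue (ball c r) \<le> (\<integral>\<^sup>+y\<in>ball c r. ennreal (norm (a - f y)) \<partial>lebesgue)"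
proof -
  define V where "V = measure lebesgue (ball c r)"
  have V: "V > 0" unfolding V_def by (rule measure_ball_pos[OF assms(2)])
  have fi: "set_integrable lebesgue (ball c r) f" by (rule set_integrable_ball[OF assms(1)])
  have ci: "set_integrable lebesgue (ball c r) (\<lambda>y. a)"
    unfolding set_integrable_def using emeasure_ball_eq[of c r]
    by (intro integrable_scaleR_left integrable_real_indicator) (auto simp: top.not_eq_extremum)
  have ca: "(\<integral>y\<in>ball c r. a \<partial>lebesgue) = V *\<^sub>R a"
    unfolding set_lebesgue_integral_def V_def using emeasure_ball_eq[of c r]
    by (subst integral_scaleR_left) (auto simp: top.not_eq_extremum intro!: integrable_real_indicator)
  have "V *\<^sub>R (a - ball_mean f c r) = (\<integral>y\<in>ball c r. a - f y \<partial>lebesgue)"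
    using V fi ci by (subst set_integral_diff(2)) (auto simp: ca ball_mean_def V_def[symmetric] scaleR_diff_right)
  then have "V * norm (a - ball_mean f c r) = norm (\<integral>y\<in>ball c r. a - f y \<partial>lebesgue)"
    using V by (metis abs_of_pos norm_scaleR)
  also have "ennreal \<dots> \<le> (\<integral>\<^sup>+y. ennreal (norm (indicator (ball c r) y *\<^sub>R (a - f y))) \<partial>lebesgue)"
    unfolding set_lebesgue_integral_def
    by (rule integral_norm_bound_ennreal) (use set_integral_diff(1)[OF ci fi] in \<open>simp add: set_integrable_def\<close>)
  also have "\<dots> = (\<integral>\<^sup>+y\<in>ball c r. ennreal (norm (a - f y)) \<partial>lebesgue)"
    by (intro nn_integral_cong) (auto simp: indicator_def)
  finally show ?thesis
    using V by (simp add: emeasure_ball_eq V_def[symmetric] ennreal_mult'[symmetric] mult.commute)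
qed

text \<open>Up to a factor 2 the mean is the best constant, since its distance from \<open>a\<close>
  is at most the average distance of \<open>f\<close> from \<open>a\<close>. Oscillation may
  therefore be estimated with any convenient constant.\<close>

lemma osc_le_twice_const:
  fixes f :: "('n::finite) cfun"
  assumes "f \<in> L1loc" "r > 0"
  shows "(\<integral>\<^sup>+x\<in>ball c r. ennreal (norm (f x - ball_mean f c r)) \<partial>lebesgue) \<le> 2 * (\<integral>\<^sup>+x\<in>ball c r. ennreal (norm (f x - a)) \<partial>lebesgue)"
proof -
  let ?I = "\<integral>\<^sup>+x\<in>ball c r. ennreal (norm (f x - a)) \<partial>lebesgue"
  have m: "f \<in> borel_measurable lebesgue" by (rule L1loc_measurable[OF assms(1)])
  have "(\<integral>\<^sup>+x\<in>ball c r. ennreal (norm (f x - ball_mean f c r)) \<partial>lebesgue)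
      \<le> (\<integral>\<^sup>+x. ennreal (norm (f x - a)) * indicator (ball c r) x + ennreal (norm (a - ball_mean f c r)) * indicator (ball c r) x \<partial>lebesgue)"
  proof (intro nn_integral_mono)
    fix x
    have "norm (f x - ball_mean f c r) \<le> norm (f x - a) + norm (a - ball_mean f c r)" by norm
    then have "ennreal (norm (f x - ball_mean f c r)) \<le> ennreal (norm (f x - a)) + ennreal (norm (a - ball_mean f c r))"
      by (rule ennreal_le_plus) auto
    then show "ennreal (norm (f x - ball_mean f c r)) * indicator (ball c r) x
       \<le> ennreal (norm (f x - a)) * indicator (ball c r) x + ennreal (norm (a - ball_mean f c r)) * indicator (ball c r) x"
      by (auto simp: indicator_def)
  qed
  also have "\<dots> = ?I + ennreal (norm (a - ball_mean f c r)) * emeasure lebesgue (ball c r)"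
    by (intro nn_integral_ball_add_const norm_diff_const_measurable m)
  also have "\<dots> \<le> ?I + ?I"
    using ball_mean_diff_le[OF assms, of a c] by (intro add_left_mono) (simp add: norm_minus_commute)
  also have "\<dots> = 2 * ?I" by (simp add: mult_2)
  finally show ?thesis .
qed

lemma Linf_L1loc:
  fixes f :: "('n::finite) cfun"
  assumes "f \<in> Linf_space" shows "f \<in> L1loc"
  unfolding L1loc_def
proof (intro CollectI allI impI)
  fix K :: "(real ^ 'n) set" assume K: "compact K"
  obtain R where R: "\<And>x. x \<in> K \<Longrightarrow> norm x \<le> R" using compact_imp_bounded[OF K] by (auto simp: bounded_iff)
  have Ks: "K \<in> sets lebesgue" using compact_imp_closed[OF K] by (auto intro!: sets_completionI_sets borel_closed)
  obtain C where C: "AE x in lebesgue. norm (f x) \<le> C" and m: "f \<in> borel_measurable lebesgue"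
    using assms by (auto simp: Linf_space_def)
  show "f absolutely_integrable_on K"
    unfolding set_integrable_def
  proof (rule bounded_ball_support_integrable)
    show "(\<lambda>x. indicator K x *\<^sub>R f x) \<in> borel_measurable lebesgue"
      using m Ks by (intro borel_measurable_scaleR borel_measurable_indicator)
    show "AE x in lebesgue. norm (indicator K x *\<^sub>R f x) \<le> max C 0"
      using C by eventually_elim (auto simp: indicator_def)
    show "AE x in lebesgue. R < norm x \<longrightarrow> indicator K x *\<^sub>R f x = 0"
    proof (intro always_eventually allI impI)
      fix x :: "real ^ 'n" assume "R < norm x"
      then have "x \<notin> K" using R[of x] by auto
      then show "indicator K x *\<^sub>R f x = 0" by simp
    qed
  qed
qed

text \<open>For bounded functions of compact support this characterises \<open>VMO\<close>, by mollification, and unlike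
  approximability it is visibly stable under products.\<close>

definition vanishing_osc :: "('n::finite) cfun \<Rightarrow> bool" where
  "vanishing_osc f \<longleftrightarrow> (\<forall>e>0. \<exists>d>0. \<forall>c r. 0 < r \<longrightarrow> r < d \<longrightarrow>
     (\<exists>a. (\<integral>\<^sup>+x\<in>ball c r. ennreal (norm (f x - a)) \<partial>lebesgue) \<le> ennreal e * emeasure lebesgue (ball c r)))"

lemma Cc_uniformly_continuous:
  assumes "g \<in> Cc" "e > 0"
  shows "\<exists>d>0. \<forall>x y. dist x y < d \<longrightarrow> norm (g x - g y) < e"
proof -
  obtain R where R: "R > 0" "\<And>x. norm x > R \<Longrightarrow> g x = 0" and c: "continuous_on UNIV g"
    using assms by (auto simp: Cc_iff)
  have "uniformly_continuous_on (cball 0 (R + 1)) g"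
    by (intro compact_uniformly_continuous continuous_on_subset[OF c]) auto
  then obtain d where d: "d > 0" "\<And>x y. x \<in> cball 0 (R+1) \<Longrightarrow> y \<in> cball 0 (R+1) \<Longrightarrow> dist y x < d \<Longrightarrow> dist (g y) (g x) < e"
    unfolding uniformly_continuous_on_def using assms(2) by meson
  have "norm (g x - g y) < e" if xy: "dist x y < min d 1" for x y
  proof (cases "norm x \<le> R + 1 \<and> norm y \<le> R + 1")
    case True
    then show ?thesis using d(2)[of y x] xy by (simp add: dist_norm)
  next
    case False
    have "norm x \<le> norm y + dist x y" "norm y \<le> norm x + dist x y" by norm+
    then have "norm x > R \<and> norm y > R" using False xy by auto
    then show ?thesis using R(2)[of x] R(2)[of y] assms(2) by simp
  qed
  then show ?thesis using d(1) by (intro exI[of _ "min d 1"]) auto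
qed

text \<open>With \<open>g\<close> in \<open>Cc\<close> close to \<open>f\<close>, the oscillation of
  \<open>f - g\<close> is small at every scale and that of \<open>g\<close> at small scales by
  uniform continuity. The constant is the mean of \<open>f - g\<close> plus the value of
  \<open>g\<close> at the centre.\<close>

lemma VMO_vanishing_osc:
  fixes f :: "('n::finite) cfun"
  assumes f: "f \<in> VMO"
  shows "vanishing_osc f"
  unfolding vanishing_osc_def
proof (intro allI impI)
  fix e :: real assume e: "e > 0"
  obtain g where g: "g \<in> Cc" "BMO_norm (\<lambda>x. f x - g x) < ennreal (e / 2)"
    using f e unfolding VMO_def by (auto dest!: spec[of _ "ennreal (e/2)"])
  obtain d where d: "d > 0" "\<And>x y. dist x y < d \<Longrightarrow> norm (g x - g y) < e / 2"
    using Cc_uniformly_continuous[OF g(1), of "e/2"] e by auto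
  have fm: "f \<in> borel_measurable lebesgue" using f by (auto simp: VMO_def BMO_def intro: L1loc_measurable)
  have gm: "g \<in> borel_measurable lebesgue" by (rule Cc_integrable_lebesgue(2)[OF g(1)])
  show "\<exists>d>0. \<forall>c r. 0 < r \<longrightarrow> r < d \<longrightarrow>
     (\<exists>a. (\<integral>\<^sup>+x\<in>ball c r. ennreal (norm (f x - a)) \<partial>lebesgue) \<le> ennreal e * emeasure lebesgue (ball c r))"
  proof (intro exI[of _ d] conjI allI impI d(1))
    fix c :: "real ^ 'n" and r :: real assume r: "0 < r" "r < d"
    define m where "m = ball_mean (\<lambda>x. f x - g x) c r"
    have "(\<integral>\<^sup>+x\<in>ball c r. ennreal (norm (f x - (m + g c))) \<partial>lebesgue)
        \<le> (\<integral>\<^sup>+x. ennreal (norm (f x - g x - m)) * indicator (ball c r) x + ennreal (e / 2) * indicator (ball c r) x \<partial>lebesgue)"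
    proof (intro nn_integral_mono)
      fix x
      show "ennreal (norm (f x - (m + g c))) * indicator (ball c r) x
         \<le> ennreal (norm (f x - g x - m)) * indicator (ball c r) x + ennreal (e / 2) * indicator (ball c r) x"
      proof (cases "x \<in> ball c r")
        case True
        then have "norm (g x - g c) < e / 2" using d(2)[of x c] r by (simp add: dist_commute)
        moreover have "norm (f x - (m + g c)) \<le> norm (f x - g x - m) + norm (g x - g c)" by norm
        ultimately have "ennreal (norm (f x - (m + g c))) \<le> ennreal (norm (f x - g x - m)) + ennreal (e / 2)"
          using e by (intro ennreal_le_plus) auto
        then show ?thesis using True by simp
      qed simp
    qed
    also have "\<dots> = (\<integral>\<^sup>+x\<in>ball c r. ennreal (norm (f x - g x - m)) \<partial>lebesgue) + ennreal (e / 2) * emeasure lebesgue (ball c r)"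
      by (intro nn_integral_ball_add_const norm_diff_const_measurable borel_measurable_diff fm gm)
    also have "\<dots> \<le> ennreal (e / 2) * emeasure lebesgue (ball c r) + ennreal (e / 2) * emeasure lebesgue (ball c r)"
      unfolding m_def using g(2) r by (intro add_right_mono BMO_norm_osc_le) auto
    also have "\<dots> = ennreal e * emeasure lebesgue (ball c r)"
      using e by (simp add: distrib_right[symmetric] ennreal_plus[symmetric] del: ennreal_plus)
    finally show "\<exists>a. (\<integral>\<^sup>+x\<in>ball c r. ennreal (norm (f x - a)) \<partial>lebesgue) \<le> ennreal e * emeasure lebesgue (ball c r)" by blast
  qed
qed

text \<open>The identity f g - a b = (f - a) g + a (g - b) reduces the claim to the factors,
  provided that the constant \<open>a\<close> stays bounded; it does, as the mean distance between
  \<open>a\<close> and the bounded \<open>f\<close> is at most 1.\<close>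

lemma vanishing_osc_mult:
  fixes f g :: "('n::finite) cfun"
  assumes f: "vanishing_osc f" "f \<in> borel_measurable lebesgue" "AE x in lebesgue. norm (f x) \<le> M"
    and g: "vanishing_osc g" "g \<in> borel_measurable lebesgue" "AE x in lebesgue. norm (g x) \<le> M" and M: "M \<ge> 0"
  shows "vanishing_osc (\<lambda>x. f x * g x)"
  unfolding vanishing_osc_def
proof (intro allI impI)
  fix e :: real assume e: "e > 0"
  \<comment> \<open>The cap at 1 yields \<open>norm a \<le> 1 + M\<close>; the two terms then
    contribute \<open>M * t\<close> and \<open>(1 + M) * t\<close>, which accounts for
    \<open>2 * M + 1\<close>.\<close>
  define t where "t = min 1 (e / (2 * M + 1))"
  have t: "t > 0" "t \<le> 1" "t * (2 * M + 1) \<le> e"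
  proof -
    have "t * (2 * M + 1) \<le> e / (2 * M + 1) * (2 * M + 1)" using M by (intro mult_right_mono) (auto simp: t_def)
    then show "t * (2 * M + 1) \<le> e" using M by simp
  qed (use e M in \<open>auto simp: t_def\<close>)
  obtain d1 where d1: "d1 > 0" "\<And>c r. 0 < r \<Longrightarrow> r < d1 \<Longrightarrow> \<exists>a. (\<integral>\<^sup>+x\<in>ball c r. ennreal (norm (f x - a)) \<partial>lebesgue) \<le> ennreal t * emeasure lebesgue (ball c r)"
    using f(1) t(1) unfolding vanishing_osc_def by meson
  obtain d2 where d2: "d2 > 0" "\<And>c r. 0 < r \<Longrightarrow> r < d2 \<Longrightarrow> \<exists>a. (\<integral>\<^sup>+x\<in>ball c r. ennreal (norm (g x - a)) \<partial>lebesgue) \<le> ennreal t * emeasure lebesgue (ball c r)"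
    using g(1) t(1) unfolding vanishing_osc_def by meson
  show "\<exists>d>0. \<forall>c r. 0 < r \<longrightarrow> r < d \<longrightarrow>
     (\<exists>a. (\<integral>\<^sup>+x\<in>ball c r. ennreal (norm (f x * g x - a)) \<partial>lebesgue) \<le> ennreal e * emeasure lebesgue (ball c r))"
  proof (intro exI[of _ "min d1 d2"] conjI allI impI)
    show "min d1 d2 > 0" using d1 d2 by simp
    fix c :: "real ^ 'n" and r :: real assume r: "0 < r" "r < min d1 d2"
    let ?V = "emeasure lebesgue (ball c r)"
    obtain a where a: "(\<integral>\<^sup>+x\<in>ball c r. ennreal (norm (f x - a)) \<partial>lebesgue) \<le> ennreal t * ?V" using d1(2)[of r c] r by auto
    obtain b where b: "(\<integral>\<^sup>+x\<in>ball c r. ennreal (norm (g x - b)) \<partial>lebesgue) \<le> ennreal t * ?V" using d2(2)[of r c] r by auto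
    have "ennreal (norm a) * ?V = (\<integral>\<^sup>+x. ennreal (norm a) * indicator (ball c r) x \<partial>lebesgue)"
      by (simp add: nn_integral_cmult_indicator)
    also have "\<dots> \<le> (\<integral>\<^sup>+x. ennreal (norm (f x - a)) * indicator (ball c r) x + ennreal M * indicator (ball c r) x \<partial>lebesgue)"
    proof (rule nn_integral_mono_AE, use f(3) in eventually_elim)
      fix x assume "norm (f x) \<le> M"
      moreover have "norm a \<le> norm (f x - a) + norm (f x)" by norm
      ultimately have "ennreal (norm a) \<le> ennreal (norm (f x - a)) + ennreal M" using M by (intro ennreal_le_plus) auto
      then show "ennreal (norm a) * indicator (ball c r) x \<le> ennreal (norm (f x - a)) * indicator (ball c r) x + ennreal M * indicator (ball c r) x"
        by (auto simp: indicator_def)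
    qed
    also have "\<dots> = (\<integral>\<^sup>+x\<in>ball c r. ennreal (norm (f x - a)) \<partial>lebesgue) + ennreal M * ?V"
      by (intro nn_integral_ball_add_const norm_diff_const_measurable f(2))
    also have "\<dots> \<le> ennreal t * ?V + ennreal M * ?V" by (intro add_right_mono a)
    also have "\<dots> = ennreal (t + M) * ?V" using t M by (simp add: distrib_right[symmetric] ennreal_plus)
    finally have "ennreal (norm a) * ?V \<le> ennreal (t + M) * ?V" .
    moreover have "ennreal y * ?V = ennreal (y * measure lebesgue (ball c r))" if "y \<ge> 0" for y
      unfolding emeasure_ball_eq by (rule ennreal_mult[symmetric, OF that measure_nonneg])
    moreover have "0 \<le> (t + M) * measure lebesgue (ball c r)" using t M by (intro mult_nonneg_nonneg) auto
    ultimately have "norm a * measure lebesgue (ball c r) \<le> (t + M) * measure lebesgue (ball c r)"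
      using t M by (simp only: norm_ge_zero add_nonneg_nonneg less_imp_le ennreal_le_iff)
    then have aM: "norm a \<le> 1 + M" using measure_ball_pos[OF r(1), of c] t(2) by (simp add: mult_le_cancel_right)
    have "(\<integral>\<^sup>+x\<in>ball c r. ennreal (norm (f x * g x - a * b)) \<partial>lebesgue)
        \<le> (\<integral>\<^sup>+x. ennreal M * (ennreal (norm (f x - a)) * indicator (ball c r) x) + ennreal (1 + M) * (ennreal (norm (g x - b)) * indicator (ball c r) x) \<partial>lebesgue)"
    proof (rule nn_integral_mono_AE, use g(3) in eventually_elim)
      fix x assume gx: "norm (g x) \<le> M"
      have "f x * g x - a * b = (f x - a) * g x + a * (g x - b)" by (simp add: algebra_simps)
      then have "norm (f x * g x - a * b) \<le> norm (f x - a) * norm (g x) + norm a * norm (g x - b)"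
        by (metis norm_mult norm_triangle_ineq)
      also have "\<dots> \<le> M * norm (f x - a) + (1 + M) * norm (g x - b)"
        using gx aM by (intro add_mono mult_right_mono) (auto simp: mult.commute[of M] intro: mult_left_mono)
      finally have "ennreal (norm (f x * g x - a * b)) \<le> ennreal (M * norm (f x - a)) + ennreal ((1 + M) * norm (g x - b))"
        using M by (intro ennreal_le_plus) auto
      also have "\<dots> = ennreal M * ennreal (norm (f x - a)) + ennreal (1 + M) * ennreal (norm (g x - b))"
        using M by (simp only: ennreal_mult norm_ge_zero add_nonneg_nonneg zero_le_one)
      finally show "ennreal (norm (f x * g x - a * b)) * indicator (ball c r) x \<le>
         ennreal M * (ennreal (norm (f x - a)) * indicator (ball c r) x) + ennreal (1 + M) * (ennreal (norm (g x - b)) * indicator (ball c r) x)"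
        by (auto simp: indicator_def)
    qed
    also have "\<dots> = ennreal M * (\<integral>\<^sup>+x\<in>ball c r. ennreal (norm (f x - a)) \<partial>lebesgue) + ennreal (1 + M) * (\<integral>\<^sup>+x\<in>ball c r. ennreal (norm (g x - b)) \<partial>lebesgue)"
    proof -
      have [measurable]: "f \<in> borel_measurable lebesgue" "g \<in> borel_measurable lebesgue" using f g by auto
      have "(\<integral>\<^sup>+x. ennreal M * (ennreal (norm (f x - a)) * indicator (ball c r) x) + ennreal (1 + M) * (ennreal (norm (g x - b)) * indicator (ball c r) x) \<partial>lebesgue)
        = (\<integral>\<^sup>+x. ennreal M * (ennreal (norm (f x - a)) * indicator (ball c r) x) \<partial>lebesgue)
          + (\<integral>\<^sup>+x. ennreal (1 + M) * (ennreal (norm (g x - b)) * indicator (ball c r) x) \<partial>lebesgue)"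
        by (rule nn_integral_add) measurable
      also have "(\<integral>\<^sup>+x. ennreal M * (ennreal (norm (f x - a)) * indicator (ball c r) x) \<partial>lebesgue)
          = ennreal M * (\<integral>\<^sup>+x\<in>ball c r. ennreal (norm (f x - a)) \<partial>lebesgue)"
        by (rule nn_integral_cmult) measurable
      also have "(\<integral>\<^sup>+x. ennreal (1 + M) * (ennreal (norm (g x - b)) * indicator (ball c r) x) \<partial>lebesgue)
          = ennreal (1 + M) * (\<integral>\<^sup>+x\<in>ball c r. ennreal (norm (g x - b)) \<partial>lebesgue)"
        by (rule nn_integral_cmult) measurable
      finally show ?thesis .
    qed
    also have "\<dots> \<le> ennreal M * (ennreal t * ?V) + ennreal (1 + M) * (ennreal t * ?V)"
      by (intro add_mono mult_left_mono a b) auto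
    also have "\<dots> = ennreal (t * (2 * M + 1)) * ?V"
    proof -
      have "ennreal (t * (2 * M + 1)) = ennreal (M * t + (1 + M) * t)" by (simp add: algebra_simps)
      also have "\<dots> = ennreal M * ennreal t + ennreal (1 + M) * ennreal t"
        using M t by (simp only: ennreal_plus ennreal_mult mult_nonneg_nonneg add_nonneg_nonneg zero_le_one less_imp_le)
      finally show ?thesis by (simp only: distrib_right mult.assoc)
    qed
    also have "\<dots> \<le> ennreal e * ?V" using t(3) by (intro mult_right_mono ennreal_leI) auto
    finally show "\<exists>a. (\<integral>\<^sup>+x\<in>ball c r. ennreal (norm (f x * g x - a)) \<partial>lebesgue) \<le> ennreal e * ?V" by blast
  qed
qed

text \<open>Translates of a Borel function are jointly measurable in the point and the shift, as the
  double integrals over mollified functions require.\<close>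

lemma borel_representative:
  fixes h :: "real ^ 'n \<Rightarrow> complex"
  assumes "h \<in> borel_measurable lebesgue"
  shows "\<exists>h'\<in>borel_measurable borel. AE x in lebesgue. h x = h' x"
proof -
  have "(\<lambda>x. Re (h x)) \<in> borel_measurable (completion lborel)" "(\<lambda>x. Im (h x)) \<in> borel_measurable (completion lborel)"
    using assms by (auto intro: borel_measurable_Re borel_measurable_Im)
  from this[THEN completion_ex_borel_measurable_real]
  obtain a b where a: "a \<in> borel_measurable lborel" "AE x in lborel. Re (h x) = a x"
    and b: "b \<in> borel_measurable lborel" "AE x in lborel. Im (h x) = b x" by blast
  have m: "(\<lambda>x. Complex (a x) (b x)) \<in> borel_measurable borel"
  proof -
    have "(\<lambda>x. complex_of_real (a x) + \<i> * complex_of_real (b x)) \<in> borel_measurable borel" using a b by measurable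
    moreover have "(\<lambda>x. complex_of_real (a x) + \<i> * complex_of_real (b x)) = (\<lambda>x. Complex (a x) (b x))"
      by (rule ext) (simp add: complex_eq_iff)
    ultimately show ?thesis by simp
  qed
  have "AE x in lebesgue. h x = Complex (a x) (b x)"
    using AE_completion[OF a(2)] AE_completion[OF b(2)] by eventually_elim (simp add: complex_eq_iff)
  with m show ?thesis by (intro bexI[of _ "\<lambda>x. Complex (a x) (b x)"])
qed

lemma vanishing_osc_cong_AE:
  assumes "AE x in lebesgue. f x = g x" "vanishing_osc f"
  shows "vanishing_osc g"
proof -
  have "(\<integral>\<^sup>+x\<in>ball c r. ennreal (norm (f x - a)) \<partial>lebesgue) = (\<integral>\<^sup>+x\<in>ball c r. ennreal (norm (g x - a)) \<partial>lebesgue)" for c r a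
    by (intro nn_integral_cong_AE) (use assms(1) in \<open>auto elim!: eventually_mono\<close>)
  then show ?thesis using assms(2) by (simp add: vanishing_osc_def)
qed

section \<open>Mollification\<close>

lemma nn_integral_lebesgue_translation:
  fixes f :: "real ^ 'n \<Rightarrow> ennreal"
  assumes "f \<in> borel_measurable borel"
  shows "(\<integral>\<^sup>+x. f (x + c) \<partial>lebesgue) = (\<integral>\<^sup>+x. f x \<partial>lebesgue)"
proof -
  have "(\<integral>\<^sup>+x. f x \<partial>lebesgue) = (\<integral>\<^sup>+x. f x \<partial>distr lborel borel ((+) c))"
    by (simp add: nn_integral_completion lborel_distr_plus)
  also have "\<dots> = (\<integral>\<^sup>+x. f (c + x) \<partial>lborel)"
    using assms by (subst nn_integral_distr) auto
  also have "\<dots> = (\<integral>\<^sup>+x. f (x + c) \<partial>lebesgue)"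
    by (simp add: nn_integral_completion add.commute)
  finally show ?thesis by simp
qed

definition mollifier :: "real \<Rightarrow> real ^ 'n \<Rightarrow> real" where
  "mollifier d x = exp_cutoff 0 (d\<^sup>2 - x \<bullet> x) / (\<integral>y. exp_cutoff 0 (d\<^sup>2 - y \<bullet> y) \<partial>(lebesgue :: (real^'n) measure))"

lemma exp_cutoff_ball_integrable:
  assumes "d > 0"
  shows "integrable lebesgue (\<lambda>y::real^'n. exp_cutoff 0 (d\<^sup>2 - y \<bullet> y))"
    "(\<integral>y. exp_cutoff 0 (d\<^sup>2 - y \<bullet> y) \<partial>(lebesgue :: (real^'n) measure)) > 0"
proof -
  have b: "ball_bump d = (\<lambda>y::real^'n. complex_of_real (exp_cutoff 0 (d\<^sup>2 - y \<bullet> y)))" by (rule ext) (simp add: ball_bump_def)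
  have "integrable lebesgue (\<lambda>y::real^'n. Re (ball_bump d y))"
    by (rule Bochner_Integration.integrable_Re[OF Cc_integrable_lebesgue(1)[OF test_fun_Cc[OF ball_bump_test_fun[OF assms]]]])
  then show i: "integrable lebesgue (\<lambda>y::real^'n. exp_cutoff 0 (d\<^sup>2 - y \<bullet> y))" unfolding b by simp
  have nn: "exp_cutoff 0 t \<ge> 0" for t by (simp add: exp_cutoff_def)
  show "(\<integral>y. exp_cutoff 0 (d\<^sup>2 - y \<bullet> y) \<partial>(lebesgue :: (real^'n) measure)) > 0"
  proof (rule ccontr)
    assume "\<not> ?thesis"
    moreover have "(\<integral>y. exp_cutoff 0 (d\<^sup>2 - y \<bullet> y) \<partial>(lebesgue :: (real^'n) measure)) \<ge> 0" by (intro Bochner_Integration.integral_nonneg nn)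
    ultimately have "(\<integral>y. exp_cutoff 0 (d\<^sup>2 - y \<bullet> y) \<partial>(lebesgue :: (real^'n) measure)) = 0" by linarith
    then have "AE y in (lebesgue :: (real^'n) measure). exp_cutoff 0 (d\<^sup>2 - y \<bullet> y) = 0"
      using i nn by (subst (asm) integral_nonneg_eq_0_iff_AE) auto
    then have "AE y in (lebesgue :: (real^'n) measure). y \<notin> ball 0 d"
    proof eventually_elim
      case (elim y)
      then show ?case using ball_bump_nonzero[of y d] by (auto simp: ball_bump_def)
    qed
    then have "emeasure lebesgue (ball (0::real^'n) d) = 0"
      by (subst (asm) AE_iff_measurable[OF ball_lebesgue_measurable[of 0 d]]) auto
    then show False using measure_ball_pos[OF assms, of "0::real^'n"] by (simp add: emeasure_ball_eq)
  qed
qed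

lemma mollifier_props:
  assumes d: "d > 0"
  shows "mollifier d (x::real^'n) \<ge> 0" "norm x \<ge> d \<Longrightarrow> mollifier d x = 0"
    "(\<integral>\<^sup>+x. ennreal (mollifier d (x::real^'n)) \<partial>lebesgue) = 1"
    "continuous_on UNIV (mollifier d :: real^'n \<Rightarrow> real)" "integrable lebesgue (mollifier d :: real^'n \<Rightarrow> real)"
    "(\<integral>x. mollifier d (x::real^'n) \<partial>lebesgue) = 1"
    "\<exists>B. \<forall>x::real^'n. mollifier d x \<le> B"
proof -
  define I where "I = (\<integral>y. exp_cutoff 0 (d\<^sup>2 - y \<bullet> y) \<partial>(lebesgue :: (real^'n) measure))"
  have I: "I > 0" unfolding I_def by (rule exp_cutoff_ball_integrable(2)[OF d])
  have m: "mollifier d = (\<lambda>x::real^'n. exp_cutoff 0 (d\<^sup>2 - x \<bullet> x) / I)" by (rule ext) (simp add: mollifier_def I_def)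
  have nn: "exp_cutoff 0 t \<ge> 0" for t by (simp add: exp_cutoff_def)
  show p: "mollifier d x \<ge> 0" for x :: "real ^ 'n" unfolding m using I nn by simp
  show "mollifier d x = 0" if "norm x \<ge> d" for x :: "real ^ 'n"
    using ball_bump_0[of d x] that d by (simp add: m ball_bump_def)
  show i: "integrable lebesgue (mollifier d :: real^'n \<Rightarrow> real)"
    unfolding m by (intro Bochner_Integration.integrable_divide exp_cutoff_ball_integrable(1)[OF d])
  show i1: "(\<integral>x. mollifier d (x::real^'n) \<partial>lebesgue) = 1"
    unfolding m using I by (simp add: I_def[symmetric])
  show "(\<integral>\<^sup>+x. ennreal (mollifier d (x::real^'n)) \<partial>lebesgue) = 1"
    using nn_integral_eq_integral[OF i] p i1 by simp
  have "continuous_on UNIV (\<lambda>x::real^'n. Re (ball_bump d x))"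
    by (intro continuous_intros test_fun_continuous ball_bump_test_fun d)
  then show "continuous_on UNIV (mollifier d :: real^'n \<Rightarrow> real)"
    unfolding m using I by (intro continuous_intros) (auto simp: ball_bump_def)
  show "\<exists>B. \<forall>x::real^'n. mollifier d x \<le> B"
  proof (intro exI[of _ "1 / I"] allI)
    fix x :: "real ^ 'n"
    have "exp_cutoff 0 (d\<^sup>2 - x \<bullet> x) \<le> 1" by (simp add: exp_cutoff_def)
    then show "mollifier d x \<le> 1 / I" unfolding m using I by (intro divide_right_mono) auto
  qed
qed

definition mollify :: "real \<Rightarrow> ('n::finite) cfun \<Rightarrow> 'n cfun" where
  "mollify d h x = (\<integral>y. h y * complex_of_real (mollifier d (y - x)) \<partial>lebesgue)"

lemma mollifier_borel: "d > 0 \<Longrightarrow> (mollifier d :: real^'n \<Rightarrow> real) \<in> borel_measurable borel"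
  by (intro borel_measurable_continuous_onI mollifier_props)

lemma mollify_integrand_integrable:
  fixes h :: "('n::finite) cfun"
  assumes "integrable lebesgue h" "d > 0"
  shows "integrable lebesgue (\<lambda>y. h y * complex_of_real (mollifier d (y - x)))"
proof -
  obtain B where B: "\<And>x::real^'n. mollifier d x \<le> B" using mollifier_props(7)[OF assms(2)] by blast
  show ?thesis
  proof (rule Bochner_Integration.integrable_bound[OF integrable_mult_right[OF integrable_norm[OF assms(1)], of B]])
    have "(\<lambda>y. mollifier d (y - x)) \<in> borel_measurable borel" using mollifier_borel[OF assms(2), where 'n='n] by measurable
    then have "(\<lambda>y. complex_of_real (mollifier d (y - x))) \<in> borel_measurable lebesgue"
      by (intro borel_measurable_lebesgue_of_borel) measurable
    then show "(\<lambda>y. h y * complex_of_real (mollifier d (y - x))) \<in> borel_measurable lebesgue"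
      by (rule borel_measurable_times[OF borel_measurable_integrable[OF assms(1)]])
    show "AE y in lebesgue. norm (h y * complex_of_real (mollifier d (y - x))) \<le> norm (B * norm (h y))"
    proof (intro always_eventually allI)
      fix y
      have "norm (h y) * mollifier d (y - x) \<le> norm (h y) * B" by (intro mult_left_mono B) simp
      then show "norm (h y * complex_of_real (mollifier d (y - x))) \<le> norm (B * norm (h y))"
        using mollifier_props(1)[OF assms(2), of "y - x"] by (simp add: norm_mult mult.commute)
    qed
  qed
qed

lemma mollify_Cc:
  fixes h :: "('n::finite) cfun"
  assumes h: "integrable lebesgue h" "\<And>x. norm x > R \<Longrightarrow> h x = 0" and R: "R > 0" and d: "d > 0"
  shows "mollify d h \<in> Cc"
  unfolding Cc_iff
proof
  obtain B where B: "\<And>x::real^'n. mollifier d x \<le> B" using mollifier_props(7)[OF d] by blast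
  show "continuous_on UNIV (mollify d h)"
    unfolding continuous_on_sequentially
  proof (intro allI ballI impI, elim conjE)
    fix x and a :: "real ^ 'n" assume x: "x \<longlonglongrightarrow> a"
    show "(mollify d h \<circ> x) \<longlonglongrightarrow> mollify d h a"
      unfolding mollify_def o_def
    proof (rule integral_dominated_convergence)
      show "integrable lebesgue (\<lambda>y. B * norm (h y))" using h(1) by simp
      show "(\<lambda>y. h y * complex_of_real (mollifier d (y - a))) \<in> borel_measurable lebesgue"
        "(\<lambda>y. h y * complex_of_real (mollifier d (y - x n))) \<in> borel_measurable lebesgue" for n
        using mollify_integrand_integrable[OF h(1) d] by (rule borel_measurable_integrable)+
      show "AE y in lebesgue. (\<lambda>n. h y * complex_of_real (mollifier d (y - x n))) \<longlonglongrightarrow> h y * complex_of_real (mollifier d (y - a))"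
      proof (intro always_eventually allI tendsto_mult tendsto_const tendsto_of_real)
        fix y
        have "isCont (mollifier d) (y - a)" using mollifier_props(4)[OF d, where 'n='n] by (simp add: continuous_on_eq_continuous_at)
        then show "(\<lambda>n. mollifier d (y - x n)) \<longlonglongrightarrow> mollifier d (y - a)"
          by (rule isCont_tendsto_compose) (intro tendsto_intros x)
      qed
      fix n
      show "AE y in lebesgue. norm (h y * complex_of_real (mollifier d (y - x n))) \<le> B * norm (h y)"
      proof (intro always_eventually allI)
        fix y
        have "norm (h y) * mollifier d (y - x n) \<le> norm (h y) * B" by (intro mult_left_mono B) simp
        then show "norm (h y * complex_of_real (mollifier d (y - x n))) \<le> B * norm (h y)"
          using mollifier_props(1)[OF d, of "y - x n"] by (simp add: norm_mult mult.commute)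
      qed
    qed
  qed
  have "mollify d h x = 0" if "norm x > R + d" for x
  proof -
    have "h y * complex_of_real (mollifier d (y - x)) = 0" for y
    proof (cases "norm y > R")
      case False
      then have "norm (y - x) \<ge> d" using that norm_triangle_ineq2[of x y] by (simp add: norm_minus_commute)
      then show ?thesis using mollifier_props(2)[OF d, of "y - x"] by simp
    qed (use h(2) in simp)
    then show ?thesis unfolding mollify_def by (simp only: Bochner_Integration.integral_zero)
  qed
  then show "\<exists>R>0. \<forall>x. norm x > R \<longrightarrow> mollify d h x = 0" using R d by (intro exI[of _ "R + d"]) auto
qed

lemma mollify_diff:
  assumes "integrable lebesgue h" "integrable lebesgue k" "d > 0"
  shows "mollify d (\<lambda>x. h x - k x) x = mollify d h x - mollify d k x"
  unfolding mollify_def left_diff_distrib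
  by (intro Bochner_Integration.integral_diff mollify_integrand_integrable assms)

text \<open>Interchange the integrals; the kernel is even, so it has mass 1 in either
  variable.\<close>

lemma mollify_L1_le:
  fixes h :: "('n::finite) cfun"
  assumes h: "integrable lebesgue h" and d: "d > 0"
  shows "(\<integral>\<^sup>+x. ennreal (norm (mollify d h x)) \<partial>lebesgue) \<le> (\<integral>\<^sup>+x. ennreal (norm (h x)) \<partial>lebesgue)"
proof -
  interpret pair_sigma_finite "lebesgue :: (real^'n) measure" "lebesgue :: (real^'n) measure"
    by (rule pair_sigma_finite_lebesgue)
  have [measurable]: "(\<lambda>x. x) \<in> measurable (lebesgue :: (real^'n) measure) borel" by (rule lebesgue_id_measurable)
  have [measurable]: "h \<in> borel_measurable lebesgue" using h by auto
  have [measurable]: "mollifier d \<in> borel_measurable (borel :: (real^'n) measure)" by (rule mollifier_borel[OF d])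
  define H where "H x y = ennreal (mollifier d (y - x))" for x y :: "real ^ 'n"
  have H1: "(\<integral>\<^sup>+x. H x y \<partial>lebesgue) = 1" for y
  proof -
    have sym: "mollifier d (y - x) = mollifier d (x - y)" for x :: "real ^ 'n"
    proof -
      have "(y - x) \<bullet> (y - x) = (x - y) \<bullet> (x - y)" by (simp add: inner_diff_left inner_diff_right inner_commute)
      then show ?thesis unfolding mollifier_def by (simp only:)
    qed
    have "(\<integral>\<^sup>+x. H x y \<partial>lebesgue) = (\<integral>\<^sup>+x. ennreal (mollifier d (x + (- y))) \<partial>lebesgue)" by (simp add: H_def sym)
    also have "\<dots> = (\<integral>\<^sup>+x. ennreal (mollifier d (x :: real^'n)) \<partial>lebesgue)"
      by (rule nn_integral_lebesgue_translation) measurable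
    finally show ?thesis using mollifier_props(3)[OF d, where 'n='n] by simp
  qed
  have "(\<integral>\<^sup>+x. ennreal (norm (mollify d h x)) \<partial>lebesgue) \<le> (\<integral>\<^sup>+x. (\<integral>\<^sup>+y. ennreal (norm (h y)) * H x y \<partial>lebesgue) \<partial>lebesgue)"
  proof (rule nn_integral_mono)
    fix x
    have "ennreal (norm (mollify d h x)) \<le> (\<integral>\<^sup>+y. ennreal (norm (h y * complex_of_real (mollifier d (y - x)))) \<partial>lebesgue)"
      unfolding mollify_def by (rule integral_norm_bound_ennreal[OF mollify_integrand_integrable[OF h d]])
    also have "\<dots> = (\<integral>\<^sup>+y. ennreal (norm (h y)) * H x y \<partial>lebesgue)"
      by (intro nn_integral_cong) (simp add: H_def norm_mult abs_of_nonneg[OF mollifier_props(1)[OF d]] ennreal_mult[OF norm_ge_zero mollifier_props(1)[OF d]])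
    finally show "ennreal (norm (mollify d h x)) \<le> (\<integral>\<^sup>+y. ennreal (norm (h y)) * H x y \<partial>lebesgue)" .
  qed
  also have "\<dots> = (\<integral>\<^sup>+y. (\<integral>\<^sup>+x. ennreal (norm (h y)) * H x y \<partial>lebesgue) \<partial>lebesgue)"
    unfolding H_def by (rule Fubini'[symmetric]) measurable
  also have "\<dots> = (\<integral>\<^sup>+y. ennreal (norm (h y)) \<partial>lebesgue)"
  proof (intro nn_integral_cong)
    fix y
    have "(\<integral>\<^sup>+x. ennreal (norm (h y)) * H x y \<partial>lebesgue) = ennreal (norm (h y)) * (\<integral>\<^sup>+x. H x y \<partial>lebesgue)"
      unfolding H_def by (intro nn_integral_cmult) measurable
    then show "(\<integral>\<^sup>+x. ennreal (norm (h y)) * H x y \<partial>lebesgue) = ennreal (norm (h y))" by (simp add: H1)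
  qed
  finally show ?thesis .
qed

lemma mollify_uniform:
  fixes H :: "('n::finite) cfun"
  assumes H: "integrable lebesgue H" and d: "d > 0" and u: "\<And>x y. dist x y < d \<Longrightarrow> norm (H x - H y) \<le> e"
  shows "norm (mollify d H x - H x) \<le> e"
proof -
  have e: "e \<ge> 0" using u[of 0 0] d by simp
  have ki: "integrable lebesgue (\<lambda>y. mollifier d (y - x))"
  proof -
    have "integrable (distr lborel borel ((+) (- x))) (mollifier d)"
      using mollifier_props(5)[OF d, where 'n='n] mollifier_borel[OF d, where 'n='n]
        integrable_completion[of "mollifier d" "lborel :: (real^'n) measure"]
      by (simp add: lborel_distr_plus)
    then have "integrable lborel (\<lambda>y. mollifier d (- x + y))"
      using mollifier_borel[OF d, where 'n='n] by (subst (asm) integrable_distr_eq) auto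
    moreover have "(\<lambda>y. mollifier d (y - x)) \<in> borel_measurable borel" using mollifier_borel[OF d, where 'n='n] by measurable
    ultimately show ?thesis by (subst integrable_completion) auto
  qed
  have k1: "(\<integral>y. mollifier d (y - x) \<partial>lebesgue) = 1"
    using integral_lebesgue_translation[OF mollifier_borel[OF d], of "- x"] mollifier_props(6)[OF d, where 'n='n] by simp
  have c1: "(\<integral>y. H x * complex_of_real (mollifier d (y - x)) \<partial>lebesgue) = H x"
    using k1 by (simp add: integral_complex_of_real)
  have ci: "integrable lebesgue (\<lambda>y. H x * complex_of_real (mollifier d (y - x)))"
    using ki by (intro integrable_mult_right integrable_of_real)
  have eq: "mollify d H x - H x = (\<integral>y. H y * complex_of_real (mollifier d (y - x)) - H x * complex_of_real (mollifier d (y - x)) \<partial>lebesgue)"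
    using Bochner_Integration.integral_diff[OF mollify_integrand_integrable[OF H d, of x] ci] by (simp only: mollify_def c1)
  have "norm (mollify d H x - H x) \<le> (\<integral>y. e * mollifier d (y - x) \<partial>lebesgue)"
    unfolding eq
  proof (rule Bochner_Integration.integral_norm_bound_integral)
    show "integrable lebesgue (\<lambda>y. H y * complex_of_real (mollifier d (y - x)) - H x * complex_of_real (mollifier d (y - x)))"
      by (intro Bochner_Integration.integrable_diff mollify_integrand_integrable H d ci)
    show "integrable lebesgue (\<lambda>y. e * mollifier d (y - x))" using ki by simp
    fix y :: "real ^ 'n"
    have "norm (H y * complex_of_real (mollifier d (y - x)) - H x * complex_of_real (mollifier d (y - x))) = norm (H y - H x) * mollifier d (y - x)"
      using mollifier_props(1)[OF d, of "y - x"] by (simp add: norm_mult flip: left_diff_distrib)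
    also have "\<dots> \<le> e * mollifier d (y - x)"
    proof (cases "dist y x < d")
      case True
      then show ?thesis using u mollifier_props(1)[OF d] by (intro mult_right_mono) auto
    qed (use mollifier_props(2)[OF d, of "y - x"] in \<open>simp add: dist_norm\<close>)
    finally show "norm (H y * complex_of_real (mollifier d (y - x)) - H x * complex_of_real (mollifier d (y - x))) \<le> e * mollifier d (y - x)" .
  qed
  also have "\<dots> = e" using k1 by simp
  finally show ?thesis .
qed

declare ball_lebesgue_measurable [measurable del]

lemma mollify_translate:
  fixes h :: "('n::finite) cfun"
  assumes "h \<in> borel_measurable borel" "d > 0"
  shows "mollify d h x = (\<integral>z. h (x + z) * complex_of_real (mollifier d z) \<partial>lebesgue)"
proof -
  have "(\<lambda>y. h y * complex_of_real (mollifier d (y - x))) \<in> borel_measurable borel"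
    using assms(1) mollifier_borel[OF assms(2), where 'n='n] by measurable
  from integral_lebesgue_translation[OF this, of x] show ?thesis by (simp add: mollify_def)
qed

text \<open>Mollification averages translates, and the oscillation of a translate on one ball is the
  oscillation of \<open>h\<close> on another ball of the same radius. The bound therefore does not
  depend on the width \<open>d\<close>, which remains free for the L1 approximation.\<close>

lemma mollify_osc_le:
  fixes h :: "('n::finite) cfun"
  assumes hb: "h \<in> borel_measurable borel" and hM: "\<And>x. norm (h x) \<le> M" and hi: "integrable lebesgue h"
    and d: "d > 0" and r: "r > 0"
    and osc: "\<And>c. \<exists>a. (\<integral>\<^sup>+x\<in>ball c r. ennreal (norm (h x - a)) \<partial>lebesgue) \<le> ennreal t * emeasure lebesgue (ball c r)"
  shows "\<exists>A. (\<integral>\<^sup>+x\<in>ball c r. ennreal (norm (mollify d h x - A)) \<partial>lebesgue) \<le> ennreal (2 * t) * emeasure lebesgue (ball c r)"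
proof -
  let ?V = "emeasure lebesgue (ball c r)"
  have [measurable]: "h \<in> borel_measurable borel" by (rule hb)
  have K[measurable]: "mollifier d \<in> borel_measurable (borel :: (real^'n) measure)" by (rule mollifier_borel[OF d])
  define V where "V = measure lebesgue (ball c r)"
  \<comment> \<open>The constant subtracted from the translate by \<open>z\<close> must be
    measurable in \<open>z\<close>, so the mean over the ball is taken instead of the constant that
    the hypothesis provides. This accounts for the factor 2 in the conclusion.\<close>
  define A where "A z = (1 / V) *\<^sub>R (\<integral>x. indicator (ball c r) x *\<^sub>R h (x + z) \<partial>lborel)" for z
  have bb[measurable]: "ball (c'::real^'n) r \<in> sets borel" for c' by simp
  have add: "(\<lambda>p. snd p + fst p) \<in> measurable (borel \<Otimes>\<^sub>M lborel) (borel :: (real^'n) measure)"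
    by (rule borel_measurable_add) (simp_all add: measurable_fst measurable_snd'' measurable_fst'')
  have ind: "(\<lambda>p. indicat_real (ball c r) (snd p)) \<in> borel_measurable ((borel :: (real^'n) measure) \<Otimes>\<^sub>M lborel)"
    by (rule measurable_compose[OF measurable_snd]) (simp add: bb)
  have Am[measurable]: "A \<in> borel_measurable borel"
    unfolding A_def
    by (intro borel_measurable_scaleR borel_measurable_const lborel.borel_measurable_lebesgue_integral)
       (simp add: split_beta borel_measurable_scaleR[OF ind measurable_compose[OF add hb]])
  have hz: "(\<lambda>x. h (x + z)) \<in> borel_measurable borel" for z by measurable
  have hzL: "(\<lambda>x. h (x + z)) \<in> L1loc" for z
    using hM borel_measurable_lebesgue_of_borel[OF hz] by (intro Linf_L1loc) (auto simp: Linf_space_def)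
  have Aball: "ball_mean (\<lambda>x. h (x + z)) c r = A z" for z
  proof -
    have "(\<lambda>x. indicator (ball c r) x *\<^sub>R h (x + z)) \<in> borel_measurable borel" by measurable
    then have "(\<integral>x. indicator (ball c r) x *\<^sub>R h (x + z) \<partial>lebesgue) = (\<integral>x. indicator (ball c r) x *\<^sub>R h (x + z) \<partial>lborel)"
      by (intro integral_completion) simp
    then show ?thesis by (simp add: ball_mean_def A_def V_def set_lebesgue_integral_def)
  qed
  have oscz: "(\<integral>\<^sup>+x\<in>ball c r. ennreal (norm (h (x + z) - A z)) \<partial>lebesgue) \<le> ennreal (2 * t) * ?V" for z
  proof -
    obtain a where a: "(\<integral>\<^sup>+x\<in>ball (c + z) r. ennreal (norm (h x - a)) \<partial>lebesgue) \<le> ennreal t * emeasure lebesgue (ball (c + z) r)"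
      using osc by blast
    have "(\<lambda>x. ennreal (norm (h x - a)) * indicator (ball (c + z) r) x) \<in> borel_measurable borel" by measurable
    from nn_integral_lebesgue_translation[OF this, of z]
    have "(\<integral>\<^sup>+x\<in>ball (c + z) r. ennreal (norm (h x - a)) \<partial>lebesgue)
        = (\<integral>\<^sup>+x. ennreal (norm (h (x + z) - a)) * indicator (ball (c + z) r) (x + z) \<partial>lebesgue)" by (rule sym)
    also have "\<dots> = (\<integral>\<^sup>+x\<in>ball c r. ennreal (norm (h (x + z) - a)) \<partial>lebesgue)"
      by (intro nn_integral_cong) (simp add: indicator_def dist_norm)
    finally have a': "(\<integral>\<^sup>+x\<in>ball c r. ennreal (norm (h (x + z) - a)) \<partial>lebesgue) \<le> ennreal t * emeasure lebesgue (ball (c + z) r)"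
      using a by simp
    have Vz: "emeasure lebesgue (ball (c + z) r) = ?V"
    proof -
      have "emeasure lebesgue (ball (c + z) r) = (\<integral>\<^sup>+x. indicator (ball (c + z) r) x \<partial>lebesgue)"
        by (rule nn_integral_indicator[symmetric, OF ball_lebesgue_measurable])
      also have "\<dots> = (\<integral>\<^sup>+x. indicator (ball (c + z) r) (x + z) \<partial>lebesgue)"
        by (rule nn_integral_lebesgue_translation[symmetric]) measurable
      also have "\<dots> = (\<integral>\<^sup>+x. indicator (ball c r) x \<partial>lebesgue)"
        by (intro nn_integral_cong) (simp add: indicator_def dist_norm)
      also have "\<dots> = ?V" by (rule nn_integral_indicator[OF ball_lebesgue_measurable])
      finally show ?thesis .
    qed
    have "(\<integral>\<^sup>+x\<in>ball c r. ennreal (norm (h (x + z) - A z)) \<partial>lebesgue) \<le> 2 * (\<integral>\<^sup>+x\<in>ball c r. ennreal (norm (h (x + z) - a)) \<partial>lebesgue)"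
      using osc_le_twice_const[OF hzL r, of z c a] by (simp only: Aball)
    also have "\<dots> \<le> 2 * (ennreal t * ?V)" using a' unfolding Vz by (intro mult_left_mono) auto
    also have "\<dots> = ennreal (2 * t) * ?V" using ennreal_mult'[of 2 t] by (simp add: mult.assoc)
    finally show ?thesis .
  qed
  have AM: "norm (A z) \<le> 2 * M" for z
  proof -
    have V: "V > 0" unfolding V_def by (rule measure_ball_pos[OF r])
    have Mn: "M \<ge> 0" using hM[of 0] norm_ge_zero order_trans by blast
    have e: "emeasure lborel (ball c r) = ennreal V" using emeasure_ball_eq[of c r] by (simp add: V_def)
    have "norm (\<integral>x. indicator (ball c r) x *\<^sub>R h (x + z) \<partial>lborel) \<le> (\<integral>x. M * indicator (ball c r) x \<partial>lborel)"
    proof (rule Bochner_Integration.integral_norm_bound_integral)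
      show I: "integrable lborel (\<lambda>x. M * indicator (ball c r) x)"
        using e by (intro integrable_mult_right integrable_real_indicator) auto
      show "integrable lborel (\<lambda>x. indicator (ball c r) x *\<^sub>R h (x + z))"
        by (rule Bochner_Integration.integrable_bound[OF I]) (use hM Mn in \<open>auto simp: indicator_def intro: order_trans\<close>)
      show "norm (indicator (ball c r) x *\<^sub>R h (x + z)) \<le> M * indicator (ball c r) x" for x
        using hM by (auto simp: indicator_def)
    qed
    also have "\<dots> = M * V" using e by (simp add: V_def measure_def)
    finally have "norm (A z) \<le> (1 / V) * (M * V)" unfolding A_def norm_scaleR using V by (simp add: pos_divide_le_eq)
    then show ?thesis using V Mn by simp
  qed
  define k where "k z = complex_of_real (mollifier d z)" for z :: "real ^ 'n"
  have ki: "integrable lebesgue k" unfolding k_def using mollifier_props(5)[OF d, where 'n='n] by (intro integrable_of_real)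
  have bi: "integrable lebesgue (\<lambda>z. w z * k z)" if "w \<in> borel_measurable borel" "\<And>z. norm (w z) \<le> B" for w B
  proof (rule Bochner_Integration.integrable_bound[OF integrable_mult_right[OF integrable_norm[OF ki], of B]])
    show "(\<lambda>z. w z * k z) \<in> borel_measurable lebesgue"
      using borel_measurable_lebesgue_of_borel[OF that(1)] ki by (intro borel_measurable_times) auto
    show "AE z in lebesgue. norm (w z * k z) \<le> norm (B * norm (k z))"
    proof (intro always_eventually allI)
      fix z have "norm (w z) * norm (k z) \<le> B * norm (k z)" by (intro mult_right_mono that) simp
      then show "norm (w z * k z) \<le> norm (B * norm (k z))" by (simp add: norm_mult)
    qed
  qed
  define A0 where "A0 = (\<integral>z. A z * k z \<partial>lebesgue)"
  define Q where "Q x z = ennreal (norm (h (x + z) - A z)) * ennreal (mollifier d z)" for x z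
  have pt: "ennreal (norm (mollify d h x - A0)) \<le> (\<integral>\<^sup>+z. Q x z \<partial>lborel)" for x
  proof -
    have i1: "integrable lebesgue (\<lambda>z. h (x + z) * k z)" by (rule bi) (measurable, rule hM)
    have i2: "integrable lebesgue (\<lambda>z. A z * k z)" by (rule bi) (measurable, rule AM)
    have eq: "mollify d h x - A0 = (\<integral>z. h (x + z) * k z - A z * k z \<partial>lebesgue)"
      unfolding mollify_translate[OF hb d] A0_def k_def[symmetric] by (rule Bochner_Integration.integral_diff[OF i1 i2, symmetric])
    have "ennreal (norm (mollify d h x - A0)) \<le> (\<integral>\<^sup>+z. ennreal (norm (h (x + z) * k z - A z * k z)) \<partial>lebesgue)"
      unfolding eq by (intro integral_norm_bound_ennreal Bochner_Integration.integrable_diff i1 i2)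
    also have "\<dots> = (\<integral>\<^sup>+z. Q x z \<partial>lebesgue)"
      by (intro nn_integral_cong)
         (simp add: Q_def k_def norm_mult abs_of_nonneg[OF mollifier_props(1)[OF d]] ennreal_mult[OF norm_ge_zero mollifier_props(1)[OF d]] flip: left_diff_distrib)
    also have "\<dots> = (\<integral>\<^sup>+z. Q x z \<partial>lborel)" by (rule nn_integral_completion)
    finally show ?thesis .
  qed
  \<comment> \<open>The double integral is taken over \<open>lborel\<close>, where the integrand is
    jointly Borel; completion does not change the value of the integral.\<close>
  have "(\<integral>\<^sup>+x\<in>ball c r. ennreal (norm (mollify d h x - A0)) \<partial>lebesgue) = (\<integral>\<^sup>+x\<in>ball c r. ennreal (norm (mollify d h x - A0)) \<partial>lborel)"
    by (rule nn_integral_completion)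
  also have "\<dots> \<le> (\<integral>\<^sup>+x. (\<integral>\<^sup>+z. Q x z * indicator (ball c r) x \<partial>lborel) \<partial>lborel)"
  proof (rule nn_integral_mono)
    fix x
    have "(\<integral>\<^sup>+z. Q x z * indicator (ball c r) x \<partial>lborel) = (\<integral>\<^sup>+z. Q x z \<partial>lborel) * indicator (ball c r) x"
      unfolding Q_def by (rule nn_integral_multc) measurable
    then show "ennreal (norm (mollify d h x - A0)) * indicator (ball c r) x \<le> (\<integral>\<^sup>+z. Q x z * indicator (ball c r) x \<partial>lborel)"
      using mult_right_mono[OF pt[of x]] by simp
  qed
  also have "\<dots> = (\<integral>\<^sup>+z. (\<integral>\<^sup>+x. Q x z * indicator (ball c r) x \<partial>lborel) \<partial>lborel)"
    unfolding Q_def by (rule lborel_pair.Fubini'[symmetric]) measurable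
  also have "\<dots> \<le> (\<integral>\<^sup>+z. (ennreal (2 * t) * ?V) * ennreal (mollifier d z) \<partial>(lborel :: (real^'n) measure))"
  proof (rule nn_integral_mono)
    fix z
    have "(\<integral>\<^sup>+x. Q x z * indicator (ball c r) x \<partial>lborel) = (\<integral>\<^sup>+x. (ennreal (norm (h (x + z) - A z)) * indicator (ball c r) x) * ennreal (mollifier d z) \<partial>lborel)"
      by (simp add: Q_def mult_ac)
    also have "\<dots> = (\<integral>\<^sup>+x\<in>ball c r. ennreal (norm (h (x + z) - A z)) \<partial>lborel) * ennreal (mollifier d z)"
      by (rule nn_integral_multc) measurable
    also have "(\<integral>\<^sup>+x\<in>ball c r. ennreal (norm (h (x + z) - A z)) \<partial>lborel) = (\<integral>\<^sup>+x\<in>ball c r. ennreal (norm (h (x + z) - A z)) \<partial>lebesgue)"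
      by (rule nn_integral_completion[symmetric])
    also have "\<dots> * ennreal (mollifier d z) \<le> (ennreal (2 * t) * ?V) * ennreal (mollifier d z)"
      by (intro mult_right_mono oscz) auto
    finally show "(\<integral>\<^sup>+x. Q x z * indicator (ball c r) x \<partial>lborel) \<le> (ennreal (2 * t) * ?V) * ennreal (mollifier d z)" .
  qed
  also have "\<dots> = (ennreal (2 * t) * ?V) * (\<integral>\<^sup>+z. ennreal (mollifier d z) \<partial>(lborel :: (real^'n) measure))" by (rule nn_integral_cmult) measurable
  also have "(\<integral>\<^sup>+z. ennreal (mollifier d z) \<partial>(lborel :: (real^'n) measure)) = (1 :: ennreal)"
    using mollifier_props(3)[OF d, where 'n='n] by (simp add: nn_integral_completion)
  finally show ?thesis by (intro exI[of _ A0]) simp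
qed

text \<open>Replace \<open>h\<close> by a test function \<open>H\<close> near it in L1. The error
  \<open>h - H\<close> and its mollification are both small, as mollification does not increase the
  L1 norm, and \<open>H\<close> differs from its mollification by a uniformly small amount on a
  bounded set.\<close>

lemma mollify_tendsto_L1:
  fixes h :: "('n::finite) cfun"
  assumes h: "h \<in> borel_measurable lebesgue" "\<And>x. norm (h x) \<le> M" "\<And>x. norm x > R \<Longrightarrow> h x = 0" and R: "R > 0" and e: "e > 0"
  shows "\<exists>d>0. (\<integral>\<^sup>+x. ennreal (norm (h x - mollify d h x)) \<partial>lebesgue) \<le> ennreal e"
proof -
  have hi: "integrable lebesgue h"
    by (rule bounded_ball_support_integrable[OF h(1), of M R]) (use h in auto)
  obtain H where H: "H \<in> test_fun" "\<And>x. norm x > R + 2 \<Longrightarrow> H x = 0" "Lp_modular 1 (\<lambda>x. H x - h x) < e / 4"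
    using Lp_dense_bounded[OF h(1,2) R h(3), of 1 "e / 4"] e by auto
  have Hi: "integrable lebesgue H" by (rule Cc_integrable_lebesgue(1)[OF test_fun_Cc[OF H(1)]])
  \<comment> \<open>\<open>H\<close> vanishes beyond \<open>R + 2\<close> and mollification with
    width at most 1 enlarges the support by at most 1.\<close>
  define W where "W = measure lebesgue (cball (0::real^'n) (R + 3))"
  define s where "s = e / 4 / (W + 1)"
  have W: "W \<ge> 0" by (simp add: W_def)
  have s: "s > 0" "s * W \<le> e / 4"
  proof -
    show "s > 0" using e W by (simp add: s_def)
    have "s * W \<le> s * (W + 1)" using \<open>s > 0\<close> by (intro mult_left_mono) auto
    also have "\<dots> = e / 4"
    proof -
      have "e / 4 / w * w = e / 4" if "w > 0" for w :: real using that by simp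
      from this[of "W + 1"] show ?thesis unfolding s_def using W by linarith
    qed
    finally show "s * W \<le> e / 4" .
  qed
  obtain d0 where d0: "d0 > 0" "\<And>x y. dist x y < d0 \<Longrightarrow> norm (H x - H y) < s"
    using Cc_uniformly_continuous[OF test_fun_Cc[OF H(1)] s(1)] by blast
  define d where "d = min d0 1"
  have d: "d > 0" "d \<le> 1" using d0 by (auto simp: d_def)
  have near: "norm (mollify d H x - H x) \<le> s" for x
    using d0(2) by (intro mollify_uniform[OF Hi d(1)]) (auto simp: d_def intro: less_imp_le)
  have far: "mollify d H x - H x = 0" if "norm x > R + 3" for x
  proof -
    have "H y * complex_of_real (mollifier d (y - x)) = 0" for y
    proof (cases "norm y > R + 2")
      case False
      then have "norm (y - x) \<ge> d" using that d(2) norm_triangle_ineq2[of x y] by (simp add: norm_minus_commute)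
      then show ?thesis using mollifier_props(2)[OF d(1), of "y - x"] by simp
    qed (use H(2) in simp)
    then have "mollify d H x = 0" unfolding mollify_def by (simp only: Bochner_Integration.integral_zero)
    then show ?thesis using H(2)[of x] that by simp
  qed
  have mH: "mollify d H \<in> borel_measurable lebesgue"
    by (rule Cc_integrable_lebesgue(2)[OF mollify_Cc[where R="R + 2", OF Hi H(2) _ d(1)]]) (use R in auto)
  have dm: "mollify d (\<lambda>x. h x - H x) \<in> borel_measurable lebesgue"
  proof (rule Cc_integrable_lebesgue(2)[OF mollify_Cc[where R="R + 2"]])
    show "integrable lebesgue (\<lambda>x. h x - H x)" using hi Hi by simp
    show "R + 2 < norm x \<Longrightarrow> h x - H x = 0" for x using h(3)[of x] H(2)[of x] R by simp
  qed (use R d in auto)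
  have hH: "(\<integral>\<^sup>+x. ennreal (norm (h x - H x)) \<partial>lebesgue) \<le> ennreal (e / 4)"
  proof -
    have "(\<integral>\<^sup>+x. ennreal (norm (h x - H x)) \<partial>lebesgue) = ennreal (\<integral>x. norm (h x - H x) \<partial>lebesgue)"
      using hi Hi by (intro nn_integral_eq_integral) auto
    also have "(\<integral>x. norm (h x - H x) \<partial>lebesgue) = Lp_modular 1 (\<lambda>x. H x - h x)"
      by (simp add: Lp_modular_def norm_minus_commute)
    finally show ?thesis using H(3) by (simp add: ennreal_leI)
  qed
  have "(\<integral>\<^sup>+x. ennreal (norm (h x - mollify d h x)) \<partial>lebesgue)
    \<le> (\<integral>\<^sup>+x. ennreal (norm (h x - H x)) + (ennreal (norm (mollify d (\<lambda>x. h x - H x) x)) + ennreal s * indicator (cball 0 (R + 3)) x) \<partial>lebesgue)"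
  proof (rule nn_integral_mono)
    fix x
    have split: "h x - mollify d h x = (h x - H x) - mollify d (\<lambda>x. h x - H x) x - (mollify d H x - H x)"
      using mollify_diff[OF hi Hi d(1), of x] by simp
    have "norm (a - b - c) \<le> norm a + (norm b + norm c)" for a b c :: complex
      using norm_triangle_ineq4[of a b] norm_triangle_ineq4[of "a - b" c] by linarith
    from this[of "h x - H x" "mollify d (\<lambda>x. h x - H x) x" "mollify d H x - H x"]
    have "norm (h x - mollify d h x) \<le> norm (h x - H x) + (norm (mollify d (\<lambda>x. h x - H x) x) + norm (mollify d H x - H x))"
      unfolding split[symmetric] .
    also have "\<dots> \<le> norm (h x - H x) + (norm (mollify d (\<lambda>x. h x - H x) x) + s * indicator (cball 0 (R + 3)) x)"
      using near[of x] far[of x] by (intro add_left_mono) (auto simp: indicator_def)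
    finally have "ennreal (norm (h x - mollify d h x)) \<le> ennreal (norm (h x - H x)) + ennreal (norm (mollify d (\<lambda>x. h x - H x) x) + s * indicator (cball 0 (R + 3)) x)"
      using s by (intro ennreal_le_plus) (auto simp: indicator_def)
    also have "ennreal (norm (mollify d (\<lambda>x. h x - H x) x) + s * indicator (cball 0 (R + 3)) x) = ennreal (norm (mollify d (\<lambda>x. h x - H x) x)) + ennreal s * indicator (cball 0 (R + 3)) x"
      using s by (auto simp: indicator_def)
    finally show "ennreal (norm (h x - mollify d h x)) \<le> ennreal (norm (h x - H x)) + (ennreal (norm (mollify d (\<lambda>x. h x - H x) x)) + ennreal s * indicator (cball 0 (R + 3)) x)" .
  qed
  also have "\<dots> = (\<integral>\<^sup>+x. ennreal (norm (h x - H x)) \<partial>lebesgue) + ((\<integral>\<^sup>+x. ennreal (norm (mollify d (\<lambda>x. h x - H x) x)) \<partial>lebesgue) + ennreal s * emeasure lebesgue (cball (0::real^'n) (R + 3)))"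
  proof -
    have [measurable]: "(\<lambda>x. ennreal (norm (h x - H x))) \<in> borel_measurable lebesgue" "(\<lambda>x. ennreal (norm (mollify d (\<lambda>x. h x - H x) x))) \<in> borel_measurable lebesgue"
      "cball (0::real^'n) (R + 3) \<in> sets lebesgue"
      using norm_diff_const_measurable[OF dm, of 0] norm_diff_const_measurable[of "\<lambda>x. h x - H x" lebesgue 0] hi Hi by auto
    show ?thesis by (subst nn_integral_add, measurable, subst nn_integral_add, measurable) (simp add: nn_integral_cmult_indicator)
  qed
  also have "\<dots> \<le> ennreal (e / 4) + (ennreal (e / 4) + ennreal (e / 4))"
  proof (intro add_mono hH)
    have "(\<integral>\<^sup>+x. ennreal (norm (mollify d (\<lambda>x. h x - H x) x)) \<partial>lebesgue) \<le> (\<integral>\<^sup>+x. ennreal (norm (h x - H x)) \<partial>lebesgue)"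
      using hi Hi by (intro mollify_L1_le d) simp
    then show "(\<integral>\<^sup>+x. ennreal (norm (mollify d (\<lambda>x. h x - H x) x)) \<partial>lebesgue) \<le> ennreal (e / 4)" using hH by (rule order_trans)
    have "emeasure lebesgue (cball (0::real^'n) (R + 3)) = ennreal W"
      unfolding W_def using emeasure_lborel_cball_finite[of "0::real^'n" "R + 3"]
      by (intro emeasure_eq_ennreal_measure) (auto simp: top.not_eq_extremum)
    then have "ennreal s * emeasure lebesgue (cball (0::real^'n) (R + 3)) = ennreal (s * W)" using s W by (simp only: ennreal_mult less_imp_le)
    also have "\<dots> \<le> ennreal (e / 4)" by (rule ennreal_leI[OF s(2)])
    finally show "ennreal s * emeasure lebesgue (cball (0::real^'n) (R + 3)) \<le> ennreal (e / 4)" .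
  qed
  also have "\<dots> = ennreal (e / 4 + (e / 4 + e / 4))" using e by (simp add: ennreal_plus[symmetric] del: ennreal_plus)
  also have "\<dots> \<le> ennreal e" using e by (intro ennreal_leI) simp
  finally show ?thesis using d(1) by blast
qed

lemma measure_ball_shift: "measure lebesgue (ball (c::real^'n) r) = measure lebesgue (ball (0::real^'n) r)"
proof (cases "r > 0")
  case True
  then show ?thesis using content_ball[of r c] content_ball[of r "0::real^'n"] by simp
next
  case False
  then have e: "ball c r = {}" "ball (0::real^'n) r = {}" by auto
  show ?thesis unfolding e ..
qed

text \<open>Balls below the radius \<open>r0\<close> are handled by the oscillations of
  \<open>h\<close> and of its mollification, both small whatever the width. On larger balls the mean
  oscillation of the difference is at most twice its L1 norm divided by the volume of the ball of
  radius \<open>r0\<close>, and the width is chosen for this.\<close>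

lemma VMO_of_vanishing_osc_borel:
  fixes h :: "('n::finite) cfun"
  assumes hb: "h \<in> borel_measurable borel" and hM: "\<And>x. norm (h x) \<le> M" and hR: "\<And>x. norm x > R \<Longrightarrow> h x = 0"
    and R: "R > 0" and osc: "vanishing_osc h" and e: "e > 0"
  shows "\<exists>g\<in>Cc. BMO_norm (\<lambda>x. h x - g x) \<le> ennreal e"
proof -
  have hm: "h \<in> borel_measurable lebesgue" by (rule borel_measurable_lebesgue_of_borel[OF hb])
  have hi: "integrable lebesgue h"
    by (rule bounded_ball_support_integrable[OF hm, of M R]) (use hM hR in auto)
  \<comment> \<open>On a small ball \<open>h\<close> contributes \<open>t\<close> and the
    mollification \<open>2 * t\<close>; passing from these constants to the mean doubles the sum,
    giving \<open>6 * t = e\<close>.\<close>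
  define t where "t = e / 6"
  have t: "t > 0" using e by (simp add: t_def)
  obtain r0 where r0: "r0 > 0" "\<And>c r. 0 < r \<Longrightarrow> r < r0 \<Longrightarrow>
      \<exists>a. (\<integral>\<^sup>+x\<in>ball c r. ennreal (norm (h x - a)) \<partial>lebesgue) \<le> ennreal t * emeasure lebesgue (ball c r)"
    using osc t unfolding vanishing_osc_def by meson
  define V0 where "V0 = measure lebesgue (ball (0::real^'n) r0)"
  have V0: "V0 > 0" unfolding V0_def by (rule measure_ball_pos[OF r0(1)])
  \<comment> \<open>The factor \<open>1 / 2\<close> compensates the doubling in the passage from the
    constant 0 to the mean on a large ball.\<close>
  obtain d where d: "d > 0" "(\<integral>\<^sup>+x. ennreal (norm (h x - mollify d h x)) \<partial>lebesgue) \<le> ennreal (e / 2 * V0)"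
    using mollify_tendsto_L1[OF hm hM hR R, of "e / 2 * V0"] e V0 by auto
  define g where "g = mollify d h"
  have g: "g \<in> Cc" unfolding g_def by (rule mollify_Cc[OF hi hR R d(1)])
  have gm: "g \<in> borel_measurable lebesgue" by (rule Cc_integrable_lebesgue(2)[OF g])
  have uL: "(\<lambda>x. h x - g x) \<in> L1loc"
    by (intro integrable_imp_L1loc Bochner_Integration.integrable_diff hi Cc_integrable_lebesgue(1)[OF g])
  have um: "(\<lambda>x. h x - g x) \<in> borel_measurable lebesgue" by (intro borel_measurable_diff hm gm)
  have "(\<integral>\<^sup>+x\<in>ball c r. ennreal (norm (h x - g x - ball_mean (\<lambda>x. h x - g x) c r)) \<partial>lebesgue) \<le> ennreal e * emeasure lebesgue (ball c r)"
    if r: "r > 0" for c r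
  proof (cases "r < r0")
    case True
    let ?V = "emeasure lebesgue (ball c r)"
    obtain a where a: "(\<integral>\<^sup>+x\<in>ball c r. ennreal (norm (h x - a)) \<partial>lebesgue) \<le> ennreal t * ?V" using r0(2)[OF r True] by blast
    obtain A where A: "(\<integral>\<^sup>+x\<in>ball c r. ennreal (norm (g x - A)) \<partial>lebesgue) \<le> ennreal (2 * t) * ?V"
      unfolding g_def using mollify_osc_le[OF hb hM hi d(1) r r0(2)[OF r True]] by blast
    have "(\<integral>\<^sup>+x\<in>ball c r. ennreal (norm (h x - g x - (a - A))) \<partial>lebesgue)
        \<le> (\<integral>\<^sup>+x. ennreal (norm (h x - a)) * indicator (ball c r) x + ennreal (norm (g x - A)) * indicator (ball c r) x \<partial>lebesgue)"
    proof (intro nn_integral_mono)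
      fix x
      have "norm (h x - g x - (a - A)) = norm ((h x - a) - (g x - A))" by (simp add: algebra_simps)
      also have "\<dots> \<le> norm (h x - a) + norm (g x - A)" by (rule norm_triangle_ineq4)
      finally have "ennreal (norm (h x - g x - (a - A))) \<le> ennreal (norm (h x - a)) + ennreal (norm (g x - A))"
        by (rule ennreal_le_plus) auto
      then show "ennreal (norm (h x - g x - (a - A))) * indicator (ball c r) x
         \<le> ennreal (norm (h x - a)) * indicator (ball c r) x + ennreal (norm (g x - A)) * indicator (ball c r) x"
        by (auto simp: indicator_def)
    qed
    also have "\<dots> = (\<integral>\<^sup>+x\<in>ball c r. ennreal (norm (h x - a)) \<partial>lebesgue) + (\<integral>\<^sup>+x\<in>ball c r. ennreal (norm (g x - A)) \<partial>lebesgue)"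
      by (intro nn_integral_add borel_measurable_times_ennreal norm_diff_const_measurable hm gm borel_measurable_indicator ball_lebesgue_measurable)
    also have "\<dots> \<le> ennreal t * ?V + ennreal (2 * t) * ?V" by (intro add_mono a A)
    also have "\<dots> = ennreal (3 * t) * ?V"
    proof -
      have "ennreal (3 * t) = ennreal (t + 2 * t)" by simp
      also have "\<dots> = ennreal t + ennreal (2 * t)" using t by (intro ennreal_plus) auto
      finally show ?thesis by (simp only: distrib_right)
    qed
    finally have main: "(\<integral>\<^sup>+x\<in>ball c r. ennreal (norm (h x - g x - (a - A))) \<partial>lebesgue) \<le> ennreal (3 * t) * ?V" .
    have "(\<integral>\<^sup>+x\<in>ball c r. ennreal (norm (h x - g x - ball_mean (\<lambda>x. h x - g x) c r)) \<partial>lebesgue)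
        \<le> 2 * (\<integral>\<^sup>+x\<in>ball c r. ennreal (norm (h x - g x - (a - A))) \<partial>lebesgue)"
      by (rule osc_le_twice_const[OF uL r])
    also have "\<dots> \<le> 2 * (ennreal (3 * t) * ?V)" by (intro mult_left_mono main) auto
    also have "\<dots> = ennreal e * ?V" using ennreal_mult'[of 2 "3 * t"] by (simp add: t_def mult.assoc[symmetric])
    finally show ?thesis .
  next
    case False
    have "V0 \<le> measure lebesgue (ball c r)"
    proof -
      have "ball (0::real^'n) r \<in> fmeasurable lebesgue"
        unfolding fmeasurable_def using ball_lebesgue_measurable[of "0::real^'n" r] emeasure_ball_eq[of "0::real^'n" r] by auto
      moreover have "ball (0::real^'n) r0 \<subseteq> ball 0 r" using False by auto
      ultimately have "V0 \<le> measure lebesgue (ball (0::real^'n) r)"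
        unfolding V0_def using ball_lebesgue_measurable by (intro measure_mono_fmeasurable)
      then show ?thesis unfolding measure_ball_shift[of c r] .
    qed
    then have V: "ennreal V0 \<le> emeasure lebesgue (ball c r)" unfolding emeasure_ball_eq by (rule ennreal_leI)
    have "(\<integral>\<^sup>+x\<in>ball c r. ennreal (norm (h x - g x - ball_mean (\<lambda>x. h x - g x) c r)) \<partial>lebesgue)
        \<le> 2 * (\<integral>\<^sup>+x\<in>ball c r. ennreal (norm (h x - g x - 0)) \<partial>lebesgue)"
      by (rule osc_le_twice_const[OF uL r])
    also have "\<dots> \<le> 2 * (\<integral>\<^sup>+x. ennreal (norm (h x - g x)) \<partial>lebesgue)"
      by (intro mult_left_mono nn_integral_mono) (auto simp: indicator_def)
    also have "\<dots> \<le> 2 * ennreal (e / 2 * V0)" using d(2) unfolding g_def by (intro mult_left_mono) auto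
    also have "\<dots> = ennreal e * ennreal V0"
    proof -
      have "2 * ennreal (e / 2 * V0) = ennreal (2 * (e / 2 * V0))" using ennreal_mult'[of 2 "e / 2 * V0"] by simp
      also have "\<dots> = ennreal (e * V0)" by simp
      also have "\<dots> = ennreal e * ennreal V0" using e V0 by (intro ennreal_mult) auto
      finally show ?thesis .
    qed
    also have "\<dots> \<le> ennreal e * emeasure lebesgue (ball c r)" by (intro mult_left_mono V) auto
    finally show ?thesis .
  qed
  then have "BMO_norm (\<lambda>x. h x - g x) \<le> ennreal e" by (rule BMO_norm_leI)
  then show ?thesis using g by blast
qed

lemma Linf_BMO_norm_finite:
  fixes f :: "('n::finite) cfun"
  assumes f: "f \<in> Linf_space"
  shows "BMO_norm f < \<infinity>"
proof -
  obtain C where C: "AE x in lebesgue. norm (f x) \<le> C" using f by (auto simp: Linf_space_def)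
  have "BMO_norm f \<le> 2 * ennreal C"
  proof (rule BMO_norm_leI)
    fix c :: "real ^ 'n" and r :: real assume r: "r > 0"
    have "(\<integral>\<^sup>+x\<in>ball c r. ennreal (norm (f x - ball_mean f c r)) \<partial>lebesgue) \<le> 2 * (\<integral>\<^sup>+x\<in>ball c r. ennreal (norm (f x - 0)) \<partial>lebesgue)"
      by (rule osc_le_twice_const[OF Linf_L1loc[OF f] r])
    also have "\<dots> \<le> 2 * (\<integral>\<^sup>+x. ennreal C * indicator (ball c r) x \<partial>lebesgue)"
      by (intro mult_left_mono nn_integral_mono_AE) (use C in \<open>auto elim!: eventually_mono simp: indicator_def intro: ennreal_leI\<close>)
    also have "\<dots> = 2 * ennreal C * emeasure lebesgue (ball c r)"
      by (simp only: nn_integral_cmult_indicator[OF ball_lebesgue_measurable] mult.assoc)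
    finally show "(\<integral>\<^sup>+x\<in>ball c r. ennreal (norm (f x - ball_mean f c r)) \<partial>lebesgue) \<le> 2 * ennreal C * emeasure lebesgue (ball c r)" .
  qed
  also have "\<dots> < \<infinity>" by (simp add: ennreal_mult_less_top)
  finally show ?thesis .
qed

lemma VMO_c_of_vanishing_osc:
  fixes h :: "('n::finite) cfun"
  assumes h: "h \<in> Linf_space" and osc: "vanishing_osc h" and supp: "AE x in lebesgue. x \<notin> cball 0 (real n) \<longrightarrow> h x = 0"
  shows "h \<in> VMO_c"
proof -
  obtain C where C: "AE x in lebesgue. norm (h x) \<le> C" and hm: "h \<in> borel_measurable lebesgue" using h by (auto simp: Linf_space_def)
  obtain h1 where h1: "h1 \<in> borel_measurable borel" "AE x in lebesgue. h x = h1 x" using borel_representative[OF hm] by blast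
  \<comment> \<open>Cutting the Borel representative makes the bound and the support condition hold
    at every point. The radius \<open>real n + 1\<close> is positive also for
    \<open>n = 0\<close>.\<close>
  define h2 where "h2 x = (if norm (h1 x) \<le> max C 0 \<and> norm x \<le> real n + 1 then h1 x else 0)" for x
  have h2b: "h2 \<in> borel_measurable borel" unfolding h2_def using h1(1) by measurable
  have ae: "AE x in lebesgue. h x = h2 x"
    using C h1(2) supp by eventually_elim (auto simp: h2_def)
  have osc2: "vanishing_osc h2" by (rule vanishing_osc_cong_AE[OF ae osc])
  have "\<exists>g\<in>Cc. BMO_norm (\<lambda>x. h x - g x) < e" if e: "e > 0" for e :: ennreal
  proof -
    obtain y where y: "0 < y" "y < e" using dense[OF e] by blast
    have "y < \<top>" by (rule order.strict_trans2[OF y(2) top_greatest])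
    then obtain t where t: "y = ennreal t" "t > 0" using y(1) by (cases y) auto
    have b2: "norm (h2 x) \<le> max C 0" for x by (simp add: h2_def)
    have s2: "h2 x = 0" if "norm x > real n + 1" for x using that by (simp add: h2_def)
    obtain g where g: "g \<in> Cc" "BMO_norm (\<lambda>x. h2 x - g x) \<le> ennreal t"
      using VMO_of_vanishing_osc_borel[OF h2b b2 s2 _ osc2 t(2)] by (metis add_nonneg_pos of_nat_0_le_iff zero_less_one)
    have "BMO_norm (\<lambda>x. h x - g x) = BMO_norm (\<lambda>x. h2 x - g x)"
    proof (rule BMO_norm_cong_AE)
      show "AE x in lebesgue. h x - g x = h2 x - g x" using ae by eventually_elim simp
      show "(\<lambda>x. h x - g x) \<in> borel_measurable lebesgue"
        by (intro borel_measurable_diff hm Cc_integrable_lebesgue(2)[OF g(1)])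
    qed
    then have "BMO_norm (\<lambda>x. h x - g x) < e" using g(2) y(2) t(1) by (simp add: le_less_trans)
    then show ?thesis using g(1) by blast
  qed
  moreover have "h \<in> BMO" using Linf_L1loc[OF h] Linf_BMO_norm_finite[OF h] by (simp add: BMO_def)
  ultimately have "h \<in> VMO" by (simp add: VMO_def)
  then show ?thesis using supp unfolding VMO_c_def VMO_on_def by blast
qed

lemma VMO_c_subset_VMO: "f \<in> VMO_c \<Longrightarrow> f \<in> VMO"
  by (auto simp: VMO_c_def VMO_on_def)

section \<open>Products, conjugates and null sets in the domain of D\<close>

lemma Linf_mult:
  assumes "f \<in> Linf_space" "g \<in> Linf_space"
  shows "(\<lambda>x. f x * g x) \<in> Linf_space"
proof -
  obtain C D where "AE x in lebesgue. norm (f x) \<le> C" "AE x in lebesgue. norm (g x) \<le> D" using assms by (auto simp: Linf_space_def)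
  then have "AE x in lebesgue. norm (f x * g x) \<le> \<bar>C\<bar> * \<bar>D\<bar>"
    by eventually_elim (auto simp: norm_mult intro!: mult_mono)
  then show ?thesis using assms by (auto simp: Linf_space_def)
qed

text \<open>Vanishing oscillation passes to products of bounded functions, and the compact support
  of one factor passes to the product. By this the functions \<open>Q * \<phi>\<close> and
  \<open>a j * \<phi>\<close> are admissible arguments of \<open>D\<close>.\<close>

lemma Linf_VMO_mult:
  fixes f g :: "('n::finite) cfun"
  assumes f: "f \<in> Linf_space \<inter> VMO" and g: "g \<in> Linf_space \<inter> VMO_c"
  shows "(\<lambda>x. f x * g x) \<in> Linf_space \<inter> VMO_c"
proof -
  have fg: "(\<lambda>x. f x * g x) \<in> Linf_space" using f g Linf_mult by blast
  obtain C D where CD: "AE x in lebesgue. norm (f x) \<le> C" "AE x in lebesgue. norm (g x) \<le> D" using f g by (auto simp: Linf_space_def)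
  have m: "f \<in> borel_measurable lebesgue" "g \<in> borel_measurable lebesgue" using f g by (auto simp: Linf_space_def)
  obtain n where n: "AE x in lebesgue. x \<notin> cball 0 (real n) \<longrightarrow> g x = 0" using g by (auto simp: VMO_c_def VMO_on_def)
  have "vanishing_osc (\<lambda>x. f x * g x)"
  proof (rule vanishing_osc_mult[where M="max (max C D) 0"])
    show "vanishing_osc f" "vanishing_osc g" using f g VMO_c_subset_VMO VMO_vanishing_osc by blast+
    show "AE x in lebesgue. norm (f x) \<le> max (max C D) 0" using CD(1) by eventually_elim auto
    show "AE x in lebesgue. norm (g x) \<le> max (max C D) 0" using CD(2) by eventually_elim auto
  qed (use m in auto)
  moreover have "AE x in lebesgue. x \<notin> cball 0 (real n) \<longrightarrow> f x * g x = 0" using n by eventually_elim simp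
  ultimately show ?thesis using VMO_c_of_vanishing_osc[OF fg] fg by blast
qed

lemma Cc_Linf_VMO_c:
  fixes f :: "('n::finite) cfun"
  assumes f: "f \<in> Cc"
  shows "f \<in> Linf_space \<inter> VMO_c"
proof -
  obtain M where M: "\<And>x. norm (f x) \<le> M" using Cc_integrable_lebesgue(3)[OF f] by blast
  have L: "f \<in> Linf_space" using M Cc_integrable_lebesgue(2)[OF f] by (auto simp: Linf_space_def)
  have "BMO_norm (\<lambda>x. f x - f x) \<le> 0" by (rule BMO_norm_leI) (simp add: ball_mean_def)
  then have "BMO_norm (\<lambda>x. f x - f x) < e" if "e > 0" for e using that by (rule le_less_trans)
  then have "f \<in> VMO" using f L Linf_L1loc[OF L] Linf_BMO_norm_finite[OF L] unfolding VMO_def BMO_def by blast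
  moreover obtain R where R: "R > 0" "\<And>x. norm x > R \<Longrightarrow> f x = 0" using f by (auto simp: Cc_iff)
  obtain n :: nat where "R \<le> real n" using real_arch_simple by blast
  then have "AE x in lebesgue. x \<notin> cball 0 (real n) \<longrightarrow> f x = 0" using R(2) by (intro always_eventually) auto
  ultimately show ?thesis using L unfolding VMO_c_def VMO_on_def by blast
qed

lemma Linf_VMO_c_cong_AE:
  assumes "f \<in> Linf_space \<inter> VMO_c" "AE x in lebesgue. f x = g x"
  shows "g \<in> Linf_space \<inter> VMO_c"
proof -
  obtain C where C: "AE x in lebesgue. norm (f x) \<le> C" and m: "f \<in> borel_measurable lebesgue" using assms(1) by (auto simp: Linf_space_def)
  have "g \<in> borel_measurable lebesgue" by (rule borel_measurable_AE[OF m assms(2)])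
  moreover have "AE x in lebesgue. norm (g x) \<le> C" using C assms(2) by eventually_elim simp
  ultimately have g: "g \<in> Linf_space" by (auto simp: Linf_space_def)
  obtain n where n: "AE x in lebesgue. x \<notin> cball 0 (real n) \<longrightarrow> f x = 0" using assms(1) by (auto simp: VMO_c_def VMO_on_def)
  have "vanishing_osc g"
    using assms(1) by (intro vanishing_osc_cong_AE[OF assms(2)] VMO_vanishing_osc VMO_c_subset_VMO) simp
  moreover have "AE x in lebesgue. x \<notin> cball 0 (real n) \<longrightarrow> g x = 0" using n assms(2) by eventually_elim simp
  ultimately show ?thesis using VMO_c_of_vanishing_osc[OF g] g by blast
qed

lemma Linf_VMO_c_cnj:
  assumes "f \<in> Linf_space \<inter> VMO_c"
  shows "(\<lambda>x. cnj (f x)) \<in> Linf_space \<inter> VMO_c"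
proof -
  have L: "(\<lambda>x. cnj (f x)) \<in> Linf_space"
    using assms by (auto simp: Linf_space_def intro: borel_measurable_cnj)
  obtain n where n: "AE x in lebesgue. x \<notin> cball 0 (real n) \<longrightarrow> f x = 0" using assms by (auto simp: VMO_c_def VMO_on_def)
  have osc: "vanishing_osc f" using assms by (intro VMO_vanishing_osc VMO_c_subset_VMO) simp
  have "vanishing_osc (\<lambda>x. cnj (f x))"
    unfolding vanishing_osc_def
  proof (intro allI impI)
    fix e :: real assume "e > 0"
    then obtain d where d: "d > 0" "\<And>c r. 0 < r \<Longrightarrow> r < d \<Longrightarrow>
      \<exists>a. (\<integral>\<^sup>+x\<in>ball c r. ennreal (norm (f x - a)) \<partial>lebesgue) \<le> ennreal e * emeasure lebesgue (ball c r)"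
      using osc unfolding vanishing_osc_def by meson
    have "norm (cnj (f x) - cnj a) = norm (f x - a)" for x a by (metis complex_cnj_diff complex_mod_cnj)
    then have "\<exists>a. (\<integral>\<^sup>+x\<in>ball c r. ennreal (norm (cnj (f x) - a)) \<partial>lebesgue) \<le> ennreal e * emeasure lebesgue (ball c r)"
      if r: "0 < r" "r < d" for c r
    proof -
      obtain a where "(\<integral>\<^sup>+x\<in>ball c r. ennreal (norm (f x - a)) \<partial>lebesgue) \<le> ennreal e * emeasure lebesgue (ball c r)"
        using d(2)[OF r] by blast
      then have "(\<integral>\<^sup>+x\<in>ball c r. ennreal (norm (cnj (f x) - cnj a)) \<partial>lebesgue) \<le> ennreal e * emeasure lebesgue (ball c r)"
        by (simp only: \<open>\<And>x a. norm (cnj (f x) - cnj a) = norm (f x - a)\<close>)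
      then show ?thesis by blast
    qed
    then show "\<exists>d>0. \<forall>c r. 0 < r \<longrightarrow> r < d \<longrightarrow>
      (\<exists>a. (\<integral>\<^sup>+x\<in>ball c r. ennreal (norm (cnj (f x) - a)) \<partial>lebesgue) \<le> ennreal e * emeasure lebesgue (ball c r))"
      using d(1) by blast
  qed
  moreover have "AE x in lebesgue. x \<notin> cball 0 (real n) \<longrightarrow> cnj (f x) = 0" using n by eventually_elim simp
  ultimately show ?thesis using VMO_c_of_vanishing_osc[OF L] L by blast
qed

section \<open>Compensated compactness in \<open>L\<^sup>2\<close>\<close>

text \<open>The Fourier side of the sum of the operators with symbols \<xi>_j / |\<xi>| applied to
  \<open>g j\<close>. At the origin, a null set, the quotients are 0.\<close>

definition symbol_sum :: "('n \<Rightarrow> ('n::finite) cfun) \<Rightarrow> 'n cfun" where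
  "symbol_sum g \<xi> = (\<Sum>j\<in>UNIV. complex_of_real (\<xi> $ j / norm \<xi>) * fourier (g j) \<xi>)"

lemma norm_coord_ratio_le: "\<bar>(\<xi>::real^'n) $ j / norm \<xi>\<bar> \<le> 1"
  using component_le_norm_cart[of \<xi> j] by (cases "\<xi> = 0") (auto simp: abs_divide)

lemma symbol_sum_lebesgue:
  assumes "\<And>j. integrable lebesgue (g j)"
  shows "symbol_sum g \<in> borel_measurable lebesgue"
proof -
  have "(\<lambda>\<xi>::real^'a. complex_of_real (\<xi> $ j / norm \<xi>)) \<in> borel_measurable lebesgue" for j
    by (intro borel_measurable_lebesgue_of_borel) measurable
  then show ?thesis
    unfolding symbol_sum_def[abs_def] by (intro borel_measurable_sum borel_measurable_times fourier_lebesgue assms)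
qed

lemma norm_symbol_sum_le: "norm (symbol_sum g \<xi>) \<le> (\<Sum>j\<in>UNIV. norm (fourier (g j) \<xi>))"
proof -
  have "norm (symbol_sum g \<xi>) \<le> (\<Sum>j\<in>UNIV. norm (complex_of_real (\<xi> $ j / norm \<xi>) * fourier (g j) \<xi>))"
    unfolding symbol_sum_def by (rule norm_sum)
  also have "\<dots> \<le> (\<Sum>j\<in>UNIV. norm (fourier (g j) \<xi>))"
  proof (rule sum_mono)
    fix j
    have "\<bar>\<xi> $ j / norm \<xi>\<bar> * norm (fourier (g j) \<xi>) \<le> 1 * norm (fourier (g j) \<xi>)"
      by (intro mult_right_mono norm_coord_ratio_le) simp
    then show "norm (complex_of_real (\<xi> $ j / norm \<xi>) * fourier (g j) \<xi>) \<le> norm (fourier (g j) \<xi>)"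
      unfolding norm_mult norm_of_real by simp
  qed
  finally show ?thesis .
qed

lemma symbol_sum_L2:
  fixes g :: "'n \<Rightarrow> ('n::finite) cfun"
  assumes g: "\<And>j. integrable lebesgue (g j)" "\<And>j. g j \<in> Lp_space 2"
  shows "symbol_sum g \<in> Lp_space 2" "Lp_modular 2 (symbol_sum g) \<le> real CARD('n) * (\<Sum>j\<in>UNIV. Lp_modular 2 (g j))"
proof -
  have i: "integrable lebesgue (\<lambda>\<xi>. real CARD('n) * (\<Sum>j\<in>UNIV. (norm (fourier (g j) \<xi>))\<^sup>2))"
    using Lp_space_integrable[OF fourier_bessel(1)[OF g]] by (intro integrable_mult_right Bochner_Integration.integrable_sum) simp
  have le: "norm (symbol_sum g \<xi>) powr 2 \<le> real CARD('n) * (\<Sum>j\<in>UNIV. (norm (fourier (g j) \<xi>))\<^sup>2)" for \<xi>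
  proof -
    have "(norm (symbol_sum g \<xi>))\<^sup>2 \<le> (\<Sum>j\<in>UNIV. norm (fourier (g j) \<xi>))\<^sup>2" by (intro power_mono norm_symbol_sum_le) simp
    also have "\<dots> \<le> (\<Sum>j\<in>UNIV. (norm (fourier (g j) \<xi>))\<^sup>2) * real CARD('n)" by (rule sum_squared_le_sum_of_squares)
    finally show ?thesis by (simp add: mult.commute)
  qed
  have m: "symbol_sum g \<in> borel_measurable lebesgue" by (rule symbol_sum_lebesgue[OF g(1)])
  show "symbol_sum g \<in> Lp_space 2" by (rule Lp_space_bound[OF m i]) (use le in auto)
  have "Lp_modular 2 (symbol_sum g) \<le> (\<integral>\<xi>. real CARD('n) * (\<Sum>j\<in>UNIV. (norm (fourier (g j) \<xi>))\<^sup>2) \<partial>lebesgue)"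
    by (rule Lp_modular_mono[OF m i]) (use le in auto)
  also have "\<dots> = real CARD('n) * (\<Sum>j\<in>UNIV. Lp_modular 2 (fourier (g j)))"
    using Lp_space_integrable[OF fourier_bessel(1)[OF g]] by (simp add: Lp_modular_def)
  also have "\<dots> \<le> real CARD('n) * (\<Sum>j\<in>UNIV. Lp_modular 2 (g j))"
    by (intro mult_left_mono sum_mono fourier_bessel g) auto
  finally show "Lp_modular 2 (symbol_sum g) \<le> real CARD('n) * (\<Sum>j\<in>UNIV. Lp_modular 2 (g j))" .
qed

lemma symbol_sum_diff:
  assumes "\<And>j. integrable lebesgue (g j)" "\<And>j. integrable lebesgue (k j)"
  shows "symbol_sum (\<lambda>j x. g j x - k j x) \<xi> = symbol_sum g \<xi> - symbol_sum k \<xi>"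
  unfolding symbol_sum_def by (simp only: fourier_diff[OF assms] right_diff_distrib sum_subtractf)

lemma L2_pairing_tendsto_0:
  assumes "\<And>k. f k \<in> Lp_space 2" "h \<in> Lp_space 2" "(\<lambda>k. Lp_modular 2 (f k)) \<longlonglongrightarrow> 0"
  shows "(\<lambda>k. \<integral>x. f k x * h x \<partial>lebesgue) \<longlonglongrightarrow> 0"
proof (rule LIMSEQ_I)
  fix e :: real assume e: "e > 0"
  \<comment> \<open>The weight makes the fixed factor contribute at most \<open>e / 2\<close>, after
    which the vanishing modular takes care of the other half.\<close>
  define s where "s = 2 * (Lp_modular 2 h + 1) / e"
  have s: "s > 0" using e Lp_modular_nonneg[of 2 h] by (simp add: s_def)
  have hs: "Lp_modular 2 h / s \<le> e / 2"
  proof -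
    have "Lp_modular 2 h \<le> e / 2 * s" using e by (simp add: s_def)
    then show ?thesis using s by (simp add: pos_divide_le_eq)
  qed
  have "e / (2 * s) > 0" using e s by simp
  from order_tendstoD(2)[OF assms(3) this] obtain N where N: "\<And>k. k \<ge> N \<Longrightarrow> Lp_modular 2 (f k) < e / (2 * s)"
    unfolding eventually_sequentially by blast
  have "norm (\<integral>x. f k x * h x \<partial>lebesgue) < e" if "k \<ge> N" for k
  proof -
    have "norm (\<integral>x. f k x * h x \<partial>lebesgue) \<le> s * Lp_modular 2 (f k) + Lp_modular 2 h / s"
      by (rule L2_product(2)[OF assms(1,2) s])
    also have "\<dots> < s * (e / (2 * s)) + e / 2"
      using N[OF that] s hs by (intro add_less_le_mono mult_strict_left_mono)
    also have "\<dots> = e" using s by simp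
    finally show ?thesis .
  qed
  then show "\<exists>no. \<forall>k\<ge>no. norm ((\<integral>x. f k x * h x \<partial>lebesgue) - 0) < e" by auto
qed

text \<open>The operators themselves are only known through approximation by test functions; Bessel's inequality
  transfers the \<open>L\<^sup>2\<close> smallness of the symbol sum to them.\<close>

lemma multiplier_sum_pairing_bound:
  fixes g :: "'n \<Rightarrow> ('n::finite) cfun"
  assumes \<psi>: "\<psi> \<in> Ck_sphere k" and B: "\<And>\<xi>. norm (hom_ext \<psi> \<xi>) \<le> B" and p: "p \<ge> 2"
    and mult: "\<And>j. Lp_multiplier p (\<lambda>\<xi>. complex_of_real (\<xi> $ j / norm \<xi>) * \<psi> \<xi>)"
    and g: "\<And>j. g j \<in> Lp_space p" "\<And>j x. norm x > R \<Longrightarrow> g j x = 0" and R: "R > 0"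
    and h: "h \<in> Lp_space 2" "\<And>x. norm x > R \<Longrightarrow> h x = 0" and s: "s > 0"
  shows "norm (\<Sum>j\<in>UNIV. \<integral>x. multiplier p (\<lambda>\<xi>. complex_of_real (\<xi> $ j / norm \<xi>) * \<psi> \<xi>) (g j) x * h x \<partial>lebesgue)
    \<le> s * (B\<^sup>2 * (4 * Lp_modular 2 (symbol_sum g))) + Lp_modular 2 h / s"
proof -
  let ?\<psi> = "\<lambda>j \<xi>. complex_of_real (\<xi> $ j / norm \<xi>) * \<psi> \<xi>"
  have p0: "p > 0" using p by simp
  have \<psi>j: "?\<psi> j \<in> Ck_sphere k" for j by (rule Ck_sphere_coord_mult[OF \<psi>])
  have "\<forall>j. \<exists>\<phi>. (\<forall>k. \<phi> k \<in> test_fun) \<and> (\<forall>k x. norm x > R + 2 \<longrightarrow> \<phi> k x = 0) \<and> (\<lambda>k. Lp_modular p (\<lambda>x. \<phi> k x - g j x)) \<longlonglongrightarrow> 0"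
    using Lp_dense_test_fun(2)[OF g(1) p0 R g(2)] by blast
  from choice[OF this] obtain \<theta> where \<theta>': "\<forall>j. (\<forall>k. \<theta> j k \<in> test_fun) \<and> (\<forall>k x. norm x > R + 2 \<longrightarrow> \<theta> j k x = 0) \<and> (\<lambda>k. Lp_modular p (\<lambda>x. \<theta> j k x - g j x)) \<longlonglongrightarrow> 0" ..
  have \<theta>: "\<theta> j k \<in> test_fun" "norm x > R + 2 \<Longrightarrow> \<theta> j k x = 0" "(\<lambda>k. Lp_modular p (\<lambda>x. \<theta> j k x - g j x)) \<longlonglongrightarrow> 0" for j k x
    using spec[OF \<theta>', of j] by simp_all
  have \<theta>p: "\<theta> j k \<in> Lp_space p" and \<theta>2: "\<theta> j k \<in> Lp_space 2" for j k
    using \<theta>(1) p0 by (auto intro: test_fun_Lp_space)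
  have \<theta>i: "integrable lebesgue (\<theta> j k)" for j k by (rule test_fun_integrable[OF \<theta>(1)])
  have gs: "AE x in lebesgue. norm x > R \<longrightarrow> g j x = 0" for j using g(2) by (intro always_eventually allI impI)
  have p1: "1 \<le> p" using p by simp
  have g2: "g j \<in> Lp_space 2" for j by (rule Lp_space_ball_subexponent(1)[OF g(1) _ p gs]) simp
  have g1: "g j \<in> Lp_space 1" for j by (rule Lp_space_ball_subexponent(1)[OF g(1) _ p1 gs]) simp
  have gi: "integrable lebesgue (g j)" for j
  proof -
    have "integrable lebesgue (\<lambda>x. norm (g j x))" using Lp_space_integrable[OF g1[of j]] by simp
    then show ?thesis using Lp_space_measurable[OF g1[of j]] by (simp add: integrable_norm_iff)
  qed
  have lim2: "(\<lambda>k. Lp_modular 2 (\<lambda>x. \<theta> j k x - g j x)) \<longlonglongrightarrow> 0" for j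
  \<comment> \<open>All approximants live in one ball of radius \<open>R + 2\<close>, so convergence
    with exponent \<open>p \<ge> 2\<close> implies convergence in L2.\<close>
  proof (rule Lp_tendsto_imp_L2_tendsto[OF _ p _ \<theta>(3)])
    show "(\<lambda>x. \<theta> j k x - g j x) \<in> Lp_space p" for k by (rule Lp_space_diff[OF \<theta>p g(1) p0])
    show "AE x in lebesgue. R + 2 < norm x \<longrightarrow> \<theta> j k x - g j x = 0" for k
      using \<theta>(2) g(2) by (intro always_eventually) auto
  qed
  define F where "F k = symbol_sum (\<lambda>j. \<theta> j k)" for k
  define G where "G = symbol_sum g"
  have G2: "G \<in> Lp_space 2" unfolding G_def by (rule symbol_sum_L2(1)[OF gi g2])
  have F2: "F k \<in> Lp_space 2" for k unfolding F_def by (rule symbol_sum_L2(1)[OF \<theta>i \<theta>2])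
  have FG: "Lp_modular 2 (\<lambda>\<xi>. F k \<xi> - G \<xi>) \<le> real CARD('n) * (\<Sum>j\<in>UNIV. Lp_modular 2 (\<lambda>x. \<theta> j k x - g j x))" for k
  proof -
    have "(\<lambda>\<xi>. F k \<xi> - G \<xi>) = symbol_sum (\<lambda>j x. \<theta> j k x - g j x)"
      unfolding F_def G_def by (rule ext) (rule symbol_sum_diff[OF \<theta>i gi, symmetric])
    then show ?thesis
      using symbol_sum_L2(2)[of "\<lambda>j x. \<theta> j k x - g j x"] \<theta>i gi Lp_space_diff[OF \<theta>2 g2] by simp
  qed
  define T where "T k x = (\<Sum>j\<in>UNIV. multiplier_test (?\<psi> j) (\<theta> j k) x)" for k x
  define W where "W k \<xi> = (\<Sum>j\<in>UNIV. hom_ext (?\<psi> j) \<xi> * fourier (\<theta> j k) \<xi>)" for k \<xi>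
  have Wi: "integrable lebesgue (W k)" for k
    unfolding W_def by (intro Bochner_Integration.integrable_sum symbol_fourier_integrable[OF \<psi>j] \<theta>)
  have TW: "T k = inv_fourier (W k)" for k
  proof
    fix x
    have "integrable lebesgue (\<lambda>\<xi>. cis (2 * pi * (x \<bullet> \<xi>)) * (hom_ext (?\<psi> j) \<xi> * fourier (\<theta> j k) \<xi>))" for j
      using fourier_integrable[OF symbol_fourier_integrable[OF \<psi>j \<theta>(1)], of "2 * pi" x] by (simp add: inner_commute)
    then show "T k x = inv_fourier (W k) x"
      unfolding T_def multiplier_test_def inv_fourier_def W_def sum_distrib_left
      by (intro Bochner_Integration.integral_sum[symmetric])
  qed
  \<comment> \<open>Away from the origin \<open>hom_ext \<psi>\<close> is a common factor of all
    symbols; what is left of the sum is \<open>F k\<close>.\<close>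
  have Wle: "AE \<xi> in lebesgue. norm (W k \<xi>) powr 2 \<le> B\<^sup>2 * (norm (F k \<xi>))\<^sup>2" for k
  proof -
    have "AE \<xi> in lebesgue. \<xi> \<noteq> (0::real^'n)" by (rule AE_completion) (rule AE_lborel_singleton)
    then show ?thesis
    proof eventually_elim
      case (elim \<xi>)
      have "W k \<xi> = (\<Sum>j\<in>UNIV. hom_ext \<psi> \<xi> * (complex_of_real (\<xi> $ j / norm \<xi>) * fourier (\<theta> j k) \<xi>))"
        unfolding W_def by (intro sum.cong refl, subst hom_ext_coord_mult[OF elim]) (simp only: mult_ac)
      also have "\<dots> = hom_ext \<psi> \<xi> * F k \<xi>" unfolding F_def symbol_sum_def by (rule sum_distrib_left[symmetric])
      finally have "norm (W k \<xi>) = norm (hom_ext \<psi> \<xi>) * norm (F k \<xi>)" by (simp add: norm_mult)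
      also have "\<dots> \<le> B * norm (F k \<xi>)" by (intro mult_right_mono B) simp
      finally have "(norm (W k \<xi>))\<^sup>2 \<le> (B * norm (F k \<xi>))\<^sup>2" by (intro power_mono) auto
      then show ?case by (simp add: power_mult_distrib)
    qed
  qed
  have Fsq: "integrable lebesgue (\<lambda>\<xi>. B\<^sup>2 * (norm (F k \<xi>))\<^sup>2)" for k
    using Lp_space_integrable[OF F2] by simp
  have W2: "W k \<in> Lp_space 2" for k
    by (rule Lp_space_bound[OF borel_measurable_integrable[OF Wi] Fsq Wle])
  have W2le: "Lp_modular 2 (W k) \<le> B\<^sup>2 * Lp_modular 2 (F k)" for k
    using Lp_modular_mono[OF borel_measurable_integrable[OF Wi] Fsq Wle] by (simp add: Lp_modular_def)
  have T2: "T k \<in> Lp_space 2" and T2le: "Lp_modular 2 (T k) \<le> B\<^sup>2 * Lp_modular 2 (F k)" for k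
    unfolding TW using inv_fourier_bessel[OF Wi W2] W2le by (auto intro: order_trans)
  \<comment> \<open>The 4 is the factor \<open>2 powr 2\<close> of the triangle inequality for
    modulars.\<close>
  have F2le: "Lp_modular 2 (F k) \<le> 4 * (Lp_modular 2 (\<lambda>\<xi>. F k \<xi> - G \<xi>) + Lp_modular 2 G)" for k
    using Lp_modular_add_le[OF Lp_space_diff[OF F2 G2] G2, of k] by simp
  have wj: "multiplier_value p (?\<psi> j) (g j) (multiplier p (?\<psi> j) (g j))" for j
    by (rule Lp_multiplier_value[OF mult \<psi>j p0 g(1)])
  have wlim: "(\<lambda>k. \<integral>x. multiplier_test (?\<psi> j) (\<theta> j k) x * h x \<partial>lebesgue) \<longlonglongrightarrow> (\<integral>x. multiplier p (?\<psi> j) (g j) x * h x \<partial>lebesgue)" for j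
  proof -
    define w where "w = multiplier p (?\<psi> j) (g j)"
    define t where "t k = multiplier_test (?\<psi> j) (\<theta> j k)" for k
    have "Lp_strongly p (\<theta> j) (g j)" using \<theta>p g \<theta>(3) by (simp add: Lp_strongly_iff_modular[OF p0])
    then have st: "Lp_strongly p t w" using wj \<theta>(1) unfolding multiplier_value_def w_def t_def by blast
    \<comment> \<open>The operators do not preserve supports, and convergence in Lp gives
      convergence in L2 only on bounded sets. Since \<open>h\<close> vanishes outside the ball, the
      images may be cut off there before pairing.\<close>
    define I where "I x = (if norm x \<le> R then 1 else 0 :: complex)" for x :: "real^'n"
    have Im: "I \<in> borel_measurable lebesgue" unfolding I_def by (intro borel_measurable_lebesgue_of_borel) measurable
    have cut: "(\<lambda>x. I x * f x) \<in> Lp_space p" "Lp_modular p (\<lambda>x. I x * f x) \<le> Lp_modular p f" if f: "f \<in> Lp_space p" for f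
    proof -
      have m: "(\<lambda>x. I x * f x) \<in> borel_measurable lebesgue" using Im Lp_space_measurable[OF f] by (intro borel_measurable_times)
      have le: "AE x in lebesgue. norm (I x * f x) powr p \<le> norm (f x) powr p" by (simp add: I_def)
      show "(\<lambda>x. I x * f x) \<in> Lp_space p" by (rule Lp_space_bound[OF m Lp_space_integrable[OF f] le])
      show "Lp_modular p (\<lambda>x. I x * f x) \<le> Lp_modular p f"
        using Lp_modular_mono[OF m Lp_space_integrable[OF f] le] by (simp add: Lp_modular_def)
    qed
    have tw: "t k \<in> Lp_space p" "w \<in> Lp_space p" "(\<lambda>k. Lp_modular p (\<lambda>x. t k x - w x)) \<longlonglongrightarrow> 0" for k
      using st by (auto simp: Lp_strongly_iff_modular[OF p0])
    have dp: "(\<lambda>x. I x * (t k x - w x)) \<in> Lp_space p" for k by (rule cut(1)[OF Lp_space_diff[OF tw(1,2) p0]])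
    have sub: "f \<in> Lp_space 2" if "f \<in> Lp_space p" "\<And>x. norm x > R \<Longrightarrow> f x = 0" for f
    proof (rule Lp_space_ball_subexponent(1)[OF that(1) _ p])
      show "AE x in lebesgue. norm x > R \<longrightarrow> f x = 0" using that(2) by (intro always_eventually allI impI)
    qed simp
    have l2: "(\<lambda>k. Lp_modular 2 (\<lambda>x. I x * (t k x - w x))) \<longlonglongrightarrow> 0"
    proof (rule Lp_tendsto_imp_L2_tendsto[OF dp p])
      show "AE x in lebesgue. R < norm x \<longrightarrow> I x * (t k x - w x) = 0" for k by (simp add: I_def)
      show "(\<lambda>k. Lp_modular p (\<lambda>x. I x * (t k x - w x))) \<longlonglongrightarrow> 0"
        by (rule tendsto_0_le_nonneg[OF Lp_modular_nonneg cut(2)[OF Lp_space_diff[OF tw(1,2) p0]] tw(3)])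
    qed
    have "(\<lambda>k. \<integral>x. (I x * (t k x - w x)) * h x \<partial>lebesgue) \<longlonglongrightarrow> 0"
    proof (rule L2_pairing_tendsto_0[OF _ h(1) l2])
      show "(\<lambda>x. I x * (t k x - w x)) \<in> Lp_space 2" for k by (rule sub[OF dp]) (simp add: I_def)
    qed
    moreover have "(\<integral>x. (I x * (t k x - w x)) * h x \<partial>lebesgue) = (\<integral>x. t k x * h x \<partial>lebesgue) - (\<integral>x. w x * h x \<partial>lebesgue)" for k
    proof -
      have e: "f x * h x = (I x * f x) * h x" for f x using h(2)[of x] by (simp add: I_def)
      have i: "integrable lebesgue (\<lambda>x. f x * h x)" if "f \<in> Lp_space p" for f
        unfolding e[of f] by (rule L2_product(1)[OF sub[OF cut(1)[OF that]] h(1)]) (simp add: I_def)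
      have "(\<integral>x. (I x * (t k x - w x)) * h x \<partial>lebesgue) = (\<integral>x. t k x * h x - w x * h x \<partial>lebesgue)"
        by (intro Bochner_Integration.integral_cong refl) (use h(2) in \<open>auto simp: I_def algebra_simps\<close>)
      also have "\<dots> = (\<integral>x. t k x * h x \<partial>lebesgue) - (\<integral>x. w x * h x \<partial>lebesgue)"
        by (rule Bochner_Integration.integral_diff[OF i[OF tw(1)] i[OF tw(2)]])
      finally show ?thesis .
    qed
    ultimately show ?thesis unfolding t_def w_def by (simp add: LIM_zero_iff)
  qed
  have Tlim: "(\<lambda>k. \<integral>x. T k x * h x \<partial>lebesgue) \<longlonglongrightarrow> (\<Sum>j\<in>UNIV. \<integral>x. multiplier p (?\<psi> j) (g j) x * h x \<partial>lebesgue)"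
  proof -
    have "(\<integral>x. T k x * h x \<partial>lebesgue) = (\<Sum>j\<in>UNIV. \<integral>x. multiplier_test (?\<psi> j) (\<theta> j k) x * h x \<partial>lebesgue)" for k
    proof -
      have "multiplier_test (?\<psi> j) (\<theta> j k) \<in> Lp_space 2" for j
      proof -
        obtain C where C: "\<And>\<xi>. norm (hom_ext (?\<psi> j) \<xi>) \<le> C" using hom_ext_bounded[OF \<psi>j] by blast
        have f2: "fourier (\<theta> j k) \<in> Lp_space 2" by (rule fourier_bessel(1)[OF \<theta>i \<theta>2])
        have si: "integrable lebesgue (\<lambda>\<xi>. hom_ext (?\<psi> j) \<xi> * fourier (\<theta> j k) \<xi>)" by (rule symbol_fourier_integrable[OF \<psi>j \<theta>(1)])
        have "(\<lambda>\<xi>. hom_ext (?\<psi> j) \<xi> * fourier (\<theta> j k) \<xi>) \<in> Lp_space 2"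
        proof (rule Lp_space_bound[OF borel_measurable_integrable[OF si]])
          show "integrable lebesgue (\<lambda>\<xi>. C\<^sup>2 * norm (fourier (\<theta> j k) \<xi>) powr 2)" using Lp_space_integrable[OF f2] by (rule integrable_mult_right)
          show "AE \<xi> in lebesgue. norm (hom_ext (?\<psi> j) \<xi> * fourier (\<theta> j k) \<xi>) powr 2 \<le> C\<^sup>2 * norm (fourier (\<theta> j k) \<xi>) powr 2"
          proof (intro always_eventually allI)
            fix \<xi>
            have "norm (hom_ext (?\<psi> j) \<xi> * fourier (\<theta> j k) \<xi>) \<le> C * norm (fourier (\<theta> j k) \<xi>)"
              unfolding norm_mult by (intro mult_right_mono C) simp
            then have "(norm (hom_ext (?\<psi> j) \<xi> * fourier (\<theta> j k) \<xi>))\<^sup>2 \<le> (C * norm (fourier (\<theta> j k) \<xi>))\<^sup>2" by (intro power_mono) auto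
            then show "norm (hom_ext (?\<psi> j) \<xi> * fourier (\<theta> j k) \<xi>) powr 2 \<le> C\<^sup>2 * norm (fourier (\<theta> j k) \<xi>) powr 2"
              unfolding norm_powr2 power_mult_distrib[of C] .
          qed
        qed
        then show ?thesis unfolding multiplier_test_def by (rule inv_fourier_bessel(1)[OF si])
      qed
      then show ?thesis unfolding T_def sum_distrib_right
        by (intro Bochner_Integration.integral_sum L2_product(1)[OF _ h(1)])
    qed
    then show ?thesis by (simp only:) (intro tendsto_sum wlim)
  qed
  have bound: "norm (\<integral>x. T k x * h x \<partial>lebesgue)
      \<le> s * (B\<^sup>2 * (4 * (real CARD('n) * (\<Sum>j\<in>UNIV. Lp_modular 2 (\<lambda>x. \<theta> j k x - g j x)) + Lp_modular 2 G))) + Lp_modular 2 h / s" for k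
  proof -
    have "norm (\<integral>x. T k x * h x \<partial>lebesgue) \<le> s * Lp_modular 2 (T k) + Lp_modular 2 h / s"
      by (rule L2_product(2)[OF T2 h(1) s])
    also have "Lp_modular 2 (T k) \<le> B\<^sup>2 * (4 * (real CARD('n) * (\<Sum>j\<in>UNIV. Lp_modular 2 (\<lambda>x. \<theta> j k x - g j x)) + Lp_modular 2 G))"
    proof -
      have "4 * (Lp_modular 2 (\<lambda>\<xi>. F k \<xi> - G \<xi>) + Lp_modular 2 G) \<le> 4 * (real CARD('n) * (\<Sum>j\<in>UNIV. Lp_modular 2 (\<lambda>x. \<theta> j k x - g j x)) + Lp_modular 2 G)"
        using FG[of k] by simp
      from order_trans[OF F2le this] show ?thesis by (intro order_trans[OF T2le] mult_left_mono) auto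
    qed
    finally show ?thesis using s by simp
  qed
  have "(\<lambda>k. s * (B\<^sup>2 * (4 * (real CARD('n) * (\<Sum>j\<in>UNIV. Lp_modular 2 (\<lambda>x. \<theta> j k x - g j x)) + Lp_modular 2 G))) + Lp_modular 2 h / s)
      \<longlonglongrightarrow> s * (B\<^sup>2 * (4 * (real CARD('n) * (\<Sum>j\<in>(UNIV::'n set). 0) + Lp_modular 2 G))) + Lp_modular 2 h / s"
    by (intro tendsto_add tendsto_mult tendsto_const tendsto_sum lim2)
  from LIMSEQ_le[OF tendsto_norm[OF Tlim] this] bound
  show ?thesis by (simp add: G_def)
qed

section \<open>Duality on frequency bands\<close>

lemma symbol_sum_norm_mult:
  fixes \<xi> :: "real ^ 'n"
  assumes "\<xi> \<noteq> 0"
  shows "complex_of_real (norm \<xi>) * symbol_sum g \<xi> = (\<Sum>j\<in>UNIV. complex_of_real (\<xi> $ j) * fourier (g j) \<xi>)"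
proof -
  have "complex_of_real (norm \<xi>) * (complex_of_real (\<xi> $ j / norm \<xi>) * c) = complex_of_real (\<xi> $ j) * c" for j c
    using assms by simp
  then show ?thesis unfolding symbol_sum_def sum_distrib_left by (intro sum.cong refl)
qed

definition band :: "real \<Rightarrow> real \<Rightarrow> (real ^ 'n) set" where
  "band \<rho> R = {\<xi>. \<rho> < norm \<xi> \<and> norm \<xi> < R}"

definition band_dual :: "real \<Rightarrow> real \<Rightarrow> ('n \<Rightarrow> ('n::finite) cfun) \<Rightarrow> 'n cfun" where
  "band_dual \<rho> R g \<xi> = (if \<xi> \<in> band \<rho> R then cnj (symbol_sum g \<xi>) / complex_of_real (norm \<xi>) else 0)"

lemma band_lebesgue: "band \<rho> R \<in> sets (lebesgue :: (real^'n) measure)"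
  unfolding band_def by (intro sets_completionI_sets) measurable

text \<open>The test function \<open>b z\<close> with \<open>z\<close> the Fourier transform of \<open>band_dual \<rho> R g\<close> recovers the
  \<open>L\<^sup>2\<close> mass of the symbol sum in the band \<open>\<rho> < norm \<xi> < R\<close>; the truncation at \<open>R\<close> keeps \<open>z\<close> smooth, and
  the one at \<open>\<rho>\<close> gains the factor \<open>1 / \<rho>\<close>.\<close>

lemma band_dual_estimates:
  fixes g :: "'n \<Rightarrow> ('n::finite) cfun" and \<rho> R :: real
  assumes g: "\<And>j. integrable lebesgue (g j)" "\<And>j. g j \<in> Lp_space 2" and \<rho>: "\<rho> \<ge> 1"
  defines "Z \<equiv> band_dual \<rho> R g"
  defines "z \<equiv> fourier Z"
  shows "z \<in> Ck_on k UNIV" "z \<in> Lp_space 2" "Lp_modular 2 z \<le> Lp_modular 2 (symbol_sum g) / \<rho>\<^sup>2"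
    "pderivative j z \<in> Lp_space 2" "Lp_modular 2 (pderivative j z) \<le> (2 * pi)\<^sup>2 * Lp_modular 2 (symbol_sum g)"
    "(\<Sum>j\<in>UNIV. \<integral>x. g j x * pderivative j z x \<partial>lebesgue)
       = - 2 * pi * \<i> * complex_of_real (\<integral>\<xi>. indicator (band \<rho> R) \<xi> * (norm (symbol_sum g \<xi>))\<^sup>2 \<partial>lebesgue)"
proof -
  let ?F = "symbol_sum g"
  have Fm: "?F \<in> borel_measurable lebesgue" by (rule symbol_sum_lebesgue[OF g(1)])
  have F2: "?F \<in> Lp_space 2" by (rule symbol_sum_L2(1)[OF g])
  have Fi: "integrable lebesgue (\<lambda>\<xi>. (norm (?F \<xi>))\<^sup>2)" using Lp_space_integrable[OF F2] by simp
  have Zm: "Z \<in> borel_measurable lebesgue"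
  proof -
    have n: "(\<lambda>\<xi>::real^'n. complex_of_real (norm \<xi>)) \<in> borel_measurable lebesgue"
      by (intro borel_measurable_lebesgue_of_borel) measurable
    have "(\<lambda>\<xi>. indicator (band \<rho> R) \<xi> *\<^sub>R (cnj (?F \<xi>) / complex_of_real (norm \<xi>))) \<in> borel_measurable lebesgue"
      by (intro borel_measurable_scaleR borel_measurable_indicator band_lebesgue borel_measurable_divide borel_measurable_cnj Fm n)
    moreover have "(\<lambda>\<xi>. indicator (band \<rho> R) \<xi> *\<^sub>R (cnj (?F \<xi>) / complex_of_real (norm \<xi>))) = Z"
      by (rule ext) (simp add: Z_def band_dual_def)
    ultimately show ?thesis by simp
  qed
  have supp: "Z \<xi> = 0" if "norm \<xi> > R" for \<xi> using that by (simp add: Z_def band_dual_def band_def)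
  define M where "M = (\<Sum>j\<in>UNIV. \<integral>x. norm (g j x) \<partial>lebesgue)"
  have FM: "norm (?F \<xi>) \<le> M" for \<xi>
    unfolding M_def by (rule order_trans[OF norm_symbol_sum_le]) (intro sum_mono fourier_norm_le g)
  have M0: "M \<ge> 0" unfolding M_def by (intro sum_nonneg Bochner_Integration.integral_nonneg) simp
  have in_band: "norm \<xi> \<ge> 1" "norm \<xi> > \<rho>" "\<xi> \<noteq> 0" if "\<xi> \<in> band \<rho> R" for \<xi> :: "real^'n"
    using that \<rho> by (auto simp: band_def)
  have Zle: "norm (Z \<xi>) \<le> norm (?F \<xi>) / \<rho>" for \<xi>
  proof (cases "\<xi> \<in> band \<rho> R")
    case True
    have "norm (?F \<xi>) / norm \<xi> \<le> norm (?F \<xi>) / \<rho>"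
      using in_band[OF True] \<rho> by (intro divide_left_mono) auto
    then show ?thesis using True by (simp add: Z_def band_dual_def norm_divide)
  qed (use \<rho> in \<open>simp add: Z_def band_dual_def\<close>)
  have Zi: "integrable lebesgue Z"
  proof (rule bounded_ball_support_integrable[OF Zm])
    have "norm (Z \<xi>) \<le> M" for \<xi>
    proof -
      have "norm (?F \<xi>) / \<rho> \<le> norm (?F \<xi>) / 1" using \<rho> by (intro divide_left_mono) auto
      then show ?thesis using Zle[of \<xi>] FM[of \<xi>] by simp
    qed
    then show "AE \<xi> in lebesgue. norm (Z \<xi>) \<le> M" by simp
    show "AE \<xi> in lebesgue. R < norm \<xi> \<longrightarrow> Z \<xi> = 0" using supp by (intro always_eventually allI impI)
  qed
  have Zsq: "AE \<xi> in lebesgue. norm (Z \<xi>) powr 2 \<le> (norm (?F \<xi>))\<^sup>2 / \<rho>\<^sup>2"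
    using power_mono[OF Zle, of _ 2] by (intro always_eventually allI) (simp add: power_divide)
  have Fi\<rho>: "integrable lebesgue (\<lambda>\<xi>. (norm (?F \<xi>))\<^sup>2 / \<rho>\<^sup>2)" using Fi by simp
  have Z2: "Z \<in> Lp_space 2" by (rule Lp_space_bound[OF Zm Fi\<rho> Zsq])
  have Z2le: "Lp_modular 2 Z \<le> Lp_modular 2 ?F / \<rho>\<^sup>2"
    using Lp_modular_mono[OF Zm Fi\<rho> Zsq] by (simp add: Lp_modular_def)
  show "z \<in> Ck_on k UNIV" unfolding z_def by (rule fourier_Ck_on[OF Zi supp])
  show "z \<in> Lp_space 2" unfolding z_def by (rule fourier_bessel(1)[OF Zi Z2])
  show "Lp_modular 2 z \<le> Lp_modular 2 ?F / \<rho>\<^sup>2"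
    unfolding z_def by (rule order_trans[OF fourier_bessel(2)[OF Zi Z2] Z2le])
  \<comment> \<open>Differentiation multiplies by a coordinate, which the division by the norm in
    \<open>Z\<close> compensates, so the derivatives are bounded independently of \<rho> and
    \<open>R\<close>.\<close>
  define Y where "Y j \<xi> = - 2 * pi * \<i> * complex_of_real (\<xi> $ j) * Z \<xi>" for j \<xi>
  have Yi: "integrable lebesgue (Y j)" for j
    unfolding Y_def by (rule bounded_support_integrable_mult[OF Zi supp]) (auto intro!: continuous_intros)
  have Ysq: "AE \<xi> in lebesgue. norm (Y j \<xi>) powr 2 \<le> (2 * pi)\<^sup>2 * (norm (?F \<xi>))\<^sup>2" for j
  proof (intro always_eventually allI)
    fix \<xi>
    have "norm (Y j \<xi>) \<le> 2 * pi * norm (?F \<xi>)"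
    proof (cases "\<xi> \<in> band \<rho> R")
      case True
      have "norm (Y j \<xi>) = 2 * pi * (\<bar>\<xi> $ j / norm \<xi>\<bar> * norm (?F \<xi>))"
        using True by (simp add: Y_def Z_def band_dual_def norm_mult norm_divide abs_divide)
      also have "\<dots> \<le> 2 * pi * (1 * norm (?F \<xi>))"
        by (intro mult_left_mono mult_right_mono norm_coord_ratio_le) auto
      finally show ?thesis by simp
    qed (simp add: Y_def Z_def band_dual_def)
    then have "(norm (Y j \<xi>))\<^sup>2 \<le> (2 * pi * norm (?F \<xi>))\<^sup>2" by (intro power_mono) auto
    then show "norm (Y j \<xi>) powr 2 \<le> (2 * pi)\<^sup>2 * (norm (?F \<xi>))\<^sup>2"
      unfolding norm_powr2 power_mult_distrib[of "2 * pi"] .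
  qed
  have Fi2: "integrable lebesgue (\<lambda>\<xi>. (2 * pi)\<^sup>2 * (norm (?F \<xi>))\<^sup>2)" using Fi by simp
  have Y2: "Y j \<in> Lp_space 2" for j by (rule Lp_space_bound[OF borel_measurable_integrable[OF Yi] Fi2 Ysq])
  have Y2le: "Lp_modular 2 (Y j) \<le> (2 * pi)\<^sup>2 * Lp_modular 2 ?F" for j
    using Lp_modular_mono[OF borel_measurable_integrable[OF Yi] Fi2 Ysq] by (simp add: Lp_modular_def)
  have pz: "pderivative j z = fourier (Y j)" for j
    unfolding z_def Y_def by (rule ext) (rule pderivative_fourier[OF Zi supp])
  show "pderivative j z \<in> Lp_space 2" unfolding pz by (rule fourier_bessel(1)[OF Yi Y2])
  show "Lp_modular 2 (pderivative j z) \<le> (2 * pi)\<^sup>2 * Lp_modular 2 ?F"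
    unfolding pz by (rule order_trans[OF fourier_bessel(2)[OF Yi Y2] Y2le])
  have "(\<Sum>j\<in>UNIV. \<integral>x. g j x * pderivative j z x \<partial>lebesgue) = (\<Sum>j\<in>UNIV. \<integral>\<xi>. fourier (g j) \<xi> * Y j \<xi> \<partial>lebesgue)"
    unfolding pz by (intro sum.cong refl fourier_multiplication_formula[symmetric] g Yi)
  also have "\<dots> = (\<integral>\<xi>. (\<Sum>j\<in>UNIV. fourier (g j) \<xi> * Y j \<xi>) \<partial>lebesgue)"
    by (intro Bochner_Integration.integral_sum[symmetric] L2_product(1) fourier_bessel(1) g Y2)
  also have "\<dots> = (\<integral>\<xi>. (- 2 * pi * \<i>) * complex_of_real (indicator (band \<rho> R) \<xi> * (norm (?F \<xi>))\<^sup>2) \<partial>lebesgue)"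
  proof (intro Bochner_Integration.integral_cong refl)
    fix \<xi> :: "real ^ 'n"
    show "(\<Sum>j\<in>UNIV. fourier (g j) \<xi> * Y j \<xi>) = (- 2 * pi * \<i>) * complex_of_real (indicator (band \<rho> R) \<xi> * (norm (?F \<xi>))\<^sup>2)"
    proof (cases "\<xi> \<in> band \<rho> R")
      case True
      \<comment> \<open>Summed over j, the coordinates rebuild the norm times the symbol sum; the
        norm cancels the denominator of \<open>Z\<close> and the squared modulus remains.\<close>
      have "(\<Sum>j\<in>UNIV. fourier (g j) \<xi> * Y j \<xi>) = (\<Sum>j\<in>UNIV. (- 2 * pi * \<i> * Z \<xi>) * (complex_of_real (\<xi> $ j) * fourier (g j) \<xi>))"
        by (intro sum.cong refl) (simp add: Y_def mult_ac)
      also have "\<dots> = (- 2 * pi * \<i> * Z \<xi>) * (complex_of_real (norm \<xi>) * ?F \<xi>)"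
        unfolding symbol_sum_norm_mult[OF in_band(3)[OF True]] by (rule sum_distrib_left[symmetric])
      also have "\<dots> = (- 2 * pi * \<i>) * (?F \<xi> * cnj (?F \<xi>))"
        using True in_band(3)[OF True] by (simp add: Z_def band_dual_def)
      also have "?F \<xi> * cnj (?F \<xi>) = complex_of_real ((norm (?F \<xi>))\<^sup>2)" by (rule complex_norm_square[symmetric])
      finally show ?thesis using True by simp
    qed (simp add: Y_def Z_def band_dual_def)
  qed
  also have "\<dots> = (- 2 * pi * \<i>) * complex_of_real (\<integral>\<xi>. indicator (band \<rho> R) \<xi> * (norm (?F \<xi>))\<^sup>2 \<partial>lebesgue)"
    by (subst integral_mult_right_zero, subst integral_complex_of_real) simp
  finally show "(\<Sum>j\<in>UNIV. \<integral>x. g j x * pderivative j z x \<partial>lebesgue)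
       = - 2 * pi * \<i> * complex_of_real (\<integral>\<xi>. indicator (band \<rho> R) \<xi> * (norm (?F \<xi>))\<^sup>2 \<partial>lebesgue)" .
qed

lemma L2_tail_small:
  fixes F :: "('n::finite) cfun"
  assumes "F \<in> Lp_space 2" "e > 0"
  shows "\<exists>R. R > r0 \<and> (\<integral>\<xi>. indicator {\<xi>. norm \<xi> \<ge> R} \<xi> * (norm (F \<xi>))\<^sup>2 \<partial>lebesgue) < e"
proof -
  have Fi: "integrable lebesgue (\<lambda>\<xi>. (norm (F \<xi>))\<^sup>2)" using Lp_space_integrable[OF assms(1)] by simp
  have s: "{\<xi>::real^'n. norm \<xi> \<ge> R} \<in> sets lebesgue" for R by (intro sets_completionI_sets) measurable
  have "(\<lambda>k. \<integral>\<xi>. indicator {\<xi>. norm \<xi> \<ge> real k} \<xi> * (norm (F \<xi>))\<^sup>2 \<partial>lebesgue) \<longlonglongrightarrow> (\<integral>\<xi>. 0 \<partial>(lebesgue :: (real^'n) measure))"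
  proof (rule integral_dominated_convergence[OF _ _ Fi])
    show "(\<lambda>\<xi>. indicator {\<xi>. norm \<xi> \<ge> real k} \<xi> * (norm (F \<xi>))\<^sup>2) \<in> borel_measurable lebesgue" for k
      using Fi by (intro borel_measurable_times borel_measurable_indicator s) auto
    show "AE \<xi> in lebesgue. (\<lambda>k. indicator {\<xi>. norm \<xi> \<ge> real k} \<xi> * (norm (F \<xi>))\<^sup>2) \<longlonglongrightarrow> 0"
    proof (intro always_eventually allI)
      fix \<xi> :: "real ^ 'n"
      obtain N :: nat where N: "norm \<xi> < real N" using reals_Archimedean2 by blast
      have "\<forall>\<^sub>F k in sequentially. 0 = indicator {\<xi>. norm \<xi> \<ge> real k} \<xi> * (norm (F \<xi>))\<^sup>2"
        using eventually_ge_at_top[of N] by eventually_elim (use N in \<open>auto simp: indicator_def\<close>)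
      then show "(\<lambda>k. indicator {\<xi>. norm \<xi> \<ge> real k} \<xi> * (norm (F \<xi>))\<^sup>2) \<longlonglongrightarrow> 0"
        by (rule Lim_transform_eventually[OF tendsto_const])
    qed
  qed (auto simp: indicator_def)
  then have "(\<lambda>k. \<integral>\<xi>. indicator {\<xi>. norm \<xi> \<ge> real k} \<xi> * (norm (F \<xi>))\<^sup>2 \<partial>lebesgue) \<longlonglongrightarrow> 0" by simp
  from order_tendstoD(2)[OF this assms(2)] obtain N where
    N: "\<And>k. k \<ge> N \<Longrightarrow> (\<integral>\<xi>. indicator {\<xi>. norm \<xi> \<ge> real k} \<xi> * (norm (F \<xi>))\<^sup>2 \<partial>lebesgue) < e"
    unfolding eventually_sequentially by blast
  obtain m :: nat where m: "r0 < real m" using reals_Archimedean2 by blast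
  show ?thesis using N[of "max N m"] m by (intro exI[of _ "real (max N m)"]) auto
qed

section \<open>Products with bounded functions, and splitting in frequency\<close>

lemma Linf_times_Lp:
  assumes w: "w \<in> borel_measurable lebesgue" "AE x in lebesgue. norm (w x) \<le> C" and U: "U \<in> Lp_space p" and p: "p > 0"
  shows "(\<lambda>x. w x * U x) \<in> Lp_space p" "Lp_modular p (\<lambda>x. w x * U x) \<le> \<bar>C\<bar> powr p * Lp_modular p U"
proof -
  have m: "(\<lambda>x. w x * U x) \<in> borel_measurable lebesgue" by (intro borel_measurable_times w(1) Lp_space_measurable[OF U])
  have i: "integrable lebesgue (\<lambda>x. \<bar>C\<bar> powr p * norm (U x) powr p)" using Lp_space_integrable[OF U] by (rule integrable_mult_right)
  have le: "AE x in lebesgue. norm (w x * U x) powr p \<le> \<bar>C\<bar> powr p * norm (U x) powr p"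
    using w(2)
  proof eventually_elim
    case (elim x)
    have "norm (w x * U x) powr p \<le> (\<bar>C\<bar> * norm (U x)) powr p"
      using elim p by (intro powr_mono2) (auto simp: norm_mult intro!: mult_right_mono)
    then show ?case by (simp add: powr_mult)
  qed
  show "(\<lambda>x. w x * U x) \<in> Lp_space p" by (rule Lp_space_bound[OF m i le])
  show "Lp_modular p (\<lambda>x. w x * U x) \<le> \<bar>C\<bar> powr p * Lp_modular p U"
    using Lp_modular_mono[OF m i le] by (simp add: Lp_modular_def)
qed

lemma Linf_ball_support_Lp:
  fixes w :: "('n::finite) cfun"
  assumes "w \<in> borel_measurable lebesgue" "AE x in lebesgue. norm (w x) \<le> C" "AE x in lebesgue. norm x > R \<longrightarrow> w x = 0" "s > 0"
  shows "w \<in> Lp_space s"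
proof -
  have "integrable lebesgue (\<lambda>x. norm (w x) powr s)"
  proof (rule bounded_ball_support_integrable[of _ "\<bar>C\<bar> powr s" R])
    show "(\<lambda>x. norm (w x) powr s) \<in> borel_measurable lebesgue" using assms(1) by measurable
    show "AE x in lebesgue. norm (norm (w x) powr s) \<le> \<bar>C\<bar> powr s"
      using assms(2) by eventually_elim (use assms(4) in \<open>auto intro!: powr_mono2\<close>)
    show "AE x in lebesgue. R < norm x \<longrightarrow> norm (w x) powr s = 0" using assms(3) by eventually_elim simp
  qed
  then show ?thesis using assms(1) by (simp add: Lp_space_def)
qed

lemma Linf_ball_support_times_bounded:
  fixes w :: "('n::finite) cfun" and U :: "nat \<Rightarrow> 'n cfun"
  assumes w: "w \<in> borel_measurable lebesgue" "AE x in lebesgue. norm (w x) \<le> C" "AE x in lebesgue. norm x > R \<longrightarrow> w x = 0"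
    and U: "\<And>n. U n \<in> Lp_space p" "\<And>n. Lp_modular p (U n) \<le> K" and p: "p \<ge> 2"
  shows "\<And>n. (\<lambda>x. w x * U n x) \<in> Lp_space 2" "\<And>n. integrable lebesgue (\<lambda>x. w x * U n x)"
    "\<exists>B. \<forall>n. Lp_modular 2 (\<lambda>x. w x * U n x) \<le> B \<and> (\<integral>x. norm (w x * U n x) \<partial>lebesgue) \<le> B"
proof -
  have p0: "p > 0" "2 \<le> p" "1 \<le> p" using p by auto
  have supp: "AE x in lebesgue. norm x > R \<longrightarrow> w x * U n x = 0" for n using w(3) by eventually_elim simp
  have L: "(\<lambda>x. w x * U n x) \<in> Lp_space p" for n by (rule Linf_times_Lp(1)[OF w(1,2) U(1) p0(1)])
  show "(\<lambda>x. w x * U n x) \<in> Lp_space 2" for n by (rule Lp_space_ball_subexponent(1)[OF L _ p0(2) supp]) simp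
  have L1: "(\<lambda>x. w x * U n x) \<in> Lp_space 1" for n by (rule Lp_space_ball_subexponent(1)[OF L _ p0(3) supp]) simp
  show "integrable lebesgue (\<lambda>x. w x * U n x)" for n
  proof -
    have "integrable lebesgue (\<lambda>x. norm (w x * U n x))" using Lp_space_integrable[OF L1[of n]] by simp
    then show ?thesis using Lp_space_measurable[OF L1[of n]] by (simp only: integrable_norm_iff)
  qed
  define B where "B = measure lebesgue (cball (0::real^'n) R) + \<bar>C\<bar> powr p * K"
  have "Lp_modular s (\<lambda>x. w x * U n x) \<le> B" if "0 < s" "s \<le> p" for s n
  proof -
    have "Lp_modular s (\<lambda>x. w x * U n x) \<le> measure lebesgue (cball (0::real^'n) R) + Lp_modular p (\<lambda>x. w x * U n x)"
      by (rule Lp_space_ball_subexponent(2)[OF L that supp])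
    also have "Lp_modular p (\<lambda>x. w x * U n x) \<le> \<bar>C\<bar> powr p * K"
      by (rule order_trans[OF Linf_times_Lp(2)[OF w(1,2) U(1) p0(1)]]) (intro mult_left_mono U, simp)
    finally show ?thesis by (simp add: B_def)
  qed
  from this[of 2] this[of 1] show "\<exists>B. \<forall>n. Lp_modular 2 (\<lambda>x. w x * U n x) \<le> B \<and> (\<integral>x. norm (w x * U n x) \<partial>lebesgue) \<le> B"
    using p by (intro exI[of _ B]) (simp add: Lp_modular_def)
qed

text \<open>Encodes the order of the limits: \<rho> is fixed first with \<open>C / \<rho>\<close>
  below half the tolerance, and n grows afterwards. The null sequence \<open>e\<close> may depend on
  \<rho>.\<close>

lemma tendsto_0_interpolate:
  fixes x :: "nat \<Rightarrow> real"
  assumes x: "\<And>n. x n \<ge> 0"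
    and step: "\<And>\<rho>. \<rho> \<ge> 1 \<Longrightarrow> \<exists>e. e \<longlonglongrightarrow> 0 \<and> (\<forall>n. x n \<le> e n + C / \<rho>)"
  shows "x \<longlonglongrightarrow> 0"
proof (rule LIMSEQ_I)
  fix \<epsilon> :: real assume \<epsilon>: "\<epsilon> > 0"
  define \<rho> where "\<rho> = 1 + 2 * \<bar>C\<bar> / \<epsilon>"
  have \<rho>: "\<rho> \<ge> 1" using \<epsilon> by (simp add: \<rho>_def)
  have "2 * \<bar>C\<bar> \<le> \<epsilon> * \<rho>" using \<epsilon> by (simp add: \<rho>_def field_simps)
  then have C\<rho>: "C / \<rho> \<le> \<epsilon> / 2" using \<rho> by (simp add: field_simps abs_le_iff)
  obtain e where e: "e \<longlonglongrightarrow> 0" "\<forall>n. x n \<le> e n + C / \<rho>" using step[OF \<rho>] by blast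
  from LIMSEQ_D[OF e(1), of "\<epsilon> / 2"] \<epsilon> obtain N where N: "\<forall>n\<ge>N. norm (e n - 0) < \<epsilon> / 2" by auto
  have "norm (x n - 0) < \<epsilon>" if "n \<ge> N" for n
  proof -
    have "\<bar>e n\<bar> < \<epsilon> / 2" using N that by simp
    moreover have "x n \<le> e n + C / \<rho>" using e(2) by simp
    ultimately show ?thesis unfolding real_norm_def using C\<rho> x[of n] by linarith
  qed
  then show "\<exists>N. \<forall>n\<ge>N. norm (x n - 0) < \<epsilon>" by blast
qed

text \<open>At a fixed frequency the exponential times \<open>w\<close> is an admissible dual
  function, because \<open>w\<close> is bounded and has bounded support.\<close>

lemma fourier_weakly_tendsto_0:
  fixes w :: "('n::finite) cfun"
  assumes U: "Lp_weakly p U (\<lambda>x. 0)" and p: "p > 1"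
    and w: "w \<in> borel_measurable lebesgue" "AE x in lebesgue. norm (w x) \<le> C" "AE x in lebesgue. norm x > R \<longrightarrow> w x = 0"
  shows "(\<lambda>n. fourier (\<lambda>x. w x * U n x) \<xi>) \<longlonglongrightarrow> 0"
proof -
  define e where "e x = cis (- 2 * pi * (x \<bullet> \<xi>)) * w x" for x
  have "e \<in> Lp_space (conj_exp p)"
  proof (rule Linf_ball_support_Lp)
    show "e \<in> borel_measurable lebesgue"
      unfolding e_def by (intro borel_measurable_times w(1) borel_measurable_lebesgue_of_borel borel_measurable_continuous_onI continuous_intros)
    show "AE x in lebesgue. norm (e x) \<le> C" using w(2) by eventually_elim (simp add: e_def norm_mult)
    show "AE x in lebesgue. norm x > R \<longrightarrow> e x = 0" using w(3) by eventually_elim (simp add: e_def)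
    show "conj_exp p > 0" using p by (simp add: conj_exp_def)
  qed
  then have "(\<lambda>n. \<integral>x. U n x * e x \<partial>lebesgue) \<longlonglongrightarrow> (\<integral>x. 0 * e x \<partial>lebesgue)"
    using U unfolding Lp_weakly_def by blast
  moreover have "(\<integral>x. U n x * e x \<partial>lebesgue) = fourier (\<lambda>x. w x * U n x) \<xi>" for n
    unfolding fourier_def by (intro Bochner_Integration.integral_cong refl) (simp add: e_def mult_ac)
  ultimately show ?thesis by simp
qed

text \<open>The transforms are bounded by the L1 bound and tend to 0 at each frequency, so dominated
  convergence applies on a ball. At high frequencies a constant is no integrable majorant; there the
  equation has to help.\<close>

lemma low_frequencies_tendsto_0:
  fixes g :: "nat \<Rightarrow> 'n \<Rightarrow> ('n::finite) cfun"
  assumes g: "\<And>n j. integrable lebesgue (g n j)" "\<And>n j. (\<integral>x. norm (g n j x) \<partial>lebesgue) \<le> B"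
    "\<And>j \<xi>. (\<lambda>n. fourier (g n j) \<xi>) \<longlonglongrightarrow> 0"
  shows "(\<lambda>n. \<integral>\<xi>. indicator {\<xi>. norm \<xi> \<le> \<rho>} \<xi> * (norm (symbol_sum (g n) \<xi>))\<^sup>2 \<partial>lebesgue) \<longlonglongrightarrow> 0"
proof -
  let ?I = "indicator {\<xi>::real^'n. norm \<xi> \<le> \<rho>} :: real^'n \<Rightarrow> real"
  define M where "M = real CARD('n) * B"
  have sM: "norm (symbol_sum (g n) \<xi>) \<le> M" for n \<xi>
  proof -
    have "norm (symbol_sum (g n) \<xi>) \<le> (\<Sum>j\<in>UNIV. norm (fourier (g n j) \<xi>))" by (rule norm_symbol_sum_le)
    also have "\<dots> \<le> (\<Sum>j\<in>(UNIV::'n set). B)" by (intro sum_mono order_trans[OF fourier_norm_le[OF g(1)] g(2)])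
    finally show ?thesis by (simp add: M_def)
  qed
  have s: "{\<xi>::real^'n. norm \<xi> \<le> \<rho>} \<in> sets lebesgue" by (intro sets_completionI_sets) measurable
  have Im: "?I \<in> borel_measurable lebesgue" by (rule borel_measurable_indicator[OF s])
  have dom: "integrable lebesgue (\<lambda>\<xi>. ?I \<xi> * M\<^sup>2)"
  proof (rule bounded_ball_support_integrable)
    show "(\<lambda>\<xi>. ?I \<xi> * M\<^sup>2) \<in> borel_measurable lebesgue" using Im by simp
    show "AE \<xi> in lebesgue. norm (?I \<xi> * M\<^sup>2) \<le> M\<^sup>2" by (auto simp: indicator_def)
    show "AE \<xi> in lebesgue. norm \<xi> > \<rho> \<longrightarrow> ?I \<xi> * M\<^sup>2 = 0" by (auto simp: indicator_def)
  qed
  have "(\<lambda>n. \<integral>\<xi>. ?I \<xi> * (norm (symbol_sum (g n) \<xi>))\<^sup>2 \<partial>lebesgue) \<longlonglongrightarrow> (\<integral>\<xi>. 0 \<partial>(lebesgue :: (real^'n) measure))"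
  proof (rule integral_dominated_convergence[OF _ _ dom])
    show "(\<lambda>\<xi>. ?I \<xi> * (norm (symbol_sum (g n) \<xi>))\<^sup>2) \<in> borel_measurable lebesgue" for n
      using Im symbol_sum_lebesgue[of "g n", OF g(1)] by measurable
    show "AE \<xi> in lebesgue. (\<lambda>n. ?I \<xi> * (norm (symbol_sum (g n) \<xi>))\<^sup>2) \<longlonglongrightarrow> 0"
    proof (intro always_eventually allI)
      fix \<xi> :: "real ^ 'n"
      have "(\<lambda>n. \<Sum>j\<in>UNIV. norm (fourier (g n j) \<xi>)) \<longlonglongrightarrow> 0"
        by (intro tendsto_null_sum tendsto_norm_zero g(3))
      then have "(\<lambda>n. norm (symbol_sum (g n) \<xi>)) \<longlonglongrightarrow> 0"
        by (rule tendsto_0_le_nonneg[rotated 2]) (auto intro: norm_symbol_sum_le)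
      from tendsto_mult[OF tendsto_const[of "?I \<xi>"] tendsto_power[OF this, of 2]]
      show "(\<lambda>n. ?I \<xi> * (norm (symbol_sum (g n) \<xi>))\<^sup>2) \<longlonglongrightarrow> 0" by simp
    qed
    show "AE \<xi> in lebesgue. norm (?I \<xi> * (norm (symbol_sum (g n) \<xi>))\<^sup>2) \<le> ?I \<xi> * M\<^sup>2" for n
      by (intro always_eventually allI) (auto simp: indicator_def intro!: power_mono sM)
  qed simp
  then show ?thesis by simp
qed

lemma L2_frequency_split:
  fixes F :: "('n::finite) cfun"
  assumes "F \<in> Lp_space 2"
  shows "Lp_modular 2 F \<le> (\<integral>\<xi>. indicator {\<xi>. norm \<xi> \<le> \<rho>} \<xi> * (norm (F \<xi>))\<^sup>2 \<partial>lebesgue)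
    + (\<integral>\<xi>. indicator (band \<rho> R) \<xi> * (norm (F \<xi>))\<^sup>2 \<partial>lebesgue)
    + (\<integral>\<xi>. indicator {\<xi>. norm \<xi> \<ge> R} \<xi> * (norm (F \<xi>))\<^sup>2 \<partial>lebesgue)"
proof -
  have Fi: "integrable lebesgue (\<lambda>\<xi>. (norm (F \<xi>))\<^sup>2)" using Lp_space_integrable[OF assms] by simp
  have s: "{\<xi>::real^'n. norm \<xi> \<le> \<rho>} \<in> sets lebesgue" "{\<xi>::real^'n. norm \<xi> \<ge> R} \<in> sets lebesgue"
    by (intro sets_completionI_sets; measurable)+
  have i: "integrable lebesgue (\<lambda>\<xi>. indicator S \<xi> * (norm (F \<xi>))\<^sup>2)" if "S \<in> sets lebesgue" for S
    using integrable_mult_indicator[OF that Fi] by simp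
  note i3 = i[OF s(1)] i[OF band_lebesgue] i[OF s(2)]
  have "Lp_modular 2 F = (\<integral>\<xi>. (norm (F \<xi>))\<^sup>2 \<partial>lebesgue)" by (simp add: Lp_modular_def)
  also have "\<dots> \<le> (\<integral>\<xi>. indicator {\<xi>. norm \<xi> \<le> \<rho>} \<xi> * (norm (F \<xi>))\<^sup>2 + indicator (band \<rho> R) \<xi> * (norm (F \<xi>))\<^sup>2
     + indicator {\<xi>. norm \<xi> \<ge> R} \<xi> * (norm (F \<xi>))\<^sup>2 \<partial>lebesgue)"
    by (intro integral_mono Fi Bochner_Integration.integrable_add i3) (auto simp: indicator_def band_def)
  finally show ?thesis
    by (simp only: Bochner_Integration.integral_add[OF Bochner_Integration.integrable_add[OF i3(1,2)] i3(3)] Bochner_Integration.integral_add[OF i3(1,2)])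
qed

lemma test_fun_bounded: "b \<in> test_fun \<Longrightarrow> \<exists>M. \<forall>x. norm (b x) \<le> M"
  using Cc_integrable_lebesgue(3) unfolding test_fun_def by blast

lemma Linf_test_fun_mult:
  assumes "a \<in> Linf_space" "b \<in> test_fun"
  shows "(\<lambda>x. a x * b x) \<in> borel_measurable lebesgue" "\<exists>C. AE x in lebesgue. norm (a x * b x) \<le> C"
    "\<exists>R. AE x in lebesgue. norm x > R \<longrightarrow> a x * b x = 0"
proof -
  obtain C where C: "a \<in> borel_measurable lebesgue" "AE x in lebesgue. norm (a x) \<le> C" using assms(1) by (auto simp: Linf_space_def)
  obtain M where M: "\<And>x. norm (b x) \<le> M" using test_fun_bounded[OF assms(2)] by blast
  show "(\<lambda>x. a x * b x) \<in> borel_measurable lebesgue"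
    by (intro borel_measurable_times C(1) borel_measurable_lebesgue_of_borel test_fun_borel assms(2))
  have "AE x in lebesgue. norm (a x * b x) \<le> \<bar>C\<bar> * M"
    using C(2) by eventually_elim (auto simp: norm_mult intro!: mult_mono M)
  then show "\<exists>C. AE x in lebesgue. norm (a x * b x) \<le> C" by blast
  obtain R where "\<And>x. norm x > R \<Longrightarrow> b x = 0" using assms(2) unfolding test_fun_iff by blast
  then show "\<exists>R. AE x in lebesgue. norm x > R \<longrightarrow> a x * b x = 0" by (intro exI[of _ R]) simp
qed

lemma test_fun_times_L2:
  assumes b: "b \<in> test_fun" "\<And>x. norm (b x) \<le> M" and z: "z \<in> Lp_space 2" "Lp_modular 2 z \<le> C"
  shows "(\<lambda>x. b x * z x) \<in> Lp_space 2" "Lp_modular 2 (\<lambda>x. b x * z x) \<le> M\<^sup>2 * C"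
proof -
  have b': "b \<in> borel_measurable lebesgue" "AE x in lebesgue. norm (b x) \<le> M"
    using b by (auto intro: borel_measurable_lebesgue_of_borel test_fun_borel)
  show "(\<lambda>x. b x * z x) \<in> Lp_space 2" by (rule Linf_times_Lp(1)[OF b' z(1)]) simp
  have "Lp_modular 2 (\<lambda>x. b x * z x) \<le> \<bar>M\<bar> powr 2 * Lp_modular 2 z" by (rule Linf_times_Lp(2)[OF b' z(1)]) simp
  also have "\<dots> \<le> \<bar>M\<bar> powr 2 * C" by (intro mult_left_mono z) simp
  finally show "Lp_modular 2 (\<lambda>x. b x * z x) \<le> M\<^sup>2 * C" by (simp add: powr_numeral)
qed

text \<open>The support of \<open>b\<close> turns L2 bounds into bounds with exponent
  \<open>s \<le> 2\<close>, and the product rule handles the derivatives. The bound is uniform in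
  \<open>z\<close>, as it will be applied to a sequence of such functions.\<close>

lemma test_fun_times_W1_bound:
  fixes b z :: "('n::finite) cfun"
  assumes b: "b \<in> test_fun" and s: "0 < s" "s \<le> 2"
  shows "\<exists>K. \<forall>z. (\<forall>k. z \<in> Ck_on k UNIV) \<longrightarrow> z \<in> Lp_space 2 \<longrightarrow> Lp_modular 2 z \<le> C \<longrightarrow>
    (\<forall>j. pderivative j z \<in> Lp_space 2 \<and> Lp_modular 2 (pderivative j z) \<le> C) \<longrightarrow>
    W1_norm s (\<lambda>x. b x * z x) \<le> K"
proof -
  obtain R where R: "\<And>x. norm x > R \<Longrightarrow> b x = 0" using b unfolding test_fun_iff by blast
  obtain M where M: "\<And>x. norm (b x) \<le> M" using test_fun_bounded[OF b] by blast
  have "\<forall>j. \<exists>N. \<forall>x. norm (pderivative j b x) \<le> N" using test_fun_bounded[OF test_fun_pderivative[OF b]] by blast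
  from choice[OF this] obtain N where N: "\<forall>j x. norm (pderivative j b x) \<le> N j" ..
  \<comment> \<open>Collects the volume of the ball, the bound for \<open>b * z\<close>, and for
    each derivative the two Leibniz terms with the factor \<open>4 = 2 powr 2\<close>. Absolute
    values make every part nonnegative whatever the sign of \<open>C\<close>.\<close>
  define L where "L = measure lebesgue (cball (0::real^'n) R) + \<bar>M\<^sup>2 * C\<bar> + (\<Sum>j\<in>UNIV. 4 * \<bar>(N j)\<^sup>2 * C + M\<^sup>2 * C\<bar>)"
  have "W1_norm s (\<lambda>x. b x * z x) \<le> (1 + real CARD('n)) * L powr (1 / s)"
    if z: "\<forall>k. z \<in> Ck_on k UNIV" "z \<in> Lp_space 2" "Lp_modular 2 z \<le> C"
      "\<forall>j. pderivative j z \<in> Lp_space 2 \<and> Lp_modular 2 (pderivative j z) \<le> C" for z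
  proof (rule W1_norm_le_of_modular[OF test_fun_mult_smooth[OF b] s(1)])
    show "z \<in> Ck_on k UNIV" for k using z by simp
    have zd: "z differentiable (at x)" for x
      using spec[OF z(1), of "Suc 0"] unfolding Ck_on_Suc differentiable_on_def by simp
    have ball: "Lp_modular s h \<le> measure lebesgue (cball (0::real^'n) R) + Lp_modular 2 h"
      if "h \<in> Lp_space 2" "\<And>x. norm x > R \<Longrightarrow> h x = 0" for h :: "'n cfun"
      by (rule Lp_space_ball_subexponent(2)[OF that(1) s]) (use that(2) in simp)
    note bz = test_fun_times_L2[OF b M z(2,3)]
    have S0: "(\<Sum>j\<in>(UNIV::'n set). 4 * \<bar>(N j)\<^sup>2 * C + M\<^sup>2 * C\<bar>) \<ge> 0" by (intro sum_nonneg) simp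
    have "Lp_modular s (\<lambda>x. b x * z x) \<le> measure lebesgue (cball (0::real^'n) R) + Lp_modular 2 (\<lambda>x. b x * z x)"
      by (rule ball[OF bz(1)]) (simp add: R)
    then show "Lp_modular s (\<lambda>x. b x * z x) \<le> L" using bz(2) S0 by (simp add: L_def)
    have four: "(2::real) powr 2 = 4" by simp
    fix j
    have zj: "pderivative j z \<in> Lp_space 2" "Lp_modular 2 (pderivative j z) \<le> C" using z(4) by auto
    have Nj: "norm (pderivative j b x) \<le> N j" for x using N by simp
    note d1 = test_fun_times_L2[OF test_fun_pderivative[OF b] Nj z(2,3)]
    note d2 = test_fun_times_L2[OF b M zj]
    have pd: "pderivative j (\<lambda>x. b x * z x) = (\<lambda>x. pderivative j b x * z x + b x * pderivative j z x)"
      by (intro ext pderivative_mult test_fun_differentiable b zd)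
    have in2: "(\<lambda>x. pderivative j b x * z x + b x * pderivative j z x) \<in> Lp_space 2"
      by (rule Lp_space_add[OF d1(1) d2(1)]) simp
    have R': "pderivative j (\<lambda>x. b x * z x) x = 0" if "norm x > R" for x
      by (rule pderivative_outside_support[OF _ that]) (simp add: R)
    have "Lp_modular s (pderivative j (\<lambda>x. b x * z x)) \<le> measure lebesgue (cball (0::real^'n) R) + Lp_modular 2 (pderivative j (\<lambda>x. b x * z x))"
      by (rule ball) (use in2 R' in \<open>simp_all add: pd\<close>)
    also have "Lp_modular 2 (pderivative j (\<lambda>x. b x * z x)) \<le> 2 powr 2 * (Lp_modular 2 (\<lambda>x. pderivative j b x * z x) + Lp_modular 2 (\<lambda>x. b x * pderivative j z x))"
      unfolding pd by (rule Lp_modular_add_le[OF d1(1) d2(1)]) simp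
    also have "\<dots> \<le> 2 powr 2 * ((N j)\<^sup>2 * C + M\<^sup>2 * C)" by (intro mult_left_mono add_mono d1 d2) simp
    also have "\<dots> \<le> 4 * \<bar>(N j)\<^sup>2 * C + M\<^sup>2 * C\<bar>"
      by (simp only: four) (intro mult_left_mono abs_ge_self, simp)
    also have "\<dots> \<le> (\<Sum>j\<in>UNIV. 4 * \<bar>(N j)\<^sup>2 * C + M\<^sup>2 * C\<bar>)" by (rule member_le_sum) auto
    finally show "Lp_modular s (pderivative j (\<lambda>x. b x * z x)) \<le> L" by (simp add: L_def)
  qed
  then show ?thesis by blast
qed

text \<open>The commutator term \<open>h\<close>, which comes from the derivative of the cutoff \<open>b\<close>, does not tend to \<open>0\<close>,
  but its pairing with \<open>z\<close> gains a factor \<open>1 / \<rho>\<close>.\<close>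

lemma compensated_symbol_sum:
  fixes a :: "'n \<Rightarrow> ('n::finite) cfun" and U :: "nat \<Rightarrow> 'n cfun"
  assumes p: "p > 2" and U: "Lp_weakly p U (\<lambda>x. 0)" "\<And>n. Lp_modular p (U n) \<le> K"
    and a: "\<And>j. a j \<in> Linf_space"
    and f: "\<And>n. f n \<in> Wm1 p" "(\<lambda>n. Wm1_norm p (f n)) \<longlonglongrightarrow> 0"
    and eq: "\<And>n \<phi>. \<phi> \<in> test_fun \<Longrightarrow> (\<Sum>j\<in>UNIV. \<integral>x. a j x * U n x * pderivative j \<phi> x \<partial>lebesgue) = - f n \<phi>"
    and b: "b \<in> test_fun"
  shows "(\<lambda>n. Lp_modular 2 (symbol_sum (\<lambda>j x. a j x * b x * U n x))) \<longlonglongrightarrow> 0"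
proof -
  define g where "g n j x = a j x * b x * U n x" for n j x
  define h where "h n j x = a j x * pderivative j b x * U n x" for n j x
  let ?F = "\<lambda>n. symbol_sum (g n)"
  have p1: "p > 1" "p \<ge> 2" using p by auto
  have s: "0 < conj_exp p" "conj_exp p \<le> 2" using p by (auto simp: conj_exp_def field_simps)
  have UL: "U n \<in> Lp_space p" for n using U(1) by (simp add: Lp_weakly_def)
  have gb: "g n j \<in> Lp_space 2 \<and> integrable lebesgue (g n j)" "(\<lambda>n. fourier (g n j) \<xi>) \<longlonglongrightarrow> 0"
    "\<exists>B. \<forall>n. Lp_modular 2 (g n j) \<le> B \<and> (\<integral>x. norm (g n j x) \<partial>lebesgue) \<le> B" for n j \<xi>
  proof -
    obtain C R where w: "AE x in lebesgue. norm (a j x * b x) \<le> C" "AE x in lebesgue. norm x > R \<longrightarrow> a j x * b x = 0"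
      using Linf_test_fun_mult(2,3)[OF a b] by blast
    note w = Linf_test_fun_mult(1)[OF a b] w
    note * = Linf_ball_support_times_bounded[where U=U, OF w UL U(2) p1(2)]
    show "g n j \<in> Lp_space 2 \<and> integrable lebesgue (g n j)" using *(1,2) by (simp add: g_def[abs_def])
    show "\<exists>B. \<forall>n. Lp_modular 2 (g n j) \<le> B \<and> (\<integral>x. norm (g n j x) \<partial>lebesgue) \<le> B" using *(3) by (simp add: g_def[abs_def])
    show "(\<lambda>n. fourier (g n j) \<xi>) \<longlonglongrightarrow> 0" using fourier_weakly_tendsto_0[OF U(1) p1(1) w] by (simp add: g_def[abs_def])
  qed
  have hb: "h n j \<in> Lp_space 2" "\<exists>B. \<forall>n. Lp_modular 2 (h n j) \<le> B \<and> (\<integral>x. norm (h n j x) \<partial>lebesgue) \<le> B" for n j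
  proof -
    note db = test_fun_pderivative[OF b, of j]
    obtain C R where w: "AE x in lebesgue. norm (a j x * pderivative j b x) \<le> C" "AE x in lebesgue. norm x > R \<longrightarrow> a j x * pderivative j b x = 0"
      using Linf_test_fun_mult(2,3)[OF a db] by blast
    note * = Linf_ball_support_times_bounded[where U=U, OF Linf_test_fun_mult(1)[OF a db] w UL U(2) p1(2)]
    show "h n j \<in> Lp_space 2" using *(1) by (simp add: h_def[abs_def])
    show "\<exists>B. \<forall>n. Lp_modular 2 (h n j) \<le> B \<and> (\<integral>x. norm (h n j x) \<partial>lebesgue) \<le> B" using *(3) by (simp add: h_def[abs_def])
  qed
  have "\<forall>j. \<exists>B. \<forall>n. Lp_modular 2 (g n j) \<le> B \<and> (\<integral>x. norm (g n j x) \<partial>lebesgue) \<le> B" using gb(3) by blast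
  from choice[OF this] obtain B1 where B1: "\<forall>j n. Lp_modular 2 (g n j) \<le> B1 j \<and> (\<integral>x. norm (g n j x) \<partial>lebesgue) \<le> B1 j" ..
  have "\<forall>j. \<exists>B. \<forall>n. Lp_modular 2 (h n j) \<le> B \<and> (\<integral>x. norm (h n j x) \<partial>lebesgue) \<le> B" using hb(2) by blast
  from choice[OF this] obtain B2 where B2: "\<forall>j n. Lp_modular 2 (h n j) \<le> B2 j \<and> (\<integral>x. norm (h n j x) \<partial>lebesgue) \<le> B2 j" ..
  define B where "B = (\<Sum>j\<in>UNIV. \<bar>B1 j\<bar> + \<bar>B2 j\<bar>)"
  have Bj: "\<bar>B1 j\<bar> + \<bar>B2 j\<bar> \<le> B" for j
    unfolding B_def by (rule member_le_sum) auto
  have gB: "Lp_modular 2 (g n j) \<le> B" "(\<integral>x. norm (g n j x) \<partial>lebesgue) \<le> B" "Lp_modular 2 (h n j) \<le> B" for n j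
  proof -
    have "Lp_modular 2 (g n j) \<le> B1 j" "(\<integral>x. norm (g n j x) \<partial>lebesgue) \<le> B1 j" "Lp_modular 2 (h n j) \<le> B2 j" using B1 B2 by auto
    then show "Lp_modular 2 (g n j) \<le> B" "(\<integral>x. norm (g n j x) \<partial>lebesgue) \<le> B" "Lp_modular 2 (h n j) \<le> B" using Bj[of j] by linarith+
  qed
  have gi: "integrable lebesgue (g n j)" "g n j \<in> Lp_space 2" for n j using gb(1) by auto
  \<comment> \<open>One factor \<open>CARD('n)\<close> comes from squaring a sum over the
    coordinates, the other from summing the bound \<open>B\<close>.\<close>
  define C1 where "C1 = real CARD('n) * (real CARD('n) * B)"
  have F2: "?F n \<in> Lp_space 2" "Lp_modular 2 (?F n) \<le> C1" for n
  proof -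
    show "?F n \<in> Lp_space 2" by (rule symbol_sum_L2(1)[OF gi])
    have "(\<Sum>j\<in>UNIV. Lp_modular 2 (g n j)) \<le> (\<Sum>j\<in>(UNIV::'n set). B)" by (intro sum_mono gB)
    then have "real CARD('n) * (\<Sum>j\<in>UNIV. Lp_modular 2 (g n j)) \<le> real CARD('n) * (\<Sum>j\<in>(UNIV::'n set). B)" by (intro mult_left_mono) auto
    from order_trans[OF symbol_sum_L2(2)[of "g n", OF gi] this] show "Lp_modular 2 (?F n) \<le> C1" by (simp add: C1_def)
  qed
  have C1_0: "C1 \<ge> 0" using order_trans[OF Lp_modular_nonneg F2(2)] .
  \<comment> \<open>For each coordinate the commutator pairing is at most
    \<open>(B + C1) / \<rho>\<close>; there are \<open>CARD('n)\<close> of them.\<close>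
  define C2 where "C2 = real CARD('n) * (B + C1)"
  \<comment> \<open>The bound for the derivatives of \<open>z n\<close>. As
    \<open>(2 * pi)\<^sup>2 \<ge> 1\<close> it also bounds \<open>z n\<close>, so one constant
    serves for the Sobolev estimate.\<close>
  define C3 where "C3 = (2 * pi)\<^sup>2 * C1"
  have pi2: "(2 * pi)\<^sup>2 \<ge> 1" using pi_ge_two by (intro one_le_power) simp
  have C3: "C1 \<le> C3" using mult_right_mono[OF pi2 C1_0] by (simp add: C3_def)
  have step: "\<exists>e. e \<longlonglongrightarrow> 0 \<and> (\<forall>n. Lp_modular 2 (?F n) \<le> e n + C2 / \<rho>)" if \<rho>: "\<rho> \<ge> 1" for \<rho>
  proof -
    \<comment> \<open>Nothing is known about the tails uniformly in n, so the outer radius is chosen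
      for each n separately; the bounds on \<open>z n\<close> are independent of it.\<close>
    have "\<forall>n. \<exists>R. R > \<rho> \<and> (\<integral>\<xi>. indicator {\<xi>. norm \<xi> \<ge> R} \<xi> * (norm (?F n \<xi>))\<^sup>2 \<partial>lebesgue) < inverse (real (Suc n))"
      by (intro allI L2_tail_small F2) simp
    from choice[OF this] obtain R where R: "\<forall>n. R n > \<rho> \<and> (\<integral>\<xi>. indicator {\<xi>. norm \<xi> \<ge> R n} \<xi> * (norm (?F n \<xi>))\<^sup>2 \<partial>lebesgue) < inverse (real (Suc n))" ..
    define z where "z n = fourier (band_dual \<rho> (R n) (g n))" for n
    define T where "T n = (\<integral>\<xi>. indicator (band \<rho> (R n)) \<xi> * (norm (?F n \<xi>))\<^sup>2 \<partial>lebesgue)" for n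
    define L where "L n = (\<integral>\<xi>. indicator {\<xi>. norm \<xi> \<le> \<rho>} \<xi> * (norm (?F n \<xi>))\<^sup>2 \<partial>lebesgue)" for n
    have \<rho>2: "\<rho>\<^sup>2 \<ge> 1" using \<rho> by (rule one_le_power)
    have zC: "Lp_modular 2 (z n) \<le> C1 / \<rho>\<^sup>2" for n
    proof -
      have "Lp_modular 2 (z n) \<le> Lp_modular 2 (?F n) / \<rho>\<^sup>2"
        unfolding z_def by (rule band_dual_estimates[OF gi \<rho>])
      also have "\<dots> \<le> C1 / \<rho>\<^sup>2" by (intro divide_right_mono F2) simp
      finally show ?thesis .
    qed
    have zC3: "Lp_modular 2 (z n) \<le> C3" for n
    proof -
      have "C1 / \<rho>\<^sup>2 \<le> C1 / 1" using \<rho>2 C1_0 by (intro divide_left_mono) auto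
      then show ?thesis using zC[of n] C3 by simp
    qed
    have z2: "z n \<in> Lp_space 2" and zk: "z n \<in> Ck_on k UNIV" and dz2: "pderivative j (z n) \<in> Lp_space 2" for n k j
      unfolding z_def by (rule band_dual_estimates[OF gi \<rho>])+
    have dzC3: "Lp_modular 2 (pderivative j (z n)) \<le> C3" for n j
    proof -
      have "Lp_modular 2 (pderivative j (z n)) \<le> (2 * pi)\<^sup>2 * Lp_modular 2 (?F n)"
        unfolding z_def by (rule band_dual_estimates[OF gi \<rho>])
      also have "\<dots> \<le> C3" unfolding C3_def by (intro mult_left_mono F2) simp
      finally show ?thesis .
    qed
    have Teq: "(\<Sum>j\<in>UNIV. \<integral>x. g n j x * pderivative j (z n) x \<partial>lebesgue) = - 2 * pi * \<i> * complex_of_real (T n)" for n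
      unfolding z_def T_def by (rule band_dual_estimates[OF gi \<rho>])
    define \<theta> where "\<theta> n x = b x * z n x" for n x
    have \<theta>: "\<theta> n \<in> test_fun" for n unfolding \<theta>_def by (rule test_fun_mult_smooth[OF b zk])
    obtain K' where K': "\<forall>z. (\<forall>k. z \<in> Ck_on k UNIV) \<longrightarrow> z \<in> Lp_space 2 \<longrightarrow> Lp_modular 2 z \<le> C3 \<longrightarrow>
      (\<forall>j. pderivative j z \<in> Lp_space 2 \<and> Lp_modular 2 (pderivative j z) \<le> C3) \<longrightarrow>
      W1_norm (conj_exp p) (\<lambda>x. b x * z x) \<le> K'" using test_fun_times_W1_bound[OF b s] ..
    have \<theta>K: "W1_norm (conj_exp p) (\<theta> n) \<le> K'" for n
      using spec[OF K', of "z n"] zk z2 zC3 dz2 dzC3 unfolding \<theta>_def by blast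
    have f0: "(\<lambda>n. f n (\<theta> n)) \<longlonglongrightarrow> 0" by (rule Wm1_test_fun_tendsto_0[OF f p1(1) \<theta> \<theta>K])
    have feq: "- f n (\<theta> n) = (\<Sum>j\<in>UNIV. \<integral>x. h n j x * z n x \<partial>lebesgue) + (- 2 * pi * \<i> * complex_of_real (T n))" for n
    proof -
      have zd: "z n differentiable (at x)" for x
        using zk[of n "Suc 0"] unfolding Ck_on_Suc differentiable_on_def by simp
      have pd: "pderivative j (\<theta> n) x = pderivative j b x * z n x + b x * pderivative j (z n) x" for j x
        unfolding \<theta>_def by (intro pderivative_mult test_fun_differentiable b zd)
      have "(\<integral>x. a j x * U n x * pderivative j (\<theta> n) x \<partial>lebesgue) = (\<integral>x. h n j x * z n x \<partial>lebesgue) + (\<integral>x. g n j x * pderivative j (z n) x \<partial>lebesgue)" for j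
      proof -
        have "(\<integral>x. a j x * U n x * pderivative j (\<theta> n) x \<partial>lebesgue) = (\<integral>x. h n j x * z n x + g n j x * pderivative j (z n) x \<partial>lebesgue)"
          by (intro Bochner_Integration.integral_cong refl) (simp add: pd h_def g_def algebra_simps)
        then show ?thesis
          by (simp only: Bochner_Integration.integral_add[OF L2_product(1)[OF hb(1) z2] L2_product(1)[OF gi(2) dz2]])
      qed
      then show ?thesis using eq[OF \<theta>, of n n] by (simp add: sum.distrib Teq)
    qed
    have T0: "T n \<ge> 0" for n unfolding T_def by (intro Bochner_Integration.integral_nonneg) simp
    have hz: "norm (\<Sum>j\<in>UNIV. \<integral>x. h n j x * z n x \<partial>lebesgue) \<le> C2 / \<rho>" for n
    proof -
      have "norm (\<integral>x. h n j x * z n x \<partial>lebesgue) \<le> (B + C1) / \<rho>" for j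
      proof -
        \<comment> \<open>The weight \<open>1 / \<rho>\<close> balances the two sides:
          \<open>h\<close> contributes at most \<open>B / \<rho>\<close>, and the mass
          \<open>C1 / \<rho>\<^sup>2\<close> of \<open>z n\<close>, multiplied by \<rho>, gives
          \<open>C1 / \<rho>\<close>.\<close>
        have "norm (\<integral>x. h n j x * z n x \<partial>lebesgue) \<le> (1 / \<rho>) * Lp_modular 2 (h n j) + Lp_modular 2 (z n) / (1 / \<rho>)"
          by (rule L2_product(2)[OF hb(1) z2]) (use \<rho> in simp)
        moreover have "(1 / \<rho>) * Lp_modular 2 (h n j) \<le> (1 / \<rho>) * B" using \<rho> by (intro mult_left_mono gB) simp
        moreover have "Lp_modular 2 (z n) / (1 / \<rho>) \<le> (C1 / \<rho>\<^sup>2) / (1 / \<rho>)" using \<rho> by (intro divide_right_mono zC) simp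
        moreover have "(C1 / \<rho>\<^sup>2) / (1 / \<rho>) = C1 / \<rho>" using \<rho> by (simp add: power2_eq_square)
        ultimately show ?thesis by (simp add: add_divide_distrib)
      qed
      then have "(\<Sum>j\<in>UNIV. norm (\<integral>x. h n j x * z n x \<partial>lebesgue)) \<le> (\<Sum>j\<in>(UNIV::'n set). (B + C1) / \<rho>)" by (intro sum_mono)
      then show ?thesis using norm_sum[of "\<lambda>j. \<integral>x. h n j x * z n x \<partial>lebesgue" UNIV] by (simp add: C2_def)
    qed
    have TT: "T n \<le> norm (f n (\<theta> n)) + C2 / \<rho>" for n
    proof -
      have "2 * pi * \<i> * complex_of_real (T n) = f n (\<theta> n) + (\<Sum>j\<in>UNIV. \<integral>x. h n j x * z n x \<partial>lebesgue)"
        using feq[of n] by (simp add: algebra_simps)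
      then have "norm (2 * pi * \<i> * complex_of_real (T n)) \<le> norm (f n (\<theta> n)) + C2 / \<rho>"
        using norm_triangle_ineq[of "f n (\<theta> n)" "\<Sum>j\<in>UNIV. \<integral>x. h n j x * z n x \<partial>lebesgue"] hz[of n] by simp
      moreover have "norm (2 * pi * \<i> * complex_of_real (T n)) = 2 * pi * T n" using T0[of n] by (simp add: norm_mult)
      moreover have "1 * T n \<le> 2 * pi * T n" using pi_ge_two T0[of n] by (intro mult_right_mono) auto
      ultimately show ?thesis by simp
    qed
    have L0: "L \<longlonglongrightarrow> 0"
      unfolding L_def[abs_def] by (rule low_frequencies_tendsto_0[OF gi(1) gB(2) gb(2)])
    have "(\<lambda>n. L n + norm (f n (\<theta> n)) + inverse (real (Suc n))) \<longlonglongrightarrow> 0 + 0 + 0"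
      by (intro tendsto_add L0 tendsto_norm_zero f0 LIMSEQ_inverse_real_of_nat)
    \<comment> \<open>Low frequencies are \<open>L n\<close>, the band is estimated through the
      equation, and the tail is below the tolerance used to choose \<open>R n\<close>.\<close>
    moreover have "Lp_modular 2 (?F n) \<le> L n + norm (f n (\<theta> n)) + inverse (real (Suc n)) + C2 / \<rho>" for n
      using L2_frequency_split[OF F2(1), of n \<rho> "R n", folded L_def T_def] spec[OF R, of n] TT[of n] by linarith
    ultimately show ?thesis by (intro exI[of _ "\<lambda>n. L n + norm (f n (\<theta> n)) + inverse (real (Suc n))"]) simp
  qed
  have "(\<lambda>n. Lp_modular 2 (?F n)) \<longlonglongrightarrow> 0" by (rule tendsto_0_interpolate[OF Lp_modular_nonneg step])
  then show ?thesis by (simp add: g_def[abs_def])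
qed

section \<open>H-distributions\<close>

lemma Lp_bounded_modular:
  assumes "Lp_bounded p F" "p > 0"
  shows "\<exists>K. \<forall>n. Lp_modular p (F n) \<le> K"
proof -
  obtain C where C: "\<And>n. Lp_norm p (F n) \<le> C" using assms(1) unfolding Lp_bounded_def by blast
  have "Lp_modular p (F n) \<le> \<bar>C\<bar> powr p" for n
  proof -
    have "Lp_norm p (F n) \<le> \<bar>C\<bar>" using C[of n] by simp
    then have "Lp_norm p (F n) powr p \<le> \<bar>C\<bar> powr p"
      using assms(2) by (intro powr_mono2) (auto simp: Lp_norm_modular)
    moreover have "Lp_norm p (F n) powr p = Lp_modular p (F n)"
      using assms(2) by (simp add: Lp_norm_modular powr_powr Lp_modular_nonneg)
    ultimately show ?thesis by simp
  qed
  then show ?thesis by blast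
qed

lemma Linf_test_fun_Lp:
  assumes "a \<in> Linf_space" "b \<in> test_fun" "s > 0"
  shows "(\<lambda>x. a x * b x) \<in> Lp_space s"
proof -
  obtain C R where w: "AE x in lebesgue. norm (a x * b x) \<le> C" "AE x in lebesgue. norm x > R \<longrightarrow> a x * b x = 0"
    using Linf_test_fun_mult(2,3)[OF assms(1,2)] by blast
  show ?thesis by (rule Linf_ball_support_Lp[OF Linf_test_fun_mult(1)[OF assms(1,2)] w assms(3)])
qed

lemma Lp_weaklyD:
  assumes "Lp_weakly p F f" "g \<in> Lp_space (conj_exp p)"
  shows "(\<lambda>n. \<integral>x. F n x * g x \<partial>lebesgue) \<longlonglongrightarrow> (\<integral>x. f x * g x \<partial>lebesgue)"
  using assms by (simp add: Lp_weakly_def)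

lemma Lp_weakly_diff_0:
  assumes u: "Lp_weakly p u u\<^sub>0" and p: "p > 1"
  shows "Lp_weakly p (\<lambda>n x. u n x - u\<^sub>0 x) (\<lambda>x. 0)"
proof -
  have L: "u n \<in> Lp_space p" "u\<^sub>0 \<in> Lp_space p" for n using u by (auto simp: Lp_weakly_def)
  have "(\<lambda>n. \<integral>x. (u n x - u\<^sub>0 x) * g x \<partial>lebesgue) \<longlonglongrightarrow> (\<integral>x. 0 * g x \<partial>lebesgue)" if g: "g \<in> Lp_space (conj_exp p)" for g
  proof -
    have "(\<lambda>n. (\<integral>x. u n x * g x \<partial>lebesgue) - (\<integral>x. u\<^sub>0 x * g x \<partial>lebesgue)) \<longlonglongrightarrow> (\<integral>x. u\<^sub>0 x * g x \<partial>lebesgue) - (\<integral>x. u\<^sub>0 x * g x \<partial>lebesgue)"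
      using u g unfolding Lp_weakly_def by (intro tendsto_diff tendsto_const) blast
    moreover have "(\<integral>x. (u n x - u\<^sub>0 x) * g x \<partial>lebesgue) = (\<integral>x. u n x * g x \<partial>lebesgue) - (\<integral>x. u\<^sub>0 x * g x \<partial>lebesgue)" for n
      unfolding left_diff_distrib
      by (rule Bochner_Integration.integral_diff[OF conj_exp_product_integrable[OF L(1) g p] conj_exp_product_integrable[OF L(2) g p]])
    ultimately show ?thesis by simp
  qed
  moreover have "(\<lambda>x. u n x - u\<^sub>0 x) \<in> Lp_space p" for n by (rule Lp_space_diff[OF L]) (use p in simp)
  moreover have "(\<lambda>x. 0) \<in> Lp_space p" by (simp add: Lp_space_def)
  ultimately show ?thesis unfolding Lp_weakly_def by blast
qed

text \<open>For a fixed test function the right-hand sides tend to 0, while weak convergence passes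
  to the limit on the left. So the limit solves the homogeneous equation, and subtracting it leaves
  the right-hand side unchanged.\<close>

lemma divergence_equation_diff_limit:
  fixes a :: "'n \<Rightarrow> ('n::finite) cfun"
  assumes u: "Lp_weakly p u u\<^sub>0" and p: "p > 1" and a: "\<And>j. a j \<in> Linf_space"
    and f: "\<And>n. f n \<in> Wm1 p" "(\<lambda>n. Wm1_norm p (f n)) \<longlonglongrightarrow> 0"
    and eq: "\<And>n \<phi>. \<phi> \<in> test_fun \<Longrightarrow> (\<Sum>j\<in>UNIV. distr_deriv j (pairing (\<lambda>x. a j x * u n x)) \<phi>) = f n \<phi>"
    and \<phi>: "\<phi> \<in> test_fun"
  shows "(\<Sum>j\<in>UNIV. \<integral>x. a j x * (u n x - u\<^sub>0 x) * pderivative j \<phi> x \<partial>lebesgue) = - f n \<phi>"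
proof -
  define w where "w j x = a j x * pderivative j \<phi> x" for j x
  have w: "w j \<in> Lp_space (conj_exp p)" for j
    unfolding w_def by (rule Linf_test_fun_Lp[OF a test_fun_pderivative[OF \<phi>]]) (use p in \<open>simp add: conj_exp_def\<close>)
  have L: "u n \<in> Lp_space p" "u\<^sub>0 \<in> Lp_space p" for n using u by (auto simp: Lp_weakly_def)
  have eq': "(\<Sum>j\<in>UNIV. \<integral>x. u n x * w j x \<partial>lebesgue) = - f n \<phi>" for n
    unfolding eq[OF \<phi>, symmetric] distr_deriv_def pairing_def sum_negf
    by (simp add: w_def mult_ac)
  have "(\<lambda>n. f n \<phi>) \<longlonglongrightarrow> 0" by (rule Wm1_test_fun_tendsto_0[OF f p \<phi> order_refl])
  then have "(\<lambda>n. - f n \<phi>) \<longlonglongrightarrow> - 0" by (rule tendsto_minus)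
  moreover have "(\<lambda>n. - f n \<phi>) \<longlonglongrightarrow> (\<Sum>j\<in>UNIV. \<integral>x. u\<^sub>0 x * w j x \<partial>lebesgue)"
    unfolding eq'[symmetric] using u w unfolding Lp_weakly_def by (intro tendsto_sum) blast
  ultimately have lim: "(\<Sum>j\<in>UNIV. \<integral>x. u\<^sub>0 x * w j x \<partial>lebesgue) = 0" using LIMSEQ_unique by fastforce
  have "(\<integral>x. a j x * (u n x - u\<^sub>0 x) * pderivative j \<phi> x \<partial>lebesgue) = (\<integral>x. u n x * w j x \<partial>lebesgue) - (\<integral>x. u\<^sub>0 x * w j x \<partial>lebesgue)" for j
  proof -
    have "(\<integral>x. a j x * (u n x - u\<^sub>0 x) * pderivative j \<phi> x \<partial>lebesgue) = (\<integral>x. u n x * w j x - u\<^sub>0 x * w j x \<partial>lebesgue)"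
      by (intro Bochner_Integration.integral_cong refl) (simp add: w_def algebra_simps)
    then show ?thesis
      by (simp only: Bochner_Integration.integral_diff[OF conj_exp_product_integrable[OF L(1) w p] conj_exp_product_integrable[OF L(2) w p]])
  qed
  then show ?thesis by (simp only: sum_subtractf eq' lim diff_zero)
qed

lemma Lp_space_cnj: "f \<in> Lp_space p \<Longrightarrow> (\<lambda>x. cnj (f x)) \<in> Lp_space p"
  by (simp add: Lp_space_def borel_measurable_cnj)

text \<open>Of the four terms of the expanded product, the two mixed ones converge by weak
  convergence alone: multiplied by \<open>w\<close>, a fixed function of Lp lies in the dual space,
  since \<open>conj_exp p \<le> p\<close> and \<open>w\<close> is bounded with bounded
  support.\<close>

lemma weak_product_limit:
  fixes w :: "('n::finite) cfun"
  assumes p: "p > 2" and w: "w \<in> borel_measurable lebesgue" "AE x in lebesgue. norm (w x) \<le> C" "AE x in lebesgue. norm x > R \<longrightarrow> w x = 0"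
    and u: "Lp_weakly p u u\<^sub>0" and v: "Lp_weakly p v v\<^sub>0"
    and lim: "(\<lambda>n. \<integral>x. w x * u n x * cnj (v n x) \<partial>lebesgue) \<longlonglongrightarrow> l"
  shows "(\<lambda>n. \<integral>x. w x * (u n x - u\<^sub>0 x) * cnj (v n x - v\<^sub>0 x) \<partial>lebesgue) \<longlonglongrightarrow> l - (\<integral>x. w x * u\<^sub>0 x * cnj (v\<^sub>0 x) \<partial>lebesgue)"
proof -
  have L: "u n \<in> Lp_space p" "u\<^sub>0 \<in> Lp_space p" "v n \<in> Lp_space p" "v\<^sub>0 \<in> Lp_space p" for n
    using u v by (auto simp: Lp_weakly_def)
  have p1: "p > 1" "p > 0" and s: "0 < conj_exp p" "conj_exp p \<le> p" using p by (auto simp: conj_exp_def field_simps)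
  have dual: "(\<lambda>x. w x * g x) \<in> Lp_space (conj_exp p)" if "g \<in> Lp_space p" for g
  proof (rule Lp_space_ball_subexponent(1)[OF _ s])
    show "(\<lambda>x. w x * g x) \<in> Lp_space p" by (rule Linf_times_Lp(1)[OF w(1,2) that p1(2)])
    show "AE x in lebesgue. norm x > R \<longrightarrow> w x * g x = 0" using w(3) by eventually_elim simp
  qed
  have I: "integrable lebesgue (\<lambda>x. w x * g x * cnj (h x))" if "g \<in> Lp_space p" "h \<in> Lp_space p" for g h
    using conj_exp_product_integrable[OF Lp_space_cnj[OF that(2)] dual[OF that(1)] p1(1)] by (simp add: mult_ac)
  have "(\<lambda>n. \<integral>x. u n x * (w x * cnj (v\<^sub>0 x)) \<partial>lebesgue) \<longlonglongrightarrow> (\<integral>x. u\<^sub>0 x * (w x * cnj (v\<^sub>0 x)) \<partial>lebesgue)"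
    by (rule Lp_weaklyD[OF u dual[OF Lp_space_cnj[OF L(4)]]])
  then have lim1: "(\<lambda>n. \<integral>x. w x * u n x * cnj (v\<^sub>0 x) \<partial>lebesgue) \<longlonglongrightarrow> (\<integral>x. w x * u\<^sub>0 x * cnj (v\<^sub>0 x) \<partial>lebesgue)"
    by (simp add: mult_ac)
  have "(\<lambda>n. \<integral>x. v n x * cnj (w x * u\<^sub>0 x) \<partial>lebesgue) \<longlonglongrightarrow> (\<integral>x. v\<^sub>0 x * cnj (w x * u\<^sub>0 x) \<partial>lebesgue)"
    by (rule Lp_weaklyD[OF v Lp_space_cnj[OF dual[OF L(2)]]])
  from tendsto_cnj[OF this]
  have lim2: "(\<lambda>n. \<integral>x. w x * u\<^sub>0 x * cnj (v n x) \<partial>lebesgue) \<longlonglongrightarrow> (\<integral>x. w x * u\<^sub>0 x * cnj (v\<^sub>0 x) \<partial>lebesgue)"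
    unfolding Bochner_Integration.integral_cnj[symmetric] by (simp add: mult_ac)
  have "(\<integral>x. w x * (u n x - u\<^sub>0 x) * cnj (v n x - v\<^sub>0 x) \<partial>lebesgue)
      = (\<integral>x. w x * u n x * cnj (v n x) \<partial>lebesgue) - (\<integral>x. w x * u n x * cnj (v\<^sub>0 x) \<partial>lebesgue)
        - ((\<integral>x. w x * u\<^sub>0 x * cnj (v n x) \<partial>lebesgue) - (\<integral>x. w x * u\<^sub>0 x * cnj (v\<^sub>0 x) \<partial>lebesgue))" for n
  proof -
    note i = I[OF L(1) L(3), of n n] I[OF L(1) L(4), of n] I[OF L(2) L(3), of n] I[OF L(2) L(4)]
    have "(\<integral>x. w x * (u n x - u\<^sub>0 x) * cnj (v n x - v\<^sub>0 x) \<partial>lebesgue)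
      = (\<integral>x. w x * u n x * cnj (v n x) - w x * u n x * cnj (v\<^sub>0 x) - (w x * u\<^sub>0 x * cnj (v n x) - w x * u\<^sub>0 x * cnj (v\<^sub>0 x)) \<partial>lebesgue)"
      by (intro Bochner_Integration.integral_cong refl) (simp add: algebra_simps)
    then show ?thesis
      by (simp only: Bochner_Integration.integral_diff[OF Bochner_Integration.integrable_diff[OF i(1,2)] Bochner_Integration.integrable_diff[OF i(3,4)]]
          Bochner_Integration.integral_diff[OF i(1,2)] Bochner_Integration.integral_diff[OF i(3,4)])
  qed
  moreover have "(\<lambda>n. (\<integral>x. w x * u n x * cnj (v n x) \<partial>lebesgue) - (\<integral>x. w x * u n x * cnj (v\<^sub>0 x) \<partial>lebesgue)
        - ((\<integral>x. w x * u\<^sub>0 x * cnj (v n x) \<partial>lebesgue) - (\<integral>x. w x * u\<^sub>0 x * cnj (v\<^sub>0 x) \<partial>lebesgue)))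
     \<longlonglongrightarrow> l - (\<integral>x. w x * u\<^sub>0 x * cnj (v\<^sub>0 x) \<partial>lebesgue) - ((\<integral>x. w x * u\<^sub>0 x * cnj (v\<^sub>0 x) \<partial>lebesgue) - (\<integral>x. w x * u\<^sub>0 x * cnj (v\<^sub>0 x) \<partial>lebesgue))"
    by (intro tendsto_diff lim lim1 lim2 tendsto_const)
  ultimately show ?thesis by simp
qed

text \<open>A continuous cutoff, used as a second factor in the limit that defines \<open>D\<close>
  and to truncate quotients.\<close>

definition plateau :: "real \<Rightarrow> ('n::finite) cfun" where
  "plateau R x = complex_of_real (max 0 (min 1 (R + 1 - norm x)))"

lemma plateau_Cc: "R \<ge> 0 \<Longrightarrow> plateau R \<in> Cc"
  unfolding Cc_iff plateau_def[abs_def]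
  by (intro conjI exI[of _ "R + 1"] continuous_intros) auto

lemma plateau_1: "norm x \<le> R \<Longrightarrow> plateau R x = 1"
  by (simp add: plateau_def)

lemma cnj_plateau [simp]: "cnj (plateau R x) = plateau R x"
  by (simp add: plateau_def)

text \<open>The inverse is the conjugate over the squared modulus. Bounding the denominator below by
  its minimum on the ball makes the quotient continuous everywhere and changes nothing on the
  ball.\<close>

lemma Cc_inverse_on_ball:
  fixes b :: "('n::finite) cfun"
  assumes b: "continuous_on UNIV b" "\<And>x. norm x \<le> R \<Longrightarrow> b x \<noteq> 0" and R: "R \<ge> 0"
  shows "\<exists>c\<in>Cc. \<forall>x. norm x \<le> R \<longrightarrow> b x * c x = 1"
proof -
  have "\<exists>y\<in>cball 0 R. \<forall>x\<in>cball (0::real^'n) R. norm (b y) \<le> norm (b x)"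
    by (rule continuous_attains_inf) (use R in \<open>auto intro!: continuous_intros continuous_on_subset[OF b(1)]\<close>)
  then obtain y where y: "norm y \<le> R" "\<And>x. norm x \<le> R \<Longrightarrow> norm (b y) \<le> norm (b x)" by (auto simp: dist_norm)
  define e where "e = (norm (b y))\<^sup>2"
  have e: "e > 0" using b(2)[OF y(1)] by (simp add: e_def)
  define q where "q x = max e ((norm (b x))\<^sup>2)" for x
  have q: "q x > 0" for x using e by (simp add: q_def)
  define c where "c x = plateau R x * (cnj (b x) / complex_of_real (q x))" for x
  have "c \<in> Cc"
  proof -
    have P: "continuous_on UNIV (plateau R :: 'n cfun)" "\<exists>S>0. \<forall>x. norm x > S \<longrightarrow> (plateau R :: 'n cfun) x = 0"
      using plateau_Cc[OF R] unfolding Cc_iff by blast+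
    have "continuous_on UNIV q" unfolding q_def[abs_def] by (intro continuous_intros b(1))
    then have "continuous_on UNIV c"
      unfolding c_def[abs_def] using q by (intro continuous_intros P(1) b(1)) (auto simp: less_imp_neq[symmetric] dest: sym)
    then show ?thesis unfolding Cc_iff using P(2) by (auto simp: c_def)
  qed
  moreover have "b x * c x = 1" if "norm x \<le> R" for x
  proof -
    have "q x = (norm (b x))\<^sup>2" using power_mono[OF y(2)[OF that], of 2] by (simp add: q_def e_def max_def)
    then have "complex_of_real (q x) = b x * cnj (b x)" by (simp only: complex_norm_square)
    then show ?thesis using b(2)[OF that] by (simp add: c_def plateau_1[OF that])
  qed
  ultimately show ?thesis by blast
qed

text \<open>The factors are corrected on the null set where \<open>\<phi>\<close> does not vanish outside its support,
  since \<open>D\<close> need not respect equality almost everywhere and the product must be \<open>\<phi>\<close> everywhere.\<close>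

lemma Linf_VMO_c_factorisation:
  fixes \<phi> :: "('n::finite) cfun"
  assumes \<phi>: "\<phi> \<in> Linf_space \<inter> VMO_c"
  shows "\<exists>R>0. \<exists>b\<in>test_fun. \<exists>b'\<in>Linf_space \<inter> VMO_c. \<exists>\<phi>'\<in>Linf_space \<inter> VMO_c.
    (\<forall>x. norm x > R \<longrightarrow> b x = 0) \<and> (AE x in lebesgue. b' x = b x) \<and>
    (AE x in lebesgue. norm x > R \<longrightarrow> \<phi>' x = 0) \<and> (\<forall>x. b' x * cnj (\<phi>' x) = \<phi> x)"
proof -
  obtain N :: nat where N: "AE x in lebesgue. x \<notin> cball 0 (real N) \<longrightarrow> \<phi> x = 0"
    using \<phi> unfolding VMO_c_def VMO_on_def by auto
  \<comment> \<open>One more than the support radius, so that the bump does not vanish on the closed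
    ball of radius \<open>N\<close> and can be inverted there.\<close>
  define R where "R = real N + 1"
  have R: "R > 0" by (simp add: R_def)
  define b where "b = (ball_bump R :: 'n cfun)"
  have bt: "b \<in> test_fun" unfolding b_def by (rule ball_bump_test_fun[OF R])
  have b0: "b x = 0" if "norm x > R" for x unfolding b_def by (rule ball_bump_0) (use R that in auto)
  have "\<exists>c\<in>Cc. \<forall>x. norm x \<le> real N \<longrightarrow> b x * c x = 1"
    by (rule Cc_inverse_on_ball[OF test_fun_continuous[OF bt]]) (simp_all add: b_def R_def ball_bump_nonzero)
  then obtain c where c: "c \<in> Cc" "\<And>x. norm x \<le> real N \<Longrightarrow> b x * c x = 1" by blast
  \<comment> \<open>The null set on which \<phi> is nonzero beyond the ball. There both corrected
    factors are 1, so the product is \<phi> exactly.\<close>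
  define E where "E = {x. norm x > real N \<and> \<phi> x \<noteq> 0}"
  have E: "AE x in lebesgue. x \<notin> E" using N by eventually_elim (auto simp: E_def)
  define b' where "b' x = (if x \<in> E then 1 else b x)" for x
  define c' where "c' x = (if x \<in> E then 1 else c x)" for x
  have AEb: "AE x in lebesgue. b x = b' x" using E by eventually_elim (simp add: b'_def)
  have AEc: "AE x in lebesgue. c x = c' x" using E by eventually_elim (simp add: c'_def)
  have bC: "b \<in> Cc" using bt by (simp add: test_fun_def)
  have b': "b' \<in> Linf_space \<inter> VMO_c" by (rule Linf_VMO_c_cong_AE[OF Cc_Linf_VMO_c[OF bC] AEb])
  have c': "c' \<in> Linf_space \<inter> VMO_c" by (rule Linf_VMO_c_cong_AE[OF Cc_Linf_VMO_c[OF c(1)] AEc])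
  define \<phi>' where "\<phi>' x = cnj (\<phi> x * c' x)" for x
  have "\<phi> \<in> Linf_space \<inter> VMO" using \<phi> VMO_c_subset_VMO by blast
  then have \<phi>': "\<phi>' \<in> Linf_space \<inter> VMO_c"
    unfolding \<phi>'_def by (intro Linf_VMO_c_cnj Linf_VMO_mult c')
  have "AE x in lebesgue. norm x > R \<longrightarrow> \<phi>' x = 0"
    using N by eventually_elim (auto simp: \<phi>'_def R_def)
  moreover have "b' x * cnj (\<phi>' x) = \<phi> x" for x
  proof (cases "x \<in> E")
    case False
    then consider "\<phi> x = 0" | "norm x \<le> real N" unfolding E_def by fastforce
    then show ?thesis
    proof cases
      case 2
      have "b' x * cnj (\<phi>' x) = (b x * c x) * \<phi> x" using False by (simp add: b'_def \<phi>'_def c'_def)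
      then show ?thesis using c(2)[OF 2] by simp
    qed (simp add: \<phi>'_def)
  qed (simp add: b'_def \<phi>'_def c'_def)
  moreover have "AE x in lebesgue. b' x = b x" using AEb by eventually_elim simp
  ultimately show ?thesis using R bt b' \<phi>' b0 by blast
qed

section \<open>Evaluating H-distributions\<close>

lemma clinear_on_zero:
  assumes "clinear_on V F" "f \<in> V"
  shows "F (\<lambda>x. 0) = 0"
proof -
  have "F (\<lambda>x. 0 * f x + 0 * f x) = 0 * F f + 0 * F f" using assms unfolding clinear_on_def by blast
  then show ?thesis by simp
qed

lemma clinear_on_add:
  assumes "clinear_on V F" "f \<in> V" "g \<in> V"
  shows "F (\<lambda>x. f x + g x) = F f + F g"
proof -
  have "F (\<lambda>x. 1 * f x + 1 * g x) = 1 * F f + 1 * F g" using assms unfolding clinear_on_def by blast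
  then show ?thesis by simp
qed

lemma H_distributionD:
  assumes "H_distribution p q U V r D"
  shows "\<psi> \<in> C_kappa \<Longrightarrow> clinear_on (Linf_space \<inter> VMO_c) (\<lambda>\<phi>. D \<phi> \<psi>)"
    "\<phi> \<in> Linf_space \<inter> VMO_c \<Longrightarrow> clinear_on C_kappa (\<lambda>\<psi>. D \<phi> \<psi>)"
    "\<phi>\<^sub>1 \<in> Linf_space \<inter> VMO_c \<Longrightarrow> \<phi>\<^sub>2 \<in> Linf_space \<inter> VMO_c \<Longrightarrow> \<psi> \<in> C_kappa \<Longrightarrow>
      (\<lambda>n. \<integral>x. multiplier p \<psi> (\<lambda>y. \<phi>\<^sub>1 y * U (r n) y) x * cnj (\<phi>\<^sub>2 x * V (r n) x) \<partial>lebesgue)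
          \<longlonglongrightarrow> D (\<lambda>x. \<phi>\<^sub>1 x * cnj (\<phi>\<^sub>2 x)) \<psi>"
    "strict_mono r"
    "U n \<in> Lp_space p" "V n \<in> Lp_space q"
  using assms unfolding H_distribution_def Lp_weakly_def by blast+

lemma Linf_Lp_mult: "w \<in> Linf_space \<Longrightarrow> g \<in> Lp_space s \<Longrightarrow> s > 0 \<Longrightarrow> (\<lambda>x. w x * g x) \<in> Lp_space s"
  unfolding Linf_space_def by (auto intro: Linf_times_Lp(1))

text \<open>If some symbol \<open>\<beta>\<close> is not an \<open>L\<^sup>p\<close> multiplier, then \<open>multiplier p \<beta>\<close> is a fixed junk value
  on \<open>L\<^sup>p\<close>, so that the limit defining \<open>D\<close> does not depend on \<open>\<phi>\<^sub>1\<close>.\<close>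

lemma H_distribution_degenerate:
  fixes U V :: "nat \<Rightarrow> ('n::finite) cfun" and \<beta> \<phi>\<^sub>1 \<phi>\<^sub>2 \<psi> :: "'n cfun"
  assumes H: "H_distribution p q U V r D" and p: "p > 0"
    and bad: "\<beta> \<in> C_kappa" "\<not> Lp_multiplier p \<beta>"
    and \<phi>: "\<phi>\<^sub>1 \<in> Linf_space \<inter> VMO_c" "\<phi>\<^sub>2 \<in> Linf_space \<inter> VMO_c" and \<psi>: "\<psi> \<in> C_kappa"
  shows "D (\<lambda>x. \<phi>\<^sub>1 x * cnj (\<phi>\<^sub>2 x)) \<psi> = 0"
proof -
  have vanish: "D (\<lambda>x. \<phi>\<^sub>1 x * cnj (\<phi>\<^sub>2 x)) \<gamma> = 0" if \<gamma>: "\<gamma> \<in> C_kappa" "\<not> Lp_multiplier p \<gamma>" for \<gamma> :: "'n cfun"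
  proof -
    \<comment> \<open>The zero function serves as the first factor for comparison: the same limit
      then equals \<open>D\<close> at 0, which is 0 by linearity.\<close>
    have Z: "((\<lambda>x. 0) :: 'n cfun) \<in> Linf_space \<inter> VMO_c" using Cc_Linf_VMO_c test_fun_0 unfolding test_fun_def by blast
    have "multiplier p \<gamma> (\<lambda>y. \<phi>\<^sub>1 y * U (r n) y) = (SOME w. False)" for n
      by (rule multiplier_undefined[OF \<gamma>(2) Linf_Lp_mult[OF _ H_distributionD(5)[OF H] p]]) (use \<phi> in simp)
    moreover have "multiplier p \<gamma> (\<lambda>y. (\<lambda>x. 0) y * U (r n) y) = (SOME w. False)" for n
      by (rule multiplier_undefined[OF \<gamma>(2) Linf_Lp_mult[OF _ H_distributionD(5)[OF H] p]]) (use Z in simp)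
    ultimately have same: "multiplier p \<gamma> (\<lambda>y. \<phi>\<^sub>1 y * U (r n) y) = multiplier p \<gamma> (\<lambda>y. (\<lambda>x. 0) y * U (r n) y)" for n by simp
    have "D (\<lambda>x. \<phi>\<^sub>1 x * cnj (\<phi>\<^sub>2 x)) \<gamma> = D (\<lambda>x. (\<lambda>x. 0) x * cnj (\<phi>\<^sub>2 x)) \<gamma>"
      by (rule LIMSEQ_unique[OF H_distributionD(3)[OF H \<phi> \<gamma>(1), unfolded same] H_distributionD(3)[OF H Z \<phi>(2) \<gamma>(1)]])
    also have "\<dots> = 0" using clinear_on_zero[OF H_distributionD(1)[OF H \<gamma>(1)] Z] by simp
    finally show ?thesis .
  qed
  show ?thesis
  proof (cases "Lp_multiplier p \<psi>")
    case True
    \<comment> \<open>A multiplier \<psi> is reached by adding the bad symbol \<beta>: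
      \<open>D\<close> vanishes at the sum and at \<beta>, hence at \<psi> by additivity in the
      symbol.\<close>
    have "\<not> Lp_multiplier p (\<lambda>\<xi>. \<psi> \<xi> + \<beta> \<xi>)"
      using Lp_multiplier_add_cancel[OF True _ \<psi> bad(1) p] bad(2) by blast
    then have "D (\<lambda>x. \<phi>\<^sub>1 x * cnj (\<phi>\<^sub>2 x)) (\<lambda>\<xi>. \<psi> \<xi> + \<beta> \<xi>) = 0"
      by (rule vanish[OF Ck_sphere_add[OF \<psi> bad(1)]])
    moreover have "(\<lambda>x. \<phi>\<^sub>1 x * cnj (\<phi>\<^sub>2 x)) \<in> Linf_space \<inter> VMO_c"
      using \<phi>(1) VMO_c_subset_VMO by (intro Linf_VMO_mult Linf_VMO_c_cnj \<phi>(2)) blast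
    ultimately show ?thesis
      using clinear_on_add[OF H_distributionD(2)[OF H] \<psi> bad(1)] vanish[OF bad] by simp
  qed (rule vanish[OF \<psi>])
qed

text \<open>After factoring \<phi>, the first factor \<open>a j * b'\<close> agrees almost
  everywhere with \<open>a j * b\<close>, for which the symbol sums tend to 0 in L2. The sum over j
  of the integrals defining \<open>D\<close> is then a pairing of the operators with a sequence
  bounded in L2.\<close>

lemma H_distribution_localisation:
  fixes U V :: "nat \<Rightarrow> ('n::finite) cfun" and a :: "'n \<Rightarrow> 'n cfun" and \<phi> \<psi> :: "'n cfun"
  assumes p: "p > 2" and H: "H_distribution p p U V r D"
    and good: "\<And>\<psi>::'n cfun. \<psi> \<in> C_kappa \<Longrightarrow> Lp_multiplier p \<psi>"
    and a: "\<And>j. a j \<in> Linf_space \<inter> VMO"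
    and V: "\<And>n. Lp_modular p (V n) \<le> K"
    and compensated: "\<And>b. b \<in> test_fun \<Longrightarrow> (\<lambda>n. Lp_modular 2 (symbol_sum (\<lambda>j x. a j x * b x * U n x))) \<longlonglongrightarrow> 0"
    and \<phi>: "\<phi> \<in> Linf_space \<inter> VMO_c" and \<psi>: "\<psi> \<in> C_kappa"
  shows "(\<Sum>j\<in>UNIV. D (\<lambda>x. a j x * \<phi> x) (\<lambda>\<xi>. complex_of_real (\<xi> $ j / norm \<xi>) * \<psi> \<xi>)) = 0"
proof -
  obtain R b b' \<phi>' where R: "R > 0" and b: "b \<in> test_fun" and b': "b' \<in> Linf_space \<inter> VMO_c"
    and \<phi>': "\<phi>' \<in> Linf_space \<inter> VMO_c" and b0: "\<forall>x. norm x > R \<longrightarrow> b x = 0"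
    and bb': "AE x in lebesgue. b' x = b x" and \<phi>'0: "AE x in lebesgue. norm x > R \<longrightarrow> \<phi>' x = 0"
    and fac: "\<forall>x. b' x * cnj (\<phi>' x) = \<phi> x"
    using Linf_VMO_c_factorisation[OF \<phi>] by blast
  define \<kappa> where "\<kappa> j \<xi> = complex_of_real (\<xi> $ j / norm \<xi>) * \<psi> \<xi>" for j :: 'n and \<xi> :: "real ^ 'n"
  have \<kappa>: "\<kappa> j \<in> C_kappa" for j unfolding \<kappa>_def by (rule Ck_sphere_coord_mult[OF \<psi>])
  have p0: "p > 0" "p \<ge> 2" using p by auto
  note UV = H_distributionD(5,6)[OF H]
  define G where "G n j x = a j x * b x * U n x" for n j x
  \<comment> \<open>The second factor vanishes outside the ball only almost everywhere;
    \<open>h\<close> does so at every point, as the pairing bound requires.\<close>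
  define h where "h n x = (if norm x > R then 0 else cnj (\<phi>' x * V n x))" for n x
  have bL: "(\<lambda>x. a j x * b x) \<in> Linf_space" for j
    using Linf_test_fun_mult(1,2)[OF _ b] a by (auto simp: Linf_space_def)
  have G: "G n j \<in> Lp_space p" for n j unfolding G_def by (rule Linf_Lp_mult[OF bL UV(1) p0(1)])
  obtain C where C: "\<phi>' \<in> borel_measurable lebesgue" "AE x in lebesgue. norm (\<phi>' x) \<le> C"
    using \<phi>' by (auto simp: Linf_space_def)
  note \<phi>V = Linf_ball_support_times_bounded[where U=V, OF C \<phi>'0 UV(2) V p0(2)]
  have hAE: "AE x in lebesgue. cnj (\<phi>' x * V n x) = h n x" for n
    using \<phi>'0 by eventually_elim (simp add: h_def)
  have h2: "h n \<in> Lp_space 2" for n by (rule Lp_space_cong_AE[OF Lp_space_cnj[OF \<phi>V(1)] hAE])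
  obtain K' where K': "\<And>n. Lp_modular 2 (h n) \<le> K'"
  proof -
    obtain B where B: "\<And>n. Lp_modular 2 (\<lambda>x. \<phi>' x * V n x) \<le> B" using \<phi>V(3) by blast
    have "Lp_modular 2 (h n) \<le> B" for n
    proof -
      have "Lp_modular 2 (\<lambda>x. cnj (\<phi>' x * V n x)) = Lp_modular 2 (h n)"
        by (rule Lp_modular_cong_AE[OF Lp_space_cnj[OF \<phi>V(1)] hAE])
      then show ?thesis using B[of n] by (simp add: Lp_modular_def norm_mult)
    qed
    then show ?thesis by (rule that)
  qed
  define M where "M n = Lp_modular 2 (symbol_sum (G n))" for n
  have M: "M \<longlonglongrightarrow> 0" unfolding M_def G_def[abs_def] by (rule compensated[OF b])
  define S where "S n = (\<Sum>j\<in>UNIV. \<integral>x. multiplier p (\<kappa> j) (G n j) x * h n x \<partial>lebesgue)" for n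
  obtain B where B: "\<And>\<xi>. norm (hom_ext \<psi> \<xi>) \<le> B" using hom_ext_bounded[OF \<psi>] by blast
  \<comment> \<open>For a fixed weight \<rho> the first term vanishes as n grows and
    \<open>K' / \<rho>\<close> remains, the shape that the exchange of limits expects.\<close>
  have S_le: "norm (S n) \<le> \<rho> * (B\<^sup>2 * (4 * M n)) + K' / \<rho>" if "\<rho> > 0" for n \<rho>
  proof -
    have "norm (S n) \<le> \<rho> * (B\<^sup>2 * (4 * M n)) + Lp_modular 2 (h n) / \<rho>"
      unfolding S_def M_def \<kappa>_def
      by (rule multiplier_sum_pairing_bound[OF \<psi> B p0(2) good[OF \<kappa>[unfolded \<kappa>_def]] G _ R h2 _ that])
        (auto simp: G_def h_def b0)
    moreover have "Lp_modular 2 (h n) / \<rho> \<le> K' / \<rho>" using that by (intro divide_right_mono K') simp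
    ultimately show ?thesis by simp
  qed
  have "(\<lambda>n. norm (S n)) \<longlonglongrightarrow> 0"
  proof (rule tendsto_0_interpolate)
    fix \<rho> :: real assume "\<rho> \<ge> 1"
    then have "\<forall>n. norm (S n) \<le> \<rho> * (B\<^sup>2 * (4 * M n)) + K' / \<rho>" by (intro allI S_le) simp
    moreover have "(\<lambda>n. \<rho> * (B\<^sup>2 * (4 * M n))) \<longlonglongrightarrow> 0"
      by (intro tendsto_mult_right_zero M)
    ultimately show "\<exists>e. e \<longlonglongrightarrow> 0 \<and> (\<forall>n. norm (S n) \<le> e n + K' / \<rho>)" by blast
  qed simp
  then have S: "S \<longlonglongrightarrow> 0" by (rule tendsto_norm_zero_cancel)
  have \<phi>1: "(\<lambda>x. a j x * b' x) \<in> Linf_space \<inter> VMO_c" for j by (rule Linf_VMO_mult[OF a b'])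
  have int_eq: "(\<integral>x. multiplier p (\<kappa> j) (\<lambda>y. a j y * b' y * U n y) x * cnj (\<phi>' x * V n x) \<partial>lebesgue)
      = (\<integral>x. multiplier p (\<kappa> j) (G n j) x * h n x \<partial>lebesgue)" for n j
  proof -
    have L: "(\<lambda>y. a j y * b' y * U n y) \<in> Lp_space p"
      by (rule Linf_Lp_mult[OF _ UV(1) p0(1)]) (use \<phi>1 in simp)
    have eq: "AE x in lebesgue. a j x * b' x * U n x = G n j x"
      using bb' by eventually_elim (simp add: G_def)
    note v1 = Lp_multiplier_value[OF good[OF \<kappa>] \<kappa> p0(1) L]
    note v2 = Lp_multiplier_value[OF good[OF \<kappa>[of j]] \<kappa> p0(1) G]
    have AEm: "AE x in lebesgue. multiplier p (\<kappa> j) (\<lambda>y. a j y * b' y * U n y) x = multiplier p (\<kappa> j) (G n j) x"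
      by (rule multiplier_value_unique[OF multiplier_value_cong_AE[OF v1 eq L p0(1)] v2 G p0(1)])
    have m1: "multiplier p (\<kappa> j) (\<lambda>y. a j y * b' y * U n y) \<in> borel_measurable lebesgue"
      using v1 by (auto simp: multiplier_value_def intro: Lp_space_measurable)
    have m2: "multiplier p (\<kappa> j) (G n j) \<in> borel_measurable lebesgue"
      using v2[of n] by (auto simp: multiplier_value_def intro: Lp_space_measurable)
    show ?thesis
    proof (rule integral_cong_AE)
      show "(\<lambda>x. multiplier p (\<kappa> j) (\<lambda>y. a j y * b' y * U n y) x * cnj (\<phi>' x * V n x)) \<in> borel_measurable lebesgue"
        by (intro borel_measurable_times m1 borel_measurable_cnj C(1) Lp_space_measurable[OF UV(2)])
      show "(\<lambda>x. multiplier p (\<kappa> j) (G n j) x * h n x) \<in> borel_measurable lebesgue"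
        by (intro borel_measurable_times m2 Lp_space_measurable[OF h2])
      show "AE x in lebesgue. multiplier p (\<kappa> j) (\<lambda>y. a j y * b' y * U n y) x * cnj (\<phi>' x * V n x)
          = multiplier p (\<kappa> j) (G n j) x * h n x"
        using AEm hAE[of n] by eventually_elim simp
    qed
  qed
  have "(\<lambda>n. \<Sum>j\<in>UNIV. \<integral>x. multiplier p (\<kappa> j) (\<lambda>y. a j y * b' y * U (r n) y) x * cnj (\<phi>' x * V (r n) x) \<partial>lebesgue)
      \<longlonglongrightarrow> (\<Sum>j\<in>UNIV. D (\<lambda>x. a j x * b' x * cnj (\<phi>' x)) (\<kappa> j))"
    by (intro tendsto_sum H_distributionD(3)[OF H \<phi>1 \<phi>' \<kappa>])
  moreover have "(\<lambda>x. a j x * b' x * cnj (\<phi>' x)) = (\<lambda>x. a j x * \<phi> x)" for j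
    using fac by (simp add: mult.assoc)
  ultimately have "(\<lambda>n. S (r n)) \<longlonglongrightarrow> (\<Sum>j\<in>UNIV. D (\<lambda>x. a j x * \<phi> x) (\<kappa> j))"
    unfolding int_eq S_def by simp
  moreover have "(\<lambda>n. S (r n)) \<longlonglongrightarrow> 0"
    using LIMSEQ_subseq_LIMSEQ[OF S H_distributionD(4)[OF H]] by (simp add: o_def)
  ultimately have "(\<Sum>j\<in>UNIV. D (\<lambda>x. a j x * \<phi> x) (\<kappa> j)) = 0" by (rule LIMSEQ_unique)
  then show ?thesis by (simp add: \<kappa>_def[abs_def])
qed

text \<open>The operator with symbol 1 is the identity almost everywhere, so the limit defining
  \<open>D\<close> is the limit of plain integrals of products, computed along the whole sequence
  from the weak limits.\<close>

lemma H_distribution_product_limit: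
  fixes u v :: "nat \<Rightarrow> ('n::finite) cfun" and Q \<phi> :: "'n cfun"
  assumes p: "p > 2" and u: "Lp_weakly p u u\<^sub>0" and v: "Lp_weakly p v v\<^sub>0"
    and H: "H_distribution p p (\<lambda>n x. u n x - u\<^sub>0 x) (\<lambda>n x. v n x - v\<^sub>0 x) r D"
    and Q: "Q \<in> Linf_space \<inter> VMO" and \<phi>: "\<phi> \<in> test_fun"
    and lim: "(\<lambda>n. pairing (\<lambda>x. Q x * u n x * cnj (v n x)) \<phi>) \<longlonglongrightarrow> l"
  shows "l - pairing (\<lambda>x. Q x * u\<^sub>0 x * cnj (v\<^sub>0 x)) \<phi> = D (\<lambda>x. Q x * \<phi> x) (\<lambda>\<xi>. 1)"
proof -
  define w where "w x = Q x * \<phi> x" for x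
  have p0: "p > 0" using p by simp
  have QL: "Q \<in> Linf_space" using Q by simp
  have \<phi>C: "\<phi> \<in> Cc" using \<phi> by (simp add: test_fun_def)
  have w: "w \<in> Linf_space \<inter> VMO_c" unfolding w_def by (rule Linf_VMO_mult[OF Q Cc_Linf_VMO_c[OF \<phi>C]])
  obtain R where R: "R > 0" "\<And>x. norm x > R \<Longrightarrow> \<phi> x = 0" using \<phi> unfolding test_fun_iff by blast
  obtain C where C: "w \<in> borel_measurable lebesgue" "AE x in lebesgue. norm (w x) \<le> C" using w by (auto simp: Linf_space_def)
  have wR: "w x = 0" if "norm x > R" for x using R(2)[OF that] by (simp add: w_def)
  have pl: "plateau R \<in> Linf_space \<inter> VMO_c" by (rule Cc_Linf_VMO_c[OF plateau_Cc]) (use R in simp)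
  \<comment> \<open>The identity holds at every point because \<open>w\<close> vanishes at every
    point beyond \<open>R\<close>; \<open>D\<close> is evaluated at a function, not at a class
    modulo null sets.\<close>
  have wpl: "w x * cnj (plateau R x) = w x" for x
    using wR[of x] plateau_1[of x R] by (cases "norm x \<le> R") auto
  have pair: "pairing (\<lambda>x. Q x * g x * cnj (h x)) \<phi> = (\<integral>x. w x * g x * cnj (h x) \<partial>lebesgue)" for g h
    unfolding pairing_def by (intro Bochner_Integration.integral_cong refl) (simp add: w_def mult_ac)
  define U where "U n x = u n x - u\<^sub>0 x" for n x
  define V where "V n x = v n x - v\<^sub>0 x" for n x
  note H' = H[folded U_def V_def]
  have UL: "U n \<in> Lp_space p" "V n \<in> Lp_space p" for n by (rule H_distributionD(5,6)[OF H'])+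
  have one: "(\<lambda>\<xi>. 1) \<in> C_kappa" by (rule Ck_sphere_const)
  have mul: "(\<integral>x. multiplier p (\<lambda>\<xi>. 1) (\<lambda>y. w y * U n y) x * cnj (plateau R x * V n x) \<partial>lebesgue)
      = (\<integral>x. w x * U n x * cnj (V n x) \<partial>lebesgue)" for n
  proof -
    have L: "(\<lambda>y. w y * U n y) \<in> Lp_space p" by (rule Linf_Lp_mult[OF _ UL(1) p0]) (use w in simp)
    note m = multiplier_one_AE[OF L p0]
    have L': "multiplier p (\<lambda>\<xi>. 1) (\<lambda>y. w y * U n y) \<in> Lp_space p"
      by (rule Lp_space_cong_AE[OF L]) (use m in eventually_elim, simp)
    have pm: "plateau R \<in> borel_measurable lebesgue" using pl by (auto simp: Linf_space_def)
    show ?thesis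
    proof (rule integral_cong_AE)
      show "(\<lambda>x. multiplier p (\<lambda>\<xi>. 1) (\<lambda>y. w y * U n y) x * cnj (plateau R x * V n x)) \<in> borel_measurable lebesgue"
        by (intro borel_measurable_times borel_measurable_cnj pm Lp_space_measurable[OF UL(2)] Lp_space_measurable[OF L'])
      show "(\<lambda>x. w x * U n x * cnj (V n x)) \<in> borel_measurable lebesgue"
        by (intro borel_measurable_times borel_measurable_cnj Lp_space_measurable[OF UL(2)] Lp_space_measurable[OF L])
      show "AE x in lebesgue. multiplier p (\<lambda>\<xi>. 1) (\<lambda>y. w y * U n y) x * cnj (plateau R x * V n x) = w x * U n x * cnj (V n x)"
        using m
      proof eventually_elim
        case (elim x)
        have "w x * U n x * cnj (plateau R x * V n x) = (w x * cnj (plateau R x)) * U n x * cnj (V n x)"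
          unfolding complex_cnj_mult by (simp only: mult_ac)
        then show ?case unfolding elim wpl .
      qed
    qed
  qed
  have "(\<lambda>n. \<integral>x. w x * U (r n) x * cnj (V (r n) x) \<partial>lebesgue) \<longlonglongrightarrow> D (\<lambda>x. w x * cnj (plateau R x)) (\<lambda>\<xi>. 1)"
    using H_distributionD(3)[OF H' w pl one] unfolding mul .
  then have D: "(\<lambda>n. \<integral>x. w x * U (r n) x * cnj (V (r n) x) \<partial>lebesgue) \<longlonglongrightarrow> D w (\<lambda>\<xi>. 1)"
    unfolding wpl .
  have "(\<lambda>n. \<integral>x. w x * u n x * cnj (v n x) \<partial>lebesgue) \<longlonglongrightarrow> l" using lim unfolding pair .
  from weak_product_limit[OF p C _ u v this] wR
  have "(\<lambda>n. \<integral>x. w x * U n x * cnj (V n x) \<partial>lebesgue) \<longlonglongrightarrow> l - (\<integral>x. w x * u\<^sub>0 x * cnj (v\<^sub>0 x) \<partial>lebesgue)"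
    unfolding U_def V_def by blast
  \<comment> \<open>The product limit exists along the full sequence, whereas \<open>D\<close> is a
    limit along \<open>r\<close>; restricting the former identifies both.\<close>
  from LIMSEQ_unique[OF LIMSEQ_subseq_LIMSEQ[OF this H_distributionD(4)[OF H'], unfolded o_def] D]
  show ?thesis unfolding pair by (simp add: w_def[abs_def])
qed

theorem theorem20:
  fixes p :: real
    and u v :: "nat \<Rightarrow> real ^ 'n \<Rightarrow> complex"
    and u\<^sub>0 v\<^sub>0 m :: "real ^ 'n \<Rightarrow> complex"
    and a :: "'n::finite \<Rightarrow> real ^ 'n \<Rightarrow> complex"
    and f :: "nat \<Rightarrow> (real ^ 'n \<Rightarrow> complex) \<Rightarrow> complex"
    and \<eta> :: "real ^ 'n \<Rightarrow> real"
    and r :: "nat \<Rightarrow> nat"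
    and D :: "(real ^ 'n \<Rightarrow> complex) \<Rightarrow> (real ^ 'n \<Rightarrow> complex) \<Rightarrow> complex"
  assumes "p > 2"
    and "Lp_bounded p u"
    and "Lp_weakly p u u\<^sub>0"
    and "\<And>j. a j \<in> Linf_space \<inter> VMO"
    and "\<And>n. f n \<in> Wm1 p"
    and "(\<lambda>n. Wm1_norm p (f n)) \<longlonglongrightarrow> 0"
    and "\<And>n \<phi>. \<phi> \<in> test_fun \<Longrightarrow>
           (\<Sum>j\<in>UNIV. distr_deriv j (pairing (\<lambda>x. a j x * u n x)) \<phi>) = f n \<phi>"
    and "m \<in> C_kappa"
    and "(\<lambda>x. complex_of_real (\<eta> x)) \<in> test_fun"
    and "\<And>x. \<eta> x \<ge> 0"
    and "\<And>n. AE x in lebesgue. v n x = \<eta> x * multiplier p m (u n) x"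
    and "AE x in lebesgue. v\<^sub>0 x = \<eta> x * multiplier p m u\<^sub>0 x"
    and "Lp_weakly p v v\<^sub>0"
    and "H_distribution p p (\<lambda>n x. u n x - u\<^sub>0 x) (\<lambda>n x. v n x - v\<^sub>0 x) r D"
  shows "(\<forall>Q \<in> Linf_space \<inter> VMO. \<forall>\<omega>. distribution \<omega> \<longrightarrow>
            distr_tendsto (\<lambda>n. pairing (\<lambda>x. Q x * u n x * cnj (v n x))) \<omega> \<longrightarrow>
            (\<forall>\<phi>\<in>test_fun. \<omega> \<phi> - pairing (\<lambda>x. Q x * u\<^sub>0 x * cnj (v\<^sub>0 x)) \<phi>
                = D (\<lambda>x. Q x * \<phi> x) (\<lambda>\<xi>. 1))) \<and>
         (\<forall>\<phi> \<in> Linf_space \<inter> VMO_c. \<forall>\<psi> \<in> C_kappa.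
            (\<Sum>j\<in>UNIV. D (\<lambda>x. a j x * \<phi> x)
               (\<lambda>\<xi>. complex_of_real (\<xi> $ j / norm \<xi>) * \<psi> \<xi>)) = 0)"
proof (intro conjI ballI allI impI)
  fix Q \<phi> :: "'n cfun" and \<omega> :: "'n cfun \<Rightarrow> complex"
  assume "Q \<in> Linf_space \<inter> VMO" "distr_tendsto (\<lambda>n. pairing (\<lambda>x. Q x * u n x * cnj (v n x))) \<omega>" "\<phi> \<in> test_fun"
  then show "\<omega> \<phi> - pairing (\<lambda>x. Q x * u\<^sub>0 x * cnj (v\<^sub>0 x)) \<phi> = D (\<lambda>x. Q x * \<phi> x) (\<lambda>\<xi>. 1)"
    unfolding distr_tendsto_def
    by (intro H_distribution_product_limit[OF assms(1,3,13,14)]) auto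
next
  fix \<phi> \<psi> :: "real ^ 'n \<Rightarrow> complex"
  assume \<phi>: "\<phi> \<in> Linf_space \<inter> VMO_c" and \<psi>: "\<psi> \<in> C_kappa"
  have p: "p > 0" "p > 1" using assms(1) by auto
  have coord: "(\<lambda>\<xi>. complex_of_real (\<xi> $ j / norm \<xi>) * \<psi> \<xi>) \<in> C_kappa" for j
    by (rule Ck_sphere_coord_mult[OF \<psi>])
  show "(\<Sum>j\<in>UNIV. D (\<lambda>x. a j x * \<phi> x) (\<lambda>\<xi>. complex_of_real (\<xi> $ j / norm \<xi>) * \<psi> \<xi>)) = 0"
  proof (cases "\<forall>\<psi>\<in>C_kappa. Lp_multiplier p (\<psi> :: 'n cfun)")
    \<comment> \<open>Each summand vanishes by itself: the factorisation presents
      \<open>a j * \<phi>\<close> pointwise as a product of the form covered by the degenerate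
      case.\<close>
    case False
    then obtain \<beta> :: "'n cfun" where \<beta>: "\<beta> \<in> C_kappa" "\<not> Lp_multiplier p \<beta>" by blast
    obtain b' \<phi>' where f: "b' \<in> Linf_space \<inter> VMO_c" "\<phi>' \<in> Linf_space \<inter> VMO_c" "\<forall>x. b' x * cnj (\<phi>' x) = \<phi> x"
      using Linf_VMO_c_factorisation[OF \<phi>] by blast
    have "D (\<lambda>x. a j x * \<phi> x) (\<lambda>\<xi>. complex_of_real (\<xi> $ j / norm \<xi>) * \<psi> \<xi>) = 0" for j
      using H_distribution_degenerate[OF assms(14) p(1) \<beta> Linf_VMO_mult[OF assms(4) f(1), of j] f(2) coord[of j]] f(3)
      by (simp add: mult.assoc)
    then show ?thesis by simp
  next
    case True
    define U where "U n x = u n x - u\<^sub>0 x" for n x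
    define V where "V n x = v n x - v\<^sub>0 x" for n x
    note H = assms(14)[folded U_def V_def]
    have L: "u n \<in> Lp_space p" "u\<^sub>0 \<in> Lp_space p" "v n \<in> Lp_space p" "v\<^sub>0 \<in> Lp_space p" for n
      using assms(3,13) by (auto simp: Lp_weakly_def)
    obtain K where K: "\<And>n. Lp_modular p (u n) \<le> K" using Lp_bounded_modular[OF assms(2) p(1)] by blast
    have UK: "Lp_modular p (U n) \<le> 2 powr p * (K + Lp_modular p u\<^sub>0)" for n
      unfolding U_def by (rule order_trans[OF Lp_modular_diff_le[OF L(1,2) p(1)]]) (intro mult_left_mono add_right_mono K, simp)
    obtain C where C: "C \<ge> 0" "\<And>g. g \<in> Lp_space p \<Longrightarrow> multiplier p m g \<in> Lp_space p \<and> Lp_modular p (multiplier p m g) \<le> C * Lp_modular p g"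
      using Lp_multiplier_modular_bound[OF _ assms(8) p(1)] True assms(8) by blast
    obtain E where E: "\<And>x. norm (complex_of_real (\<eta> x)) \<le> E" using test_fun_bounded[OF assms(9)] by blast
    have \<eta>m: "(\<lambda>x. complex_of_real (\<eta> x)) \<in> borel_measurable lebesgue"
      by (intro borel_measurable_lebesgue_of_borel test_fun_borel assms(9))
    \<comment> \<open>The bound on \<open>v n\<close> is read off from its formula: in this case
      \<open>m\<close> is a multiplier, hence bounded on Lp, and the cutoff \<eta> is
      bounded.\<close>
    have vK: "Lp_modular p (v n) \<le> \<bar>E\<bar> powr p * (C * K)" for n
    proof -
      have "Lp_modular p (v n) = Lp_modular p (\<lambda>x. complex_of_real (\<eta> x) * multiplier p m (u n) x)"
        by (rule Lp_modular_cong_AE[OF L(3) assms(11)])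
      also have "\<dots> \<le> \<bar>E\<bar> powr p * Lp_modular p (multiplier p m (u n))"
        by (rule Linf_times_Lp(2)[OF \<eta>m _ _ p(1)]) (use E C(2)[OF L(1)] in auto)
      also have "\<dots> \<le> \<bar>E\<bar> powr p * (C * K)"
        using C(2)[OF L(1), of n] mult_left_mono[OF K[of n] C(1)] by (intro mult_left_mono) auto
      finally show ?thesis .
    qed
    have VK: "Lp_modular p (V n) \<le> 2 powr p * (\<bar>E\<bar> powr p * (C * K) + Lp_modular p v\<^sub>0)" for n
      unfolding V_def by (rule order_trans[OF Lp_modular_diff_le[OF L(3,4) p(1)]]) (intro mult_left_mono add_right_mono vK, simp)
    have aL: "a j \<in> Linf_space" for j using assms(4) by simp
    have U0: "Lp_weakly p U (\<lambda>x. 0)" unfolding U_def by (rule Lp_weakly_diff_0[OF assms(3) p(2)])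
    have eq: "(\<Sum>j\<in>UNIV. \<integral>x. a j x * U n x * pderivative j \<theta> x \<partial>lebesgue) = - f n \<theta>" if "\<theta> \<in> test_fun" for n \<theta>
      unfolding U_def by (rule divergence_equation_diff_limit[OF assms(3) p(2) aL assms(5,6,7) that])
    show ?thesis
      by (rule H_distribution_localisation[OF assms(1) H bspec[OF True] assms(4) VK
            compensated_symbol_sum[OF assms(1) U0 UK aL assms(5,6) eq] \<phi> \<psi>])
  qed
qed

end
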